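(* Let $n\ge 2$ and let $M$ be a spherical catenoid in the hyperbolic space $\mathbb{H}^{n+1}$. Then the index of $M$ is at most $1$.
   Context: $\mathbb{H}^{n+1}$ is the $(n+1)$-dimensional hyperbolic space of constant sectional curvature $-1$, viewed as $\{x\in\mathbb{L}^{n+2}:\langle x,x\rangle=-1,\ x_1\ge1\}$, where $\mathbb{L}^{n+2}$ is $\mathbb{R}^{n+2}$ with the Lorentzian metric $\langle x,y\rangle=-x_1y_1+x_2y_2+\cdots+x_{n+2}y_{n+2}$. A spherical catenoid is a complete rotationally symmetric minimal hypersurface of $\mathbb{H}^{n+1}$ foliated by spheres, i.e. (up to isometry) a complete minimal hypersurface invariant under the group $SO(n)$ of rotations fixing the geodesic $\{(\cosh u,\sinh u,0,\dots,0):u\in\mathbb{R}\}$ pointwise, obtained by rotating a generating curve $\alpha(s)=(x(s),y(s),z(s),0,\dots,0)$, $s\in\mathbb{R}$, with $z(s)>0$, about this geodesic, so that it is diffeomorphic to $\mathbb{R}\times\mathbb{S}^{n-1}$. For a minimal hypersurface $M$ of $\mathbb{H}^{n+1}$ with second fundamental form $A$, the stability operator is $L=\Delta+|A|^2-n$. For a compact domain $\Omega\subset M$, $\mathrm{Index}(\Omega)$ is the number, counted with multiplicity, of negative eigenvalues $\lambda$ of the Dirichlet problem $Lf=-\lambda f$ in $\Omega$, $f=0$ on $\partial\Omega$. The index of $M$ is the supremum of $\mathrm{Index}(\Omega)$ over all compact domains $\Omega\subset M$. *)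

theory Defs
  imports "HOL-Analysis.Analysis" "HOL-Library.Function_Algebras" "HOL-Library.Extended_Nat"
begin

section \<open>Hyperbolic space in the Lorentzian model\<close>

text \<open>
  The space \<open>L^(n+2)\<close> is \<open>real \<times> real \<times> (real^'n)\<close> with \<open>n = CARD('n)\<close>: the first two
  coordinates are \<open>x_1\<close>, \<open>x_2\<close>, and the third component collects \<open>x_3, ..., x_(n+2)\<close>.
\<close>

type_synonym 'n lorentz = "real \<times> real \<times> (real, 'n) vec"

definition lorentz_inner :: "'n::finite lorentz \<Rightarrow> 'n lorentz \<Rightarrow> real" where
  "lorentz_inner p q =
     - (fst p * fst q) + fst (snd p) * fst (snd q) + snd (snd p) \<bullet> snd (snd q)"

definition hyperbolic_space :: "'n::finite lorentz set" where
  "hyperbolic_space = {p. lorentz_inner p p = -1 \<and> fst p \<ge> 1}"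

text \<open>
  Isometries of hyperbolic space are exactly the restrictions of the linear Lorentz
  transformations that preserve the sheet \<open>x_1 \<ge> 1\<close>.
\<close>

definition hyperbolic_isometry :: "('n::finite lorentz \<Rightarrow> 'n lorentz) \<Rightarrow> bool" where
  "hyperbolic_isometry T \<longleftrightarrow>
     linear T \<and> (\<forall>p q. lorentz_inner (T p) (T q) = lorentz_inner p q) \<and>
     T ` hyperbolic_space = hyperbolic_space"


section \<open>Functions of class C^k and charts\<close>

text \<open>Used for open sets only.\<close>

fun C_k_on :: "nat \<Rightarrow> 'a::euclidean_space set \<Rightarrow> ('a \<Rightarrow> 'b::euclidean_space) \<Rightarrow> bool" where
  "C_k_on 0 U f \<longleftrightarrow> continuous_on U f"
| "C_k_on (Suc k) U f \<longleftrightarrow>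
     (\<forall>x\<in>U. f differentiable (at x)) \<and>
     (\<forall>v. C_k_on k U (\<lambda>x. frechet_derivative f (at x) v))"

definition smooth_on :: "'a::euclidean_space set \<Rightarrow> ('a \<Rightarrow> 'b::euclidean_space) \<Rightarrow> bool" where
  "smooth_on U f \<longleftrightarrow> (\<forall>k. C_k_on k U f)"

definition pderiv_at :: "'n::finite \<Rightarrow> (real^'n \<Rightarrow> 'b::euclidean_space) \<Rightarrow> real^'n \<Rightarrow> 'b" where
  "pderiv_at i f u = frechet_derivative f (at u) (axis i 1)"

text \<open>
  Local parametrizations of an embedded \<open>n\<close>-dimensional submanifold \<open>S\<close> of a Euclidean space.
\<close>

definition chart :: "'a::euclidean_space set \<Rightarrow> (real^'n::finite) set \<Rightarrow> (real^'n \<Rightarrow> 'a) \<Rightarrow> bool" where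
  "chart S U Y \<longleftrightarrow>
     open U \<and> smooth_on U Y \<and> (\<forall>u\<in>U. inj (frechet_derivative Y (at u))) \<and>
     openin (top_of_set S) (Y ` U) \<and> (\<exists>Z. homeomorphism U (Y ` U) Y Z)"


section \<open>Immersed hypersurfaces of hyperbolic space\<close>

text \<open>
  A hypersurface is given by an immersion \<open>F\<close> of an \<open>n\<close>-dimensional manifold \<open>S\<close>, itself
  an embedded submanifold of some Euclidean space; only the values of \<open>F\<close> on \<open>S\<close> matter.
  Functions on the hypersurface are functions on \<open>S\<close>, and the local geometry is computed from
  the local parametrization \<open>X = F \<circ> Y\<close>, where \<open>Y\<close> is a chart of \<open>S\<close>.
\<close>

definition immersed_hypersurface ::
    "'a::euclidean_space set \<Rightarrow> ('a \<Rightarrow> 'n::finite lorentz) \<Rightarrow> bool" where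
  "immersed_hypersurface S F \<longleftrightarrow>
     F ` S \<subseteq> hyperbolic_space \<and>
     (\<forall>p\<in>S. \<exists>(U :: (real^'n) set) Y. chart S U Y \<and> p \<in> Y ` U) \<and>
     (\<forall>(U :: (real^'n) set) Y. chart S U Y \<longrightarrow>
        smooth_on U (F \<circ> Y) \<and> (\<forall>u\<in>U. inj (frechet_derivative (F \<circ> Y) (at u))))"

definition metric_matrix :: "(real^'n \<Rightarrow> 'n::finite lorentz) \<Rightarrow> real^'n \<Rightarrow> real^'n^'n" where
  "metric_matrix X u = (\<chi> i j. lorentz_inner (pderiv_at i X u) (pderiv_at j X u))"

text \<open>
  A unit normal is tangent to hyperbolic space (orthogonal to the position vector) and orthogonal
  to the hypersurface; it is unique up to sign, and nothing below depends on the choice made.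
\<close>

definition is_unit_normal :: "(real^'n \<Rightarrow> 'n::finite lorentz) \<Rightarrow> real^'n \<Rightarrow> 'n lorentz \<Rightarrow> bool" where
  "is_unit_normal X u N \<longleftrightarrow>
     lorentz_inner N N = 1 \<and> lorentz_inner N (X u) = 0 \<and>
     (\<forall>i. lorentz_inner N (pderiv_at i X u) = 0)"

definition unit_normal :: "(real^'n \<Rightarrow> 'n::finite lorentz) \<Rightarrow> real^'n \<Rightarrow> 'n lorentz" where
  "unit_normal X u = (SOME N. is_unit_normal X u N)"

text \<open>
  The Levi-Civita connection of hyperbolic space is the tangential part of the flat derivative,
  so \<open>A(X_i, X_j)\<close> is the product of the flat second derivative with the unit normal.
\<close>

definition second_ff :: "(real^'n \<Rightarrow> 'n::finite lorentz) \<Rightarrow> real^'n \<Rightarrow> real^'n^'n" where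
  "second_ff X u = (\<chi> i j. lorentz_inner (pderiv_at i (pderiv_at j X) u) (unit_normal X u))"

definition shape_operator :: "(real^'n \<Rightarrow> 'n::finite lorentz) \<Rightarrow> real^'n \<Rightarrow> real^'n^'n" where
  "shape_operator X u = matrix_inv (metric_matrix X u) ** second_ff X u"

definition minimal_hypersurface ::
    "'a::euclidean_space set \<Rightarrow> ('a \<Rightarrow> 'n::finite lorentz) \<Rightarrow> bool" where
  "minimal_hypersurface S F \<longleftrightarrow>
     immersed_hypersurface S F \<and>
     (\<forall>(U :: (real^'n) set) Y. chart S U Y \<longrightarrow>
        (\<forall>u\<in>U. trace (shape_operator (F \<circ> Y) u) = 0))"

text \<open>
  Riemannian distance of the induced metric. As \<open>F\<close> is an immersion, a continuous curve
  \<open>c\<close> in \<open>S\<close> is piecewise of class \<open>C^1\<close> iff \<open>F \<circ> c\<close> is.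
\<close>

definition curve_length :: "('a \<Rightarrow> 'n::finite lorentz) \<Rightarrow> (real \<Rightarrow> 'a) \<Rightarrow> real" where
  "curve_length F c = integral {0..1}
     (\<lambda>t. let v = vector_derivative (F \<circ> c) (at t) in sqrt (lorentz_inner v v))"

definition riemannian_dist ::
    "'a::euclidean_space set \<Rightarrow> ('a \<Rightarrow> 'n::finite lorentz) \<Rightarrow> 'a \<Rightarrow> 'a \<Rightarrow> real" where
  "riemannian_dist S F p q = Inf (curve_length F `
     {c. path c \<and> path_image c \<subseteq> S \<and> pathstart c = p \<and> pathfinish c = q \<and>
         (F \<circ> c) piecewise_C1_differentiable_on {0..1}})"

definition complete_hypersurface ::
    "'a::euclidean_space set \<Rightarrow> ('a \<Rightarrow> 'n::finite lorentz) \<Rightarrow> bool" where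
  "complete_hypersurface S F \<longleftrightarrow> Metric_space.mcomplete S (riemannian_dist S F)"


section \<open>The stability operator and the index\<close>

text \<open>The Laplacian in local coordinates; \<open>h\<close> is the coordinate expression \<open>f \<circ> Y\<close>.\<close>

definition laplacian ::
    "(real^'n \<Rightarrow> 'n::finite lorentz) \<Rightarrow> (real^'n \<Rightarrow> real) \<Rightarrow> real^'n \<Rightarrow> real" where
  "laplacian X h u =
     (let rho = (\<lambda>v. sqrt (det (metric_matrix X v)));
          ginv = (\<lambda>v. matrix_inv (metric_matrix X v))
      in (\<Sum>i\<in>UNIV. pderiv_at i
            (\<lambda>v. rho v * (\<Sum>j\<in>UNIV. ginv v $ i $ j * pderiv_at j h v)) u) / rho u)"

definition normsq_second_ff :: "(real^'n \<Rightarrow> 'n::finite lorentz) \<Rightarrow> real^'n \<Rightarrow> real" where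
  "normsq_second_ff X u =
     (let ginv = matrix_inv (metric_matrix X u); h = second_ff X u
      in \<Sum>i\<in>UNIV. \<Sum>j\<in>UNIV. \<Sum>k\<in>UNIV. \<Sum>l\<in>UNIV.
           ginv $ i $ k * ginv $ j $ l * h $ i $ j * h $ k $ l)"

definition stability_operator ::
    "(real^'n \<Rightarrow> 'n::finite lorentz) \<Rightarrow> (real^'n \<Rightarrow> real) \<Rightarrow> real^'n \<Rightarrow> real" where
  "stability_operator X h u =
     laplacian X h u + (normsq_second_ff X u - real CARD('n)) * h u"

text \<open>A compact domain is the compact closure of a nonempty connected open set.\<close>

definition compact_domain :: "'a::euclidean_space set \<Rightarrow> 'a set \<Rightarrow> bool" where
  "compact_domain S \<Omega> \<longleftrightarrow>
     \<Omega> \<subseteq> S \<and> compact \<Omega> \<and>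
     top_of_set S interior_of \<Omega> \<noteq> {} \<and> connected (top_of_set S interior_of \<Omega>) \<and>
     top_of_set S closure_of (top_of_set S interior_of \<Omega>) = \<Omega>"

text \<open>
  The solutions of the Dirichlet problem \<open>L f = - \<lambda> f\<close> in \<open>\<Omega>\<close>, \<open>f = 0\<close> on the boundary,
  the zero solution included. Functions on \<open>\<Omega>\<close> are represented by their extension by zero,
  so that linear independence is the one on \<open>\<Omega>\<close>.
\<close>

definition dirichlet_eigenspace ::
    "'a::euclidean_space set \<Rightarrow> ('a \<Rightarrow> 'n::finite lorentz) \<Rightarrow> 'a set \<Rightarrow> real \<Rightarrow> ('a \<Rightarrow> real) set" where
  "dirichlet_eigenspace S F \<Omega> lam = {f.
     (\<forall>p. p \<notin> \<Omega> \<longrightarrow> f p = 0) \<and>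
     continuous_on \<Omega> f \<and>
     (\<forall>p \<in> top_of_set S frontier_of \<Omega>. f p = 0) \<and>
     (\<forall>(U :: (real^'n) set) Y. chart S U Y \<and> Y ` U \<subseteq> top_of_set S interior_of \<Omega> \<longrightarrow>
        C_k_on 2 U (f \<circ> Y) \<and>
        (\<forall>u\<in>U. stability_operator (F \<circ> Y) (f \<circ> Y) u = - lam * f (Y u)))}"

definition fun_space_dim :: "('a \<Rightarrow> real) set \<Rightarrow> enat" where
  "fun_space_dim E =
     (SUP B \<in> {B. finite B \<and> B \<subseteq> E \<and> \<not> module.dependent (\<lambda>(c::real) f x. c * f x) B}.
        enat (card B))"

text \<open>
  The number of negative eigenvalues with multiplicity is the sum over all negative \<open>\<lambda>\<close> of the
  dimension of the eigenspace (zero unless \<open>\<lambda>\<close> is an eigenvalue), as an extended natural number.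
\<close>

definition domain_index ::
    "'a::euclidean_space set \<Rightarrow> ('a \<Rightarrow> 'n::finite lorentz) \<Rightarrow> 'a set \<Rightarrow> enat" where
  "domain_index S F \<Omega> =
     (SUP \<Lambda> \<in> {\<Lambda>. finite \<Lambda> \<and> \<Lambda> \<subseteq> {..<0}}.
        \<Sum>lam\<in>\<Lambda>. fun_space_dim (dirichlet_eigenspace S F \<Omega> lam))"

definition hypersurface_index ::
    "'a::euclidean_space set \<Rightarrow> ('a \<Rightarrow> 'n::finite lorentz) \<Rightarrow> enat" where
  "hypersurface_index S F = (SUP \<Omega> \<in> {\<Omega>. compact_domain S \<Omega>}. domain_index S F \<Omega>)"


section \<open>Spherical catenoids\<close>

abbreviation cylinder :: "(real \<times> (real^'n::finite)) set" where
  "cylinder \<equiv> UNIV \<times> sphere 0 1"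

text \<open>
  The rotations in \<open>SO(n)\<close> fixing the geodesic \<open>(cosh u, sinh u, 0)\<close> pointwise act on the third
  component; the orbit of \<open>(x, y, (z, 0, ..., 0))\<close> with \<open>z > 0\<close> is the set of all
  \<open>(x, y, z \<omega>)\<close> with \<open>\<omega>\<close> in the unit sphere.
\<close>

definition rotate_curve ::
    "(real \<Rightarrow> real) \<Rightarrow> (real \<Rightarrow> real) \<Rightarrow> (real \<Rightarrow> real) \<Rightarrow> real \<times> (real^'n::finite) \<Rightarrow> 'n lorentz" where
  "rotate_curve x y z = (\<lambda>(s, \<omega>). (x s, y s, z s *\<^sub>R \<omega>))"

definition spherical_catenoid :: "(real \<times> (real^'n::finite) \<Rightarrow> 'n lorentz) \<Rightarrow> bool" where
  "spherical_catenoid F \<longleftrightarrow>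
     (\<exists>T x y z. hyperbolic_isometry T \<and>
        smooth_on UNIV x \<and> smooth_on UNIV y \<and> smooth_on UNIV z \<and> (\<forall>s. z s > 0) \<and>
        (\<forall>p\<in>cylinder. F p = T (rotate_curve x y z p))) \<and>
     minimal_hypersurface cylinder F \<and>
     complete_hypersurface cylinder F"

end

theory Submission
  imports Defs "HOL-Probability.Distributions"
begin

text \<open>Let s be the parameter of the generating curve and let the other coordinates run over
  the unit sphere of dimension n-1. The induced metric is E^2 ds^2 + z^2 g, with E the speed of the
  curve and g the round metric. Let w be the derivative of z with respect to arc length. One
  principal curvature has multiplicity n-1 and square K; minimality fixes the other one, so |A|^2 =
  n(n-1)K, and it also gives a differential equation for w. With P = z^(n-1) and V = |A|^2 - n, the
  quadratic form of -L is, up to a constant factor, the integral of P/E u_s^2 + E P/z^2 |grad u|^2 -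
  V E P u^2, where grad is the gradient on the sphere.

  This form is nonnegative on a space of codimension at most one
  (\<open>energy_integral_nonneg\<close>). Split u into its mean m(s) over the orbit spheres and the
  rest. On the rest, the sharp Poincare inequality of the sphere (\<open>sphere_poincare\<close>,
  constant n-1) bounds the spherical gradient from below, and the remaining one-dimensional form is
  nonnegative because z^(1-n) is a positive supersolution
  (\<open>quadratic_form_higher_modes\<close>). For the mean, w solves the radial Jacobi equation
  and is strictly increasing, so it has at most one zero; if m vanishes there, the Riccati
  substitution by the logarithmic derivative of w gives nonnegativity
  (\<open>quadratic_form_radial\<close>). The only constraint is thus one linear condition on u.

  The Poincare inequality of the sphere is deduced from the Gaussian one, since the direction of a
  Gaussian vector is uniformly distributed and independent of its length. The Gaussian inequality
  follows from the one on the line by tensorisation of the variance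
  (\<open>gauss_space_poincare\<close>). The divergence theorem on the sphere comes from the one in
  Euclidean space in the same spirit.

  Suppose two eigenfunctions with negative eigenvalues were linearly independent. The form would be
  negative definite on their span, but some nonzero combination satisfies the linear condition, a
  contradiction. The domain has an arbitrary boundary and the eigenfunctions are only continuous up
  to it, so this is carried out for truncations by functions of the sum \<rho> of the two squares.
  The energy where \<rho> is positive is finite (\<open>integrable_T0\<close>), which makes the
  truncation errors tend to zero (\<open>error_tendsto_0\<close>) and gives orthogonality for
  different eigenvalues (\<open>N_orthogonal\<close>). Hence two eigenfunctions are always dependent
  (\<open>linearly_dependent\<close>), and nonzero ones belong to the same eigenvalue
  (\<open>eigenvalues_equal\<close>).

  To connect this with the intrinsic definitions, functions on the cylinder are extended to be
  homogeneous of degree zero in the sphere variable, and the geometry is computed in stereographic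
  charts along the line through their centre (\<open>rotation_profile_X\<close>,
  \<open>jacobi_equation\<close>). Rotating the chart brings any point of the cylinder to that
  line.\<close>

section \<open>Poincare inequality for the Gaussian measure on the line\<close>

definition gauss_line :: "real measure" where
  "gauss_line = density lborel (\<lambda>x. ennreal (std_normal_density x))"

lemma sets_gauss_line [measurable_cong, simp]: "sets gauss_line = sets borel"
  by (simp add: gauss_line_def)

lemma space_gauss_line [simp]: "space gauss_line = UNIV"
  by (simp add: gauss_line_def)

lemma prob_space_gauss_line: "prob_space gauss_line"
  unfolding gauss_line_def by (rule prob_space_normal_density) simp

lemma nn_integral_gauss_line:
  "f \<in> borel_measurable borel \<Longrightarrow>
   (\<integral>\<^sup>+x. f x \<partial>gauss_line) = (\<integral>\<^sup>+x. ennreal (std_normal_density x) * f x \<partial>lborel)"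
  unfolding gauss_line_def by (subst nn_integral_density) auto

lemma DERIV_neg_std_normal_density:
  "((\<lambda>x. - std_normal_density x) has_real_derivative (std_normal_density x * x)) (at x)"
  unfolding std_normal_density_def
  by (auto intro!: derivative_eq_intros simp: field_simps power2_eq_square)

lemma std_normal_density_at_top: "(std_normal_density \<longlongrightarrow> 0) at_top"
  and std_normal_density_at_bot: "(std_normal_density \<longlongrightarrow> 0) at_bot"
proof -
  have 1: "filterlim (\<lambda>x::real. x\<^sup>2 / 2) at_top at_top"
    by real_asymp
  have 2: "filterlim (\<lambda>x::real. x\<^sup>2 / 2) at_top at_bot"
    by real_asymp
  have e: "((\<lambda>x. 1 / sqrt (2 * pi) * exp (- (x\<^sup>2 / 2))) \<longlongrightarrow> 1 / sqrt (2*pi) * 0) F"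
    if "filterlim (\<lambda>x::real. x\<^sup>2 / 2) at_top F" for F
    by (intro tendsto_mult tendsto_const filterlim_compose[OF exp_at_bot]
        filterlim_compose[OF filterlim_uminus_at_bot_at_top] that)
  show "(std_normal_density \<longlongrightarrow> 0) at_top" "(std_normal_density \<longlongrightarrow> 0) at_bot"
    using e[OF 1] e[OF 2] unfolding std_normal_density_def by simp_all
qed

lemma integrable_std_normal_density_mult:
  "integrable lborel (\<lambda>x. std_normal_density x * x)"
  using integrable_std_normal_moment[of 1] by simp

text \<open>The negative density is an antiderivative of the integrand and vanishes at
  infinity.\<close>

lemma std_normal_upper_first_moment:
  "(\<integral>x. indicator {t..} x * (std_normal_density x * x) \<partial>lborel) = std_normal_density t"
proof -
  have "(LBINT x=ereal t..\<infinity>. std_normal_density x * x) = 0 - (- std_normal_density t)"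
  proof (rule interval_integral_FTC_integrable)
    show "set_integrable lborel (einterval (ereal t) \<infinity>) (\<lambda>x. std_normal_density x * x)"
      unfolding set_integrable_def
      by (rule integrable_mult_indicator) (auto simp: integrable_std_normal_density_mult)
    show "((\<lambda>x. - std_normal_density x) has_vector_derivative std_normal_density x * x) (at x)" for x
      using DERIV_neg_std_normal_density[of x] by (simp add: has_real_derivative_iff_has_vector_derivative)
    show "isCont (\<lambda>x. std_normal_density x * x) x" for x
      unfolding std_normal_density_def by (intro continuous_intros) auto
    show "(((\<lambda>x. - std_normal_density x) \<circ> real_of_ereal) \<longlongrightarrow> - std_normal_density t) (at_right (ereal t))"
      unfolding ereal_tendsto_simps
      by (rule isCont_tendsto_compose[of t _ "\<lambda>x. x"], unfold std_normal_density_def)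
         (auto intro!: continuous_intros tendsto_intros)
    show "(((\<lambda>x. - std_normal_density x) \<circ> real_of_ereal) \<longlongrightarrow> 0) (at_left \<infinity>)"
      unfolding ereal_tendsto_simps using tendsto_minus[OF std_normal_density_at_top] by simp
  qed auto
  also have "(LBINT x=ereal t..\<infinity>. std_normal_density x * x)
      = (\<integral>x. indicator {t<..} x * (std_normal_density x * x) \<partial>lborel)"
    by (simp add: interval_lebesgue_integral_def set_lebesgue_integral_def einterval_def greaterThan_def)
  also have "\<dots> = (\<integral>x. indicator {t..} x * (std_normal_density x * x) \<partial>lborel)"
    by (rule integral_cong_AE) (use AE_lborel_singleton[of t] in \<open>auto simp: indicator_def elim!: eventually_mono\<close>)
  finally show ?thesis by simp
qed

lemma std_normal_lower_first_moment:
  "(\<integral>x. indicator {..t} x * (std_normal_density x * x) \<partial>lborel) = - std_normal_density t"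
proof -
  have i: "integrable lborel (\<lambda>x. indicator A x * (std_normal_density x * x))" if "A \<in> sets borel" for A
    using integrable_mult_indicator[OF _ integrable_std_normal_density_mult, of A] that by simp
  have "(\<integral>x. indicator {..t} x * (std_normal_density x * x) \<partial>lborel)
      + (\<integral>x. indicator {t..} x * (std_normal_density x * x) \<partial>lborel)
      = (\<integral>x. indicator {..t} x * (std_normal_density x * x) + indicator {t..} x * (std_normal_density x * x) \<partial>lborel)"
    by (rule Bochner_Integration.integral_add[symmetric]) (auto intro!: i)
  also have "\<dots> = (\<integral>x. std_normal_density x * x \<partial>lborel)"
    by (rule integral_cong_AE) (use AE_lborel_singleton[of t] in \<open>auto simp: indicator_def elim!: eventually_mono\<close>)
  also have "\<dots> = 0" using integral_std_normal_moment_odd[of 0] by simp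
  finally show ?thesis using std_normal_upper_first_moment[of t] by simp
qed

text \<open>Write b - a = (b - t) + (t - a) and let \<open>P\<close>, \<open>R\<close> be the masses
  of the two half-lines. The first moments turn the integral into P (d - t R) + (d + t P) R with d
  the density at t; the terms in t cancel and P + R = 1. This identity puts the correct weight on
  the squared derivative in the Poincare inequality.\<close>

lemma gauss_line_kernel:
  "(\<integral>\<^sup>+a. \<integral>\<^sup>+b. ennreal (indicator {..t} a * indicator {t..} b * (b - a)) \<partial>gauss_line \<partial>gauss_line)
     = ennreal (std_normal_density t)"
proof -
  let ?d = std_normal_density
  interpret prob_space gauss_line by (rule prob_space_gauss_line)
  define P where "P = (\<integral>x. indicator {..t} x * ?d x \<partial>lborel)"
  define R where "R = (\<integral>x. indicator {t..} x * ?d x \<partial>lborel)"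
  have iI: "integrable lborel (\<lambda>x. indicator A x * ?d x)" if "A \<in> sets borel" for A
    using integrable_mult_indicator[of A lborel ?d] that by simp
  have iI1: "integrable lborel (\<lambda>x. indicator A x * (?d x * x))" if "A \<in> sets borel" for A
    using integrable_mult_indicator[OF _ integrable_std_normal_density_mult, of A] that by simp
  have "P + R = (\<integral>x. indicator {..t} x * ?d x + indicator {t..} x * ?d x \<partial>lborel)"
    unfolding P_def R_def by (rule Bochner_Integration.integral_add[symmetric]) (auto intro!: iI)
  also have "\<dots> = (\<integral>x. ?d x \<partial>lborel)"
    by (rule integral_cong_AE) (use AE_lborel_singleton[of t] in \<open>auto simp: indicator_def elim!: eventually_mono\<close>)
  finally have PR: "P + R = 1" by simp
  have P0: "P \<ge> 0" "R \<ge> 0" by (auto simp: P_def R_def)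
  have nnP: "(\<integral>\<^sup>+a. ennreal (indicator {..t} a) \<partial>gauss_line) = ennreal P"
  proof -
    have "(\<integral>\<^sup>+a. ennreal (indicator {..t} a) \<partial>gauss_line) = (\<integral>\<^sup>+x. ennreal (indicator {..t} x * ?d x) \<partial>lborel)"
      by (subst nn_integral_gauss_line) (auto intro!: nn_integral_cong simp: ennreal_mult' mult.commute)
    also have "\<dots> = ennreal P" unfolding P_def by (rule nn_integral_eq_integral) (auto intro!: iI)
    finally show ?thesis .
  qed
  have nnR: "(\<integral>\<^sup>+a. ennreal (indicator {t..} a) \<partial>gauss_line) = ennreal R"
  proof -
    have "(\<integral>\<^sup>+a. ennreal (indicator {t..} a) \<partial>gauss_line) = (\<integral>\<^sup>+x. ennreal (indicator {t..} x * ?d x) \<partial>lborel)"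
      by (subst nn_integral_gauss_line) (auto intro!: nn_integral_cong simp: ennreal_mult' mult.commute)
    also have "\<dots> = ennreal R" unfolding R_def by (rule nn_integral_eq_integral) (auto intro!: iI)
    finally show ?thesis .
  qed
  have B: "(\<integral>\<^sup>+b. ennreal (indicator {t..} b * (b - t)) \<partial>gauss_line) = ennreal (?d t - t * R)" (is "?B = _")
    and B0: "?d t - t * R \<ge> 0"
  proof -
    have "?B = (\<integral>\<^sup>+x. ennreal (indicator {t..} x * (?d x * x) - t * (indicator {t..} x * ?d x)) \<partial>lborel)"
      by (subst nn_integral_gauss_line)
        (auto intro!: nn_integral_cong simp: ennreal_mult'[symmetric] indicator_def algebra_simps)
    also have "\<dots> = ennreal (\<integral>x. indicator {t..} x * (?d x * x) - t * (indicator {t..} x * ?d x) \<partial>lborel)"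
    proof (rule nn_integral_eq_integral)
      show "AE x in lborel. 0 \<le> indicator {t..} x * (?d x * x) - t * (indicator {t..} x * ?d x)"
        by (auto simp: indicator_def mult.commute[of t] intro!: mult_left_mono)
    qed (intro Bochner_Integration.integrable_diff integrable_mult_right iI iI1; simp)
    also have eq: "(\<integral>x. indicator {t..} x * (?d x * x) - t * (indicator {t..} x * ?d x) \<partial>lborel) = ?d t - t * R"
      unfolding R_def using std_normal_upper_first_moment[of t]
      by (subst Bochner_Integration.integral_diff) (auto intro!: iI iI1)
    finally show "?B = ennreal (?d t - t * R)" .
    have "0 \<le> (\<integral>x. indicator {t..} x * (?d x * x) - t * (indicator {t..} x * ?d x) \<partial>lborel)"
      by (rule Bochner_Integration.integral_nonneg)
         (auto simp: indicator_def mult.commute[of t] intro!: mult_left_mono)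
    then show "?d t - t * R \<ge> 0" using eq by simp
  qed
  have A: "(\<integral>\<^sup>+b. ennreal (indicator {..t} b * (t - b)) \<partial>gauss_line) = ennreal (?d t + t * P)" (is "?A = _")
    and A0: "?d t + t * P \<ge> 0"
  proof -
    have "?A = (\<integral>\<^sup>+x. ennreal (t * (indicator {..t} x * ?d x) - indicator {..t} x * (?d x * x)) \<partial>lborel)"
      by (subst nn_integral_gauss_line)
        (auto intro!: nn_integral_cong simp: ennreal_mult'[symmetric] indicator_def algebra_simps)
    also have "\<dots> = ennreal (\<integral>x. t * (indicator {..t} x * ?d x) - indicator {..t} x * (?d x * x) \<partial>lborel)"
    proof (rule nn_integral_eq_integral)
      show "AE x in lborel. 0 \<le> t * (indicator {..t} x * ?d x) - indicator {..t} x * (?d x * x)"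
        by (auto simp: indicator_def mult.commute[of t] intro!: mult_left_mono)
    qed (intro Bochner_Integration.integrable_diff integrable_mult_right iI iI1; simp)
    also have eq: "(\<integral>x. t * (indicator {..t} x * ?d x) - indicator {..t} x * (?d x * x) \<partial>lborel) = ?d t + t * P"
      unfolding P_def using std_normal_lower_first_moment[of t]
      by (subst Bochner_Integration.integral_diff) (auto intro!: iI iI1)
    finally show "?A = ennreal (?d t + t * P)" .
    have "0 \<le> (\<integral>x. t * (indicator {..t} x * ?d x) - indicator {..t} x * (?d x * x) \<partial>lborel)"
      by (rule Bochner_Integration.integral_nonneg)
         (auto simp: indicator_def mult.commute[of t] intro!: mult_left_mono)
    then show "?d t + t * P \<ge> 0" using eq by simp
  qed
  have "(\<integral>\<^sup>+b. ennreal (indicator {..t} a * indicator {t..} b * (b - a)) \<partial>gauss_line)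
      = ennreal (indicator {..t} a) * ennreal (?d t - t * R) + ennreal (indicator {..t} a * (t - a)) * ennreal R" for a
  proof -
    have "(\<integral>\<^sup>+b. ennreal (indicator {..t} a * indicator {t..} b * (b - a)) \<partial>gauss_line)
       = (\<integral>\<^sup>+b. ennreal (indicator {..t} a) * ennreal (indicator {t..} b * (b - t))
            + ennreal (indicator {..t} a * (t - a)) * ennreal (indicator {t..} b) \<partial>gauss_line)"
      by (intro nn_integral_cong)
         (auto simp: indicator_def ennreal_mult'[symmetric] ennreal_plus[symmetric] simp del: ennreal_plus)
    also have "\<dots> = ennreal (indicator {..t} a) * ennreal (?d t - t * R) + ennreal (indicator {..t} a * (t - a)) * ennreal R"
      by (subst nn_integral_add) (auto simp: nn_integral_cmult B nnR)
    finally show ?thesis .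
  qed
  then have "(\<integral>\<^sup>+a. \<integral>\<^sup>+b. ennreal (indicator {..t} a * indicator {t..} b * (b - a)) \<partial>gauss_line \<partial>gauss_line)
     = (\<integral>\<^sup>+a. ennreal (indicator {..t} a) * ennreal (?d t - t * R) + ennreal (indicator {..t} a * (t - a)) * ennreal R \<partial>gauss_line)"
    by simp
  also have "\<dots> = ennreal P * ennreal (?d t - t * R) + ennreal (?d t + t * P) * ennreal R"
    by (subst nn_integral_add) (auto simp: nn_integral_multc A nnP)
  also have "\<dots> = ennreal (P * (?d t - t * R) + (?d t + t * P) * R)"
    using P0 A0 B0 by (simp only: ennreal_mult ennreal_plus mult_nonneg_nonneg)
  also have "P * (?d t - t * R) + (?d t + t * P) * R = ?d t * (P + R)"
    by (simp add: algebra_simps)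
  finally show ?thesis by (simp add: PR)
qed

text \<open>Cauchy--Schwarz on \<open>[a,b]\<close>, from \<open>(g' - c)\<^sup>2 \<ge> 0\<close> with \<open>c\<close> the slope of the secant.\<close>

lemma secant_square_le:
  fixes g g' :: "real \<Rightarrow> real"
  assumes "a < b" and cont: "continuous_on UNIV g" and fin: "finite Z"
    and der: "\<And>t. t \<notin> Z \<Longrightarrow> (g has_real_derivative g' t) (at t)"
    and [measurable]: "g' \<in> borel_measurable borel"
  shows "ennreal ((g a - g b)\<^sup>2) \<le> (\<integral>\<^sup>+t. ennreal (indicator {a..b} t * (b - a)) * ennreal ((g' t)\<^sup>2) \<partial>lborel)"
proof -
  define J where "J = (\<integral>\<^sup>+t. ennreal (indicator {a..b} t * (g' t)\<^sup>2) \<partial>lborel)"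
  have rhs: "(\<integral>\<^sup>+t. ennreal (indicator {a..b} t * (b - a)) * ennreal ((g' t)\<^sup>2) \<partial>lborel) = ennreal (b - a) * J"
    unfolding J_def using \<open>a < b\<close>
    by (subst nn_integral_cmult[symmetric]) (auto intro!: nn_integral_cong simp: ennreal_mult'[symmetric] indicator_def)
  show ?thesis
  proof (cases "J = \<infinity>")
    case True
    then show ?thesis using \<open>a < b\<close> by (simp add: rhs ennreal_mult_top)
  next
    case False
    have int: "integrable lborel (\<lambda>t. indicator {a..b} t * (g' t)\<^sup>2)"
      by (rule integrableI_nonneg) (use False in \<open>auto simp: J_def less_top\<close>)
    define I where "I = (\<integral>t. indicator {a..b} t * (g' t)\<^sup>2 \<partial>lborel)"
    have JI: "J = ennreal I" unfolding J_def I_def by (rule nn_integral_eq_integral[OF int]) auto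
    have "((\<lambda>t. indicator {a..b} t * (g' t)\<^sup>2) has_integral I) UNIV"
      unfolding I_def by (rule has_integral_integral_lborel[OF int])
    then have h1: "((\<lambda>t. (g' t)\<^sup>2) has_integral I) {a..b}"
      by (subst has_integral_restrict_UNIV[symmetric])
         (erule has_integral_eq[rotated], simp add: indicator_def)
    have h2: "(g' has_integral (g b - g a)) {a..b}"
      by (rule fundamental_theorem_of_calculus_interior_strong[OF fin])
         (use \<open>a < b\<close> der cont in \<open>auto simp: has_real_derivative_iff_has_vector_derivative intro: continuous_on_subset\<close>)
    define c where "c = (g b - g a) / (b - a)"
    have h3: "((\<lambda>t. 2 * c * g' t - c\<^sup>2) has_integral (2 * c * (g b - g a) - c\<^sup>2 * (b - a))) {a..b}"
      using has_integral_diff[OF has_integral_mult_right[OF h2, of "2*c"] has_integral_const_real[of "c\<^sup>2" a b]] \<open>a < b\<close>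
      by (simp add: mult.commute)
    have "2 * c * (g b - g a) - c\<^sup>2 * (b - a) \<le> I"
    proof (rule has_integral_le[OF h3 h1])
      show "2 * c * g' t - c\<^sup>2 \<le> (g' t)\<^sup>2" for t
        using zero_le_power2[of "g' t - c"] by (simp add: power2_eq_square algebra_simps)
    qed
    then have "(b - a) * (2 * c * (g b - g a) - c\<^sup>2 * (b - a)) \<le> (b - a) * I"
      using \<open>a < b\<close> by (intro mult_left_mono) auto
    moreover have "(b - a) * c = g b - g a" using \<open>a < b\<close> by (simp add: c_def)
    then have "(b - a) * (2 * c * (g b - g a) - c\<^sup>2 * (b - a)) = (g a - g b)\<^sup>2"
      by (algebra)
    ultimately have "(g a - g b)\<^sup>2 \<le> (b - a) * I" by simp
    then show ?thesis unfolding rhs JI using \<open>a < b\<close>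
      by (simp add: ennreal_mult'[symmetric] ennreal_leI)
  qed
qed

text \<open>Average the secant bound over two independent Gaussian points and exchange the
  integrals; by \<open>gauss_line_kernel\<close> the squared derivative at t receives the density at
  t as weight. For square integrable g the left side is twice the variance. Finitely many
  exceptional points are allowed because the function to which this is finally applied has a corner
  at the origin.\<close>

lemma gauss_line_poincare:
  fixes g g' :: "real \<Rightarrow> real"
  assumes cont: "continuous_on UNIV g" and fin: "finite Z"
    and der: "\<And>t. t \<notin> Z \<Longrightarrow> (g has_real_derivative g' t) (at t)"
    and [measurable]: "g' \<in> borel_measurable borel"
  shows "(\<integral>\<^sup>+a. \<integral>\<^sup>+b. ennreal ((g a - g b)\<^sup>2) \<partial>gauss_line \<partial>gauss_line)
    \<le> 2 * (\<integral>\<^sup>+t. ennreal ((g' t)\<^sup>2) \<partial>gauss_line)"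
proof -
  interpret prob_space gauss_line by (rule prob_space_gauss_line)
  interpret PS: pair_sigma_finite gauss_line gauss_line ..
  interpret PL: pair_sigma_finite gauss_line lborel ..
  have [measurable]: "g \<in> borel_measurable borel" by (rule borel_measurable_continuous_onI[OF cont])
  \<comment> \<open>For a < b this is the bound of \<open>secant_square_le\<close>. For a > b the
    indicators exclude every t, so \<open>k a b + k b a\<close> covers both orders.\<close>
  define k where "k = (\<lambda>a b. \<integral>\<^sup>+t. ennreal (indicator {..t} a * indicator {t..} b * (b - a)) * ennreal ((g' t)\<^sup>2) \<partial>lborel)"
  have ind: "indicator {..t} a * indicator {t..} b * (b - a) = (if a \<le> t \<and> t \<le> b then b - a else 0)" for a b t :: real
    by (auto simp: indicator_def)
  have km [measurable]: "(\<lambda>(a, b). k a b) \<in> borel_measurable (borel \<Otimes>\<^sub>M borel)"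
    unfolding k_def ind by measurable
  have le: "ennreal ((g a - g b)\<^sup>2) \<le> k a b + k b a" for a b
  proof -
    have *: "ennreal ((g a - g b)\<^sup>2) \<le> k a b" if "a < b" for a b
    proof -
      have "(\<integral>\<^sup>+t. ennreal (indicator {a..b} t * (b - a)) * ennreal ((g' t)\<^sup>2) \<partial>lborel) = k a b"
        unfolding k_def by (intro nn_integral_cong) (auto simp: indicator_def)
      then show ?thesis using secant_square_le[OF that cont fin der] by simp
    qed
    consider "a < b" | "b < a" | "a = b" by linarith
    then show ?thesis
    proof cases
      case 1 then show ?thesis using *[OF 1] by (meson order.trans le_iff_add)
    next
      case 2 then show ?thesis using *[OF 2] by (metis add.commute le_iff_add order.trans power2_commute)
    qed simp
  qed
  have "(\<integral>\<^sup>+a. \<integral>\<^sup>+b. ennreal ((g a - g b)\<^sup>2) \<partial>gauss_line \<partial>gauss_line)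
      \<le> (\<integral>\<^sup>+a. \<integral>\<^sup>+b. k a b + k b a \<partial>gauss_line \<partial>gauss_line)"
    by (intro nn_integral_mono le)
  also have "\<dots> = (\<integral>\<^sup>+a. \<integral>\<^sup>+b. k a b \<partial>gauss_line \<partial>gauss_line) + (\<integral>\<^sup>+a. \<integral>\<^sup>+b. k b a \<partial>gauss_line \<partial>gauss_line)"
    by (subst nn_integral_add[symmetric], measurable) (auto intro!: nn_integral_cong nn_integral_add)
  also have "(\<integral>\<^sup>+a. \<integral>\<^sup>+b. k b a \<partial>gauss_line \<partial>gauss_line) = (\<integral>\<^sup>+a. \<integral>\<^sup>+b. k a b \<partial>gauss_line \<partial>gauss_line)"
    by (rule PS.Fubini') measurable
  also have "(\<integral>\<^sup>+a. \<integral>\<^sup>+b. k a b \<partial>gauss_line \<partial>gauss_line)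
     = (\<integral>\<^sup>+a. \<integral>\<^sup>+t. \<integral>\<^sup>+b. ennreal (if a \<le> t \<and> t \<le> b then b - a else 0) * ennreal ((g' t)\<^sup>2) \<partial>gauss_line \<partial>lborel \<partial>gauss_line)"
    unfolding k_def ind by (intro nn_integral_cong PL.Fubini'[symmetric]) measurable
  also have "\<dots> = (\<integral>\<^sup>+t. \<integral>\<^sup>+a. \<integral>\<^sup>+b. ennreal (if a \<le> t \<and> t \<le> b then b - a else 0) * ennreal ((g' t)\<^sup>2) \<partial>gauss_line \<partial>gauss_line \<partial>lborel)"
    by (rule PL.Fubini'[symmetric]) measurable
  also have "\<dots> = (\<integral>\<^sup>+t. \<integral>\<^sup>+a. \<integral>\<^sup>+b. ennreal (indicator {..t} a * indicator {t..} b * (b - a)) * ennreal ((g' t)\<^sup>2) \<partial>gauss_line \<partial>gauss_line \<partial>lborel)"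
    unfolding ind ..
  also have "\<dots> = (\<integral>\<^sup>+t. ennreal (std_normal_density t) * ennreal ((g' t)\<^sup>2) \<partial>lborel)"
  proof (rule nn_integral_cong)
    fix t
    have "(\<integral>\<^sup>+a. \<integral>\<^sup>+b. ennreal (indicator {..t} a * indicator {t..} b * (b - a)) * ennreal ((g' t)\<^sup>2) \<partial>gauss_line \<partial>gauss_line)
      = (\<integral>\<^sup>+a. \<integral>\<^sup>+b. ennreal (indicator {..t} a * indicator {t..} b * (b - a)) \<partial>gauss_line \<partial>gauss_line) * ennreal ((g' t)\<^sup>2)"
      by (simp add: nn_integral_multc)
    then show "(\<integral>\<^sup>+a. \<integral>\<^sup>+b. ennreal (indicator {..t} a * indicator {t..} b * (b - a)) * ennreal ((g' t)\<^sup>2) \<partial>gauss_line \<partial>gauss_line)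
      = ennreal (std_normal_density t) * ennreal ((g' t)\<^sup>2)"
      by (simp add: gauss_line_kernel)
  qed
  also have "\<dots> = (\<integral>\<^sup>+t. ennreal ((g' t)\<^sup>2) \<partial>gauss_line)"
    by (simp add: nn_integral_gauss_line)
  finally show ?thesis by (simp add: mult_2)
qed

section \<open>Tensorisation of the variance\<close>

text \<open>The right side minus the left side is the square of a - b - c + d.\<close>

lemma quadrilateral_le:
  fixes a b c d :: real
  shows "(a - d)\<^sup>2 + (b - c)\<^sup>2 \<le> (a - c)\<^sup>2 + (b - d)\<^sup>2 + ((a - b)\<^sup>2 + (c - d)\<^sup>2)"
  using zero_le_power2[of "a - b - c + d"] by (simp add: power2_eq_square algebra_simps)

text \<open>Apply \<open>quadrilateral_le\<close> to the values of g at (x,y), (x,y'), (x',y) and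
  (x',y') and integrate. Exchanging the independent copies y and y' maps one diagonal to the other
  and a pair of opposite sides to each other, so the integrated inequality is twice the
  claim.\<close>

lemma efron_stein_pair:
  fixes g :: "'a \<Rightarrow> 'b \<Rightarrow> real"
  assumes "prob_space M" "prob_space N"
    and g [measurable]: "(\<lambda>(x, y). g x y) \<in> borel_measurable (M \<Otimes>\<^sub>M N)"
  shows "(\<integral>\<^sup>+x. \<integral>\<^sup>+y. \<integral>\<^sup>+x'. \<integral>\<^sup>+y'. ennreal ((g x y - g x' y')\<^sup>2) \<partial>N \<partial>M \<partial>N \<partial>M)
    \<le> (\<integral>\<^sup>+y. \<integral>\<^sup>+x. \<integral>\<^sup>+x'. ennreal ((g x y - g x' y)\<^sup>2) \<partial>M \<partial>M \<partial>N)
     + (\<integral>\<^sup>+x. \<integral>\<^sup>+y. \<integral>\<^sup>+y'. ennreal ((g x y - g x y')\<^sup>2) \<partial>N \<partial>N \<partial>M)" (is "?D \<le> ?A + ?B")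
proof -
  interpret M: prob_space M by fact
  interpret N: prob_space N by fact
  interpret MN: pair_sigma_finite M N ..
  interpret NM: pair_sigma_finite N M ..
  interpret MM: pair_sigma_finite M M ..
  interpret NN: pair_sigma_finite N N ..
  have [measurable]: "(\<lambda>x. g (f x) (h x)) \<in> borel_measurable L"
    if [measurable]: "f \<in> measurable L M" "h \<in> measurable L N" for f h and L :: "'z measure"
    using measurable_compose[OF measurable_Pair[OF that] g] by simp
  let ?S = "\<lambda>u. \<integral>\<^sup>+x. \<integral>\<^sup>+y. \<integral>\<^sup>+x'. \<integral>\<^sup>+y'. ennreal (u x y x' y') \<partial>N \<partial>M \<partial>N \<partial>M"
  have swap_y: "(\<integral>\<^sup>+x. \<integral>\<^sup>+y. \<integral>\<^sup>+x'. \<integral>\<^sup>+y'. u x y x' y' \<partial>N \<partial>M \<partial>N \<partial>M)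
      = (\<integral>\<^sup>+x. \<integral>\<^sup>+y. \<integral>\<^sup>+x'. \<integral>\<^sup>+y'. u x y' x' y \<partial>N \<partial>M \<partial>N \<partial>M)"
    if [measurable]: "(\<lambda>(x, y, x', y'). u x y x' y') \<in> borel_measurable (M \<Otimes>\<^sub>M N \<Otimes>\<^sub>M M \<Otimes>\<^sub>M N)"
    for u :: "'a \<Rightarrow> 'b \<Rightarrow> 'a \<Rightarrow> 'b \<Rightarrow> ennreal"
  proof -
    have [measurable]: "(\<lambda>w. u (a w) (b w) (c w) (d w)) \<in> borel_measurable L"
      if [measurable]: "a \<in> measurable L M" "b \<in> measurable L N" "c \<in> measurable L M" "d \<in> measurable L N"
      for a b c d and L :: "'z measure"
      using measurable_compose[OF measurable_Pair[OF that(1) measurable_Pair[OF that(2) measurable_Pair[OF that(3,4)]]]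
          \<open>(\<lambda>(x, y, x', y'). u x y x' y') \<in> borel_measurable (M \<Otimes>\<^sub>M N \<Otimes>\<^sub>M M \<Otimes>\<^sub>M N)\<close>] by simp
    have "(\<integral>\<^sup>+y. \<integral>\<^sup>+x'. \<integral>\<^sup>+y'. u x y x' y' \<partial>N \<partial>M \<partial>N) = (\<integral>\<^sup>+y. \<integral>\<^sup>+x'. \<integral>\<^sup>+y'. u x y' x' y \<partial>N \<partial>M \<partial>N)"
      if [measurable]: "x \<in> space M" for x
    proof -
      have "(\<integral>\<^sup>+y. \<integral>\<^sup>+x'. \<integral>\<^sup>+y'. u x y x' y' \<partial>N \<partial>M \<partial>N) = (\<integral>\<^sup>+x'. \<integral>\<^sup>+y. \<integral>\<^sup>+y'. u x y x' y' \<partial>N \<partial>N \<partial>M)"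
        by (rule MN.Fubini') measurable
      also have "\<dots> = (\<integral>\<^sup>+x'. \<integral>\<^sup>+y. \<integral>\<^sup>+y'. u x y' x' y \<partial>N \<partial>N \<partial>M)"
        by (intro nn_integral_cong NN.Fubini') measurable
      also have "\<dots> = (\<integral>\<^sup>+y. \<integral>\<^sup>+x'. \<integral>\<^sup>+y'. u x y' x' y \<partial>N \<partial>M \<partial>N)"
        by (rule NM.Fubini') measurable
      finally show ?thesis .
    qed
    then show ?thesis by (rule nn_integral_cong)
  qed
  have add4: "(\<integral>\<^sup>+x. \<integral>\<^sup>+y. \<integral>\<^sup>+x'. \<integral>\<^sup>+y'. u x y x' y' + v x y x' y' \<partial>N \<partial>M \<partial>N \<partial>M)
      = (\<integral>\<^sup>+x. \<integral>\<^sup>+y. \<integral>\<^sup>+x'. \<integral>\<^sup>+y'. u x y x' y' \<partial>N \<partial>M \<partial>N \<partial>M)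
      + (\<integral>\<^sup>+x. \<integral>\<^sup>+y. \<integral>\<^sup>+x'. \<integral>\<^sup>+y'. v x y x' y' \<partial>N \<partial>M \<partial>N \<partial>M)"
    if [measurable]: "(\<lambda>(x, y, x', y'). u x y x' y') \<in> borel_measurable (M \<Otimes>\<^sub>M N \<Otimes>\<^sub>M M \<Otimes>\<^sub>M N)"
       "(\<lambda>(x, y, x', y'). v x y x' y') \<in> borel_measurable (M \<Otimes>\<^sub>M N \<Otimes>\<^sub>M M \<Otimes>\<^sub>M N)"
    for u v :: "'a \<Rightarrow> 'b \<Rightarrow> 'a \<Rightarrow> 'b \<Rightarrow> ennreal"
  proof -
    have [measurable]: "(\<lambda>w. u (a w) (b w) (c w) (d w)) \<in> borel_measurable L"
      if [measurable]: "a \<in> measurable L M" "b \<in> measurable L N" "c \<in> measurable L M" "d \<in> measurable L N"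
      for a b c d and L :: "'z measure"
      using measurable_compose[OF measurable_Pair[OF that(1) measurable_Pair[OF that(2) measurable_Pair[OF that(3,4)]]]
          \<open>(\<lambda>(x, y, x', y'). u x y x' y') \<in> borel_measurable (M \<Otimes>\<^sub>M N \<Otimes>\<^sub>M M \<Otimes>\<^sub>M N)\<close>] by simp
    have [measurable]: "(\<lambda>w. v (a w) (b w) (c w) (d w)) \<in> borel_measurable L"
      if [measurable]: "a \<in> measurable L M" "b \<in> measurable L N" "c \<in> measurable L M" "d \<in> measurable L N"
      for a b c d and L :: "'z measure"
      using measurable_compose[OF measurable_Pair[OF that(1) measurable_Pair[OF that(2) measurable_Pair[OF that(3,4)]]]
          \<open>(\<lambda>(x, y, x', y'). v x y x' y') \<in> borel_measurable (M \<Otimes>\<^sub>M N \<Otimes>\<^sub>M M \<Otimes>\<^sub>M N)\<close>] by simp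
    show ?thesis
      apply (subst nn_integral_add[symmetric], measurable, rule nn_integral_cong)
      apply (subst nn_integral_add[symmetric], measurable, rule nn_integral_cong)
      apply (subst nn_integral_add[symmetric], measurable, rule nn_integral_cong)
      apply (subst nn_integral_add[symmetric], measurable)
      done
  qed
  have A: "?S (\<lambda>x y x' y'. (g x y - g x' y)\<^sup>2) = ?A"
  proof -
    have "?S (\<lambda>x y x' y'. (g x y - g x' y)\<^sup>2) = (\<integral>\<^sup>+x. \<integral>\<^sup>+y. \<integral>\<^sup>+x'. ennreal ((g x y - g x' y)\<^sup>2) \<partial>M \<partial>N \<partial>M)"
      by (simp add: N.emeasure_space_1)
    also have "\<dots> = ?A" by (rule NM.Fubini') measurable
    finally show ?thesis .
  qed
  have B: "?S (\<lambda>x y x' y'. (g x y - g x y')\<^sup>2) = ?B"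
    by (simp add: M.emeasure_space_1)
  have A': "?S (\<lambda>x y x' y'. (g x y' - g x' y')\<^sup>2) = ?A"
    by (subst swap_y, measurable) (rule A)
  have B': "?S (\<lambda>x y x' y'. (g x' y - g x' y')\<^sup>2) = ?B"
    by (simp add: M.emeasure_space_1) (rule MN.Fubini', measurable)
  have D': "?S (\<lambda>x y x' y'. (g x y' - g x' y)\<^sup>2) = ?D"
    by (subst swap_y, measurable)
  have "?D + ?D = ?S (\<lambda>x y x' y'. (g x y - g x' y')\<^sup>2) + ?S (\<lambda>x y x' y'. (g x y' - g x' y)\<^sup>2)"
    by (simp only: D')
  also have "\<dots> = ?S (\<lambda>x y x' y'. (g x y - g x' y')\<^sup>2 + (g x y' - g x' y)\<^sup>2)"
    by (simp, subst add4, measurable)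
  also have "\<dots> \<le> ?S (\<lambda>x y x' y'. (g x y - g x' y)\<^sup>2 + (g x y' - g x' y')\<^sup>2
       + ((g x y - g x y')\<^sup>2 + (g x' y - g x' y')\<^sup>2))"
    by (intro nn_integral_mono ennreal_leI quadrilateral_le)
  also have "\<dots> = (?A + ?A) + (?B + ?B)"
    unfolding ennreal_plus[OF add_nonneg_nonneg[OF zero_le_power2 zero_le_power2] add_nonneg_nonneg[OF zero_le_power2 zero_le_power2]]
      ennreal_plus[OF zero_le_power2 zero_le_power2]
    by (subst add4, measurable, subst add4, measurable, subst add4, measurable) (simp only: A B A' B')
  finally have "2 * ?D \<le> 2 * (?A + ?B)" by (simp add: mult_2 algebra_simps)
  then show ?thesis by (subst (asm) ennreal_mult_le_mult_iff) auto
qed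

text \<open>Induction on the coordinates: \<open>efron_stein_pair\<close> separates the new
  coordinate from the old ones, and the induction hypothesis is applied under the integral for each
  fixed value of the new coordinate.\<close>

lemma efron_stein_gauss:
  fixes f :: "('i \<Rightarrow> real) \<Rightarrow> real"
  assumes "finite I" and "f \<in> borel_measurable (PiM I (\<lambda>_. gauss_line))"
  shows "(\<integral>\<^sup>+x. \<integral>\<^sup>+y. ennreal ((f x - f y)\<^sup>2) \<partial>PiM I (\<lambda>_. gauss_line) \<partial>PiM I (\<lambda>_. gauss_line))
    \<le> (\<Sum>i\<in>I. \<integral>\<^sup>+x. \<integral>\<^sup>+a. \<integral>\<^sup>+b. ennreal ((f (x(i := a)) - f (x(i := b)))\<^sup>2) \<partial>gauss_line \<partial>gauss_line \<partial>PiM I (\<lambda>_. gauss_line))"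
  using assms
proof (induction I arbitrary: f rule: finite_induct)
  case empty
  interpret product_prob_space "\<lambda>_. gauss_line" "{}" 
    by (simp add: product_prob_space_def product_prob_space_axioms_def product_sigma_finite_def prob_space_gauss_line prob_space_imp_sigma_finite)
  show ?case by (simp add: nn_integral_empty)
next
  case (insert i I)
  let ?G = gauss_line
  interpret G: prob_space gauss_line by (rule prob_space_gauss_line)
  interpret product_sigma_finite "\<lambda>_. gauss_line" ..
  interpret PI: prob_space "PiM I (\<lambda>_. gauss_line)" by (rule prob_space_PiM) (rule prob_space_gauss_line)
  interpret PIG: pair_sigma_finite "PiM I (\<lambda>_. gauss_line)" gauss_line ..
  interpret GPI: pair_sigma_finite gauss_line "PiM I (\<lambda>_. gauss_line)" ..
  note [measurable] = insert.prems
  note fi = \<open>finite I\<close> \<open>i \<notin> I\<close>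
  have upd [measurable]: "(\<lambda>x. (h x)(i := k x)) \<in> measurable L (PiM (insert i I) (\<lambda>_. ?G))"
    if [measurable]: "h \<in> measurable L (PiM I (\<lambda>_. ?G))" "k \<in> borel_measurable L" for h k and L :: "'z measure"
    by (rule measurable_fun_upd[where J=I]) (auto simp: measurable_cong_sets[OF refl sets_gauss_line])
  have upd2 [measurable]: "(\<lambda>x. (h x)(j := k x)) \<in> measurable L (PiM I (\<lambda>_. ?G))"
    if "j \<in> I" and [measurable]: "h \<in> measurable L (PiM I (\<lambda>_. ?G))" "k \<in> borel_measurable L" for h k j and L :: "'z measure"
    using that(1) by (intro measurable_fun_upd[where J=I]) (auto simp: measurable_cong_sets[OF refl sets_gauss_line])
  have upd3 [measurable]: "(\<lambda>x. (h x)(j := k x)) \<in> measurable L (PiM (insert i I) (\<lambda>_. ?G))"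
    if "j \<in> insert i I" and [measurable]: "h \<in> measurable L (PiM (insert i I) (\<lambda>_. ?G))" "k \<in> borel_measurable L" for h k j and L :: "'z measure"
    using that(1) by (intro measurable_fun_upd[where J="insert i I"]) (auto simp: measurable_cong_sets[OF refl sets_gauss_line])
  have "(\<integral>\<^sup>+x. \<integral>\<^sup>+y. ennreal ((f x - f y)\<^sup>2) \<partial>PiM (insert i I) (\<lambda>_. ?G) \<partial>PiM (insert i I) (\<lambda>_. ?G))
     = (\<integral>\<^sup>+x. \<integral>\<^sup>+a. \<integral>\<^sup>+y. \<integral>\<^sup>+b. ennreal ((f (x(i := a)) - f (y(i := b)))\<^sup>2) \<partial>?G \<partial>PiM I (\<lambda>_. ?G) \<partial>?G \<partial>PiM I (\<lambda>_. ?G))"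
    using fi by (simp add: product_nn_integral_insert)
  also have "\<dots> \<le> (\<integral>\<^sup>+a. \<integral>\<^sup>+x. \<integral>\<^sup>+y. ennreal ((f (x(i := a)) - f (y(i := a)))\<^sup>2) \<partial>PiM I (\<lambda>_. ?G) \<partial>PiM I (\<lambda>_. ?G) \<partial>?G)
     + (\<integral>\<^sup>+x. \<integral>\<^sup>+a. \<integral>\<^sup>+b. ennreal ((f (x(i := a)) - f (x(i := b)))\<^sup>2) \<partial>?G \<partial>?G \<partial>PiM I (\<lambda>_. ?G))"
    by (rule efron_stein_pair[where g="\<lambda>x a. f (x(i := a))"]) (unfold_locales, measurable)
  \<comment> \<open>The integrand overwrites coordinate i, so integrating over that coordinate as
    well contributes only the factor one.\<close>
  also have "(\<integral>\<^sup>+x. \<integral>\<^sup>+a. \<integral>\<^sup>+b. ennreal ((f (x(i := a)) - f (x(i := b)))\<^sup>2) \<partial>?G \<partial>?G \<partial>PiM I (\<lambda>_. ?G))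
      = (\<integral>\<^sup>+x. \<integral>\<^sup>+a. \<integral>\<^sup>+b. ennreal ((f (x(i := a)) - f (x(i := b)))\<^sup>2) \<partial>?G \<partial>?G \<partial>PiM (insert i I) (\<lambda>_. ?G))"
    using fi by (simp add: product_nn_integral_insert G.emeasure_space_1[simplified])
  finally have split: "(\<integral>\<^sup>+x. \<integral>\<^sup>+y. ennreal ((f x - f y)\<^sup>2) \<partial>PiM (insert i I) (\<lambda>_. ?G) \<partial>PiM (insert i I) (\<lambda>_. ?G))
     \<le> (\<integral>\<^sup>+a. \<integral>\<^sup>+x. \<integral>\<^sup>+y. ennreal ((f (x(i := a)) - f (y(i := a)))\<^sup>2) \<partial>PiM I (\<lambda>_. ?G) \<partial>PiM I (\<lambda>_. ?G) \<partial>?G)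
     + (\<integral>\<^sup>+x. \<integral>\<^sup>+a. \<integral>\<^sup>+b. ennreal ((f (x(i := a)) - f (x(i := b)))\<^sup>2) \<partial>?G \<partial>?G \<partial>PiM (insert i I) (\<lambda>_. ?G))" .
  have "(\<integral>\<^sup>+a. \<integral>\<^sup>+x. \<integral>\<^sup>+y. ennreal ((f (x(i := a)) - f (y(i := a)))\<^sup>2) \<partial>PiM I (\<lambda>_. ?G) \<partial>PiM I (\<lambda>_. ?G) \<partial>?G)
    \<le> (\<integral>\<^sup>+a. (\<Sum>j\<in>I. \<integral>\<^sup>+x. \<integral>\<^sup>+c. \<integral>\<^sup>+d. ennreal ((f ((x(j := c))(i := a)) - f ((x(j := d))(i := a)))\<^sup>2) \<partial>?G \<partial>?G \<partial>PiM I (\<lambda>_. ?G)) \<partial>?G)"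
    by (intro nn_integral_mono insert.IH) measurable
  also have "\<dots> = (\<Sum>j\<in>I. \<integral>\<^sup>+a. \<integral>\<^sup>+x. \<integral>\<^sup>+c. \<integral>\<^sup>+d. ennreal ((f ((x(j := c))(i := a)) - f ((x(j := d))(i := a)))\<^sup>2) \<partial>?G \<partial>?G \<partial>PiM I (\<lambda>_. ?G) \<partial>?G)"
    by (intro nn_integral_sum) measurable
  also have "\<dots> = (\<Sum>j\<in>I. \<integral>\<^sup>+x. \<integral>\<^sup>+c. \<integral>\<^sup>+d. ennreal ((f (x(j := c)) - f (x(j := d)))\<^sup>2) \<partial>?G \<partial>?G \<partial>PiM (insert i I) (\<lambda>_. ?G))"
  proof (intro sum.cong refl)
    fix j assume j: "j \<in> I"
    then have "j \<noteq> i" using fi by auto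
    have "(\<integral>\<^sup>+x. \<integral>\<^sup>+c. \<integral>\<^sup>+d. ennreal ((f (x(j := c)) - f (x(j := d)))\<^sup>2) \<partial>?G \<partial>?G \<partial>PiM (insert i I) (\<lambda>_. ?G))
      = (\<integral>\<^sup>+a. \<integral>\<^sup>+x. \<integral>\<^sup>+c. \<integral>\<^sup>+d. ennreal ((f ((x(i := a))(j := c)) - f ((x(i := a))(j := d)))\<^sup>2) \<partial>?G \<partial>?G \<partial>PiM I (\<lambda>_. ?G) \<partial>?G)"
      using fi j by (intro product_nn_integral_insert_rev) (auto, measurable)
    then show "(\<integral>\<^sup>+a. \<integral>\<^sup>+x. \<integral>\<^sup>+c. \<integral>\<^sup>+d. ennreal ((f ((x(j := c))(i := a)) - f ((x(j := d))(i := a)))\<^sup>2) \<partial>?G \<partial>?G \<partial>PiM I (\<lambda>_. ?G) \<partial>?G)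
       = (\<integral>\<^sup>+x. \<integral>\<^sup>+c. \<integral>\<^sup>+d. ennreal ((f (x(j := c)) - f (x(j := d)))\<^sup>2) \<partial>?G \<partial>?G \<partial>PiM (insert i I) (\<lambda>_. ?G))"
      using \<open>j \<noteq> i\<close> by (simp add: fun_upd_twist)
  qed
  finally show ?case
    unfolding sum.insert[OF fi] by (subst add.commute) (rule order.trans[OF split add_right_mono])
qed

section \<open>The Gaussian measure on Euclidean space and its Poincare inequality\<close>

lemma lborel_vec_eq:
  "(lborel :: (real^'n::finite) measure) = distr (PiM UNIV (\<lambda>_. lborel)) borel (\<lambda>f. \<chi> i. f i)"
proof (rule lborel_eqI)
  interpret product_sigma_finite "\<lambda>_::'n. (lborel :: real measure)" ..
  have m [measurable]: "(\<lambda>f. \<chi> i. f i) \<in> measurable (PiM UNIV (\<lambda>_::'n. (lborel :: real measure))) (borel :: (real^'n) measure)"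
  proof (rule borel_measurable_euclidean_space[THEN iffD2], rule ballI)
    fix b :: "real^'n" assume "b \<in> Basis"
    then obtain k where "b = axis k 1" by (auto simp: Basis_vec_def)
    then have "(\<lambda>f. (\<chi> i. f i) \<bullet> b) = (\<lambda>f :: 'n \<Rightarrow> real. f k)" by (auto simp: inner_axis)
    then show "(\<lambda>f. (\<chi> i. f i) \<bullet> b) \<in> borel_measurable (PiM UNIV (\<lambda>_::'n. (lborel :: real measure)))"
      by simp
  qed
  show "sets (distr (PiM UNIV (\<lambda>_::'n. (lborel :: real measure))) borel (\<lambda>f. \<chi> i. f i)) = sets (borel :: (real^'n) measure)"
    by simp
  fix l u :: "real^'n" assume le: "\<And>b. b \<in> Basis \<Longrightarrow> l \<bullet> b \<le> u \<bullet> b"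
  have le': "l $ i \<le> u $ i" for i
    using le[of "axis i 1"] by (auto simp: Basis_vec_def inner_axis)
  have "emeasure (distr (PiM UNIV (\<lambda>_::'n. (lborel :: real measure))) borel (\<lambda>f. \<chi> i. f i)) (box l u)
      = emeasure (PiM UNIV (\<lambda>_::'n. (lborel :: real measure))) (\<Pi>\<^sub>E i\<in>UNIV. {l $ i <..< u $ i})"
    by (subst emeasure_distr) (auto intro!: arg_cong[where f="emeasure _"] simp: space_PiM mem_box_cart PiE_def Pi_def extensional_def)
  also have "\<dots> = (\<Prod>i\<in>UNIV. ennreal (u $ i - l $ i))"
    by (subst emeasure_PiM) (auto simp: le')
  also have "\<dots> = ennreal (\<Prod>i\<in>UNIV. (u $ i - l $ i))"
    by (rule prod_ennreal) (simp add: le')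
  also have "(\<Prod>i\<in>UNIV. (u $ i - l $ i)) = (\<Prod>b\<in>Basis. (u - l) \<bullet> b)"
  proof -
    have B: "(Basis :: (real^'n) set) = (\<lambda>i. axis i 1) ` UNIV" by (auto simp: Basis_vec_def)
    have "inj (\<lambda>i::'n. axis i (1::real))" by (auto simp: inj_on_def axis_eq_axis)
    then show ?thesis unfolding B by (subst prod.reindex) (auto simp: inner_axis)
  qed
  finally show "emeasure (distr (PiM UNIV (\<lambda>_::'n. (lborel :: real measure))) borel (\<lambda>f. \<chi> i. f i)) (box l u)
     = ennreal (\<Prod>b\<in>Basis. (u - l) \<bullet> b)" .
qed

definition gauss_density :: "real^'n::finite \<Rightarrow> real" where
  "gauss_density x = (\<Prod>i\<in>UNIV. std_normal_density (x $ i))"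

lemma gauss_density_eq:
  "gauss_density (x :: real^'n::finite) = (1 / sqrt (2 * pi)) ^ CARD('n) * exp (- (norm x)\<^sup>2 / 2)"
proof -
  have "gauss_density x = (\<Prod>i\<in>(UNIV::'n set). 1 / sqrt (2 * pi)) * (\<Prod>i\<in>UNIV. exp (- (x $ i)\<^sup>2 / 2))"
    unfolding gauss_density_def std_normal_density_def by (rule prod.distrib)
  also have "(\<Prod>i\<in>UNIV. exp (- (x $ i)\<^sup>2 / 2)) = exp (\<Sum>i\<in>UNIV. - (x $ i)\<^sup>2 / 2)"
    by (simp add: exp_sum)
  also have "(\<Sum>i\<in>UNIV. - (x $ i)\<^sup>2 / 2) = - (norm x)\<^sup>2 / 2"
    by (simp add: norm_vec_def L2_set_def sum_nonneg sum_negf sum_divide_distrib[symmetric])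
  finally show ?thesis by simp
qed

lemma gauss_density_nonneg [simp]: "gauss_density x \<ge> 0"
  by (simp add: gauss_density_def prod_nonneg)

lemma continuous_gauss_density: "continuous_on UNIV (gauss_density :: real^'n::finite \<Rightarrow> real)"
  unfolding gauss_density_eq by (intro continuous_intros) auto

lemma borel_measurable_gauss_density [measurable]: "gauss_density \<in> borel_measurable borel"
  by (rule borel_measurable_continuous_onI[OF continuous_gauss_density])

definition gauss_space :: "(real^'n::finite) measure" where
  "gauss_space = density lborel (\<lambda>x. ennreal (gauss_density x))"

lemma sets_gauss_space [measurable_cong, simp]: "sets gauss_space = sets borel"
  by (simp add: gauss_space_def)

lemma space_gauss_space [simp]: "space gauss_space = UNIV"
  by (simp add: gauss_space_def)

lemma measurable_vec_lambda_PiM: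
  "(\<lambda>f. \<chi> i. f i) \<in> measurable (PiM UNIV (\<lambda>_::'n::finite. (borel :: real measure))) (borel :: (real^'n) measure)"
proof (rule borel_measurable_euclidean_space[THEN iffD2], rule ballI)
  fix b :: "real^'n" assume "b \<in> Basis"
  then obtain k where "b = axis k 1" by (auto simp: Basis_vec_def)
  then have "(\<lambda>f. (\<chi> i. f i) \<bullet> b) = (\<lambda>f :: 'n \<Rightarrow> real. f k)" by (auto simp: inner_axis)
  then show "(\<lambda>f. (\<chi> i. f i) \<bullet> b) \<in> borel_measurable (PiM UNIV (\<lambda>_::'n. (borel :: real measure)))"
    by simp
qed

lemma PiM_gauss_line:
  "PiM UNIV (\<lambda>_::'n::finite. gauss_line) = density (PiM UNIV (\<lambda>_. lborel)) (\<lambda>x. \<Prod>i\<in>UNIV. ennreal (std_normal_density (x i)))"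
proof -
  interpret G: prob_space gauss_line by (rule prob_space_gauss_line)
  interpret product_sigma_finite "\<lambda>_::'n. gauss_line" ..
  interpret L: product_sigma_finite "\<lambda>_::'n. (lborel :: real measure)" ..
  show ?thesis
  proof (rule PiM_eqI[symmetric])
    show "sets (density (PiM UNIV (\<lambda>_. lborel)) (\<lambda>x. \<Prod>i\<in>UNIV. ennreal (std_normal_density (x i)))) = sets (PiM UNIV (\<lambda>_::'n. gauss_line))"
      unfolding sets_density by (rule sets_PiM_cong) auto
    fix A :: "'n \<Rightarrow> real set" assume A: "\<And>i. i \<in> UNIV \<Longrightarrow> A i \<in> sets gauss_line"
    have [measurable]: "A i \<in> sets borel" for i using A[of i] by simp
    have S: "Pi\<^sub>E UNIV A \<in> sets (PiM UNIV (\<lambda>_::'n. (lborel :: real measure)))"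
      by (rule sets_PiM_I_finite) auto
    have ind: "indicator (Pi\<^sub>E UNIV A) x = (\<Prod>i\<in>UNIV. indicator (A i) (x i) :: ennreal)" for x :: "'n \<Rightarrow> real"
    proof (cases "x \<in> Pi\<^sub>E UNIV A")
      case False
      then obtain i where "x i \<notin> A i" by (auto simp: PiE_def Pi_def extensional_def)
      then have "(\<Prod>i\<in>UNIV. indicator (A i) (x i) :: ennreal) = 0" by (intro prod_zero) (auto intro!: exI[of _ i])
      then show ?thesis using False by simp
    qed (auto simp: PiE_def Pi_def intro!: prod.neutral)
    have "emeasure (density (PiM UNIV (\<lambda>_. lborel)) (\<lambda>x. \<Prod>i\<in>UNIV. ennreal (std_normal_density (x i)))) (Pi\<^sub>E UNIV A)
      = (\<integral>\<^sup>+x. (\<Prod>i\<in>UNIV. ennreal (std_normal_density (x i))) * indicator (Pi\<^sub>E UNIV A) x \<partial>PiM UNIV (\<lambda>_::'n. lborel))"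
      using S by (subst emeasure_density) auto
    also have "\<dots> = (\<integral>\<^sup>+x. (\<Prod>i\<in>UNIV. ennreal (std_normal_density (x i)) * indicator (A i) (x i)) \<partial>PiM UNIV (\<lambda>_::'n. lborel))"
      unfolding ind by (simp add: prod.distrib)
    also have "\<dots> = (\<Prod>i\<in>UNIV. \<integral>\<^sup>+t. ennreal (std_normal_density t) * indicator (A i) t \<partial>lborel)"
      by (rule L.product_nn_integral_prod) auto
    also have "\<dots> = (\<Prod>i\<in>UNIV. emeasure gauss_line (A i))"
      unfolding gauss_line_def by (intro prod.cong refl) (subst emeasure_density, auto)
    finally show "emeasure (density (PiM UNIV (\<lambda>_. lborel)) (\<lambda>x. \<Prod>i\<in>UNIV. ennreal (std_normal_density (x i)))) (Pi\<^sub>E UNIV A)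
      = (\<Prod>i\<in>UNIV. emeasure gauss_line (A i))" .
  qed simp
qed

lemma nn_integral_gauss_space:
  assumes [measurable]: "h \<in> borel_measurable borel"
  shows "(\<integral>\<^sup>+x. h x \<partial>gauss_space) = (\<integral>\<^sup>+f. h (\<chi> i. f i) \<partial>PiM UNIV (\<lambda>_::'n::finite. gauss_line))"
proof -
  note [measurable] = measurable_vec_lambda_PiM
  have "(\<integral>\<^sup>+x. h x \<partial>gauss_space) = (\<integral>\<^sup>+x. ennreal (gauss_density x) * h x \<partial>lborel)"
    unfolding gauss_space_def by (rule nn_integral_density) auto
  also have "\<dots> = (\<integral>\<^sup>+f. ennreal (gauss_density (\<chi> i. f i)) * h (\<chi> i. f i) \<partial>PiM UNIV (\<lambda>_::'n. lborel))"
    by (subst lborel_vec_eq) (subst nn_integral_distr, auto)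
  also have "\<dots> = (\<integral>\<^sup>+f. h (\<chi> i. f i) \<partial>PiM UNIV (\<lambda>_::'n::finite. gauss_line))"
    unfolding PiM_gauss_line by (subst nn_integral_density) (auto simp: gauss_density_def prod_ennreal)
  finally show ?thesis .
qed

lemma prob_space_gauss_space: "prob_space (gauss_space :: (real^'n::finite) measure)"
proof
  interpret P: prob_space "PiM UNIV (\<lambda>_::'n. gauss_line)"
    by (rule prob_space_PiM) (rule prob_space_gauss_line)
  have "(\<integral>\<^sup>+x. 1 \<partial>(gauss_space :: (real^'n) measure)) = 1"
    by (subst nn_integral_gauss_space) (auto simp: P.emeasure_space_1)
  then show "emeasure gauss_space (space (gauss_space :: (real^'n) measure)) = 1" by simp
qed

text \<open>Tensorisation reduces the claim to variations of one coordinate at a time, where the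
  inequality on the line applies. Its constant does not depend on the dimension, and the squared
  partial derivatives add up to the squared gradient.\<close>

theorem gauss_space_poincare:
  fixes F :: "real^'n::finite \<Rightarrow> real"
  assumes cont: "continuous_on UNIV F" and fin: "finite Z"
    and der: "\<And>x. x \<notin> Z \<Longrightarrow> (F has_derivative F' x) (at x)"
    and meas: "\<And>i. (\<lambda>x. F' x (axis i 1)) \<in> borel_measurable borel"
  shows "(\<integral>\<^sup>+x. \<integral>\<^sup>+y. ennreal ((F x - F y)\<^sup>2) \<partial>gauss_space \<partial>gauss_space)
    \<le> 2 * (\<integral>\<^sup>+x. ennreal (\<Sum>i\<in>UNIV. (F' x (axis i 1))\<^sup>2) \<partial>gauss_space)"
proof -
  let ?G = "PiM UNIV (\<lambda>_::'n. gauss_line)"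
  let ?v = "\<lambda>f :: 'n \<Rightarrow> real. (\<chi> i. f i) :: real^'n"
  interpret G: prob_space gauss_line by (rule prob_space_gauss_line)
  interpret PSF: product_sigma_finite "\<lambda>_::'n. gauss_line" ..
  interpret P: prob_space ?G by (rule prob_space_PiM) (rule prob_space_gauss_line)
  interpret GS: prob_space "gauss_space :: (real^'n) measure" by (rule prob_space_gauss_space)
  note [measurable] = measurable_vec_lambda_PiM meas
  have [measurable]: "F \<in> borel_measurable borel" by (rule borel_measurable_continuous_onI[OF cont])
  have line: "(\<integral>\<^sup>+a. \<integral>\<^sup>+b. ennreal ((F (?v (x(i := a))) - F (?v (x(i := b))))\<^sup>2) \<partial>gauss_line \<partial>gauss_line)
      \<le> 2 * (\<integral>\<^sup>+t. ennreal ((F' (?v (x(i := t))) (axis i 1))\<^sup>2) \<partial>gauss_line)" for x i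
  \<comment> \<open>On a line parallel to the i-th axis, the parameters of exceptional points are
    among their i-th coordinates, hence finite in number.\<close>
  proof (rule gauss_line_poincare[where Z="(\<lambda>v. v $ i) ` Z"])
    define x0 where "x0 = ?v (x(i := 0))"
    have eq: "?v (x(i := t)) = x0 + t *\<^sub>R axis i 1" for t
      by (auto simp: x0_def vec_eq_iff axis_def)
    have c: "continuous_on UNIV (\<lambda>t. ?v (x(i := t)))" unfolding eq by (intro continuous_intros)
    show "continuous_on UNIV (\<lambda>t. F (?v (x(i := t))))"
      by (rule continuous_on_compose2[OF cont c]) auto
    show "finite ((\<lambda>v. v $ i) ` Z)" using fin by simp
    have mv [measurable]: "(\<lambda>t. ?v (x(i := t))) \<in> borel_measurable borel"
      by (rule borel_measurable_continuous_onI[OF c])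
    show "(\<lambda>t. F' (?v (x(i := t))) (axis i 1)) \<in> borel_measurable borel" by measurable
    fix t assume t: "t \<notin> (\<lambda>v. v $ i) ` Z"
    have "?v (x(i := t)) \<notin> Z"
    proof
      assume "?v (x(i := t)) \<in> Z"
      then have "?v (x(i := t)) $ i \<in> (\<lambda>v. v $ i) ` Z" by (rule imageI)
      then show False using t by simp
    qed
    then have D: "(F has_derivative F' (?v (x(i := t)))) (at (?v (x(i := t))))" by (rule der)
    have d: "((\<lambda>t. ?v (x(i := t))) has_derivative (\<lambda>h. h *\<^sub>R axis i 1)) (at t)"
      unfolding eq by (auto intro!: derivative_eq_intros)
    have lin: "linear (F' (?v (x(i := t))))" using D by (rule has_derivative_linear)
    have "((\<lambda>t. F (?v (x(i := t)))) has_derivative (\<lambda>h. F' (?v (x(i := t))) (h *\<^sub>R axis i 1))) (at t)"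
      using diff_chain_at[OF d D] by (simp add: o_def)
    then show "((\<lambda>t. F (?v (x(i := t)))) has_real_derivative F' (?v (x(i := t))) (axis i 1)) (at t)"
      unfolding has_field_derivative_def linear_cmul[OF lin] real_scaleR_def mult.commute[of _ "F' _ _"] .
  qed
  have "(\<integral>\<^sup>+x. \<integral>\<^sup>+y. ennreal ((F x - F y)\<^sup>2) \<partial>gauss_space \<partial>gauss_space)
     = (\<integral>\<^sup>+x. \<integral>\<^sup>+y. ennreal ((F (?v x) - F (?v y))\<^sup>2) \<partial>?G \<partial>?G)"
    by (simp add: nn_integral_gauss_space)
  also have "\<dots> \<le> (\<Sum>i\<in>UNIV. \<integral>\<^sup>+x. \<integral>\<^sup>+a. \<integral>\<^sup>+b. ennreal ((F (?v (x(i := a))) - F (?v (x(i := b))))\<^sup>2) \<partial>gauss_line \<partial>gauss_line \<partial>?G)"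
    by (rule efron_stein_gauss) measurable
  also have "\<dots> \<le> (\<Sum>i\<in>UNIV. \<integral>\<^sup>+x. 2 * (\<integral>\<^sup>+t. ennreal ((F' (?v (x(i := t))) (axis i 1))\<^sup>2) \<partial>gauss_line) \<partial>?G)"
    by (intro sum_mono nn_integral_mono line)
  also have "\<dots> = (\<Sum>i\<in>UNIV. 2 * (\<integral>\<^sup>+x. ennreal ((F' x (axis i 1))\<^sup>2) \<partial>gauss_space))"
  proof (intro sum.cong refl)
    fix i :: 'n
    \<comment> \<open>Coordinate i of x is overwritten by t. Splitting it off from the product
      measure shows that resampling it leaves the integral unchanged.\<close>
    let ?I = "UNIV - {i}"
    have U: "insert i ?I = UNIV" by auto
    have um [measurable]: "(\<lambda>x. (h x)(i := k x)) \<in> measurable L (PiM UNIV (\<lambda>_. borel))"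
      if [measurable]: "h \<in> measurable L (PiM UNIV (\<lambda>_::'n. borel))" "k \<in> borel_measurable L"
      for h and k :: "'z \<Rightarrow> real" and L :: "'z measure"
      by (rule measurable_fun_upd[where J=UNIV]) auto
    have m: "(\<lambda>x. \<integral>\<^sup>+t. ennreal ((F' (?v (x(i := t))) (axis i 1))\<^sup>2) \<partial>gauss_line) \<in> borel_measurable ?G"
      by measurable
    have m2: "(\<lambda>x. ennreal ((F' (?v x) (axis i 1))\<^sup>2)) \<in> borel_measurable ?G"
      by measurable
    have "(\<integral>\<^sup>+x. \<integral>\<^sup>+t. ennreal ((F' (?v (x(i := t))) (axis i 1))\<^sup>2) \<partial>gauss_line \<partial>?G)
       = (\<integral>\<^sup>+x. ennreal ((F' (?v x) (axis i 1))\<^sup>2) \<partial>?G)"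
      using PSF.product_nn_integral_insert[of ?I i "\<lambda>x. \<integral>\<^sup>+t. ennreal ((F' (?v (x(i := t))) (axis i 1))\<^sup>2) \<partial>gauss_line"]
        PSF.product_nn_integral_insert[of ?I i "\<lambda>x. ennreal ((F' (?v x) (axis i 1))\<^sup>2)"] m m2
      unfolding U by (simp add: G.emeasure_space_1[simplified])
    then show "(\<integral>\<^sup>+x. 2 * (\<integral>\<^sup>+t. ennreal ((F' (?v (x(i := t))) (axis i 1))\<^sup>2) \<partial>gauss_line) \<partial>?G)
       = 2 * (\<integral>\<^sup>+x. ennreal ((F' x (axis i 1))\<^sup>2) \<partial>gauss_space)"
      by (subst nn_integral_cmult[OF m], subst nn_integral_gauss_space, measurable) (simp only:)
  qed
  also have "\<dots> = 2 * (\<integral>\<^sup>+x. ennreal (\<Sum>i\<in>UNIV. (F' x (axis i 1))\<^sup>2) \<partial>gauss_space)"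
    by (simp add: sum_distrib_left[symmetric] nn_integral_sum[symmetric] sum_ennreal)
  finally show ?thesis .
qed

lemma nn_integral_gauss_space_norm_square:
  "(\<integral>\<^sup>+x. ennreal ((norm x)\<^sup>2) \<partial>(gauss_space :: (real^'n::finite) measure)) = ennreal (CARD('n))"
proof -
  let ?G = "PiM UNIV (\<lambda>_::'n. gauss_line)"
  interpret G: prob_space gauss_line by (rule prob_space_gauss_line)
  interpret PSF: product_sigma_finite "\<lambda>_::'n. gauss_line" ..
  have one: "(\<integral>\<^sup>+t. ennreal (t\<^sup>2) \<partial>gauss_line) = 1"
  proof -
    have "(\<integral>\<^sup>+t. ennreal (t\<^sup>2) \<partial>gauss_line) = (\<integral>\<^sup>+t. ennreal (std_normal_density t * t\<^sup>2) \<partial>lborel)"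
      by (subst nn_integral_gauss_line) (auto intro!: nn_integral_cong simp: ennreal_mult'[symmetric])
    also have "\<dots> = ennreal (\<integral>t. std_normal_density t * t\<^sup>2 \<partial>lborel)"
      by (rule nn_integral_eq_integral) (use integrable_std_normal_moment[of 2] in auto)
    also have "(\<integral>t. std_normal_density t * t\<^sup>2 \<partial>lborel) = 1"
      using integral_std_normal_moment_even[of 1] by simp
    finally show ?thesis by simp
  qed
  have "(\<integral>\<^sup>+x. ennreal ((norm x)\<^sup>2) \<partial>(gauss_space :: (real^'n) measure))
     = (\<integral>\<^sup>+f. (\<Sum>i\<in>UNIV. ennreal ((f i)\<^sup>2)) \<partial>?G)"
    by (subst nn_integral_gauss_space)
       (auto intro!: nn_integral_cong simp: norm_vec_def L2_set_def sum_nonneg sum_ennreal)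
  also have "\<dots> = (\<Sum>i\<in>UNIV. \<integral>\<^sup>+f. ennreal ((f i)\<^sup>2) \<partial>?G)"
    by (rule nn_integral_sum) auto
  also have "\<dots> = (\<Sum>i\<in>(UNIV::'n set). 1)"
  proof (intro sum.cong refl)
    fix i :: 'n
    have "(\<integral>\<^sup>+f. ennreal ((f i)\<^sup>2) \<partial>?G) = (\<integral>\<^sup>+f. (\<Prod>j\<in>UNIV. if j = i then ennreal ((f j)\<^sup>2) else 1) \<partial>?G)"
      by (intro nn_integral_cong) (simp add: prod.delta)
    also have "\<dots> = (\<Prod>j\<in>UNIV. \<integral>\<^sup>+t. (if j = i then ennreal (t\<^sup>2) else 1) \<partial>gauss_line)"
      by (rule PSF.product_nn_integral_prod) auto
    also have "\<dots> = 1"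
    proof (intro prod.neutral ballI)
      fix j
      show "(\<integral>\<^sup>+t. (if j = i then ennreal (t\<^sup>2) else 1) \<partial>gauss_line) = 1"
        by (cases "j = i") (simp_all add: one G.emeasure_space_1[simplified])
    qed
    finally show "(\<integral>\<^sup>+f. ennreal ((f i)\<^sup>2) \<partial>?G) = 1" .
  qed
  also have "\<dots> = ennreal (CARD('n))" by (simp add: ennreal_of_nat_eq_real_of_nat)
  finally show ?thesis .
qed

section \<open>Integrals of derivatives of functions with bounded support\<close>

lemma integrable_continuous_bounded_support:
  fixes f :: "'a::euclidean_space \<Rightarrow> real"
  assumes "continuous_on UNIV f" and "\<And>x. norm x > R \<Longrightarrow> f x = 0"
  shows "integrable lborel f"
proof -
  have "integrable lborel (\<lambda>x. indicator (cball 0 R) x *\<^sub>R f x)"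
    by (rule borel_integrable_compact) (use assms(1) in \<open>auto intro: continuous_on_subset\<close>)
  also have "(\<lambda>x. indicator (cball 0 R) x *\<^sub>R f x) = f"
    using assms(2) by (auto simp: fun_eq_iff indicator_def not_le)
  finally show ?thesis .
qed

text \<open>The integral of \<open>G (x + t b)\<close> does not depend on \<open>t\<close>; differentiate at \<open>t = 0\<close>.\<close>

lemma integral_directional_derivative_eq_0:
  fixes G :: "'a::euclidean_space \<Rightarrow> real"
  assumes der: "\<And>x. (G has_derivative G' x) (at x)"
    and cont: "continuous_on UNIV (\<lambda>x. G' x b)"
    and supp: "\<And>x. norm x > R \<Longrightarrow> G x = 0"
  shows "(\<integral>x. G' x b \<partial>lborel) = 0"
proof -
  have contG: "continuous_on UNIV G"
    using der by (meson continuous_at_imp_continuous_on has_derivative_continuous)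
  have intG: "integrable lborel G"
    by (rule integrable_continuous_bounded_support[OF contG supp])
  have [measurable]: "G \<in> borel_measurable borel" "(\<lambda>x. G' x b) \<in> borel_measurable borel"
    by (rule borel_measurable_continuous_onI[OF contG], rule borel_measurable_continuous_onI[OF cont])
  have supp': "G' x b = 0" if "norm x > R" for x
  proof -
    have "open {x :: 'a. norm x > R}" by (intro open_Collect_less continuous_intros)
    then have "eventually (\<lambda>y. y \<in> {x. norm x > R}) (nhds x)"
      using that by (intro eventually_nhds_in_open) auto
    then have ev: "eventually (\<lambda>y. (\<lambda>_. 0) y = G y) (nhds x)"
      by eventually_elim (simp add: supp)
    have "(G has_derivative (\<lambda>_. 0)) (at x)"
      by (rule has_derivative_transform_eventually[OF has_derivative_const[of 0] eventually_at_filter[THEN iffD2]])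
         (use ev that in \<open>auto simp: supp elim: eventually_mono\<close>)
    then show ?thesis using has_derivative_unique[OF der] by metis
  qed
  obtain B where B: "\<And>x. \<bar>G' x b\<bar> \<le> B" and B0: "B \<ge> 0"
  proof -
    have "compact ((\<lambda>x. G' x b) ` cball 0 R)"
      by (rule compact_continuous_image) (use cont in \<open>auto intro: continuous_on_subset\<close>)
    then obtain B where bB: "\<And>x. x \<in> cball 0 R \<Longrightarrow> \<bar>G' x b\<bar> \<le> B"
      by (metis (no_types, lifting) bounded_iff compact_imp_bounded imageI real_norm_def)
    have "\<bar>G' x b\<bar> \<le> max B 0" for x
    proof (cases "norm x \<le> R")
      case True
      then have "\<bar>G' x b\<bar> \<le> B" by (intro bB) simp
      then show ?thesis by simp
    qed (use supp'[of x] in simp)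
    then show ?thesis using that[of "max B 0"] by auto
  qed
  have hder: "((\<lambda>t. G (x + t *\<^sub>R b)) has_real_derivative G' (x + t *\<^sub>R b) b) (at t)" for x t
  proof -
    have lin: "linear (G' (x + t *\<^sub>R b))" using der by (rule has_derivative_linear)
    have "((\<lambda>t. x + t *\<^sub>R b) has_derivative (\<lambda>h. h *\<^sub>R b)) (at t)"
      by (auto intro!: derivative_eq_intros)
    from diff_chain_at[OF this der] show ?thesis
      unfolding has_field_derivative_def o_def linear_cmul[OF lin] real_scaleR_def mult.commute[of _ "G' _ _"] .
  qed
  \<comment> \<open>Difference quotients with step 1/(k+1). Their integrals vanish by translation
    invariance, and the mean value theorem bounds them by \<open>B\<close> on a ball enlarged by the
    norm of b, which permits dominated convergence.\<close>
  define D where "D = (\<lambda>k x. (G (x + (1 / real (Suc k)) *\<^sub>R b) - G x) * real (Suc k))"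
  have Dbound: "\<bar>D k x\<bar> \<le> B * indicator (cball 0 (R + norm b)) x" for k x
  proof (cases "x \<in> cball 0 (R + norm b)")
    case True
    obtain \<xi> where "G (x + (1 / real (Suc k)) *\<^sub>R b) - G (x + 0 *\<^sub>R b) = (1 / real (Suc k) - 0) * G' (x + \<xi> *\<^sub>R b) b"
      using MVT2[of 0 "1 / real (Suc k)" "\<lambda>t. G (x + t *\<^sub>R b)" "\<lambda>t. G' (x + t *\<^sub>R b) b"] hder by auto
    then have "D k x = G' (x + \<xi> *\<^sub>R b) b" unfolding D_def by simp
    then show ?thesis using B True by simp
  next
    case False
    then have n: "norm x > R + norm b" by (simp add: not_le)
    have "norm ((1 / real (Suc k)) *\<^sub>R b) \<le> norm b"
      using mult_right_mono[of "1 / real (Suc k)" 1 "norm b"] by simp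
    then have "norm (x + (1 / real (Suc k)) *\<^sub>R b) > R"
      using n norm_diff_ineq[of x "(1 / real (Suc k)) *\<^sub>R b"] by linarith
    moreover have "norm x > R" using n norm_ge_zero[of b] by linarith
    ultimately show ?thesis using False by (simp add: D_def supp)
  qed
  have D0: "(\<integral>x. D k x \<partial>lborel) = 0" for k
  proof -
    let ?c = "(1 / real (Suc k)) *\<^sub>R b"
    have i1: "integrable lborel (\<lambda>x. G (?c + x))"
      using integrable_distr[of "(+) ?c" lborel borel G] intG by (simp add: lborel_distr_plus)
    have "(\<integral>x. G (?c + x) \<partial>lborel) = (\<integral>x. G x \<partial>lborel)"
      using integral_distr[of "(+) ?c" lborel borel G] by (simp add: lborel_distr_plus)
    then show ?thesis unfolding D_def using i1 intG by (simp add: add.commute)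
  qed
  have lim: "(\<lambda>k. D k x) \<longlonglongrightarrow> G' x b" for x
  proof -
    have "((\<lambda>t. (G (x + t *\<^sub>R b) - G (x + 0 *\<^sub>R b)) / (t - 0)) \<longlongrightarrow> G' (x + 0 *\<^sub>R b) b) (at 0)"
      using hder[of x 0] unfolding has_field_derivative_iff .
    moreover have "filterlim (\<lambda>k. 1 / real (Suc k)) (at 0) sequentially"
      by (intro filterlim_atI LIMSEQ_Suc[OF lim_1_over_n]) (auto intro!: always_eventually)
    ultimately have "(\<lambda>k. (G (x + (1 / real (Suc k)) *\<^sub>R b) - G (x + 0 *\<^sub>R b)) / (1 / real (Suc k) - 0)) \<longlonglongrightarrow> G' (x + 0 *\<^sub>R b) b"
      by (rule filterlim_compose)
    then show ?thesis by (simp add: D_def)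
  qed
  have "(\<lambda>k. \<integral>x. D k x \<partial>lborel) \<longlonglongrightarrow> (\<integral>x. G' x b \<partial>lborel)"
  proof (rule integral_dominated_convergence[where w="\<lambda>x. B * indicator (cball 0 (R + norm b)) x"])
    show "integrable lborel (\<lambda>x :: 'a. B * indicator (cball 0 (R + norm b)) x)"
      using emeasure_lborel_cball_finite[of "0 :: 'a" "R + norm b"]
      by (intro integrable_mult_right integrable_real_indicator) auto
  qed (auto simp: lim Dbound, simp add: D_def)
  then show ?thesis by (simp add: D0 LIMSEQ_const_iff)
qed

section \<open>The uniform measure on the sphere and polar coordinates\<close>

text \<open>The uniform probability measure of the unit sphere, encoded as the law of the direction
  of a Gaussian vector. It is a measure on the whole space concentrated on the sphere; the origin,
  where \<open>sgn\<close> is zero, is a Gaussian null set.\<close>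

definition sphere_measure :: "(real^'n::finite) measure" where
  "sphere_measure = distr gauss_space borel sgn"

lemma borel_measurable_sgn [measurable]: "sgn \<in> borel_measurable (borel :: (real^'n::finite) measure)"
  unfolding sgn_div_norm[abs_def] by measurable

lemma sets_sphere_measure [measurable_cong, simp]: "sets sphere_measure = sets borel"
  by (simp add: sphere_measure_def)

lemma space_sphere_measure [simp]: "space sphere_measure = UNIV"
  by (simp add: sphere_measure_def)

lemma prob_space_sphere_measure: "prob_space sphere_measure"
  unfolding sphere_measure_def by (rule prob_space.prob_space_distr[OF prob_space_gauss_space]) simp

lemma AE_gauss_space_nonzero: "AE x in (gauss_space :: (real^'n::finite) measure). x \<noteq> 0"
  unfolding gauss_space_def by (subst AE_density) (use AE_lborel_singleton[of "0 :: real^'n"] in \<open>auto elim!: eventually_mono\<close>)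

lemma AE_sphere_measure: "AE x in sphere_measure. norm x = 1"
  unfolding sphere_measure_def
  by (subst AE_distr_iff) (use AE_gauss_space_nonzero in \<open>auto simp: norm_sgn elim!: eventually_mono\<close>)

lemma nn_integral_lborel_scale:
  fixes f :: "'a::euclidean_space \<Rightarrow> ennreal"
  assumes [measurable]: "f \<in> borel_measurable borel" and "c > 0"
  shows "(\<integral>\<^sup>+x. f x \<partial>lborel) = ennreal (c ^ DIM('a)) * (\<integral>\<^sup>+x. f (c *\<^sub>R x) \<partial>lborel)"
  using \<open>c > 0\<close>
  by (subst lborel_affine[of c 0])
     (auto simp: nn_integral_density nn_integral_distr nn_integral_cmult)

text \<open>Length and direction are independent. By scaling, the ball of radius r has r^n times the
  mass of the unit ball for every weight that depends only on the direction. The distributions of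
  the length for two such weights are therefore proportional, and the ratio is read off the unit
  ball. The product form avoids a division by its volume.\<close>

lemma nn_integral_radial_mult:
  fixes \<phi> :: "real^'n::finite \<Rightarrow> ennreal"
  assumes [measurable]: "\<phi> \<in> borel_measurable borel" "h \<in> borel_measurable borel"
    and bound: "\<And>x. \<phi> x \<le> ennreal C"
  shows "(\<integral>\<^sup>+x. h (norm x) * \<phi> (sgn x) \<partial>lborel) * (\<integral>\<^sup>+x. indicator (ball 0 1) x \<partial>(lborel :: (real^'n) measure))
    = (\<integral>\<^sup>+x. h (norm (x :: real^'n)) \<partial>lborel) * (\<integral>\<^sup>+x. indicator (ball 0 1) x * \<phi> (sgn x) \<partial>lborel)"
proof -
  define V where "V = (\<integral>\<^sup>+x. indicator (ball 0 1) x \<partial>(lborel :: (real^'n) measure))"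
  define B where "B = (\<integral>\<^sup>+x. indicator (ball 0 1) x * \<phi> (sgn x) \<partial>lborel)"
  \<comment> \<open>The length is taken with a minus sign, so that centred balls become the
    half-lines \<open>{t<..}\<close> on which measures on the line are compared below.\<close>
  define \<nu> where "\<nu> = (\<lambda>\<psi> :: real^'n \<Rightarrow> ennreal. distr (density lborel (\<lambda>x. \<psi> (sgn x))) borel (\<lambda>x. - norm x))"
  have Vfin: "V < \<infinity>" unfolding V_def using emeasure_lborel_ball_finite[of "0 :: real^'n" 1] by simp
  have "B \<le> (\<integral>\<^sup>+x. indicator (ball 0 1) x * ennreal C \<partial>(lborel :: (real^'n) measure))"
    unfolding B_def by (intro nn_integral_mono mult_left_mono bound) auto
  also have "\<dots> < \<infinity>"
    using emeasure_lborel_ball_finite[of "0 :: real^'n" 1]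
    by (subst nn_integral_multc) (auto simp: ennreal_mult_less_top intro!: borel_measurable_indicator)
  finally have Bfin: "B < \<infinity>" .
  have tail: "emeasure (\<nu> \<psi>) {t<..}
      = ennreal ((if t < 0 then - t else 0) ^ CARD('n)) * (\<integral>\<^sup>+x. indicator (ball 0 1) x * \<psi> (sgn x) \<partial>lborel)"
    if [measurable]: "\<psi> \<in> borel_measurable borel" for \<psi> t
  proof -
    have [measurable]: "{x :: real^'n. t < - norm x} \<in> sets borel" by measurable
    have "emeasure (\<nu> \<psi>) {t<..} = (\<integral>\<^sup>+x. \<psi> (sgn x) * indicator {x. t < - norm x} x \<partial>lborel)"
      unfolding \<nu>_def by (subst emeasure_distr, simp, simp, subst emeasure_density) (auto simp: vimage_def)
    also have "\<dots> = ennreal ((if t < 0 then - t else 0) ^ CARD('n)) * (\<integral>\<^sup>+x. indicator (ball 0 1) x * \<psi> (sgn x) \<partial>lborel)"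
    proof (cases "t < 0")
      case True
      have "(\<integral>\<^sup>+x. \<psi> (sgn x) * indicator {x. t < - norm x} x \<partial>lborel)
        = ennreal ((- t) ^ CARD('n)) * (\<integral>\<^sup>+x. \<psi> (sgn ((- t) *\<^sub>R x)) * indicator {x :: real^'n. t < - norm x} ((- t) *\<^sub>R x) \<partial>lborel)"
        by (subst nn_integral_lborel_scale[of _ "- t"]) (use True in auto)
      also have "(\<integral>\<^sup>+x. \<psi> (sgn ((- t) *\<^sub>R x)) * indicator {x :: real^'n. t < - norm x} ((- t) *\<^sub>R x) \<partial>lborel)
         = (\<integral>\<^sup>+x. indicator (ball 0 1) x * \<psi> (sgn x) \<partial>lborel)"
      proof (rule nn_integral_cong)
        fix x :: "real^'n"
        have "sgn ((- t) *\<^sub>R x) = sgn x" using True by (simp only: sgn_scaleR) simp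
        moreover have "t < - norm ((- t) *\<^sub>R x) \<longleftrightarrow> norm x < 1"
          using True by simp
        ultimately show "\<psi> (sgn ((- t) *\<^sub>R x)) * indicator {x. t < - norm x} ((- t) *\<^sub>R x) = indicator (ball 0 1) x * \<psi> (sgn x)"
          by (auto simp: indicator_def)
      qed
      finally show ?thesis using True by simp
    next
      case False
      then have "{x :: real^'n. t < - norm x} = {}" by (auto simp: not_less) (metis neg_le_0_iff_le norm_ge_zero order.trans not_less)
      then show ?thesis using False by (simp add: zero_power)
    qed
    finally show ?thesis .
  qed
  have "scale_measure V (\<nu> \<phi>) = scale_measure B (\<nu> (\<lambda>_. 1))"
  proof (rule measure_eqI_lessThan)
    show "sets (scale_measure V (\<nu> \<phi>)) = sets borel" "sets (scale_measure B (\<nu> (\<lambda>_. 1))) = sets borel"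
      by (auto simp: \<nu>_def)
    fix t :: real
    show "emeasure (scale_measure V (\<nu> \<phi>)) {t<..} < \<infinity>"
      using Vfin Bfin by (simp add: tail B_def[symmetric] ennreal_mult_less_top)
    show "emeasure (scale_measure V (\<nu> \<phi>)) {t<..} = emeasure (scale_measure B (\<nu> (\<lambda>_. 1))) {t<..}"
      by (simp add: tail) (simp add: B_def V_def ac_simps)
  qed
  then have "(\<integral>\<^sup>+r. h (- r) \<partial>scale_measure V (\<nu> \<phi>)) = (\<integral>\<^sup>+r. h (- r) \<partial>scale_measure B (\<nu> (\<lambda>_. 1)))" by simp
  moreover have "(\<integral>\<^sup>+r. h (- r) \<partial>scale_measure V (\<nu> \<phi>)) = V * (\<integral>\<^sup>+x. \<phi> (sgn x) * h (norm x) \<partial>lborel)"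
    by (subst nn_integral_scale_measure) (auto simp: \<nu>_def nn_integral_distr nn_integral_density)
  moreover have "(\<integral>\<^sup>+r. h (- r) \<partial>scale_measure B (\<nu> (\<lambda>_. 1))) = B * (\<integral>\<^sup>+x. h (norm (x :: real^'n)) \<partial>lborel)"
    by (subst nn_integral_scale_measure) (auto simp: \<nu>_def nn_integral_distr nn_integral_density)
  ultimately show ?thesis
    unfolding V_def[symmetric] B_def[symmetric] by (simp add: ac_simps)
qed

text \<open>In \<open>nn_integral_radial_mult\<close> the choice of the Gaussian density as radial
  factor identifies the ratio of the two unit ball integrals as the integral over
  \<open>sphere_measure\<close>.\<close>

lemma nn_integral_radial_sphere:
  fixes \<phi> :: "real^'n::finite \<Rightarrow> ennreal"
  assumes [measurable]: "\<phi> \<in> borel_measurable borel" "h \<in> borel_measurable borel"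
    and bound: "\<And>x. \<phi> x \<le> ennreal C"
  shows "(\<integral>\<^sup>+x. h (norm x) * \<phi> (sgn x) \<partial>lborel)
    = (\<integral>\<^sup>+x. h (norm (x :: real^'n)) \<partial>lborel) * (\<integral>\<^sup>+x. \<phi> x \<partial>sphere_measure)"
proof -
  let ?V = "\<integral>\<^sup>+x. indicator (ball 0 1) x \<partial>(lborel :: (real^'n) measure)"
  let ?B = "\<integral>\<^sup>+x. indicator (ball 0 1) x * \<phi> (sgn x) \<partial>lborel"
  define g where "g = (\<lambda>r. ennreal ((1 / sqrt (2 * pi)) ^ CARD('n) * exp (- r\<^sup>2 / 2)))"
  have [measurable]: "g \<in> borel_measurable borel" unfolding g_def by measurable
  have gd: "ennreal (gauss_density x) = g (norm x)" for x :: "real^'n"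
    unfolding g_def gauss_density_eq ..
  interpret prob_space "gauss_space :: (real^'n) measure" by (rule prob_space_gauss_space)
  have "(\<integral>\<^sup>+x. g (norm (x :: real^'n)) \<partial>lborel) = (\<integral>\<^sup>+x. 1 \<partial>(gauss_space :: (real^'n) measure))"
    unfolding gauss_space_def by (subst nn_integral_density) (auto simp: gd)
  then have g1: "(\<integral>\<^sup>+x. g (norm (x :: real^'n)) \<partial>lborel) = 1"
    using emeasure_space_1 by simp
  have "(\<integral>\<^sup>+x. g (norm x) * \<phi> (sgn x) \<partial>lborel) = (\<integral>\<^sup>+x. \<phi> x \<partial>sphere_measure)"
    unfolding sphere_measure_def
    by (subst nn_integral_distr, simp, simp) (auto simp: gauss_space_def nn_integral_density gd)
  then have B: "?B = (\<integral>\<^sup>+x. \<phi> x \<partial>sphere_measure) * ?V"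
    using nn_integral_radial_mult[of \<phi> g C, OF assms(1) _ bound] by (simp add: g1)
  have "(\<integral>\<^sup>+x. h (norm x) * \<phi> (sgn x) \<partial>lborel) * ?V
     = ((\<integral>\<^sup>+x. h (norm (x :: real^'n)) \<partial>lborel) * (\<integral>\<^sup>+x. \<phi> x \<partial>sphere_measure)) * ?V"
    using nn_integral_radial_mult[OF assms] by (simp add: B mult.assoc)
  moreover have "?V \<noteq> 0" "?V \<noteq> \<infinity>"
    by (auto simp: emeasure_lborel_ball_finite less_top[symmetric] content_ball_pos
          dest!: arg_cong[where f=enn2real] simp flip: measure_def)
  ultimately show ?thesis by (metis (no_types, lifting) infinity_ennreal_def mult_divide_eq_ennreal)
qed

text \<open>The signed version: adding the bound \<open>C\<close> makes \<phi> nonnegative, and the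
  contribution of the constant is subtracted again.\<close>

lemma integral_radial_sphere:
  fixes \<phi> :: "real^'n::finite \<Rightarrow> real"
  assumes [measurable]: "\<phi> \<in> borel_measurable borel" "h \<in> borel_measurable borel"
    and bound: "\<And>x. \<bar>\<phi> x\<bar> \<le> C" and h0: "\<And>r. h r \<ge> 0"
    and int: "integrable lborel (\<lambda>x :: real^'n. h (norm x))"
  shows "integrable lborel (\<lambda>x. h (norm x) * \<phi> (sgn x))"
    and "(\<integral>x. h (norm x) * \<phi> (sgn x) \<partial>lborel) = (\<integral>x. h (norm (x :: real^'n)) \<partial>lborel) * (\<integral>x. \<phi> x \<partial>sphere_measure)"
proof -
  interpret S: prob_space "sphere_measure :: (real^'n) measure" by (rule prob_space_sphere_measure)
  have *: "integrable lborel (\<lambda>x. h (norm x) * \<psi> (sgn x))"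
    if [measurable]: "\<psi> \<in> borel_measurable borel" and b: "\<And>x. \<bar>\<psi> x\<bar> \<le> D" for \<psi> :: "real^'n \<Rightarrow> real" and D
  proof (rule Bochner_Integration.integrable_bound[OF integrable_mult_right[OF int, of D]])
    have "D \<ge> 0" using b[of 0] by linarith
    then show "AE x in lborel. norm (h (norm x) * \<psi> (sgn x)) \<le> norm (D * h (norm x))"
      using b h0 by (intro AE_I2) (simp add: abs_mult mult.commute[of D] mult_left_mono)
  qed measurable
  show i1: "integrable lborel (\<lambda>x. h (norm x) * \<phi> (sgn x))" by (rule *[OF _ bound]) measurable
  define \<psi> where "\<psi> = (\<lambda>x. \<phi> x + C)"
  have [measurable]: "\<psi> \<in> borel_measurable borel" by (simp add: \<psi>_def)
  have \<psi>: "0 \<le> \<psi> x" "\<bar>\<psi> x\<bar> \<le> 2 * C" for x using bound[of x] by (auto simp: \<psi>_def abs_le_iff)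
  have iS: "integrable sphere_measure \<phi>" by (rule S.integrable_const_bound[of _ C]) (auto simp: bound)
  have "(\<integral>x. h (norm x) * \<psi> (sgn x) \<partial>lborel) = enn2real (\<integral>\<^sup>+x. ennreal (h (norm x) * \<psi> (sgn x)) \<partial>lborel)"
    by (rule integral_eq_nn_integral) (auto simp: h0 \<psi>)
  also have "(\<integral>\<^sup>+x. ennreal (h (norm x) * \<psi> (sgn x)) \<partial>lborel) = (\<integral>\<^sup>+x. ennreal (h (norm x)) * ennreal (\<psi> (sgn x)) \<partial>lborel)"
    by (simp add: ennreal_mult h0 \<psi>)
  also have "\<dots> = (\<integral>\<^sup>+x. ennreal (h (norm (x :: real^'n))) \<partial>lborel) * (\<integral>\<^sup>+x. ennreal (\<psi> x) \<partial>sphere_measure)"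
    by (rule nn_integral_radial_sphere[where C="2 * C"]) (auto intro!: ennreal_leI abs_le_D1[OF \<psi>(2)])
  also have "enn2real \<dots> = (\<integral>x. h (norm (x :: real^'n)) \<partial>lborel) * (\<integral>x. \<psi> x \<partial>sphere_measure)"
    by (simp add: enn2real_mult integral_eq_nn_integral h0 \<psi>)
  finally have "(\<integral>x. h (norm x) * \<psi> (sgn x) \<partial>lborel) = (\<integral>x. h (norm (x :: real^'n)) \<partial>lborel) * (\<integral>x. \<psi> x \<partial>sphere_measure)" .
  moreover have "(\<integral>x. \<psi> x \<partial>sphere_measure) = (\<integral>x. \<phi> x \<partial>sphere_measure) + C"
    unfolding \<psi>_def using iS S.prob_space by simp
  moreover have "(\<integral>x. h (norm x) * \<psi> (sgn x) \<partial>lborel) = (\<integral>x. h (norm x) * \<phi> (sgn x) \<partial>lborel) + (\<integral>x. h (norm (x :: real^'n)) \<partial>lborel) * C"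
    unfolding \<psi>_def using i1 int by (simp add: distrib_left)
  ultimately show "(\<integral>x. h (norm x) * \<phi> (sgn x) \<partial>lborel) = (\<integral>x. h (norm (x :: real^'n)) \<partial>lborel) * (\<integral>x. \<phi> x \<partial>sphere_measure)"
    by (simp add: distrib_left)
qed

lemma integral_gauss_space_radial_sphere:
  fixes \<phi> :: "real^'n::finite \<Rightarrow> real"
  assumes [measurable]: "\<phi> \<in> borel_measurable borel" "h \<in> borel_measurable borel"
    and bound: "\<And>x. \<bar>\<phi> x\<bar> \<le> C" and h0: "\<And>r. h r \<ge> 0"
    and int: "integrable gauss_space (\<lambda>x :: real^'n. h (norm x))"
  shows "integrable gauss_space (\<lambda>x. h (norm x) * \<phi> (sgn x))"
    and "(\<integral>x. h (norm x) * \<phi> (sgn x) \<partial>gauss_space) = (\<integral>x. h (norm (x :: real^'n)) \<partial>gauss_space) * (\<integral>x. \<phi> x \<partial>sphere_measure)"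
proof -
  define g where "g = (\<lambda>r. (1 / sqrt (2 * pi)) ^ CARD('n) * exp (- r\<^sup>2 / 2))"
  have [measurable]: "g \<in> borel_measurable borel" unfolding g_def by measurable
  have gd: "gauss_density x = g (norm x)" for x :: "real^'n" unfolding g_def gauss_density_eq ..
  have g0: "g r \<ge> 0" for r by (simp add: g_def)
  have int': "integrable lborel (\<lambda>x :: real^'n. g (norm x) * h (norm x))"
    using int unfolding gauss_space_def by (subst (asm) integrable_density) (auto simp: gd g0)
  note r = integral_radial_sphere[of \<phi> "\<lambda>r. g r * h r" C, OF assms(1) _ bound _ int']
  show "integrable gauss_space (\<lambda>x. h (norm x) * \<phi> (sgn x))"
    unfolding gauss_space_def using r(1) by (subst integrable_density) (auto simp: gd g0 h0 ac_simps)
  show "(\<integral>x. h (norm x) * \<phi> (sgn x) \<partial>gauss_space) = (\<integral>x. h (norm (x :: real^'n)) \<partial>gauss_space) * (\<integral>x. \<phi> x \<partial>sphere_measure)"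
    unfolding gauss_space_def using r(2)
    by (subst integral_density, simp, simp, simp add: gd g0, subst integral_density, simp, simp, simp add: gd g0)
       (simp add: gd g0 h0 mult.assoc)
qed

section \<open>Homogeneous functions and the sharp Poincare inequality on the sphere\<close>

lemma homogeneous_has_derivative_scale:
  fixes u :: "'a::euclidean_space \<Rightarrow> real"
  assumes der: "\<And>x. x \<noteq> 0 \<Longrightarrow> (u has_derivative u' x) (at x)"
    and hom: "\<And>c x. c > 0 \<Longrightarrow> u (c *\<^sub>R x) = u x"
    and "x \<noteq> 0" "c > 0"
  shows "u' (c *\<^sub>R x) h = u' x h / c"
proof -
  have "((\<lambda>y. c *\<^sub>R y) has_derivative (\<lambda>h. c *\<^sub>R h)) (at x)" by (auto intro!: derivative_eq_intros)
  moreover have "(u has_derivative u' (c *\<^sub>R x)) (at (c *\<^sub>R x))" using assms by (intro der) auto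
  ultimately have "((\<lambda>y. u (c *\<^sub>R y)) has_derivative (\<lambda>h. u' (c *\<^sub>R x) (c *\<^sub>R h))) (at x)"
    by (rule diff_chain_at[unfolded o_def])
  then have "(u has_derivative (\<lambda>h. u' (c *\<^sub>R x) (c *\<^sub>R h))) (at x)"
    by (simp only: hom[OF \<open>c > 0\<close>])
  then have "u' x = (\<lambda>h. u' (c *\<^sub>R x) (c *\<^sub>R h))" using has_derivative_unique der \<open>x \<noteq> 0\<close> by blast
  moreover have "linear (u' (c *\<^sub>R x))" using assms by (intro has_derivative_linear[OF der]) auto
  ultimately have "u' x h = c * u' (c *\<^sub>R x) h" by (simp add: linear_cmul)
  then show ?thesis using \<open>c > 0\<close> by simp
qed

lemma homogeneous_radial_derivative:
  fixes u :: "'a::euclidean_space \<Rightarrow> real"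
  assumes der: "(u has_derivative u') (at x)"
    and hom: "\<And>c. c > 0 \<Longrightarrow> u (c *\<^sub>R x) = u x"
  shows "u' x = 0"
proof -
  have "((\<lambda>c. c *\<^sub>R x) has_derivative (\<lambda>h. h *\<^sub>R x)) (at 1)" by (auto intro!: derivative_eq_intros)
  moreover have "(u has_derivative u') (at (1 *\<^sub>R x))" using der by simp
  ultimately have "((\<lambda>c. u (c *\<^sub>R x)) has_derivative (\<lambda>h. u' (h *\<^sub>R x))) (at 1)"
    by (rule diff_chain_at[unfolded o_def])
  moreover have "((\<lambda>c. u (c *\<^sub>R x)) has_derivative (\<lambda>h. 0)) (at 1)"
  proof (rule has_derivative_transform_within_open[of "\<lambda>_. u x" _ _ _ "{0<..}"])
    show "((\<lambda>_. u x) has_derivative (\<lambda>h. 0)) (at 1)" by (rule has_derivative_const)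
  qed (auto simp: hom)
  ultimately have "(\<lambda>h. u' (h *\<^sub>R x)) = (\<lambda>h. 0)" by (rule has_derivative_unique)
  from fun_cong[OF this, of 1] show ?thesis by simp
qed

lemma sum_axis_eq:
  fixes L :: "real^'n::finite \<Rightarrow> real"
  assumes "linear L"
  shows "(\<Sum>i\<in>UNIV. x $ i * L (axis i 1)) = L x"
proof -
  have "L x = L (\<Sum>i\<in>UNIV. x $ i *\<^sub>R axis i 1)"
    using basis_expansion[of x] by (simp add: scalar_mult_eq_scaleR)
  also have "\<dots> = (\<Sum>i\<in>UNIV. x $ i * L (axis i 1))"
    using assms by (simp add: linear_sum linear_cmul)
  finally show ?thesis ..
qed

lemma homogeneous_bounded:
  fixes u :: "real^'n::finite \<Rightarrow> real"
  assumes "continuous_on (sphere 0 1) u"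
  obtains C where "C \<ge> 0" "\<And>x. \<bar>u (sgn x)\<bar> \<le> C"
proof -
  have "bounded (u ` sphere 0 1)"
    by (intro compact_imp_bounded compact_continuous_image assms compact_sphere)
  then obtain C where C: "\<And>x. x \<in> sphere 0 1 \<Longrightarrow> \<bar>u x\<bar> \<le> C"
    by (metis (no_types, lifting) bounded_iff imageI real_norm_def)
  have "\<bar>u (sgn x)\<bar> \<le> \<bar>C\<bar> + \<bar>u 0\<bar>" for x
  proof (cases "x = 0")
    case False
    then have "\<bar>u (sgn x)\<bar> \<le> C" by (intro C) (simp add: norm_sgn)
    then show ?thesis by linarith
  qed simp
  then show ?thesis by (intro that[of "\<bar>C\<bar> + \<bar>u 0\<bar>"]) auto
qed

text \<open>The sharp constant comes from the Gaussian inequality for the extension of \<open>u - m\<close> that is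
  homogeneous of degree one: \<open>\<bar>\<nabla>(r v)\<bar>\<^sup>2 = v\<^sup>2 + r\<^sup>2 \<bar>\<nabla>v\<bar>\<^sup>2\<close>, while \<open>r\<^sup>2\<close> has mean \<open>n\<close>.\<close>

theorem sphere_poincare:
  fixes u :: "real^'n::finite \<Rightarrow> real"
  assumes der: "\<And>x. x \<noteq> 0 \<Longrightarrow> (u has_derivative u' x) (at x)"
    and cont: "\<And>i. continuous_on (- {0}) (\<lambda>x. u' x (axis i 1))"
    and hom: "\<And>c x. c > 0 \<Longrightarrow> u (c *\<^sub>R x) = u x"
  shows "(real CARD('n) - 1) * (\<integral>x. (u x - (\<integral>y. u y \<partial>sphere_measure))\<^sup>2 \<partial>sphere_measure)
    \<le> (\<integral>x. (\<Sum>i\<in>UNIV. (u' x (axis i 1))\<^sup>2) \<partial>sphere_measure)"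
proof -
  interpret S: prob_space "sphere_measure :: (real^'n) measure" by (rule prob_space_sphere_measure)
  interpret G: prob_space "gauss_space :: (real^'n) measure" by (rule prob_space_gauss_space)
  define m where "m = (\<integral>y. u y \<partial>sphere_measure)"
  define v where "v = (\<lambda>x. u x - m)"
  define Q where "Q = (\<lambda>x. \<Sum>i\<in>UNIV. (u' x (axis i 1))\<^sup>2)"
  define F where "F = (\<lambda>x. norm x * v x)"
  define F' where "F' = (\<lambda>x h. (sgn x \<bullet> h) * v x + norm x * u' x h)"
  have sgn_u: "u (sgn x) = u x" for x
    using hom[of "inverse (norm x)" x] by (cases "x = 0") (auto simp: sgn_div_norm)
  have contu: "continuous_on (- {0}) u"
    using der by (intro continuous_at_imp_continuous_on) (auto dest: has_derivative_continuous)
  have [measurable]: "u \<in> borel_measurable borel"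
    by (rule borel_measurable_continuous_countable_exceptions[of "{0}"]) (auto simp: contu)
  have mu': "(\<lambda>x. u' x (axis i 1)) \<in> borel_measurable borel" for i
    by (rule borel_measurable_continuous_countable_exceptions[of "{0}"]) (auto simp: cont)
  have [measurable]: "Q \<in> borel_measurable borel" unfolding Q_def using mu' by measurable
  have [measurable]: "v \<in> borel_measurable borel" unfolding v_def by measurable
  obtain C where C: "C \<ge> 0" "\<And>x. \<bar>u (sgn x)\<bar> \<le> C"
    by (rule homogeneous_bounded[of u]) (auto intro: continuous_on_subset[OF contu])
  have contQ: "continuous_on (- {0}) Q" unfolding Q_def by (intro continuous_intros cont)
  obtain D where D: "D \<ge> 0" "\<And>x. \<bar>Q (sgn x)\<bar> \<le> D"
    by (rule homogeneous_bounded[of Q]) (auto intro: continuous_on_subset[OF contQ])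
  define M where "M = C + \<bar>m\<bar>"
  have vb: "\<bar>v x\<bar> \<le> M" for x using C(2)[of x] unfolding sgn_u v_def M_def by linarith
  have v2b: "\<bar>(v x)\<^sup>2\<bar> \<le> M\<^sup>2" for x using power_mono[OF vb[of x], of 2] by simp
  have vs: "v (sgn x) = v x" for x by (simp add: v_def sgn_u)
  have Fder: "(F has_derivative F' x) (at x)" if "x \<noteq> 0" for x
    unfolding F_def F'_def v_def
    by (rule has_derivative_eq_rhs, rule has_derivative_mult[OF has_derivative_norm[OF that] has_derivative_diff[OF der[OF that] has_derivative_const]])
       (auto simp: fun_eq_iff inner_commute algebra_simps)
  have contF: "continuous_on UNIV F"
  proof (rule continuous_at_imp_continuous_on, rule ballI)
    fix x :: "real^'n"
    show "isCont F x"
    proof (cases "x = 0")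
      case True
      have "(F \<longlongrightarrow> 0) (at 0)"
      proof (rule Lim_null_comparison)
        show "eventually (\<lambda>x. norm (F x) \<le> M * norm x) (at 0)"
          using vb by (intro always_eventually) (simp add: F_def abs_mult mult.commute[of M] mult_left_mono)
        show "((\<lambda>x::real^'n. M * norm x) \<longlongrightarrow> 0) (at 0)" by (auto intro!: tendsto_eq_intros)
      qed
      then show ?thesis using True by (simp add: isCont_def F_def)
    next
      case False
      then show ?thesis using Fder has_derivative_continuous by blast
    qed
  qed
  have [measurable]: "F \<in> borel_measurable borel" by (rule borel_measurable_continuous_onI[OF contF])
  have mF': "(\<lambda>x. F' x (axis i 1)) \<in> borel_measurable borel" for i
    unfolding F'_def using mu' by measurable
  have r2: "integrable gauss_space (\<lambda>x::real^'n. (norm x)\<^sup>2)"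
    by (rule integrableI_nonneg) (auto simp: nn_integral_gauss_space_norm_square)
  have r2i: "(\<integral>x. (norm (x::real^'n))\<^sup>2 \<partial>gauss_space) = CARD('n)"
    by (subst integral_eq_nn_integral) (auto simp: nn_integral_gauss_space_norm_square)
  have r1: "integrable gauss_space (\<lambda>x::real^'n. \<bar>norm x\<bar>)"
  proof (rule Bochner_Integration.integrable_bound[OF Bochner_Integration.integrable_add[OF r2 G.integrable_const[of 1]]])
    have "r \<le> r\<^sup>2 + 1" for r :: real using zero_le_power2[of "r - 1/2"] by (simp add: power2_eq_square algebra_simps)
    then show "AE x in gauss_space. norm \<bar>norm (x::real^'n)\<bar> \<le> norm ((norm x)\<^sup>2 + 1)" by (intro AE_I2) simp
  qed measurable
  have iu: "integrable sphere_measure u"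
  proof (rule S.integrable_const_bound[of _ C])
    show "AE x in sphere_measure. norm (u x) \<le> C" using C(2) unfolding sgn_u by simp
  qed measurable
  have v0: "(\<integral>x. v x \<partial>sphere_measure) = 0"
    unfolding v_def using iu S.prob_space by (simp add: m_def)
  have F0: "integrable gauss_space F" "(\<integral>x. F x \<partial>gauss_space) = 0"
    using integral_gauss_space_radial_sphere[of v "\<lambda>r. \<bar>r\<bar>" M] vb r1 by (simp_all add: F_def vs v0)
  have F2: "integrable gauss_space (\<lambda>x. (F x)\<^sup>2)"
     "(\<integral>x. (F x)\<^sup>2 \<partial>gauss_space) = CARD('n) * (\<integral>x. (v x)\<^sup>2 \<partial>sphere_measure)"
    using integral_gauss_space_radial_sphere[of "\<lambda>x. (v x)\<^sup>2" "\<lambda>r. r\<^sup>2" "M\<^sup>2"] v2b r2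
    by (simp_all add: F_def vs r2i power_mult_distrib)
  let ?I = "\<integral>x. (F x)\<^sup>2 \<partial>gauss_space"
  \<comment> \<open>\<open>F\<close> has Gaussian mean zero, so the mixed term disappears and the
    double integral will be twice the second moment of \<open>F\<close>.\<close>
  have inner: "(\<integral>\<^sup>+y. ennreal ((F x - F y)\<^sup>2) \<partial>gauss_space) = ennreal ((F x)\<^sup>2 + ?I)" for x
  proof -
    have eq: "(F x - F y)\<^sup>2 = ((F x)\<^sup>2 - 2 * F x * F y) + (F y)\<^sup>2" for y by (simp add: power2_eq_square algebra_simps)
    have "(\<integral>\<^sup>+y. ennreal ((F x - F y)\<^sup>2) \<partial>gauss_space) = ennreal (\<integral>y. (F x - F y)\<^sup>2 \<partial>gauss_space)"
    proof (rule nn_integral_eq_integral)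
      show "integrable gauss_space (\<lambda>y. (F x - F y)\<^sup>2)" unfolding eq using F0(1) F2(1) by simp
    qed simp
    also have "(\<integral>y. (F x - F y)\<^sup>2 \<partial>gauss_space) = (F x)\<^sup>2 + ?I"
      unfolding eq using F0 F2(1) G.prob_space by simp
    finally show ?thesis .
  qed
  have "(\<integral>\<^sup>+x. \<integral>\<^sup>+y. ennreal ((F x - F y)\<^sup>2) \<partial>gauss_space \<partial>gauss_space) = (\<integral>\<^sup>+x. ennreal ((F x)\<^sup>2 + ?I) \<partial>gauss_space)"
    by (simp add: inner)
  also have "\<dots> = ennreal (\<integral>x. (F x)\<^sup>2 + ?I \<partial>gauss_space)"
    by (rule nn_integral_eq_integral) (use F2(1) in auto)
  also have "(\<integral>x. (F x)\<^sup>2 + ?I \<partial>gauss_space) = 2 * ?I"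
    using F2(1) G.prob_space by simp
  finally have lhs: "(\<integral>\<^sup>+x. \<integral>\<^sup>+y. ennreal ((F x - F y)\<^sup>2) \<partial>gauss_space \<partial>gauss_space) = ennreal (2 * ?I)" .
  \<comment> \<open>The cross term is a multiple of the radial derivative of u, which vanishes by
    homogeneity; the direction contributes a unit vector. What remains depends on the direction of x
    only.\<close>
  have grad: "(\<Sum>i\<in>UNIV. (F' x (axis i 1))\<^sup>2) = (v (sgn x))\<^sup>2 + Q (sgn x)" if x: "x \<noteq> 0" for x
  proof -
    have lin: "linear (u' x)" using der[OF x] by (rule has_derivative_linear)
    have rad: "u' x x = 0" by (rule homogeneous_radial_derivative[OF der[OF x]]) (rule hom)
    have us: "u' (sgn x) h = norm x * u' x h" for h
      using homogeneous_has_derivative_scale[of u u' x "inverse (norm x)" h, OF der hom x] x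
      by (simp add: sgn_div_norm divide_simps)
    have "(F' x (axis i 1))\<^sup>2 = (v x)\<^sup>2 * (sgn x $ i)\<^sup>2 + 2 * v x * (x $ i * u' x (axis i 1)) + (u' (sgn x) (axis i 1))\<^sup>2" for i
    proof -
      have a: "x $ i = sgn x $ i * norm x" using x by (simp add: sgn_div_norm)
      show ?thesis unfolding F'_def us a
        by (simp add: inner_axis power2_eq_square algebra_simps)
    qed
    then have "(\<Sum>i\<in>UNIV. (F' x (axis i 1))\<^sup>2)
       = (v x)\<^sup>2 * (\<Sum>i\<in>UNIV. (sgn x $ i)\<^sup>2) + 2 * v x * (\<Sum>i\<in>UNIV. x $ i * u' x (axis i 1)) + Q (sgn x)"
      by (simp add: sum.distrib sum_distrib_left Q_def)
    also have "(\<Sum>i\<in>UNIV. (sgn x $ i)\<^sup>2) = (norm (sgn x))\<^sup>2"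
      by (simp add: norm_vec_def L2_set_def sum_nonneg)
    also have "\<dots> = 1" using x by (simp add: norm_sgn)
    finally show ?thesis by (simp add: sum_axis_eq[OF lin] rad vs)
  qed
  have iQ: "integrable sphere_measure Q"
    unfolding sphere_measure_def
    by (subst integrable_distr_eq) (auto intro!: G.integrable_const_bound[of _ D] simp: D)
  have iv2: "integrable sphere_measure (\<lambda>x. (v x)\<^sup>2)"
    by (rule S.integrable_const_bound[of _ "M\<^sup>2"]) (use v2b in auto)
  have "(\<integral>\<^sup>+x. ennreal (\<Sum>i\<in>UNIV. (F' x (axis i 1))\<^sup>2) \<partial>gauss_space) = (\<integral>\<^sup>+x. ennreal ((v (sgn x))\<^sup>2 + Q (sgn x)) \<partial>gauss_space)"
    by (rule nn_integral_cong_AE) (use AE_gauss_space_nonzero in eventually_elim, simp add: grad)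
  also have "\<dots> = (\<integral>\<^sup>+x. ennreal ((v x)\<^sup>2 + Q x) \<partial>sphere_measure)"
    unfolding sphere_measure_def by (subst nn_integral_distr) auto
  also have "\<dots> = ennreal (\<integral>x. (v x)\<^sup>2 + Q x \<partial>sphere_measure)"
    by (rule nn_integral_eq_integral) (use iv2 iQ in \<open>auto simp: Q_def intro!: add_nonneg_nonneg sum_nonneg\<close>)
  also have "(\<integral>x. (v x)\<^sup>2 + Q x \<partial>sphere_measure) = (\<integral>x. (v x)\<^sup>2 \<partial>sphere_measure) + (\<integral>x. Q x \<partial>sphere_measure)"
    using iv2 iQ by simp
  finally have rhs: "(\<integral>\<^sup>+x. ennreal (\<Sum>i\<in>UNIV. (F' x (axis i 1))\<^sup>2) \<partial>gauss_space)
     = ennreal ((\<integral>x. (v x)\<^sup>2 \<partial>sphere_measure) + (\<integral>x. Q x \<partial>sphere_measure))" .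
  have Q0: "0 \<le> (\<integral>x. Q x \<partial>sphere_measure)" by (rule Bochner_Integration.integral_nonneg) (simp add: Q_def sum_nonneg)
  have v20: "0 \<le> (\<integral>x. (v x)\<^sup>2 \<partial>sphere_measure)" by (rule Bochner_Integration.integral_nonneg) simp
  have "(\<integral>\<^sup>+x. \<integral>\<^sup>+y. ennreal ((F x - F y)\<^sup>2) \<partial>gauss_space \<partial>gauss_space)
    \<le> 2 * (\<integral>\<^sup>+x. ennreal (\<Sum>i\<in>UNIV. (F' x (axis i 1))\<^sup>2) \<partial>gauss_space)"
    by (rule gauss_space_poincare[OF contF, of "{0}"]) (auto simp: Fder mF')
  then have "ennreal (2 * ?I) \<le> ennreal (2 * ((\<integral>x. (v x)\<^sup>2 \<partial>sphere_measure) + (\<integral>x. Q x \<partial>sphere_measure)))"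
    unfolding lhs rhs by (subst ennreal_mult'[of 2 "_ + _"]) (use Q0 v20 in simp_all)
  then have "?I \<le> (\<integral>x. (v x)\<^sup>2 \<partial>sphere_measure) + (\<integral>x. Q x \<partial>sphere_measure)"
    using Q0 v20 by (subst (asm) ennreal_le_iff) auto
  then show ?thesis unfolding F2(2) by (simp add: v_def m_def Q_def algebra_simps)
qed

section \<open>The divergence theorem on the sphere\<close>

text \<open>The square of the positive part is continuously differentiable; it is the building block
  of the bump function and of the cut-offs below.\<close>

lemma DERIV_max_0_square: "((\<lambda>t::real. (max 0 t)\<^sup>2) has_real_derivative 2 * max 0 t) (at t)"
proof -
  consider "t < 0" | "t > 0" | "t = 0" by linarith
  then show ?thesis
  proof cases
    case 1
    have "((\<lambda>t::real. 0) has_real_derivative 2 * max 0 t) (at t)" using 1 by (auto intro!: derivative_eq_intros)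
    then show ?thesis
      by (rule has_field_derivative_transform_within_open[where S="{..<0}"]) (use 1 in auto)
  next
    case 2
    have "((\<lambda>t::real. t\<^sup>2) has_real_derivative 2 * max 0 t) (at t)" using 2 by (auto intro!: derivative_eq_intros)
    then show ?thesis
      by (rule has_field_derivative_transform_within_open[where S="{0<..}"]) (use 2 in auto)
  next
    case 3
    have "((\<lambda>y::real. ((max 0 y)\<^sup>2 - (max 0 0)\<^sup>2) / (y - 0)) \<longlongrightarrow> 0) (at 0)"
    proof (rule Lim_null_comparison)
      show "eventually (\<lambda>y::real. norm (((max 0 y)\<^sup>2 - (max 0 0)\<^sup>2) / (y - 0)) \<le> \<bar>y\<bar>) (at 0)"
        by (intro always_eventually) (auto simp: max_def power2_eq_square abs_mult divide_le_eq)
      show "((\<lambda>y::real. \<bar>y\<bar>) \<longlongrightarrow> 0) (at 0)" by (auto intro!: tendsto_eq_intros)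
    qed
    then show ?thesis using 3 by (simp add: has_field_derivative_iff)
  qed
qed

lemma integral_pos_continuous:
  fixes f :: "'a::euclidean_space \<Rightarrow> real"
  assumes "continuous_on UNIV f" "integrable lborel f" "\<And>x. f x \<ge> 0" "f a > 0"
  shows "(\<integral>x. f x \<partial>lborel) > 0"
proof -
  have [measurable]: "f \<in> borel_measurable borel" by (rule borel_measurable_continuous_onI) fact
  have "(\<integral>x. f x \<partial>lborel) \<noteq> 0"
  proof
    assume "(\<integral>x. f x \<partial>lborel) = 0"
    then have "AE x in lborel. f x = 0"
      using assms by (subst (asm) integral_nonneg_eq_0_iff_AE) auto
    then have "{x. f x \<noteq> 0} \<in> null_sets lborel"
      by (subst (asm) AE_iff_null) auto
    then have "negligible {x. f x \<noteq> 0}"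
      by (meson negligible_iff_null_sets null_sets_completionI)
    moreover have "open {x. f x \<noteq> 0}" using assms(1) by (intro open_Collect_neq) auto
    moreover have "a \<in> {x. f x \<noteq> 0}" using assms(4) by simp
    ultimately show False using open_not_negligible by blast
  qed
  then show ?thesis using Bochner_Integration.integral_nonneg[of lborel f] assms(3) by (simp add: order.strict_iff_order)
qed

lemma homogeneous_minus1_has_derivative_scale:
  fixes W :: "'a::euclidean_space \<Rightarrow> real"
  assumes der: "\<And>x. x \<noteq> 0 \<Longrightarrow> (W has_derivative W' x) (at x)"
    and hom: "\<And>c x. c > 0 \<Longrightarrow> W (c *\<^sub>R x) = W x / c"
    and "x \<noteq> 0" "c > 0"
  shows "W' (c *\<^sub>R x) h = W' x h / c\<^sup>2"
proof -
  have "((\<lambda>y. c *\<^sub>R y) has_derivative (\<lambda>h. c *\<^sub>R h)) (at x)" by (auto intro!: derivative_eq_intros)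
  moreover have "(W has_derivative W' (c *\<^sub>R x)) (at (c *\<^sub>R x))" using assms by (intro der) auto
  ultimately have "((\<lambda>y. W (c *\<^sub>R y)) has_derivative (\<lambda>h. W' (c *\<^sub>R x) (c *\<^sub>R h))) (at x)"
    by (rule diff_chain_at[unfolded o_def])
  then have "((\<lambda>y. W y / c) has_derivative (\<lambda>h. W' (c *\<^sub>R x) (c *\<^sub>R h))) (at x)"
    by (simp only: hom[OF \<open>c > 0\<close>])
  moreover have "((\<lambda>y. W y / c) has_derivative (\<lambda>h. W' x h / c)) (at x)"
    using \<open>c > 0\<close> by (intro bounded_linear.has_derivative[OF bounded_linear_divide] der) (use assms in auto)
  ultimately have "(\<lambda>h. W' (c *\<^sub>R x) (c *\<^sub>R h)) = (\<lambda>h. W' x h / c)" by (rule has_derivative_unique)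
  then have "W' (c *\<^sub>R x) (c *\<^sub>R h) = W' x h / c" by meson
  moreover have "linear (W' (c *\<^sub>R x))" using assms by (intro has_derivative_linear[OF der]) auto
  ultimately have "c * W' (c *\<^sub>R x) h = W' x h / c" by (simp add: linear_cmul)
  then show ?thesis using \<open>c > 0\<close> by (simp add: field_simps power2_eq_square)
qed

text \<open>Divergence theorem on the sphere for a tangential field, from the one on \<open>\<real>\<^sup>n\<close> applied to the
  product of the field with a radial bump function.\<close>

lemma sphere_divergence:
  fixes W :: "'n::finite \<Rightarrow> real^'n \<Rightarrow> real"
  assumes der: "\<And>i x. x \<noteq> 0 \<Longrightarrow> (W i has_derivative W' i x) (at x)"
    and cont: "\<And>i. continuous_on (- {0}) (\<lambda>x. W' i x (axis i 1))"
    and hom: "\<And>i c x. c > 0 \<Longrightarrow> W i (c *\<^sub>R x) = W i x / c"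
    and tang: "\<And>x. x \<noteq> 0 \<Longrightarrow> (\<Sum>i\<in>UNIV. x $ i * W i x) = 0"
  shows "(\<integral>x. (\<Sum>i\<in>UNIV. W' i x (axis i 1)) \<partial>sphere_measure) = 0"
proof -
  interpret S: prob_space "sphere_measure :: (real^'n) measure" by (rule prob_space_sphere_measure)
  \<comment> \<open>\<open>p\<close> is positive exactly between 1 and 4, so
    \<open>h (norm x)\<close> is a bump on the annulus of radii 1 and 2, away from the origin where
    the field is singular.\<close>
  define p where "p = (\<lambda>q::real. (q - 1) * (4 - q))"
  define h where "h = (\<lambda>r::real. (max 0 (p (r\<^sup>2)))\<^sup>2)"
  define k' where "k' = (\<lambda>q::real. (max 0 (p q))\<^sup>2 + q * (2 * max 0 (p q) * (5 - 2 * q)))"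
  \<comment> \<open>The divergence of \<open>W\<close> has degree -2; the factor
    \<open>x \<bullet> x\<close> compensates for it, so the divergence of \<open>G\<close> is the
    bump times a function of the direction. The derivative of the radial factor pairs with
    \<open>W\<close> to zero because \<open>W\<close> is tangential.\<close>
  define G where "G = (\<lambda>i x. (x \<bullet> x) * (max 0 (p (x \<bullet> x)))\<^sup>2 * W i x)"
  define G' where "G' = (\<lambda>i x e. (x \<bullet> x) * (max 0 (p (x \<bullet> x)))\<^sup>2 * W' i x e + (k' (x \<bullet> x) * (2 * (x \<bullet> e))) * W i x)"
  define Dv where "Dv = (\<lambda>x. \<Sum>i\<in>UNIV. W' i x (axis i 1))"
  have h0: "h r \<ge> 0" for r by (simp add: h_def)
  have conth: "continuous_on UNIV (\<lambda>x::real^'n. h (norm x))"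
    unfolding h_def p_def by (intro continuous_intros)
  have pneg: "max 0 (p q) = 0" if "q < 1 \<or> q > 4" for q
  proof -
    have "p q \<le> 0" using that unfolding p_def by (auto intro: mult_nonpos_nonneg mult_nonneg_nonpos)
    then show ?thesis by simp
  qed
  have hsupp: "h (norm x) = 0" if "norm x > 2" for x :: "real^'n"
    using power_strict_mono[OF that, of 2] pneg[of "(norm x)\<^sup>2"] by (simp add: h_def)
  have inth: "integrable lborel (\<lambda>x::real^'n. h (norm x))"
    by (rule integrable_continuous_bounded_support[OF conth hsupp])
  have [measurable]: "h \<in> borel_measurable borel" unfolding h_def p_def by measurable
  have posh: "(\<integral>x. h (norm (x::real^'n)) \<partial>lborel) > 0"
  proof -
    obtain a :: "real^'n" where "norm a = sqrt 2" using vector_choose_size[of "sqrt 2"] by auto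
    then have "h (norm a) > 0" by (simp add: h_def p_def)
    then show ?thesis by (rule integral_pos_continuous[OF conth inth h0])
  qed
  have contW: "continuous_on (- {0}) (W i)" for i
    using der by (intro continuous_at_imp_continuous_on) (auto dest: has_derivative_continuous)
  have near0: "G i x = 0" "G' i x e = 0" if "norm x < 1" for i x e
  proof -
    have "x \<bullet> x < 1" using power_strict_mono[OF that, of 2] by (simp add: dot_square_norm)
    then show "G i x = 0" "G' i x e = 0" by (simp_all add: G_def G'_def k'_def pneg)
  qed
  have kder: "((\<lambda>q. q * (max 0 (p q))\<^sup>2) has_real_derivative k' q) (at q)" for q
  proof -
    have "(p has_real_derivative (5 - 2 * q)) (at q)" unfolding p_def by (auto intro!: derivative_eq_intros)
    from DERIV_mult[OF DERIV_ident DERIV_chain2[OF DERIV_max_0_square this]]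
    show ?thesis by (rule DERIV_cong) (simp add: k'_def)
  qed
  have Gder: "(G i has_derivative G' i x) (at x)" for i x
  proof (cases "x = 0")
    case True
    have "((\<lambda>_. 0) has_derivative (\<lambda>_. 0)) (at x)" by simp
    then have "(G i has_derivative (\<lambda>_. 0)) (at x)"
      by (rule has_derivative_transform_within_open[of _ _ _ _ "ball 0 1"]) (auto simp: True near0)
    moreover have "G' i x = (\<lambda>_. 0)" using True by (auto simp: near0)
    ultimately show ?thesis by simp
  next
    case False
    have "((\<lambda>x::real^'n. x \<bullet> x) has_derivative (\<lambda>e. 2 * (x \<bullet> e))) (at x)"
      by (auto intro!: derivative_eq_intros simp: inner_commute)
    moreover have "((\<lambda>q. q * (max 0 (p q))\<^sup>2) has_derivative (\<lambda>t. k' (x \<bullet> x) * t)) (at (x \<bullet> x))"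
      using kder[of "x \<bullet> x"] by (simp add: has_field_derivative_def)
    ultimately have "((\<lambda>x::real^'n. (x \<bullet> x) * (max 0 (p (x \<bullet> x)))\<^sup>2) has_derivative (\<lambda>e. k' (x \<bullet> x) * (2 * (x \<bullet> e)))) (at x)"
      by (rule diff_chain_at[unfolded o_def])
    from has_derivative_mult[OF this der[OF False]] show ?thesis
      unfolding G_def G'_def .
  qed
  have Gcont: "continuous_on UNIV (\<lambda>x. G' i x (axis i 1))" for i
  proof -
    have "continuous_on (ball 0 1) (\<lambda>x. G' i x (axis i 1))"
      by (rule continuous_on_eq[OF continuous_on_const[of _ 0]]) (simp add: near0)
    moreover have "continuous_on (- {0}) (\<lambda>x. G' i x (axis i 1))"
      unfolding G'_def k'_def p_def by (intro continuous_intros cont contW)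
    ultimately have "continuous_on (ball 0 1 \<union> - {0}) (\<lambda>x. G' i x (axis i 1))"
      by (intro continuous_on_open_Un) auto
    moreover have "ball 0 1 \<union> - {0} = (UNIV :: (real^'n) set)" by auto
    ultimately show ?thesis by simp
  qed
  have G'supp: "G' i x e = 0" if "norm x > 2" for i x e
  proof -
    have "x \<bullet> x > 4" using power_strict_mono[OF that, of 2] by (simp add: dot_square_norm)
    then show ?thesis by (simp add: G'_def k'_def pneg)
  qed
  have Gsupp: "G i x = 0" if "norm x > 2" for i x
  proof -
    have "x \<bullet> x > 4" using power_strict_mono[OF that, of 2] by (simp add: dot_square_norm)
    then show ?thesis by (simp add: G_def pneg)
  qed
  have iG: "integrable lborel (\<lambda>x. G' i x (axis i 1))" for i
    by (rule integrable_continuous_bounded_support[OF Gcont G'supp])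
  have "(\<integral>x. G' i x (axis i 1) \<partial>lborel) = 0" for i
    by (rule integral_directional_derivative_eq_0[OF Gder Gcont Gsupp])
  then have "0 = (\<integral>x. (\<Sum>i\<in>UNIV. G' i x (axis i 1)) \<partial>lborel)"
    using iG by (simp add: Bochner_Integration.integral_sum)
  also have "\<dots> = (\<integral>x. h (norm x) * Dv (sgn (sgn x)) \<partial>lborel)"
  proof (rule arg_cong[where f="integral\<^sup>L lborel"], rule ext)
    fix x :: "real^'n"
    show "(\<Sum>i\<in>UNIV. G' i x (axis i 1)) = h (norm x) * Dv (sgn (sgn x))"
    proof (cases "x = 0")
      case True
      then show ?thesis by (simp add: near0 h_def pneg)
    next
      case False
      have W's: "W' i x e = W' i (sgn x) e / (norm x)\<^sup>2" for i e
        using homogeneous_minus1_has_derivative_scale[of "W i" "W' i" x "inverse (norm x)" e, OF der hom False] False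
        by (simp add: sgn_div_norm field_simps)
      have "(\<Sum>i\<in>UNIV. G' i x (axis i 1)) = (x \<bullet> x) * (max 0 (p (x \<bullet> x)))\<^sup>2 * (\<Sum>i\<in>UNIV. W' i x (axis i 1))
          + k' (x \<bullet> x) * 2 * (\<Sum>i\<in>UNIV. x $ i * W i x)"
        by (simp add: G'_def sum.distrib sum_distrib_left inner_axis mult.assoc)
      also have "\<dots> = h (norm x) * Dv (sgn x)"
        using False by (simp add: tang W's h_def Dv_def sum_divide_distrib[symmetric] dot_square_norm)
      also have "\<dots> = h (norm x) * Dv (sgn (sgn x))" using False by (simp add: sgn_div_norm[of "sgn x"] norm_sgn)
      finally show ?thesis .
    qed
  qed
  also have "\<dots> = (\<integral>x. h (norm (x::real^'n)) \<partial>lborel) * (\<integral>x. Dv (sgn x) \<partial>sphere_measure)"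
  proof -
    have contD: "continuous_on (- {0}) Dv" unfolding Dv_def by (intro continuous_intros cont)
    have [measurable]: "Dv \<in> borel_measurable borel"
      by (rule borel_measurable_continuous_countable_exceptions[of "{0}"]) (auto simp: contD)
    obtain C where "\<And>x. \<bar>Dv (sgn x)\<bar> \<le> C"
      by (rule homogeneous_bounded[of Dv]) (auto intro: continuous_on_subset[OF contD])
    then show ?thesis by (intro integral_radial_sphere(2)[where C=C] h0 inth) auto
  qed
  finally have "(\<integral>x. Dv (sgn x) \<partial>sphere_measure) = 0" using posh by simp
  moreover have "(\<integral>x. Dv (sgn x) \<partial>sphere_measure) = (\<integral>x. Dv x \<partial>sphere_measure)"
  proof (rule integral_cong_AE)
    have contD: "continuous_on (- {0}) Dv" unfolding Dv_def by (intro continuous_intros cont)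
    have [measurable]: "Dv \<in> borel_measurable borel"
      by (rule borel_measurable_continuous_countable_exceptions[of "{0}"]) (auto simp: contD)
    show "(\<lambda>x. Dv (sgn x)) \<in> borel_measurable sphere_measure" "Dv \<in> borel_measurable sphere_measure" by measurable
    show "AE x in sphere_measure. Dv (sgn x) = Dv x"
      using AE_sphere_measure by eventually_elim (simp add: sgn_div_norm)
  qed
  ultimately show ?thesis by (simp add: Dv_def)
qed

section \<open>Functions on the cylinder with bounded support\<close>

text \<open>Functions on the cylinder are carried by its thickening, where the sphere is replaced by
  the punctured space, so that Euclidean derivatives make sense. The default value at the origin
  makes them Borel measurable on the whole space.\<close>

definition cyl_cont :: "real \<Rightarrow> (real \<times> (real^'n::finite) \<Rightarrow> real) \<Rightarrow> bool" where
  "cyl_cont S g \<longleftrightarrow> continuous_on (UNIV \<times> (- {0})) g \<and> (\<forall>s. g (s, 0) = 0) \<and> (\<forall>s x. \<bar>s\<bar> > S \<longrightarrow> g (s, x) = 0)"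

lemma cyl_cont_borel_measurable: "cyl_cont S g \<Longrightarrow> g \<in> borel_measurable borel"
proof -
  assume g: "cyl_cont S g"
  have "open (UNIV \<times> (- {0}) :: (real \<times> (real^'n)) set)" by (intro open_Times) auto
  then have "(\<lambda>x. indicator (UNIV \<times> (- {0})) x *\<^sub>R g x) \<in> borel_measurable borel"
    using g by (intro borel_measurable_continuous_on_indicator borel_open) (auto simp: cyl_cont_def)
  also have "(\<lambda>x. indicator (UNIV \<times> (- {0})) x *\<^sub>R g x) = g"
    using g by (auto simp: fun_eq_iff indicator_def cyl_cont_def)
  finally show ?thesis .
qed

lemma cyl_cont_add: "cyl_cont S f \<Longrightarrow> cyl_cont S g \<Longrightarrow> cyl_cont S (\<lambda>p. f p + g p)"
  and cyl_cont_diff: "cyl_cont S f \<Longrightarrow> cyl_cont S g \<Longrightarrow> cyl_cont S (\<lambda>p. f p - g p)"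
  and cyl_cont_mult: "cyl_cont S f \<Longrightarrow> cyl_cont S g \<Longrightarrow> cyl_cont S (\<lambda>p. f p * g p)"
  and cyl_cont_cmult: "continuous_on UNIV a \<Longrightarrow> cyl_cont S g \<Longrightarrow> cyl_cont S (\<lambda>p. a (fst p) * g p)"
  by (auto simp: cyl_cont_def intro!: continuous_intros intro: continuous_on_compose2[of UNIV a])

lemma cyl_cont_power2: "cyl_cont S f \<Longrightarrow> cyl_cont S (\<lambda>p. (f p)\<^sup>2)"
  unfolding power2_eq_square by (rule cyl_cont_mult)

lemma cyl_cont_sum: "finite I \<Longrightarrow> (\<And>i. i \<in> I \<Longrightarrow> cyl_cont S (f i)) \<Longrightarrow> cyl_cont S (\<lambda>p. \<Sum>i\<in>I. f i p)"
  by (auto simp: cyl_cont_def intro!: continuous_intros)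

lemma cyl_cont_bounded:
  assumes "cyl_cont S g"
  obtains C where "C \<ge> 0" "\<And>s x. norm x = 1 \<Longrightarrow> \<bar>g (s, x)\<bar> \<le> C"
proof -
  have "compact (g ` ({-\<bar>S\<bar>..\<bar>S\<bar>} \<times> sphere 0 1))"
    using assms by (intro compact_continuous_image compact_Times compact_sphere)
       (auto simp: cyl_cont_def intro: continuous_on_subset)
  then obtain C where C: "\<And>p. p \<in> {-\<bar>S\<bar>..\<bar>S\<bar>} \<times> sphere 0 1 \<Longrightarrow> \<bar>g p\<bar> \<le> C"
    by (metis (no_types, lifting) bounded_iff compact_imp_bounded imageI real_norm_def)
  have "\<bar>g (s, x)\<bar> \<le> \<bar>C\<bar>" if "norm x = 1" for s x
  proof (cases "\<bar>s\<bar> \<le> \<bar>S\<bar>")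
    case True
    then have "\<bar>g (s, x)\<bar> \<le> C" using that by (intro C) (auto simp: abs_le_iff)
    then show ?thesis by linarith
  next
    case False
    then have "\<bar>s\<bar> > S" by linarith
    then show ?thesis using assms by (simp add: cyl_cont_def)
  qed
  then show ?thesis using that[of "\<bar>C\<bar>"] by auto
qed

lemma cyl_cont_integrable_slice:
  assumes g: "cyl_cont S (g :: real \<times> (real^'n::finite) \<Rightarrow> real)"
  shows "integrable sphere_measure (\<lambda>x. g (s, x))"
proof -
  interpret S: prob_space "sphere_measure :: (real^'n) measure" by (rule prob_space_sphere_measure)
  note [measurable] = cyl_cont_borel_measurable[OF g]
  obtain C where C: "\<And>s x. norm x = 1 \<Longrightarrow> \<bar>g (s, x)\<bar> \<le> C" using cyl_cont_bounded[OF g] by metis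
  show ?thesis
    by (rule S.integrable_const_bound[of _ C]) (use AE_sphere_measure C in \<open>auto elim!: eventually_mono\<close>)
qed

lemma cyl_cont_integrable:
  assumes g: "cyl_cont S (g :: real \<times> (real^'n::finite) \<Rightarrow> real)"
  shows "integrable (lborel \<Otimes>\<^sub>M sphere_measure) g"
proof -
  interpret S: prob_space "sphere_measure :: (real^'n) measure" by (rule prob_space_sphere_measure)
  interpret P: pair_sigma_finite "lborel :: real measure" "sphere_measure :: (real^'n) measure" ..
  have "g \<in> borel_measurable borel" by (rule cyl_cont_borel_measurable[OF g])
  then have [measurable]: "g \<in> borel_measurable (lborel \<Otimes>\<^sub>M sphere_measure)"
    by (subst measurable_cong_sets[OF sets_pair_measure_cong[OF sets_lborel sets_sphere_measure] refl])
       (simp add: borel_prod)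
  obtain C where C0: "C \<ge> 0" and C: "\<And>s x. norm x = 1 \<Longrightarrow> \<bar>g (s, x)\<bar> \<le> C" using cyl_cont_bounded[OF g] by metis
  show ?thesis
  proof (rule P.Fubini_integrable)
    show "AE s in lborel. integrable sphere_measure (\<lambda>x. g (s, x))" by (simp add: cyl_cont_integrable_slice[OF g])
    show "integrable lborel (\<lambda>s. \<integral>x. norm (g (s, x)) \<partial>sphere_measure)"
    proof (rule Bochner_Integration.integrable_bound[of _ "\<lambda>s. C * indicator {-\<bar>S\<bar>..\<bar>S\<bar>} s"])
      show "AE s in lborel. norm (\<integral>x. norm (g (s, x)) \<partial>sphere_measure) \<le> norm (C * indicator {-\<bar>S\<bar>..\<bar>S\<bar>} s)"
      proof (rule AE_I2)
        fix s
        show "norm (\<integral>x. norm (g (s, x)) \<partial>sphere_measure) \<le> norm (C * indicator {-\<bar>S\<bar>..\<bar>S\<bar>} s)"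
        proof (cases "\<bar>s\<bar> \<le> \<bar>S\<bar>")
          case True
          have "(\<integral>x. norm (g (s, x)) \<partial>sphere_measure) \<le> C"
            using cyl_cont_integrable_slice[OF g] C AE_sphere_measure
            by (intro S.integral_le_const) (auto elim!: eventually_mono)
          moreover have "0 \<le> (\<integral>x. norm (g (s, x)) \<partial>sphere_measure)" by (rule Bochner_Integration.integral_nonneg) simp
          ultimately show ?thesis using True C0 by (auto simp: indicator_def abs_le_iff)
        next
          case False
          then have "\<bar>s\<bar> > S" by linarith
          then show ?thesis using g by (simp add: cyl_cont_def)
        qed
      qed
    qed auto
  qed measurable
qed

lemma cyl_cont_Fubini:
  assumes g: "cyl_cont S (g :: real \<times> (real^'n::finite) \<Rightarrow> real)"
  shows "(\<integral>s. \<integral>x. g (s, x) \<partial>sphere_measure \<partial>lborel) = (\<integral>x. \<integral>s. g (s, x) \<partial>lborel \<partial>sphere_measure)"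
    and "(\<integral>p. g p \<partial>(lborel \<Otimes>\<^sub>M sphere_measure)) = (\<integral>s. \<integral>x. g (s, x) \<partial>sphere_measure \<partial>lborel)"
    and "integrable lborel (\<lambda>s. \<integral>x. g (s, x) \<partial>sphere_measure)"
proof -
  interpret S: prob_space "sphere_measure :: (real^'n) measure" by (rule prob_space_sphere_measure)
  interpret P: pair_sigma_finite "lborel :: real measure" "sphere_measure :: (real^'n) measure" ..
  have i: "integrable (lborel \<Otimes>\<^sub>M sphere_measure) (\<lambda>(s, x). g (s, x))" using cyl_cont_integrable[OF g] by simp
  show "(\<integral>s. \<integral>x. g (s, x) \<partial>sphere_measure \<partial>lborel) = (\<integral>x. \<integral>s. g (s, x) \<partial>lborel \<partial>sphere_measure)"
    using P.Fubini_integral[OF i] by simp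
  show "(\<integral>p. g p \<partial>(lborel \<Otimes>\<^sub>M sphere_measure)) = (\<integral>s. \<integral>x. g (s, x) \<partial>sphere_measure \<partial>lborel)"
    using P.integral_fst[OF i] by simp
  show "integrable lborel (\<lambda>s. \<integral>x. g (s, x) \<partial>sphere_measure)"
    using P.integrable_fst[OF i] by simp
qed

lemma cyl_cont_isCont_mean:
  assumes g: "cyl_cont S (g :: real \<times> (real^'n::finite) \<Rightarrow> real)"
  shows "continuous_on UNIV (\<lambda>s. \<integral>x. g (s, x) \<partial>sphere_measure)"
proof (rule continuous_on_sequentiallyI)
  interpret S: prob_space "sphere_measure :: (real^'n) measure" by (rule prob_space_sphere_measure)
  note [measurable] = cyl_cont_borel_measurable[OF g]
  fix X s assume X: "X \<longlonglongrightarrow> (s::real)"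
  obtain C where C: "\<And>s x. norm x = 1 \<Longrightarrow> \<bar>g (s, x)\<bar> \<le> C" using cyl_cont_bounded[OF g] by metis
  show "(\<lambda>k. \<integral>x. g (X k, x) \<partial>sphere_measure) \<longlonglongrightarrow> (\<integral>x. g (s, x) \<partial>sphere_measure)"
  proof (rule integral_dominated_convergence[where w="\<lambda>_. C"])
    show "AE x in sphere_measure. (\<lambda>k. g (X k, x)) \<longlonglongrightarrow> g (s, x)"
      using AE_sphere_measure
    proof eventually_elim
      case (elim x)
      then have "x \<noteq> 0" by auto
      have "continuous_on UNIV (\<lambda>s. g (s, x))"
        by (rule continuous_on_compose2[of "UNIV \<times> (- {0})" g UNIV "\<lambda>s. (s, x)"])
           (use g \<open>x \<noteq> 0\<close> in \<open>auto simp: cyl_cont_def intro!: continuous_intros\<close>)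
      then have "isCont (\<lambda>s. g (s, x)) s" by (simp add: continuous_on_eq_continuous_at)
      then show ?case by (rule isCont_tendsto_compose[OF _ X])
    qed
    show "AE x in sphere_measure. norm (g (X k, x)) \<le> C" for k
      using AE_sphere_measure C by (auto elim!: eventually_mono)
  qed auto
qed

lemma cyl_cont_DERIV_mean:
  assumes u: "cyl_cont S (u :: real \<times> (real^'n::finite) \<Rightarrow> real)" and us: "cyl_cont S us"
    and der: "\<And>s x. x \<noteq> 0 \<Longrightarrow> ((\<lambda>s. u (s, x)) has_real_derivative us (s, x)) (at s)"
  shows "((\<lambda>s. \<integral>x. u (s, x) \<partial>sphere_measure) has_real_derivative (\<integral>x. us (s, x) \<partial>sphere_measure)) (at s)"
  unfolding has_field_derivative_iff tendsto_at_iff_sequentially o_def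
proof (intro allI impI)
  interpret S: prob_space "sphere_measure :: (real^'n) measure" by (rule prob_space_sphere_measure)
  note [measurable] = cyl_cont_borel_measurable[OF u] cyl_cont_borel_measurable[OF us]
  fix X assume X: "\<forall>i. X i \<in> UNIV - {s}" "X \<longlonglongrightarrow> s"
  obtain C where C: "\<And>s x. norm x = 1 \<Longrightarrow> \<bar>us (s, x)\<bar> \<le> C" using cyl_cont_bounded[OF us] by metis
  have eq: "((\<integral>x. u (X k, x) \<partial>sphere_measure) - (\<integral>x. u (s, x) \<partial>sphere_measure)) / (X k - s)
     = (\<integral>x. (u (X k, x) - u (s, x)) / (X k - s) \<partial>sphere_measure)" for k
    using cyl_cont_integrable_slice[OF u] by simp
  show "(\<lambda>k. ((\<integral>x. u (X k, x) \<partial>sphere_measure) - (\<integral>x. u (s, x) \<partial>sphere_measure)) / (X k - s)) \<longlonglongrightarrow> (\<integral>x. us (s, x) \<partial>sphere_measure)"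
    unfolding eq
  proof (rule integral_dominated_convergence[where w="\<lambda>_. C"])
    show "AE x in sphere_measure. (\<lambda>k. (u (X k, x) - u (s, x)) / (X k - s)) \<longlonglongrightarrow> us (s, x)"
      using AE_sphere_measure
    proof eventually_elim
      case (elim x)
      then have "x \<noteq> 0" by auto
      from der[OF this, of s] show ?case
        unfolding has_field_derivative_iff tendsto_at_iff_sequentially o_def using X by auto
    qed
    show "AE x in sphere_measure. norm ((u (X k, x) - u (s, x)) / (X k - s)) \<le> C" for k
      using AE_sphere_measure
    proof eventually_elim
      case (elim x)
      then have "x \<noteq> 0" by auto
      have "norm (u (X k, x) - u (s, x)) \<le> C * norm (X k - s)"
        by (rule field_differentiable_bound[of UNIV "\<lambda>s. u (s, x)" "\<lambda>s. us (s, x)"])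
           (use der[OF \<open>x \<noteq> 0\<close>] C elim in auto)
      then show ?case using X(1) by (auto simp: divide_le_eq abs_divide)
    qed
  qed auto
qed

section \<open>One-dimensional quadratic forms of the profile curve\<close>

text \<open>\<open>R\<close> dominates the derivative of a function that vanishes far out, and the
  integral of that derivative is zero.\<close>

lemma integral_nonneg_of_derivative_le:
  fixes H h R :: "real \<Rightarrow> real"
  assumes contH: "continuous_on UNIV H" and "finite Z"
    and der: "\<And>s. s \<notin> Z \<Longrightarrow> (H has_real_derivative h s) (at s)"
    and le: "\<And>s. s \<notin> Z \<Longrightarrow> h s \<le> R s"
    and contR: "continuous_on UNIV R"
    and supp: "\<And>s. \<bar>s\<bar> > S \<Longrightarrow> H s = 0" "\<And>s. \<bar>s\<bar> > S \<Longrightarrow> R s = 0"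
  shows "0 \<le> (\<integral>s. R s \<partial>lborel)"
proof -
  define T where "T = \<bar>S\<bar> + 1"
  have T: "- T < T" "\<bar>-T\<bar> > S" "\<bar>T\<bar> > S" by (auto simp: T_def)
  have iR: "integrable lborel R"
    by (rule integrable_continuous_bounded_support[OF contR, of S]) (auto simp: supp)
  have "(R has_integral (\<integral>s. R s \<partial>lborel)) UNIV" by (rule has_integral_integral_lborel[OF iR])
  then have R: "(R has_integral (\<integral>s. R s \<partial>lborel)) {-T..T}"
  proof (subst has_integral_restrict_UNIV[symmetric], erule_tac has_integral_eq[rotated])
    show "R x = (if x \<in> {- T..T} then R x else 0)" for x
      using supp(2)[of x] by (auto simp: T_def)
  qed
  \<comment> \<open>On the exceptional set the values are replaced by those of \<open>R\<close>, so
    that the comparison holds everywhere; the fundamental theorem of calculus tolerates the finite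
    set.\<close>
  define h' where "h' = (\<lambda>s. if s \<in> Z then R s else h s)"
  have "(h' has_integral (H T - H (-T))) {-T..T}"
    by (rule fundamental_theorem_of_calculus_interior_strong[OF \<open>finite Z\<close>])
       (use T contH der in \<open>auto simp: h'_def has_real_derivative_iff_has_vector_derivative[symmetric] intro: continuous_on_subset\<close>)
  then have "(h' has_integral 0) {-T..T}" using supp(1)[OF T(2)] supp(1)[OF T(3)] by simp
  from has_integral_le[OF this R] show ?thesis by (auto simp: h'_def le)
qed

text \<open>Complete the square in v'. Here d stands for the derivative of \<phi>, and the left side
  is the derivative of v^2 \<phi>. For \<phi> = p y'/y with y positive, the hypothesis says that y
  is a supersolution, (p y')' <= q y; so a positive supersolution makes the form with coefficients p
  and q nonnegative on functions with bounded support.\<close>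

lemma riccati_le:
  fixes p \<phi> :: real
  assumes "p > 0" and "d + \<phi>\<^sup>2 / p \<le> q"
  shows "2 * v * v' * \<phi> + v\<^sup>2 * d \<le> p * v'\<^sup>2 + q * v\<^sup>2"
proof -
  have "v\<^sup>2 * d \<le> v\<^sup>2 * (q - \<phi>\<^sup>2 / p)" using assms(2) by (intro mult_left_mono) auto
  moreover have "0 \<le> (p * v' - v * \<phi>)\<^sup>2 / p" using \<open>p > 0\<close> by simp
  moreover have "(p * v' - v * \<phi>)\<^sup>2 / p = p * v'\<^sup>2 - 2 * v * v' * \<phi> + v\<^sup>2 * (\<phi>\<^sup>2 / p)"
    using \<open>p > 0\<close> by (simp add: power2_eq_square field_simps)
  ultimately show ?thesis by (simp add: algebra_simps)
qed

text \<open>\<open>E\<close> is the speed of the generating curve, \<open>w\<close> the derivative of \<open>z\<close> with respect to arc length and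
  \<open>K\<close> the squared principal curvature in the directions of the rotation spheres. The equation for \<open>w'\<close>
  says that the mean curvature vanishes.\<close>

locale rotation_profile =
  fixes n :: nat and z E w :: "real \<Rightarrow> real"
  assumes n2: "n \<ge> 2" and z_pos: "z s > 0" and E_pos: "E s > 0"
    and contE: "continuous_on UNIV E"
    and K_nonneg': "(w s)\<^sup>2 \<le> 1 + (z s)\<^sup>2"
    and dz: "(z has_real_derivative E s * w s) (at s)"
    and dw: "(w has_real_derivative E s * (z s + (real n - 1) * ((1 + (z s)\<^sup>2 - (w s)\<^sup>2) / (z s)\<^sup>2) * z s)) (at s)"
begin

definition K :: "real \<Rightarrow> real" where "K s = (1 + (z s)\<^sup>2 - (w s)\<^sup>2) / (z s)\<^sup>2"
definition P :: "real \<Rightarrow> real" where "P s = z s ^ (n - 1)"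
text \<open>The potential |A|^2 - n. Minimality makes the remaining principal curvature -(n-1) times
  the one with square \<open>K\<close> and multiplicity n-1, hence |A|^2 = (n-1) K + (n-1)^2 K = n
  (n-1) K. The function \<open>P\<close> is the volume of the orbit sphere up to a constant
  factor.\<close>

definition V :: "real \<Rightarrow> real" where "V s = real n * (real n - 1) * K s - real n"

lemma z_neq [simp]: "z s \<noteq> 0" and E_neq [simp]: "E s \<noteq> 0" and P_pos: "P s > 0"
  using z_pos[of s] E_pos[of s] by (auto simp: P_def)

lemma P_neq [simp]: "P s \<noteq> 0" using P_pos[of s] by simp

lemma K_nonneg: "K s \<ge> 0" using K_nonneg'[of s] by (simp add: K_def)

lemma K_eq: "K s * (z s)\<^sup>2 = 1 + (z s)\<^sup>2 - (w s)\<^sup>2" by (simp add: K_def)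

lemma dw': "(w has_real_derivative E s * z s * (1 + (real n - 1) * K s)) (at s)"
  using dw[of s] by (rule DERIV_cong) (simp add: K_def algebra_simps)

lemma dP: "(P has_real_derivative (real n - 1) * P s * E s * w s / z s) (at s)"
proof -
  obtain m where m: "n = Suc (Suc m)" using n2 by (metis add_2_eq_Suc le_Suc_ex)
  show ?thesis unfolding P_def
    by (rule DERIV_cong[OF DERIV_power[OF dz]]) (simp add: m field_simps)
qed

text \<open>Since z' = E w, this says that K z^(2n) is constant along the curve, the first integral
  of the equation of minimal rotation hypersurfaces.\<close>

lemma dK: "(K has_real_derivative - 2 * real n * K s * E s * w s / z s) (at s)"
proof -
  have "(K has_real_derivative ((2 * z s * (E s * w s) - 2 * w s * (E s * z s * (1 + (real n - 1) * K s))) * (z s)\<^sup>2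
      - (1 + (z s)\<^sup>2 - (w s)\<^sup>2) * (2 * z s * (E s * w s))) / ((z s)\<^sup>2 * (z s)\<^sup>2)) (at s)"
    unfolding K_def[abs_def]
    by (auto intro!: derivative_eq_intros dz dw'[unfolded K_def] simp: K_def)
  then show ?thesis
    unfolding K_eq[symmetric] by (rule DERIV_cong) (simp add: field_simps power2_eq_square)
qed

lemma cont_z: "continuous_on UNIV z" and cont_w: "continuous_on UNIV w"
  and cont_K: "continuous_on UNIV K" and cont_P: "continuous_on UNIV P"
  using dz dw' dK dP by (auto intro!: continuous_at_imp_continuous_on DERIV_isCont)

lemma cont_V: "continuous_on UNIV V"
  unfolding V_def by (intro continuous_intros cont_K)

text \<open>As \<open>K\<close> is nonnegative, the derivative of \<open>w\<close> is positive, so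
  \<open>w\<close> has at most one zero. This is what leaves a single linear condition, and hence
  the bound one for the index.\<close>

lemma finite_zeros_w: "finite {s. w s = 0}"
proof -
  have mono: "w a < w b" if "a < b" for a b
  proof (rule DERIV_pos_imp_increasing[OF that], intro exI conjI)
    fix s
    show "(w has_real_derivative E s * z s * (1 + (real n - 1) * K s)) (at s)" by (rule dw')
    show "E s * z s * (1 + (real n - 1) * K s) > 0"
      using z_pos[of s] E_pos[of s] K_nonneg[of s] n2 by (intro mult_pos_pos add_pos_nonneg mult_nonneg_nonneg) auto
  qed
  show ?thesis
  proof (cases "\<exists>a. w a = 0")
    case True
    then obtain a where "w a = 0" by blast
    have "{s. w s = 0} \<subseteq> {a}"
    proof
      fix b assume "b \<in> {s. w s = 0}"
      then show "b \<in> {a}" using mono[of a b] mono[of b a] \<open>w a = 0\<close> by (cases a b rule: linorder_cases) auto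
    qed
    then show ?thesis by (rule finite_subset) simp
  qed simp
qed

text \<open>Modes orthogonal to the constants: \<open>z\<^bsup>1-n\<^esup>\<close> is a positive supersolution.\<close>

lemma quadratic_form_higher_modes:
  fixes v v' :: "real \<Rightarrow> real"
  assumes dv: "\<And>s. (v has_real_derivative v' s) (at s)" and cv': "continuous_on UNIV v'"
    and supp: "\<And>s. \<bar>s\<bar> > S \<Longrightarrow> v s = 0" "\<And>s. \<bar>s\<bar> > S \<Longrightarrow> v' s = 0"
  shows "0 \<le> (\<integral>s. P s / E s * (v' s)\<^sup>2 + E s * P s * ((real n - 1) / (z s)\<^sup>2 - V s) * (v s)\<^sup>2 \<partial>lborel)"
proof -
  \<comment> \<open>This is P/E times the logarithmic derivative of z^(1-n). The Riccati inequality
    below holds with the slack n E P.\<close>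
  define \<phi> where "\<phi> = (\<lambda>s. (1 - real n) * (P s * w s / z s))"
  define \<phi>' where "\<phi>' = (\<lambda>s. (1 - real n) * (E s * P s) * ((real n - 2) * (w s)\<^sup>2 / (z s)\<^sup>2 + 1 + (real n - 1) * K s))"
  have cv: "continuous_on UNIV v" using dv by (auto intro!: continuous_at_imp_continuous_on DERIV_isCont)
  have d\<phi>: "(\<phi> has_real_derivative \<phi>' s) (at s)" for s
    unfolding \<phi>_def
    by (rule DERIV_cong, rule DERIV_cmult, rule DERIV_divide[OF DERIV_mult[OF dP dw'] dz z_neq])
       (simp add: \<phi>'_def field_simps power2_eq_square)
  have ric: "\<phi>' s + (\<phi> s)\<^sup>2 / (P s / E s) \<le> E s * P s * ((real n - 1) / (z s)\<^sup>2 - V s)" for s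
  proof -
    have w2: "(w s)\<^sup>2 = 1 + (z s)\<^sup>2 - K s * (z s)\<^sup>2" using K_eq[of s] by simp
    have "\<phi>' s + (\<phi> s)\<^sup>2 / (P s / E s) = E s * P s * ((real n - 1) * ((real n - 1) - (real n - 2)) * ((w s)\<^sup>2 / (z s)\<^sup>2)
       + (1 - real n) * (1 + (real n - 1) * K s))"
      unfolding \<phi>_def \<phi>'_def by (simp add: field_simps power2_eq_square)
    also have "(w s)\<^sup>2 / (z s)\<^sup>2 = 1 / (z s)\<^sup>2 + 1 - K s"
      unfolding w2 by (simp add: field_simps)
    also have "E s * P s * ((real n - 1) * ((real n - 1) - (real n - 2)) * (1 / (z s)\<^sup>2 + 1 - K s)
       + (1 - real n) * (1 + (real n - 1) * K s))
      = E s * P s * ((real n - 1) / (z s)\<^sup>2 - V s) - real n * (E s * P s)"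
      unfolding V_def by (simp add: algebra_simps)
    finally show ?thesis using E_pos[of s] P_pos[of s] by simp
  qed
  show ?thesis
  proof (rule integral_nonneg_of_derivative_le[where Z="{}" and H="\<lambda>s. (v s)\<^sup>2 * \<phi> s"
        and h="\<lambda>s. 2 * v s * v' s * \<phi> s + (v s)\<^sup>2 * \<phi>' s" and S=S])
    have c\<phi>: "continuous_on UNIV \<phi>" using d\<phi> by (auto intro!: continuous_at_imp_continuous_on DERIV_isCont)
    show "continuous_on UNIV (\<lambda>s. (v s)\<^sup>2 * \<phi> s)" by (intro continuous_intros cv c\<phi>)
    show "((\<lambda>s. (v s)\<^sup>2 * \<phi> s) has_real_derivative 2 * v s * v' s * \<phi> s + (v s)\<^sup>2 * \<phi>' s) (at s)" for s
      by (auto intro!: derivative_eq_intros dv d\<phi>)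
    show "2 * v s * v' s * \<phi> s + (v s)\<^sup>2 * \<phi>' s \<le> P s / E s * (v' s)\<^sup>2 + E s * P s * ((real n - 1) / (z s)\<^sup>2 - V s) * (v s)\<^sup>2" for s
      using P_pos[of s] E_pos[of s] by (intro riccati_le ric) auto
    show "continuous_on UNIV (\<lambda>s. P s / E s * (v' s)\<^sup>2 + E s * P s * ((real n - 1) / (z s)\<^sup>2 - V s) * (v s)\<^sup>2)"
      by (intro continuous_intros cv cv' contE cont_P cont_z cont_V) auto
  qed (auto simp: supp)
qed

text \<open>Rotationally symmetric functions: \<open>w\<close> is the Jacobi field of the translations along the axis.\<close>

lemma quadratic_form_radial:
  fixes v v' :: "real \<Rightarrow> real"
  assumes dv: "\<And>s. (v has_real_derivative v' s) (at s)" and cv': "continuous_on UNIV v'"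
    and supp: "\<And>s. \<bar>s\<bar> > S \<Longrightarrow> v s = 0" "\<And>s. \<bar>s\<bar> > S \<Longrightarrow> v' s = 0"
    and zero: "\<And>s. w s = 0 \<Longrightarrow> v s = 0"
  shows "0 \<le> (\<integral>s. P s / E s * (v' s)\<^sup>2 + (- V s * E s * P s) * (v s)\<^sup>2 \<partial>lborel)"
proof -
  \<comment> \<open>This is P w'/E, so \<open>dc\<close> is the radial Jacobi equation for
    \<open>w\<close>, and \<phi> = c/w is the associated Riccati solution away from the zero of
    \<open>w\<close>.\<close>
  define c where "c = (\<lambda>s. P s * z s * (1 + (real n - 1) * K s))"
  have c_pos: "c s > 0" for s
    unfolding c_def using z_pos[of s] P_pos[of s] K_nonneg[of s] n2
    by (intro mult_pos_pos add_pos_nonneg mult_nonneg_nonneg) auto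
  have cv: "continuous_on UNIV v" using dv by (auto intro!: continuous_at_imp_continuous_on DERIV_isCont)
  have dc: "(c has_real_derivative - V s * E s * P s * w s) (at s)" for s
    unfolding c_def
    by (rule DERIV_cong, rule DERIV_mult[OF DERIV_mult[OF dP dz] DERIV_add[OF DERIV_const DERIV_cmult[OF dK]]])
       (simp add: V_def field_simps power2_eq_square)
  have cc: "continuous_on UNIV c" using dc by (auto intro!: continuous_at_imp_continuous_on DERIV_isCont)
  have dwc: "(w has_real_derivative E s * c s / P s) (at s)" for s
    using dw'[of s] by (rule DERIV_cong) (simp add: c_def)
  define \<phi> where "\<phi> = (\<lambda>s. c s / w s)"
  define \<phi>' where "\<phi>' = (\<lambda>s. - V s * E s * P s - (\<phi> s)\<^sup>2 / (P s / E s))"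
  have d\<phi>: "(\<phi> has_real_derivative \<phi>' s) (at s)" if "w s \<noteq> 0" for s
    unfolding \<phi>_def
    by (rule DERIV_cong, rule DERIV_divide[OF dc dwc that])
       (use that in \<open>simp add: \<phi>'_def \<phi>_def field_simps power2_eq_square\<close>)
  show ?thesis
  proof (rule integral_nonneg_of_derivative_le[where Z="{s. w s = 0}" and H="\<lambda>s. (v s)\<^sup>2 * \<phi> s"
        and h="\<lambda>s. 2 * v s * v' s * \<phi> s + (v s)\<^sup>2 * \<phi>' s" and S=S])
    show "finite {s. w s = 0}" by (rule finite_zeros_w)
    show "continuous_on UNIV (\<lambda>s. (v s)\<^sup>2 * \<phi> s)"
    proof (intro continuous_at_imp_continuous_on ballI)
      fix a
      show "isCont (\<lambda>s. (v s)\<^sup>2 * \<phi> s) a"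
      proof (cases "w a = 0")
        case False
        then show ?thesis by (intro continuous_intros DERIV_isCont[OF d\<phi>] DERIV_isCont[OF dv])
      next
        case True
        \<comment> \<open>At a zero of \<open>w\<close> the derivative of \<open>w\<close> is
          positive while v vanishes too, so v^2 c/w tends to zero. The identity expresses it by
          difference quotients; it also holds for x = 0 because division by zero gives zero.\<close>
        have quot: "C * (m / d)\<^sup>2 / (x / d) * d = m\<^sup>2 * (C / x)" if "d \<noteq> 0" for C m d x :: real
          using that by (cases "x = 0") (simp_all add: field_simps power2_eq_square)
        have "((\<lambda>s. c s * ((v s - v a) / (s - a))\<^sup>2 / ((w s - w a) / (s - a)) * (s - a)) \<longlongrightarrow>
             c a * (v' a)\<^sup>2 / (E a * c a / P a) * 0) (at a)"
        proof -
          have 1: "(c \<longlongrightarrow> c a) (at a)" using DERIV_isCont[OF dc] by (simp add: isCont_def)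
          have 2: "((\<lambda>s. (v s - v a) / (s - a)) \<longlongrightarrow> v' a) (at a)" using dv[of a] by (simp add: has_field_derivative_iff)
          have 3: "((\<lambda>s. (w s - w a) / (s - a)) \<longlongrightarrow> E a * c a / P a) (at a)" using dwc[of a] by (simp add: has_field_derivative_iff)
          have 4: "E a * c a / P a \<noteq> 0" using c_pos[of a] by simp
          have 5: "((\<lambda>s. s - a) \<longlongrightarrow> 0) (at a)" by (auto intro!: tendsto_eq_intros)
          show ?thesis
            by (rule tendsto_mult[OF tendsto_divide[OF tendsto_mult[OF 1 tendsto_power[OF 2]] 3 4] 5])
        qed
        moreover have "eventually (\<lambda>s. c s * ((v s - v a) / (s - a))\<^sup>2 / ((w s - w a) / (s - a)) * (s - a) = (v s)\<^sup>2 * \<phi> s) (at a)"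
          unfolding eventually_at_filter
        proof (intro always_eventually allI impI)
          fix s assume "s \<noteq> a"
          then have "s - a \<noteq> 0" by simp
          from quot[OF this, of "c s" "v s" "w s"]
          show "c s * ((v s - v a) / (s - a))\<^sup>2 / ((w s - w a) / (s - a)) * (s - a) = (v s)\<^sup>2 * \<phi> s"
            unfolding True zero[OF True] \<phi>_def diff_zero .
        qed
        ultimately have "((\<lambda>s. (v s)\<^sup>2 * \<phi> s) \<longlongrightarrow> 0) (at a)"
          by (simp add: tendsto_cong)
        then show ?thesis by (simp add: isCont_def zero[OF True])
      qed
    qed
    fix s
    show "((\<lambda>s. (v s)\<^sup>2 * \<phi> s) has_real_derivative 2 * v s * v' s * \<phi> s + (v s)\<^sup>2 * \<phi>' s) (at s)" if "s \<notin> {s. w s = 0}"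
      using that by (auto intro!: derivative_eq_intros dv d\<phi>)
    show "2 * v s * v' s * \<phi> s + (v s)\<^sup>2 * \<phi>' s \<le> P s / E s * (v' s)\<^sup>2 + (- V s * E s * P s) * (v s)\<^sup>2"
      using P_pos[of s] E_pos[of s] by (intro riccati_le) (auto simp: \<phi>'_def)
    show "continuous_on UNIV (\<lambda>s. P s / E s * (v' s)\<^sup>2 + (- V s * E s * P s) * (v s)\<^sup>2)"
      by (intro continuous_intros cv cv' contE cont_P cont_V) auto
  qed (auto simp: supp)
qed

end

section \<open>Nonnegativity of the stability form under one linear condition\<close>

lemma cyl_cont_lift:
  assumes "continuous_on UNIV m" "\<And>s. \<bar>s\<bar> > S \<Longrightarrow> m s = 0"
  shows "cyl_cont S (\<lambda>p :: real \<times> (real^'n::finite). if snd p = 0 then 0 else m (fst p))"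
  unfolding cyl_cont_def
proof (intro conjI allI impI)
  have "continuous_on (UNIV \<times> - {0 :: real^'n}) (\<lambda>p. m (fst p))"
    by (rule continuous_on_compose2[OF assms(1)]) (auto intro!: continuous_intros)
  then show "continuous_on (UNIV \<times> - {0 :: real^'n}) (\<lambda>p. if snd p = 0 then 0 else m (fst p))"
    by (rule continuous_on_eq) auto
qed (auto simp: assms)

locale rotation_profile_dim = rotation_profile n z E w for n z E w +
  fixes dim_type :: "'n::finite itself"
  assumes n_def: "n = CARD('n)"
begin

text \<open>The density of the quadratic form of -L with respect to ds and the normalised sphere
  measure: E P is the area element, and the squared gradient is u_s^2/E^2 plus the squared spherical
  gradient over z^2. For a function homogeneous of degree zero, the Euclidean partial derivatives
  \<open>ux\<close> give the spherical gradient on the unit sphere. Derivatives are passed as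
  separate arguments.\<close>

definition energy :: "(real \<times> (real^'n) \<Rightarrow> real) \<Rightarrow> (real \<times> (real^'n) \<Rightarrow> real) \<Rightarrow> ('n \<Rightarrow> real \<times> (real^'n) \<Rightarrow> real)
    \<Rightarrow> real \<times> (real^'n) \<Rightarrow> real" where
  "energy u us ux p = P (fst p) / E (fst p) * (us p)\<^sup>2 + E (fst p) * P (fst p) / (z (fst p))\<^sup>2 * (\<Sum>i\<in>UNIV. (ux i p)\<^sup>2)
     - V (fst p) * E (fst p) * P (fst p) * (u p)\<^sup>2"

text \<open>On each orbit sphere, the squares of u and of its s-derivative split into the square of
  the mean plus the variance, and \<open>sphere_poincare\<close> replaces the spherical gradient of
  u by n-1 times its variance. The mean is handled by \<open>quadratic_form_radial\<close>, since by
  assumption it vanishes where \<open>w\<close> does; the deviation from the mean is handled by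
  \<open>quadratic_form_higher_modes\<close>.\<close>

theorem energy_integral_nonneg:
  fixes u us :: "real \<times> (real^'n) \<Rightarrow> real"
  assumes u: "cyl_cont S u" and us: "cyl_cont S us" and ux: "\<And>i. cyl_cont S (ux i)"
    and du: "\<And>s x. x \<noteq> 0 \<Longrightarrow> ((\<lambda>s. u (s, x)) has_real_derivative us (s, x)) (at s)"
    and dux: "\<And>s x. x \<noteq> 0 \<Longrightarrow> ((\<lambda>x. u (s, x)) has_derivative (\<lambda>h. \<Sum>i\<in>UNIV. h $ i * ux i (s, x))) (at x)"
    and hom: "\<And>s c x. c > 0 \<Longrightarrow> u (s, c *\<^sub>R x) = u (s, x)"
    and zero: "\<And>s. w s = 0 \<Longrightarrow> (\<integral>x. u (s, x) \<partial>sphere_measure) = 0"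
  shows "0 \<le> (\<integral>s. \<integral>x. energy u us ux (s, x) \<partial>sphere_measure \<partial>lborel)"
proof -
  interpret S: prob_space "sphere_measure :: (real^'n) measure" by (rule prob_space_sphere_measure)
  define m where "m = (\<lambda>s. \<integral>x. u (s, x) \<partial>sphere_measure)"
  define m' where "m' = (\<lambda>s. \<integral>x. us (s, x) \<partial>sphere_measure)"
  have cm: "continuous_on UNIV m" "continuous_on UNIV m'"
    unfolding m_def m'_def by (rule cyl_cont_isCont_mean[OF u], rule cyl_cont_isCont_mean[OF us])
  have dm: "(m has_real_derivative m' s) (at s)" for s
    unfolding m_def m'_def by (rule cyl_cont_DERIV_mean[OF u us du])
  have sm: "m s = 0" "m' s = 0" if "\<bar>s\<bar> > S" for s
    using that u us by (auto simp: m_def m'_def cyl_cont_def)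
  define M where "M = (\<lambda>p :: real \<times> (real^'n). if snd p = 0 then 0 else m (fst p))"
  define M' where "M' = (\<lambda>p :: real \<times> (real^'n). if snd p = 0 then 0 else m' (fst p))"
  have M: "cyl_cont S M" "cyl_cont S M'"
    unfolding M_def M'_def by (rule cyl_cont_lift[OF cm(1) sm(1)], simp, rule cyl_cont_lift[OF cm(2) sm(2)], simp)
  \<comment> \<open>No spherical derivative is left in \<open>B\<close>. After an exchange of the
    integrals, it is for each fixed direction the one-dimensional form of the deviation from the
    mean.\<close>
  define B where "B = (\<lambda>p. P (fst p) / E (fst p) * (us p - M' p)\<^sup>2
      + E (fst p) * P (fst p) * ((real n - 1) / (z (fst p))\<^sup>2 - V (fst p)) * (u p - M p)\<^sup>2)"
  define C where "C = (\<lambda>s. P s / E s * (m' s)\<^sup>2 + (- V s * E s * P s) * (m s)\<^sup>2)"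
  note cc = cont_P contE cont_z cont_V
  have c1: "continuous_on UNIV (\<lambda>s. P s / E s)" "continuous_on UNIV (\<lambda>s. E s * P s * ((real n - 1) / (z s)\<^sup>2 - V s))"
     "continuous_on UNIV (\<lambda>s. E s * P s / (z s)\<^sup>2)" "continuous_on UNIV (\<lambda>s. V s * E s * P s)"
    by (intro continuous_intros cc; simp)+
  have B: "cyl_cont S B"
    unfolding B_def
    by (intro cyl_cont_add cyl_cont_cmult[OF c1(1)] cyl_cont_cmult[OF c1(2)] cyl_cont_power2 cyl_cont_diff us u M)
  have en: "cyl_cont S (energy u us ux)"
    unfolding energy_def[abs_def]
    by (intro cyl_cont_add cyl_cont_diff cyl_cont_cmult[OF c1(1)] cyl_cont_cmult[OF c1(3)] cyl_cont_cmult[OF c1(4)]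
          cyl_cont_power2 cyl_cont_sum us u ux finite)
  have intC: "integrable lborel C"
  proof (rule integrable_continuous_bounded_support[of _ S])
    show "continuous_on UNIV C" unfolding C_def by (intro continuous_intros cm cc) simp
  qed (simp add: C_def sm)
  have slice: "(\<integral>x. energy u us ux (s, x) \<partial>sphere_measure) \<ge> (\<integral>x. B (s, x) \<partial>sphere_measure) + C s" for s
  proof -
    note isl = cyl_cont_integrable_slice
    have i1: "integrable sphere_measure (\<lambda>x. u (s, x))" "integrable sphere_measure (\<lambda>x. us (s, x))"
      by (rule isl[OF u], rule isl[OF us])
    have i1': "integrable sphere_measure (\<lambda>x. (u (s, x))\<^sup>2)" "integrable sphere_measure (\<lambda>x. (us (s, x))\<^sup>2)"
      by (rule isl[OF cyl_cont_power2[OF u]], rule isl[OF cyl_cont_power2[OF us]])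
    have i1'': "integrable sphere_measure (\<lambda>x. (\<Sum>i\<in>UNIV. (ux i (s, x))\<^sup>2))"
      by (rule isl[OF cyl_cont_sum[OF finite cyl_cont_power2[OF ux]]])
    have var: "(\<integral>x. (g x - c)\<^sup>2 \<partial>sphere_measure) = (\<integral>x. (g x)\<^sup>2 \<partial>sphere_measure) - c\<^sup>2"
      if g: "integrable sphere_measure g" "integrable sphere_measure (\<lambda>x. (g x)\<^sup>2)" "(\<integral>x. g x \<partial>sphere_measure) = c"
      for g :: "real^'n \<Rightarrow> real" and c
    proof -
      have "(\<integral>x. (g x - c)\<^sup>2 \<partial>sphere_measure) = (\<integral>x. ((g x)\<^sup>2 - 2 * c * g x) + c\<^sup>2 \<partial>sphere_measure)"
        by (simp add: power2_eq_square algebra_simps)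
      also have "\<dots> = (\<integral>x. (g x)\<^sup>2 \<partial>sphere_measure) - 2 * c * c + c\<^sup>2"
        using g S.prob_space by simp
      finally show ?thesis by (simp add: power2_eq_square)
    qed
    have nz: "AE x in (sphere_measure :: (real^'n) measure). x \<noteq> 0"
      using AE_sphere_measure by eventually_elim auto
    have i2: "integrable sphere_measure (\<lambda>x. (u (s, x) - m s)\<^sup>2)" "integrable sphere_measure (\<lambda>x. (us (s, x) - m' s)\<^sup>2)"
      unfolding power2_diff using i1 i1' by auto
    have Bs: "(\<integral>x. B (s, x) \<partial>sphere_measure)
      = P s / E s * (\<integral>x. (us (s, x) - m' s)\<^sup>2 \<partial>sphere_measure)
        + E s * P s * ((real n - 1) / (z s)\<^sup>2 - V s) * (\<integral>x. (u (s, x) - m s)\<^sup>2 \<partial>sphere_measure)"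
    proof -
      have "(\<integral>x. B (s, x) \<partial>sphere_measure) = (\<integral>x. P s / E s * (us (s, x) - m' s)\<^sup>2
        + E s * P s * ((real n - 1) / (z s)\<^sup>2 - V s) * (u (s, x) - m s)\<^sup>2 \<partial>sphere_measure)"
      proof (rule integral_cong_AE)
        show "(\<lambda>x. B (s, x)) \<in> borel_measurable sphere_measure" using isl[OF B] by auto
        show "AE x in sphere_measure. B (s, x) = P s / E s * (us (s, x) - m' s)\<^sup>2
            + E s * P s * ((real n - 1) / (z s)\<^sup>2 - V s) * (u (s, x) - m s)\<^sup>2"
          using nz by eventually_elim (simp add: B_def M_def M'_def)
      qed (use i2 in auto)
      also have "\<dots> = P s / E s * (\<integral>x. (us (s, x) - m' s)\<^sup>2 \<partial>sphere_measure)
        + E s * P s * ((real n - 1) / (z s)\<^sup>2 - V s) * (\<integral>x. (u (s, x) - m s)\<^sup>2 \<partial>sphere_measure)"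
        using i2 by simp
      finally show ?thesis .
    qed
    have es: "(\<integral>x. energy u us ux (s, x) \<partial>sphere_measure)
      = P s / E s * (\<integral>x. (us (s, x))\<^sup>2 \<partial>sphere_measure)
       + E s * P s / (z s)\<^sup>2 * (\<integral>x. (\<Sum>i\<in>UNIV. (ux i (s, x))\<^sup>2) \<partial>sphere_measure)
       - V s * E s * P s * (\<integral>x. (u (s, x))\<^sup>2 \<partial>sphere_measure)"
      unfolding energy_def using i1 i1' i1'' by simp
    have ax: "(\<Sum>i\<in>UNIV. axis k 1 $ i * ux i p) = ux k p" for k p
      by (simp add: axis_def if_distrib[of "\<lambda>t. t * _"] sum.delta cong: if_cong)
    have "(real CARD('n) - 1) * (\<integral>x. (u (s, x) - (\<integral>y. u (s, y) \<partial>sphere_measure))\<^sup>2 \<partial>sphere_measure)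
      \<le> (\<integral>x. (\<Sum>k\<in>UNIV. ((\<Sum>i\<in>UNIV. axis k 1 $ i * ux i (s, x)))\<^sup>2) \<partial>sphere_measure)"
    proof (rule sphere_poincare[where u' = "\<lambda>x h. \<Sum>i\<in>UNIV. h $ i * ux i (s, x)"])
      show "continuous_on (- {0}) (\<lambda>x. \<Sum>i\<in>UNIV. axis k 1 $ i * ux i (s, x))" for k
        unfolding ax
        by (rule continuous_on_compose2[of "UNIV \<times> (- {0})" "ux k" _ "\<lambda>x. (s, x)"])
           (use ux[of k] in \<open>auto simp: cyl_cont_def intro!: continuous_intros\<close>)
    qed (use dux hom in auto)
    then have "(real n - 1) * (\<integral>x. (u (s, x) - m s)\<^sup>2 \<partial>sphere_measure) \<le> (\<integral>x. (\<Sum>i\<in>UNIV. (ux i (s, x))\<^sup>2) \<partial>sphere_measure)"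
      unfolding ax m_def n_def .
    then have "E s * P s / (z s)\<^sup>2 * ((real n - 1) * (\<integral>x. (u (s, x) - m s)\<^sup>2 \<partial>sphere_measure))
      \<le> E s * P s / (z s)\<^sup>2 * (\<integral>x. (\<Sum>i\<in>UNIV. (ux i (s, x))\<^sup>2) \<partial>sphere_measure)"
      using E_pos[of s] P_pos[of s] by (intro mult_left_mono) auto
    moreover have v1: "(\<integral>x. (u (s, x) - m s)\<^sup>2 \<partial>sphere_measure) = (\<integral>x. (u (s, x))\<^sup>2 \<partial>sphere_measure) - (m s)\<^sup>2"
      by (rule var[OF i1(1) i1'(1)]) (simp add: m_def)
    moreover have v2: "(\<integral>x. (us (s, x) - m' s)\<^sup>2 \<partial>sphere_measure) = (\<integral>x. (us (s, x))\<^sup>2 \<partial>sphere_measure) - (m' s)\<^sup>2"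
      by (rule var[OF i1(2) i1'(2)]) (simp add: m'_def)
    moreover have "E s * P s * ((real n - 1) / (z s)\<^sup>2 - V s) * y = E s * P s / (z s)\<^sup>2 * ((real n - 1) * y) - V s * E s * P s * y" for y
      by (simp add: field_simps)
    ultimately show ?thesis
      unfolding Bs es C_def by (simp add: right_diff_distrib)
  qed
  have "0 \<le> (\<integral>x. \<integral>s. B (s, x) \<partial>lborel \<partial>sphere_measure)"
  proof (rule integral_nonneg_AE)
    show "AE x in sphere_measure. 0 \<le> (\<integral>s. B (s, x) \<partial>lborel)"
      using AE_sphere_measure
    proof eventually_elim
      case (elim x)
      then have x: "x \<noteq> 0" by auto
      have cus: "continuous_on UNIV (\<lambda>s. us (s, x))"
        by (rule continuous_on_compose2[of "UNIV \<times> (- {0})" us UNIV "\<lambda>s. (s, x)"])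
           (use us x in \<open>auto simp: cyl_cont_def intro!: continuous_intros\<close>)
      have "0 \<le> (\<integral>s. P s / E s * (us (s, x) - m' s)\<^sup>2 + E s * P s * ((real n - 1) / (z s)\<^sup>2 - V s) * (u (s, x) - m s)\<^sup>2 \<partial>lborel)"
        by (rule quadratic_form_higher_modes[of _ _ S])
           (use du[OF x] dm cus cm sm u us in \<open>auto intro!: derivative_intros continuous_intros simp: cyl_cont_def\<close>)
      then show ?case using x by (simp add: B_def M_def M'_def)
    qed
  qed
  moreover have "0 \<le> (\<integral>s. C s \<partial>lborel)"
    unfolding C_def by (rule quadratic_form_radial[OF dm cm(2) sm]) (auto simp: m_def zero)
  moreover have "(\<integral>s. (\<integral>x. B (s, x) \<partial>sphere_measure) + C s \<partial>lborel) \<le> (\<integral>s. \<integral>x. energy u us ux (s, x) \<partial>sphere_measure \<partial>lborel)"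
    by (rule integral_mono[OF Bochner_Integration.integrable_add[OF cyl_cont_Fubini(3)[OF B] intC] cyl_cont_Fubini(3)[OF en] slice])
  moreover have "(\<integral>s. (\<integral>x. B (s, x) \<partial>sphere_measure) + C s \<partial>lborel) = (\<integral>s. (\<integral>x. B (s, x) \<partial>sphere_measure) \<partial>lborel) + (\<integral>s. C s \<partial>lborel)"
    by (rule Bochner_Integration.integral_add[OF cyl_cont_Fubini(3)[OF B] intC])
  ultimately show ?thesis using cyl_cont_Fubini(1)[OF B] by linarith
qed

end

section \<open>Two solutions and the weak form of their equations\<close>

lemma cyl_cont_continuous_slice:
  assumes "cyl_cont S h"
  shows "continuous_on (- {0}) (\<lambda>x. h (s, x))" and "x \<noteq> 0 \<Longrightarrow> continuous_on UNIV (\<lambda>s. h (s, x))"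
proof -
  have h: "continuous_on (UNIV \<times> (- {0})) h" using assms by (simp add: cyl_cont_def)
  show "continuous_on (- {0}) (\<lambda>x. h (s, x))"
    by (rule continuous_on_compose2[OF h]) (auto intro!: continuous_intros)
  show "continuous_on UNIV (\<lambda>s. h (s, x))" if "x \<noteq> 0"
    by (rule continuous_on_compose2[OF h]) (use that in \<open>auto intro!: continuous_intros\<close>)
qed

text \<open>The cut-off vanishes up to a positive level, so its composition with a continuous
  function that is zero outside an open set vanishes near every point of the complement.\<close>

definition smooth_cut :: "real \<Rightarrow> (real \<Rightarrow> real) \<Rightarrow> (real \<Rightarrow> real) \<Rightarrow> bool" where
  "smooth_cut \<epsilon> \<theta> \<theta>' \<longleftrightarrow> \<epsilon> > 0 \<and> continuous_on UNIV \<theta> \<and> continuous_on UNIV \<theta>' \<and>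
     (\<forall>t. (\<theta> has_real_derivative \<theta>' t) (at t)) \<and> (\<forall>t\<le>\<epsilon>. \<theta> t = 0 \<and> \<theta>' t = 0)"

lemma smooth_cut_square:
  "smooth_cut \<epsilon> \<theta> \<theta>' \<Longrightarrow> smooth_cut \<epsilon> (\<lambda>t. (\<theta> t)\<^sup>2) (\<lambda>t. 2 * \<theta> t * \<theta>' t)"
  unfolding smooth_cut_def by (auto intro!: continuous_intros derivative_eq_intros)

text \<open>Two Dirichlet eigenfunctions, indexed by \<open>bool\<close> and extended to be
  homogeneous of degree zero; \<open>Om\<close> is the cone over the interior of the domain. They
  are differentiable inside \<open>Om\<close> but only continuous at its boundary. The equation is
  in divergence form, multiplied by the area density E P; on the unit sphere the Euclidean Laplacian
  of the extension is the spherical one.\<close>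

locale two_solutions = rotation_profile_dim n z E w dim_type
  for n z E w and dim_type :: "'n::finite itself" +
  fixes S :: real and Om :: "(real \<times> (real^'n)) set" and lam :: "bool \<Rightarrow> real"
    and f fs g :: "bool \<Rightarrow> real \<times> (real^'n) \<Rightarrow> real"
    and fx :: "bool \<Rightarrow> 'n \<Rightarrow> real \<times> (real^'n) \<Rightarrow> real"
    and fxx :: "bool \<Rightarrow> 'n \<Rightarrow> 'n \<Rightarrow> real \<times> (real^'n) \<Rightarrow> real"
  assumes open_Om: "open Om" and Om_nz: "(s, x) \<in> Om \<Longrightarrow> x \<noteq> 0"
    and Om_cone: "(s, x) \<in> Om \<Longrightarrow> c > 0 \<Longrightarrow> (s, c *\<^sub>R x) \<in> Om"
    and lam_neg: "lam b < 0"
    and f_cyl: "cyl_cont S (f b)" and f_out: "p \<notin> Om \<Longrightarrow> f b p = 0"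
    and f_hom: "c > 0 \<Longrightarrow> f b (s, c *\<^sub>R x) = f b (s, x)"
    and cont_fs: "continuous_on Om (fs b)" and cont_g: "continuous_on Om (g b)"
    and cont_fx: "continuous_on Om (fx b i)" and cont_fxx: "continuous_on Om (fxx b i j)"
    and d_f: "(s, x) \<in> Om \<Longrightarrow> ((\<lambda>t. f b (t, x)) has_real_derivative fs b (s, x)) (at s)"
    and d_fs: "(s, x) \<in> Om \<Longrightarrow> ((\<lambda>t. P t / E t * fs b (t, x)) has_real_derivative g b (s, x)) (at s)"
    and dx_f: "(s, x) \<in> Om \<Longrightarrow> ((\<lambda>y. f b (s, y)) has_derivative (\<lambda>h. \<Sum>i\<in>UNIV. h $ i * fx b i (s, x))) (at x)"
    and dx_fx: "(s, x) \<in> Om \<Longrightarrow> ((\<lambda>y. fx b i (s, y)) has_derivative (\<lambda>h. \<Sum>j\<in>UNIV. h $ j * fxx b i j (s, x))) (at x)"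
    and pde: "(s, x) \<in> Om \<Longrightarrow> norm x = 1 \<Longrightarrow>
       g b (s, x) + E s * P s / (z s)\<^sup>2 * (\<Sum>i\<in>UNIV. fxx b i i (s, x)) + V s * E s * P s * f b (s, x)
         = - lam b * E s * P s * f b (s, x)"
begin

abbreviation cylM :: "(real \<times> (real^'n)) measure" where "cylM \<equiv> lborel \<Otimes>\<^sub>M sphere_measure"

text \<open>Truncation at levels of this sum cuts off both functions, and all their combinations, at
  once; the set where it exceeds a positive level stays away from the boundary of
  \<open>Om\<close>.\<close>

definition \<rho> :: "real \<times> (real^'n) \<Rightarrow> real" where "\<rho> p = (\<Sum>b\<in>UNIV. (f b p)\<^sup>2)"
definition \<rho>s :: "real \<times> (real^'n) \<Rightarrow> real" where "\<rho>s p = 2 * (\<Sum>b\<in>UNIV. f b p * fs b p)"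
definition \<rho>x :: "'n \<Rightarrow> real \<times> (real^'n) \<Rightarrow> real" where "\<rho>x i p = 2 * (\<Sum>b\<in>UNIV. f b p * fx b i p)"

text \<open>The inner product of the gradients of two of the functions, times the area
  density.\<close>

definition G :: "bool \<Rightarrow> bool \<Rightarrow> real \<times> (real^'n) \<Rightarrow> real" where
  "G a b p = P (fst p) / E (fst p) * (fs a p * fs b p) + E (fst p) * P (fst p) / (z (fst p))\<^sup>2 * (\<Sum>i\<in>UNIV. fx a i p * fx b i p)"

lemma \<rho>_cyl: "cyl_cont S \<rho>"
  unfolding \<rho>_def[abs_def] by (intro cyl_cont_sum cyl_cont_power2 f_cyl) simp

lemma \<rho>_nonneg: "\<rho> p \<ge> 0" by (simp add: \<rho>_def sum_nonneg)

lemma \<rho>_out: "p \<notin> Om \<Longrightarrow> \<rho> p = 0" by (simp add: \<rho>_def f_out)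

lemma cont_on_Om: "cyl_cont S h \<Longrightarrow> continuous_on Om h"
  unfolding cyl_cont_def by (rule continuous_on_subset) (auto dest: Om_nz)

lemma cont_fst: "continuous_on UNIV h \<Longrightarrow> continuous_on A (\<lambda>p :: real \<times> (real^'n). h (fst p) :: real)"
  by (rule continuous_on_compose2[of UNIV h]) (auto intro: continuous_intros)

lemma cont_coeff: "continuous_on UNIV (\<lambda>s. P s / E s)" "continuous_on UNIV (\<lambda>s. E s * P s / (z s)\<^sup>2)"
     "continuous_on UNIV (\<lambda>s. V s * E s * P s)" "continuous_on UNIV (\<lambda>s. E s * P s)"
  by (intro continuous_intros cont_P contE cont_z cont_V; simp)+

lemmas cont_Om = cont_on_Om[OF f_cyl] cont_on_Om[OF \<rho>_cyl] cont_fs cont_g cont_fx cont_fxx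
  cont_fst[OF cont_coeff(1)] cont_fst[OF cont_coeff(2)] cont_fst[OF cont_coeff(3)] cont_fst[OF cont_coeff(4)]

lemma cont_\<rho>s: "continuous_on Om \<rho>s" and cont_\<rho>x: "continuous_on Om (\<rho>x i)" and cont_G: "continuous_on Om (G a b)"
  unfolding \<rho>s_def[abs_def] \<rho>x_def[abs_def] G_def[abs_def] by (intro continuous_intros cont_Om)+

lemma open_punctured: "open (UNIV \<times> (- {0}) :: (real \<times> (real^'n)) set)"
  by (intro open_Times) auto

lemma near_out:
  assumes "x \<noteq> 0" "\<epsilon> > 0" "(s, x) \<notin> Om"
  shows "open {p \<in> UNIV \<times> (- {0}). \<rho> p < \<epsilon>}" "(s, x) \<in> {p \<in> UNIV \<times> (- {0}). \<rho> p < \<epsilon>}"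
proof -
  have "continuous_on (UNIV \<times> (- {0})) \<rho>" using \<rho>_cyl by (simp add: cyl_cont_def)
  from continuous_open_preimage[OF this open_punctured, of "{..<\<epsilon>}"]
  show "open {p \<in> UNIV \<times> (- {0}). \<rho> p < \<epsilon>}" by (simp add: vimage_def Int_def)
  show "(s, x) \<in> {p \<in> UNIV \<times> (- {0}). \<rho> p < \<epsilon>}" using assms by (simp add: \<rho>_out)
qed

text \<open>The open sets \<open>Om\<close> and {\<rho> < \<epsilon>} cover the punctured space. The
  product is continuous on the first and zero on the second, so the behaviour of h at the boundary
  does not enter.\<close>

lemma cut_cyl_cont:
  assumes \<theta>: "continuous_on UNIV \<theta>" "\<And>t. t \<le> \<epsilon> \<Longrightarrow> \<theta> t = 0" "\<epsilon> > 0" and h: "continuous_on Om h"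
  shows "cyl_cont S (\<lambda>p. \<theta> (\<rho> p) * h p)"
  unfolding cyl_cont_def
proof (intro conjI allI impI)
  let ?A = "{p \<in> UNIV \<times> (- {0}). \<rho> p < \<epsilon>}"
  have c\<rho>: "continuous_on (UNIV \<times> (- {0})) \<rho>" using \<rho>_cyl by (simp add: cyl_cont_def)
  have "open ?A"
    using continuous_open_preimage[OF c\<rho> open_punctured, of "{..<\<epsilon>}"] by (simp add: vimage_def Int_def)
  moreover have "continuous_on ?A (\<lambda>p. \<theta> (\<rho> p) * h p)"
    by (rule continuous_on_eq[OF continuous_on_const[of _ 0]]) (simp add: \<theta>)
  moreover have "continuous_on Om (\<lambda>p. \<theta> (\<rho> p) * h p)"
    by (intro continuous_intros h continuous_on_compose2[OF \<theta>(1) cont_on_Om[OF \<rho>_cyl]]) auto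
  ultimately have "continuous_on (?A \<union> Om) (\<lambda>p. \<theta> (\<rho> p) * h p)"
    using open_Om by (intro continuous_on_open_Un) auto
  moreover have "?A \<union> Om = UNIV \<times> (- {0})"
    using \<rho>_out \<theta>(3) by (auto dest: Om_nz)
  ultimately show "continuous_on (UNIV \<times> (- {0})) (\<lambda>p. \<theta> (\<rho> p) * h p)" by simp
qed (use \<rho>_cyl \<theta> in \<open>auto simp: cyl_cont_def\<close>)

lemma cut_cyl:
  assumes "smooth_cut \<epsilon> \<theta> \<theta>'" "continuous_on Om h"
  shows "cyl_cont S (\<lambda>p. \<theta> (\<rho> p) * h p)" "cyl_cont S (\<lambda>p. \<theta>' (\<rho> p) * h p)"
  using assms by (auto simp: smooth_cut_def intro!: cut_cyl_cont[where \<epsilon>=\<epsilon>])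

lemma d_\<rho>: "(s, x) \<in> Om \<Longrightarrow> ((\<lambda>t. \<rho> (t, x)) has_real_derivative \<rho>s (s, x)) (at s)"
  unfolding \<rho>_def \<rho>s_def by (auto intro!: derivative_eq_intros d_f simp: sum_distrib_left mult_ac)

lemma dx_\<rho>: "(s, x) \<in> Om \<Longrightarrow> ((\<lambda>y. \<rho> (s, y)) has_derivative (\<lambda>h. \<Sum>i\<in>UNIV. h $ i * \<rho>x i (s, x))) (at x)"
  unfolding \<rho>_def \<rho>x_def UNIV_bool
  apply simp
  apply (rule has_derivative_eq_rhs)
   apply (rule has_derivative_add)
    apply (rule has_derivative_power[OF dx_f], assumption)
   apply (rule has_derivative_power[OF dx_f], assumption)
  apply (simp add: fun_eq_iff sum_distrib_left sum.distrib[symmetric] algebra_simps)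
  done

text \<open>The product rule inside \<open>Om\<close>; at points outside, the product vanishes
  identically nearby and all terms of the formula are zero.\<close>

lemma d_cut:
  assumes \<theta>: "smooth_cut \<epsilon> \<theta> \<theta>'" and x: "x \<noteq> 0"
    and h: "(s, x) \<in> Om \<Longrightarrow> ((\<lambda>t. h (t, x)) has_real_derivative hs (s, x)) (at s)"
  shows "((\<lambda>t. \<theta> (\<rho> (t, x)) * h (t, x)) has_real_derivative
     \<theta>' (\<rho> (s, x)) * (\<rho>s (s, x) * h (s, x)) + \<theta> (\<rho> (s, x)) * hs (s, x)) (at s)"
proof (cases "(s, x) \<in> Om")
  case True
  have "((\<lambda>t. \<theta> (\<rho> (t, x))) has_real_derivative \<theta>' (\<rho> (s, x)) * \<rho>s (s, x)) (at s)"
    using \<theta> d_\<rho>[OF True] by (intro DERIV_chain2[of \<theta>]) (auto simp: smooth_cut_def)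
  from DERIV_mult[OF this h[OF True]] show ?thesis by (rule DERIV_cong) (simp add: algebra_simps)
next
  case False
  have \<epsilon>: "\<epsilon> > 0" using \<theta> by (simp add: smooth_cut_def)
  note o = near_out[OF x \<epsilon> False]
  have "open ((\<lambda>t. (t, x)) -` {p \<in> UNIV \<times> (- {0}). \<rho> p < \<epsilon>})"
    by (rule open_vimage[OF o(1)]) (intro continuous_intros)
  moreover have "((\<lambda>_. 0) has_real_derivative 0) (at s)" by simp
  ultimately have "((\<lambda>t. \<theta> (\<rho> (t, x)) * h (t, x)) has_real_derivative 0) (at s)"
    using o(2) by (intro has_field_derivative_transform_within_open[of "\<lambda>_. 0" 0 s _ "\<lambda>t. \<theta> (\<rho> (t, x)) * h (t, x)"])
       (use \<theta> in \<open>auto simp: smooth_cut_def\<close>)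
  moreover have "\<theta> (\<rho> (s, x)) = 0" "\<theta>' (\<rho> (s, x)) = 0" using \<theta> False by (auto simp: \<rho>_out smooth_cut_def)
  ultimately show ?thesis by simp
qed

lemma dx_cut:
  assumes \<theta>: "smooth_cut \<epsilon> \<theta> \<theta>'" and x: "x \<noteq> 0"
    and h: "(s, x) \<in> Om \<Longrightarrow> ((\<lambda>y. h (s, y)) has_derivative (\<lambda>e. \<Sum>j\<in>UNIV. e $ j * hx j (s, x))) (at x)"
  shows "((\<lambda>y. \<theta> (\<rho> (s, y)) * h (s, y)) has_derivative
     (\<lambda>e. \<Sum>j\<in>UNIV. e $ j * (\<theta>' (\<rho> (s, x)) * (\<rho>x j (s, x) * h (s, x)) + \<theta> (\<rho> (s, x)) * hx j (s, x)))) (at x)"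
proof (cases "(s, x) \<in> Om")
  case True
  have "(\<theta> has_derivative (\<lambda>t. \<theta>' (\<rho> (s, x)) * t)) (at (\<rho> (s, x)))"
    using \<theta> by (auto simp: smooth_cut_def has_field_derivative_def)
  from diff_chain_at[OF dx_\<rho>[OF True] this]
  have "((\<lambda>y. \<theta> (\<rho> (s, y))) has_derivative (\<lambda>e. \<theta>' (\<rho> (s, x)) * (\<Sum>i\<in>UNIV. e $ i * \<rho>x i (s, x)))) (at x)"
    by (simp add: o_def)
  from has_derivative_mult[OF this h[OF True]] show ?thesis
    by (rule has_derivative_eq_rhs)
       (simp add: fun_eq_iff sum_distrib_left sum_distrib_right sum.distrib[symmetric] algebra_simps)
next
  case False
  have \<epsilon>: "\<epsilon> > 0" using \<theta> by (simp add: smooth_cut_def)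
  note o = near_out[OF x \<epsilon> False]
  have op: "open ((\<lambda>y. (s, y)) -` {p \<in> UNIV \<times> (- {0}). \<rho> p < \<epsilon>})"
    by (rule open_vimage[OF o(1)]) (intro continuous_intros)
  have "((\<lambda>y. \<theta> (\<rho> (s, y)) * h (s, y)) has_derivative (\<lambda>_. 0)) (at x)"
    using o(2) by (intro has_derivative_transform_within_open[OF has_derivative_const[of 0] op])
       (use \<theta> in \<open>auto simp: smooth_cut_def\<close>)
  moreover have "\<theta> (\<rho> (s, x)) = 0" "\<theta>' (\<rho> (s, x)) = 0" using \<theta> False by (auto simp: \<rho>_out smooth_cut_def)
  ultimately show ?thesis by simp
qed

lemma \<rho>_hom: "c > 0 \<Longrightarrow> \<rho> (s, c *\<^sub>R x) = \<rho> (s, x)"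
  by (simp add: \<rho>_def f_hom)

lemma axis_sum: "(\<Sum>i\<in>UNIV. axis k 1 $ i * (a i :: real)) = a (k :: 'n)"
  by (simp add: axis_def if_distrib[of "\<lambda>t. t * _"] sum.delta cong: if_cong)

lemma fx_hom:
  assumes "(s, x) \<in> Om" "c > 0"
  shows "fx b i (s, c *\<^sub>R x) = fx b i (s, x) / c"
proof -
  have "((\<lambda>y. c *\<^sub>R y) has_derivative (\<lambda>h. c *\<^sub>R h)) (at x)" by (auto intro!: derivative_eq_intros)
  from diff_chain_at[OF this dx_f[OF Om_cone[OF assms]]]
  have "((\<lambda>y. f b (s, y)) has_derivative (\<lambda>h. \<Sum>i\<in>UNIV. (c *\<^sub>R h) $ i * fx b i (s, c *\<^sub>R x))) (at x)"
    by (simp add: o_def f_hom[OF assms(2)])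
  from has_derivative_unique[OF this dx_f[OF assms(1)]]
  have "(\<Sum>j\<in>UNIV. (c *\<^sub>R axis i 1) $ j * fx b j (s, c *\<^sub>R x)) = (\<Sum>j\<in>UNIV. axis i 1 $ j * fx b j (s, x))"
    by (rule fun_cong)
  then have "c * fx b i (s, c *\<^sub>R x) = fx b i (s, x)"
    by (simp add: axis_sum mult.assoc sum_distrib_left[symmetric])
  then show ?thesis using assms(2) by (simp add: field_simps)
qed

lemma fx_radial: "(s, x) \<in> Om \<Longrightarrow> (\<Sum>i\<in>UNIV. x $ i * fx b i (s, x)) = 0"
  using homogeneous_radial_derivative[OF dx_f[of s x b]] f_hom by blast

lemma integral_cylM_cong:
  assumes "cyl_cont S h1" "cyl_cont S h2" "\<And>s x. norm x = 1 \<Longrightarrow> h1 (s, x) = h2 (s, x)"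
  shows "(\<integral>p. h1 p \<partial>cylM) = (\<integral>p. h2 p \<partial>cylM)"
proof -
  have "(\<integral>x. h1 (s, x) \<partial>sphere_measure) = (\<integral>x. h2 (s, x) \<partial>sphere_measure)" for s
    using cyl_cont_integrable_slice[OF assms(1), of s] cyl_cont_integrable_slice[OF assms(2), of s] AE_sphere_measure assms(3)
    by (intro integral_cong_AE) (auto elim!: eventually_mono)
  then show ?thesis using cyl_cont_Fubini(2)[OF assms(1)] cyl_cont_Fubini(2)[OF assms(2)] by simp
qed

text \<open>Test the equation of \<open>f b\<close> with \<open>\<theta> (\<rho> p) * f a p\<close>,
  which has bounded support and vanishes near the boundary, and integrate by parts in s and on the
  sphere. The terms with \<theta>' come from the gradient of \<rho>, which is twice the sum of
  \<open>f c\<close> times its gradient.\<close>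

lemma weak_form:
  assumes \<theta>: "smooth_cut \<epsilon> \<theta> \<theta>'"
  shows "(\<integral>p. \<theta> (\<rho> p) * (G a b p - V (fst p) * E (fst p) * P (fst p) * (f a p * f b p))
       + \<theta>' (\<rho> p) * (2 * (\<Sum>c\<in>UNIV. f a p * f c p * G c b p)) \<partial>cylM)
    = lam b * (\<integral>p. \<theta> (\<rho> p) * (E (fst p) * P (fst p) * (f a p * f b p)) \<partial>cylM)"
proof -
  note cut = cut_cyl[OF \<theta>]
  \<comment> \<open>The s-derivative of the test function times the flux P/E \<open>fs b\<close>;
    its integral over s vanishes.\<close>
  define A1 where "A1 = (\<lambda>p. \<theta>' (\<rho> p) * (\<rho>s p * (f a p * (P (fst p) / E (fst p) * fs b p)))
      + \<theta> (\<rho> p) * (fs a p * (P (fst p) / E (fst p) * fs b p) + f a p * g b p))"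
  \<comment> \<open>The divergence of the test function times the spatial gradient of
    \<open>f b\<close>, a tangential field of degree -1; its integral over each sphere
    vanishes.\<close>
  define A2 where "A2 = (\<lambda>p. \<Sum>i\<in>UNIV. \<theta>' (\<rho> p) * (\<rho>x i p * (f a p * fx b i p))
      + \<theta> (\<rho> p) * (fx a i p * fx b i p + f a p * fxx b i i p))"
  have c1: "cyl_cont S A1"
    unfolding A1_def by (intro cyl_cont_add cut) (intro continuous_intros cont_Om cont_\<rho>s)+
  have c2: "cyl_cont S A2"
    unfolding A2_def by (intro cyl_cont_sum cyl_cont_add cut finite) (intro continuous_intros cont_Om cont_\<rho>x)+
  have z0: "(\<integral>s. A1 (s, x) \<partial>lborel) = 0" if x: "x \<noteq> 0" for x
  proof -
    have cF: "cyl_cont S (\<lambda>p. \<theta> (\<rho> p) * (f a p * (P (fst p) / E (fst p) * fs b p)))"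
      by (intro cut continuous_intros cont_Om)
    have "((\<lambda>t. \<theta> (\<rho> (t, x)) * (f a (t, x) * (P t / E t * fs b (t, x)))) has_real_derivative A1 (s, x)) (at s)" for s
    proof -
      have "(s, x) \<in> Om \<Longrightarrow> ((\<lambda>t. f a (t, x) * (P t / E t * fs b (t, x))) has_real_derivative
          fs a (s, x) * (P s / E s * fs b (s, x)) + f a (s, x) * g b (s, x)) (at s)"
        using DERIV_mult[OF d_f d_fs, of s x] by (rule DERIV_cong) (auto simp: algebra_simps)
      from d_cut[OF \<theta> x, where h="\<lambda>p. f a p * (P (fst p) / E (fst p) * fs b p)"
          and hs="\<lambda>p. fs a p * (P (fst p) / E (fst p) * fs b p) + f a p * g b p" and s=s, unfolded fst_conv, OF this]
      show ?thesis by (simp add: A1_def)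
    qed
    then have "(\<integral>s. A1 (s, x) * 1 \<partial>lborel) = 0"
    proof (intro integral_directional_derivative_eq_0[where G="\<lambda>t. \<theta> (\<rho> (t, x)) * (f a (t, x) * (P t / E t * fs b (t, x)))" and R=S])
      show "continuous_on UNIV (\<lambda>s. A1 (s, x) * 1)"
        using cyl_cont_continuous_slice(2)[OF c1 x] by simp
    qed (use cF in \<open>auto simp: has_field_derivative_def cyl_cont_def\<close>)
    then show ?thesis by simp
  qed
  have "(\<integral>x. (\<integral>s. A1 (s, x) \<partial>lborel) \<partial>sphere_measure) = (\<integral>x. 0 \<partial>(sphere_measure :: (real^'n) measure))"
  proof (intro integral_cong_AE)
    interpret Sp: prob_space "sphere_measure :: (real^'n) measure" by (rule prob_space_sphere_measure)
    interpret PS: pair_sigma_finite "lborel :: real measure" "sphere_measure :: (real^'n) measure" ..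
    show "(\<lambda>x. \<integral>s. A1 (s, x) \<partial>lborel) \<in> borel_measurable sphere_measure"
      using PS.integrable_snd[of "\<lambda>s x. A1 (s, x)"] cyl_cont_integrable[OF c1] by auto
    show "AE x in sphere_measure. (\<integral>s. A1 (s, x) \<partial>lborel) = 0"
      using AE_sphere_measure
    proof eventually_elim
      case (elim x)
      then have "x \<noteq> 0" by auto
      then show ?case by (rule z0)
    qed
  qed auto
  then have I1: "(\<integral>p. A1 p \<partial>cylM) = 0"
    using cyl_cont_Fubini(1,2)[OF c1] by simp
  have "(\<integral>x. A2 (s, x) \<partial>sphere_measure) = 0" for s
  proof -
    let ?W' = "\<lambda>i x e. \<Sum>j\<in>UNIV. e $ j * (\<theta>' (\<rho> (s, x)) * (\<rho>x j (s, x) * (f a (s, x) * fx b i (s, x)))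
        + \<theta> (\<rho> (s, x)) * (fx a j (s, x) * fx b i (s, x) + f a (s, x) * fxx b i j (s, x)))"
    have "(\<integral>x. (\<Sum>i\<in>UNIV. ?W' i x (axis i 1)) \<partial>sphere_measure) = 0"
    proof (rule sphere_divergence[where W="\<lambda>i x. \<theta> (\<rho> (s, x)) * (f a (s, x) * fx b i (s, x))"])
      fix x :: "real^'n" and i
      assume x: "x \<noteq> 0"
      have "(s, x) \<in> Om \<Longrightarrow> ((\<lambda>y. f a (s, y) * fx b i (s, y)) has_derivative
          (\<lambda>e. \<Sum>j\<in>UNIV. e $ j * (fx a j (s, x) * fx b i (s, x) + f a (s, x) * fxx b i j (s, x)))) (at x)"
        using has_derivative_mult[OF dx_f dx_fx, of s x]
        by (rule has_derivative_eq_rhs)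
           (auto simp: fun_eq_iff sum_distrib_left sum_distrib_right sum.distrib[symmetric] algebra_simps)
      from dx_cut[OF \<theta> x, where h="\<lambda>p. f a p * fx b i p"
          and hx="\<lambda>j p. fx a j p * fx b i p + f a p * fxx b i j p" and s=s, OF this]
      show "((\<lambda>x. \<theta> (\<rho> (s, x)) * (f a (s, x) * fx b i (s, x))) has_derivative ?W' i x) (at x)" .
    next
      fix i
      have "cyl_cont S (\<lambda>p. \<theta>' (\<rho> p) * (\<rho>x i p * (f a p * fx b i p))
          + \<theta> (\<rho> p) * (fx a i p * fx b i p + f a p * fxx b i i p))"
        by (intro cyl_cont_add cut) (intro continuous_intros cont_Om cont_\<rho>x)+
      from cyl_cont_continuous_slice(1)[OF this, of s]
      show "continuous_on (- {0}) (\<lambda>x. ?W' i x (axis i 1))" by (simp only: axis_sum)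
    next
      fix i c and x :: "real^'n" assume c: "c > (0::real)"
      show "\<theta> (\<rho> (s, c *\<^sub>R x)) * (f a (s, c *\<^sub>R x) * fx b i (s, c *\<^sub>R x)) = \<theta> (\<rho> (s, x)) * (f a (s, x) * fx b i (s, x)) / c"
      proof (cases "(s, x) \<in> Om")
        case True
        then show ?thesis using c by (simp add: \<rho>_hom f_hom fx_hom)
      next
        case False
        then show ?thesis using c by (simp add: f_hom f_out)
      qed
    next
      fix x :: "real^'n"
      have "(\<Sum>i\<in>UNIV. x $ i * (\<theta> (\<rho> (s, x)) * (f a (s, x) * fx b i (s, x)))) = \<theta> (\<rho> (s, x)) * f a (s, x) * (\<Sum>i\<in>UNIV. x $ i * fx b i (s, x))"
        by (simp add: sum_distrib_left mult_ac)
      also have "\<dots> = 0" by (cases "(s, x) \<in> Om") (auto simp: fx_radial f_out)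
      finally show "(\<Sum>i\<in>UNIV. x $ i * (\<theta> (\<rho> (s, x)) * (f a (s, x) * fx b i (s, x)))) = 0" .
    qed
    then show ?thesis by (simp add: axis_sum A2_def)
  qed
  then have I2: "(\<integral>p. E (fst p) * P (fst p) / (z (fst p))\<^sup>2 * A2 p \<partial>cylM) = 0"
    using cyl_cont_Fubini(2)[OF cyl_cont_cmult[OF cont_coeff(2) c2]] by simp
  define B where "B = (\<lambda>p. (\<theta> (\<rho> p) * (G a b p - V (fst p) * E (fst p) * P (fst p) * (f a p * f b p))
       + \<theta>' (\<rho> p) * (2 * (\<Sum>c\<in>UNIV. f a p * f c p * G c b p))))"
  define C where "C = (\<lambda>p. \<theta> (\<rho> p) * (E (fst p) * P (fst p) * (f a p * f b p)))"
  have cB: "cyl_cont S B" and cC: "cyl_cont S C"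
    unfolding B_def C_def by (intro cyl_cont_add cut continuous_intros cont_Om cont_G)+
  have c12: "cyl_cont S (\<lambda>p. A1 p + E (fst p) * P (fst p) / (z (fst p))\<^sup>2 * A2 p)"
    by (intro cyl_cont_add c1 cyl_cont_cmult[OF cont_coeff(2) c2])
  have cBC: "cyl_cont S (\<lambda>p. B p - lam b * C p)"
    using cyl_cont_diff[OF cB cyl_cont_cmult[OF continuous_on_const[of _ "lam b"] cC]] .
  have "(\<integral>p. A1 p + E (fst p) * P (fst p) / (z (fst p))\<^sup>2 * A2 p \<partial>cylM) = 0"
    using I1 I2 cyl_cont_integrable[OF c1] cyl_cont_integrable[OF cyl_cont_cmult[OF cont_coeff(2) c2]]
    by simp
  moreover have "(\<integral>p. B p - lam b * C p \<partial>cylM) = (\<integral>p. A1 p + E (fst p) * P (fst p) / (z (fst p))\<^sup>2 * A2 p \<partial>cylM)"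
  proof (rule integral_cylM_cong[OF cBC c12])
    fix s and x :: "real^'n" assume x: "norm x = 1"
    show "B (s, x) - lam b * C (s, x) = A1 (s, x) + E (fst (s, x)) * P (fst (s, x)) / (z (fst (s, x)))\<^sup>2 * A2 (s, x)"
    proof (cases "(s, x) \<in> Om")
      case False
      then have "\<theta> (\<rho> (s, x)) = 0" "\<theta>' (\<rho> (s, x)) = 0" using \<theta> by (auto simp: \<rho>_out smooth_cut_def)
      then show ?thesis by (simp add: A1_def A2_def B_def C_def)
    next
      case True
      define L where "L = (\<Sum>i\<in>UNIV. fxx b i i (s, x))"
      have g: "g b (s, x) = - lam b * E s * P s * f b (s, x) - V s * E s * P s * f b (s, x) - E s * P s / (z s)\<^sup>2 * L"
      proof -
        have move: "p1 = p4 - p3 - p2" if "p1 + p2 + p3 = p4" for p1 p2 p3 p4 :: real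
          using that by simp
        show ?thesis by (rule move[OF pde[OF True x, of b, folded L_def]])
      qed
      \<comment> \<open>The sum over c is reassembled into the derivatives of \<rho>, the form in
        which it appears in \<open>A1\<close> and \<open>A2\<close>.\<close>
      have GB: "2 * (\<Sum>c\<in>UNIV. f a (s, x) * f c (s, x) * G c b (s, x))
         = \<rho>s (s, x) * (f a (s, x) * (P s / E s * fs b (s, x)))
           + E s * P s / (z s)\<^sup>2 * (\<Sum>i\<in>UNIV. \<rho>x i (s, x) * (f a (s, x) * fx b i (s, x)))"
      proof -
        define T where "T = (\<lambda>c. \<Sum>i\<in>UNIV. fx c i (s, x) * fx b i (s, x))"
        have "(\<Sum>i\<in>UNIV. \<rho>x i (s, x) * (f a (s, x) * fx b i (s, x)))
          = (\<Sum>i\<in>UNIV. 2 * f a (s, x) * f True (s, x) * (fx True i (s, x) * fx b i (s, x))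
              + 2 * f a (s, x) * f False (s, x) * (fx False i (s, x) * fx b i (s, x)))"
          by (intro sum.cong refl) (simp add: \<rho>x_def UNIV_bool algebra_simps)
        also have "\<dots> = 2 * f a (s, x) * f True (s, x) * T True + 2 * f a (s, x) * f False (s, x) * T False"
          by (simp only: sum.distrib sum_distrib_left T_def)
        finally have h: "(\<Sum>i\<in>UNIV. \<rho>x i (s, x) * (f a (s, x) * fx b i (s, x)))
          = 2 * f a (s, x) * f True (s, x) * T True + 2 * f a (s, x) * f False (s, x) * T False" .
        have T: "(\<Sum>i\<in>UNIV. fx c i (s, x) * fx b i (s, x)) = T c" for c by (simp add: T_def)
        show ?thesis unfolding h G_def T \<rho>s_def UNIV_bool fst_conv
          by (simp add: algebra_simps)
      qed
      have A2s: "A2 (s, x) = \<theta>' (\<rho> (s, x)) * (\<Sum>i\<in>UNIV. \<rho>x i (s, x) * (f a (s, x) * fx b i (s, x)))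
        + \<theta> (\<rho> (s, x)) * ((\<Sum>i\<in>UNIV. fx a i (s, x) * fx b i (s, x)) + f a (s, x) * L)"
        by (simp only: A2_def L_def sum.distrib sum_distrib_left distrib_left)
      show ?thesis
        unfolding B_def GB A2s unfolding A1_def C_def g G_def fst_conv
        by (simp only: algebra_simps)
    qed
  qed
  ultimately have "(\<integral>p. B p - lam b * C p \<partial>cylM) = 0" by simp
  then have "(\<integral>p. B p \<partial>cylM) = lam b * (\<integral>p. C p \<partial>cylM)"
    using cyl_cont_integrable[OF cB] cyl_cont_integrable[OF cC] by simp
  then show ?thesis by (simp add: B_def C_def)
qed

end

section \<open>Strict positivity, and cut-offs with uniform bounds\<close>

lemma (in rotation_profile) w_less:
  assumes "a < b" shows "w a < w b"
proof (rule DERIV_pos_imp_increasing[OF assms], intro exI conjI)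
  fix s
  show "(w has_real_derivative E s * z s * (1 + (real n - 1) * K s)) (at s)" by (rule dw')
  show "E s * z s * (1 + (real n - 1) * K s) > 0"
    using z_pos[of s] E_pos[of s] K_nonneg[of s] n2 by (intro mult_pos_pos add_pos_nonneg mult_nonneg_nonneg) auto
qed

text \<open>If the slice at s0 had integral zero, it would vanish for almost every Gaussian vector
  by homogeneity, hence almost everywhere; but it is positive on a nonempty open set. The slice
  integral is continuous in s, so positivity at s0 is enough.\<close>

lemma cyl_cont_integral_pos:
  fixes g :: "real \<times> (real^'n::finite) \<Rightarrow> real"
  assumes g: "cyl_cont S g" and nonneg: "\<And>p. g p \<ge> 0"
    and hom: "\<And>s c x. c > 0 \<Longrightarrow> g (s, c *\<^sub>R x) = g (s, x)" and pos: "g (s0, x0) > 0"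
  shows "(\<integral>p. g p \<partial>(lborel \<Otimes>\<^sub>M sphere_measure)) > 0"
proof -
  define J where "J = (\<lambda>s. \<integral>x. g (s, x) \<partial>sphere_measure)"
  have sgn_g: "g (s, sgn x) = g (s, x)" for s x
    using hom[of "inverse (norm x)" s x] by (cases "x = 0") (auto simp: sgn_div_norm)
  note [measurable] = cyl_cont_borel_measurable[OF g]
  have J0: "J s0 \<noteq> 0"
  proof
    assume "J s0 = 0"
    then have "AE x in sphere_measure. g (s0, x) = 0"
      unfolding J_def using cyl_cont_integrable_slice[OF g, of s0] nonneg
      by (subst (asm) integral_nonneg_eq_0_iff_AE) auto
    then have "AE x in gauss_space. g (s0, sgn x) = 0"
      unfolding sphere_measure_def by (subst (asm) AE_distr_iff) auto
    then have "AE x in lborel. ennreal (gauss_density x) > 0 \<longrightarrow> g (s0, x) = 0"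
      unfolding gauss_space_def sgn_g by (subst (asm) AE_density) auto
    then have "AE x in lborel. g (s0, x) = 0"
      by eventually_elim (simp add: gauss_density_eq)
    then have "{x. g (s0, x) \<noteq> 0} \<in> null_sets lborel"
      by (subst (asm) AE_iff_null) auto
    then have "negligible {x. g (s0, x) \<noteq> 0}"
      by (meson negligible_iff_null_sets null_sets_completionI)
    then have "negligible {x \<in> - {0}. g (s0, x) \<noteq> 0}" by (rule negligible_subset) auto
    moreover have "open {x \<in> - {0}. g (s0, x) \<noteq> 0}"
    proof -
      have o: "open (- {0 :: real^'n})" "open (- {0 :: real})" by (auto intro: open_Compl)
      show ?thesis
        using continuous_open_preimage[OF cyl_cont_continuous_slice(1)[OF g, of s0] o]
        by (simp add: vimage_def Int_def)
    qed
    moreover have "x0 \<in> {x \<in> - {0}. g (s0, x) \<noteq> 0}"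
      using pos g by (auto simp: cyl_cont_def)
    ultimately show False using open_not_negligible by blast
  qed
  have Jn: "J s \<ge> 0" for s unfolding J_def by (rule Bochner_Integration.integral_nonneg) (rule nonneg)
  have "(\<integral>s. J s \<partial>lborel) > 0"
  proof (rule integral_pos_continuous)
    show "continuous_on UNIV J" "integrable lborel J"
      unfolding J_def by (rule cyl_cont_isCont_mean[OF g], rule cyl_cont_Fubini(3)[OF g])
    show "J s0 > 0" using J0 Jn[of s0] by simp
  qed (rule Jn)
  then show ?thesis using cyl_cont_Fubini(2)[OF g] by (simp add: J_def)
qed

text \<open>An increasing cut-off between 0 and 1 that vanishes up to e = 1/(k+1) and tends to 1 at
  every positive t. The formula is chosen so that t times the derivative is bounded uniformly in k
  and tends to zero, which is what makes the truncation errors disappear.\<close>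

definition cut_fun :: "nat \<Rightarrow> real \<Rightarrow> real" where
  "cut_fun k t = (let e = 1 / real (Suc k); q = (max 0 (t - e))\<^sup>2 in q / (q + e\<^sup>2))"

definition cut_der :: "nat \<Rightarrow> real \<Rightarrow> real" where
  "cut_der k t = (let e = 1 / real (Suc k) in 2 * max 0 (t - e) * e\<^sup>2 / ((max 0 (t - e))\<^sup>2 + e\<^sup>2)\<^sup>2)"

lemma smooth_cut_cut_fun: "smooth_cut (1 / real (Suc k)) (cut_fun k) (cut_der k)"
proof -
  define e where "e = 1 / real (Suc k)"
  have e: "e > 0" by (simp add: e_def)
  have pos: "(max 0 (t - e))\<^sup>2 + e\<^sup>2 > 0" for t using e by (intro add_nonneg_pos) auto
  have nz: "(max 0 (t - e))\<^sup>2 + e\<^sup>2 \<noteq> 0" for t by (rule less_imp_neq[OF pos, symmetric])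
  have c1: "cut_fun k = (\<lambda>t. (max 0 (t - e))\<^sup>2 / ((max 0 (t - e))\<^sup>2 + e\<^sup>2))"
    by (simp add: fun_eq_iff cut_fun_def Let_def e_def)
  have c2: "cut_der k = (\<lambda>t. 2 * max 0 (t - e) * e\<^sup>2 / ((max 0 (t - e))\<^sup>2 + e\<^sup>2)\<^sup>2)"
    by (simp add: fun_eq_iff cut_der_def Let_def e_def)
  have d: "((\<lambda>t. (max 0 (t - e))\<^sup>2) has_real_derivative 2 * max 0 (t - e)) (at t)" for t
  proof -
    have "((\<lambda>t. t - e) has_real_derivative 1) (at t)" by (auto intro!: derivative_eq_intros)
    from DERIV_chain2[OF DERIV_max_0_square this] show ?thesis by (rule DERIV_cong) simp
  qed
  have "(cut_fun k has_real_derivative cut_der k t) (at t)" for t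
    unfolding c1 c2
    by (rule DERIV_cong, rule DERIV_divide[OF d DERIV_add[OF d DERIV_const] nz])
       (simp add: power2_eq_square algebra_simps)
  moreover have "continuous_on UNIV (cut_fun k)" "continuous_on UNIV (cut_der k)"
    unfolding c1 c2 using nz by (auto intro!: continuous_intros)
  ultimately show ?thesis unfolding smooth_cut_def e_def[symmetric] using e by (auto simp: c1 c2)
qed

lemma cut_fun_bounds: "0 \<le> cut_fun k t" "cut_fun k t \<le> 1" "0 \<le> cut_der k t"
proof -
  have H: "x / (x + y) \<le> 1" if "x \<ge> 0" "y > 0" for x y :: real using that by (simp add: divide_le_eq)
  show "cut_fun k t \<le> 1" unfolding cut_fun_def Let_def by (intro H) simp_all
  show "0 \<le> cut_fun k t" "0 \<le> cut_der k t" unfolding cut_fun_def cut_der_def Let_def by simp_all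
qed

text \<open>With m = t - e > 0 the product equals 2 (m + e) m e^2 / (m^2 + e^2)^2; now 2 m^2 + 2 m e
  <= 3 (m^2 + e^2) and e^2 <= m^2 + e^2.\<close>

lemma cut_der_bound: "t \<ge> 0 \<Longrightarrow> t * cut_der k t \<le> 3"
proof -
  assume t: "t \<ge> 0"
  define e where "e = 1 / real (Suc k)"
  have e: "e > 0" by (simp add: e_def)
  show ?thesis
  proof (cases "t \<le> e")
    case True
    then show ?thesis unfolding cut_der_def Let_def e_def[symmetric] by simp
  next
    case False
    define m where "m = t - e"
    have m: "m > 0" "t = m + e" "max 0 (t - e) = m" using False by (auto simp: m_def)
    have q: "m\<^sup>2 + e\<^sup>2 > 0" using m e by (intro add_pos_pos) auto
    have "2 * m * e \<le> m\<^sup>2 + e\<^sup>2" "0 \<le> e\<^sup>2"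
      using zero_le_power2[of "m - e"] by (simp_all add: power2_eq_square algebra_simps)
    moreover have "2 * x + y \<le> 3 * (x + c)" if "y \<le> x + c" "0 \<le> c" for x y c :: real
      using that by argo
    ultimately have "2 * m\<^sup>2 + 2 * m * e \<le> 3 * (m\<^sup>2 + e\<^sup>2)" by blast
    then have "(m + e) * (2 * m) \<le> 3 * (m\<^sup>2 + e\<^sup>2)" by (simp add: power2_eq_square algebra_simps)
    then have A: "(m + e) * (2 * m) * e\<^sup>2 \<le> 3 * (m\<^sup>2 + e\<^sup>2) * (m\<^sup>2 + e\<^sup>2)"
      by (rule mult_mono) auto
    have B: "t * cut_der k t = (m + e) * (2 * m) * e\<^sup>2 / ((m\<^sup>2 + e\<^sup>2) * (m\<^sup>2 + e\<^sup>2))"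
      unfolding cut_der_def Let_def e_def[symmetric] m(3)
      by (subst m(2)) (simp only: power2_eq_square[of "m\<^sup>2 + e\<^sup>2"] times_divide_eq_right mult.assoc)
    show ?thesis unfolding B
      by (subst pos_divide_le_eq[OF mult_pos_pos[OF q q]]) (rule A[unfolded mult.assoc[of 3]])
  qed
qed

lemma cut_fun_limits:
  assumes "t > 0"
  shows "(\<lambda>k. cut_fun k t) \<longlonglongrightarrow> 1" "(\<lambda>k. t * cut_der k t) \<longlonglongrightarrow> 0"
proof -
  have e: "(\<lambda>k. 1 / real (Suc k)) \<longlonglongrightarrow> 0" by (rule LIMSEQ_Suc[OF lim_1_over_n])
  have "(\<lambda>k. cut_fun k t) \<longlonglongrightarrow> (max 0 (t - 0))\<^sup>2 / ((max 0 (t - 0))\<^sup>2 + 0\<^sup>2)"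
    unfolding cut_fun_def Let_def using assms by (intro tendsto_intros e) auto
  then show "(\<lambda>k. cut_fun k t) \<longlonglongrightarrow> 1" using assms by simp
  have "(\<lambda>k. t * cut_der k t) \<longlonglongrightarrow> t * (2 * max 0 (t - 0) * 0\<^sup>2 / ((max 0 (t - 0))\<^sup>2 + 0\<^sup>2)\<^sup>2)"
    unfolding cut_der_def Let_def using assms by (intro tendsto_intros e) auto
  then show "(\<lambda>k. t * cut_der k t) \<longlonglongrightarrow> 0" by simp
qed

text \<open>Multiply by A and complete the square; the result is positive while A is
  negative.\<close>

lemma negative_definite_2x2:
  fixes A B C a b :: real
  assumes "A < 0" "A * C > B\<^sup>2" "a \<noteq> 0 \<or> b \<noteq> 0"
  shows "A * a\<^sup>2 + 2 * B * a * b + C * b\<^sup>2 < 0"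
proof -
  have "A * (A * a\<^sup>2 + 2 * B * a * b + C * b\<^sup>2) = (A * a + B * b)\<^sup>2 + (A * C - B\<^sup>2) * b\<^sup>2"
    by (simp add: power2_eq_square algebra_simps)
  also have "\<dots> > 0"
  proof (cases "b = 0")
    case True
    then show ?thesis using assms by simp
  next
    case False
    then show ?thesis using assms by (intro add_nonneg_pos mult_pos_pos) auto
  qed
  finally show ?thesis using \<open>A < 0\<close> by (simp add: zero_less_mult_iff)
qed

section \<open>Finite energy, vanishing truncation errors and linear dependence\<close>

context two_solutions
begin

definition T :: "real \<times> (real^'n) \<Rightarrow> real" where "T p = G True True p + G False False p"

lemma G_sym: "G a b p = G b a p" by (simp add: G_def mult.commute)

text \<open>The matrix \<open>G\<close> is a Gram matrix: its quadratic form is the gradient energy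
  density of the linear combination with coefficients c, hence it is nonnegative.\<close>

lemma G_form: "(\<Sum>a\<in>UNIV. \<Sum>b\<in>UNIV. c a * c b * G a b p)
   = P (fst p) / E (fst p) * (\<Sum>b\<in>UNIV. c b * fs b p)\<^sup>2
     + E (fst p) * P (fst p) / (z (fst p))\<^sup>2 * (\<Sum>i\<in>UNIV. (\<Sum>b\<in>UNIV. c b * fx b i p)\<^sup>2)"
proof -
  have "(\<Sum>i\<in>UNIV. (\<Sum>b\<in>UNIV. c b * fx b i p)\<^sup>2)
    = (\<Sum>i\<in>UNIV. c True * c True * (fx True i p * fx True i p) + 2 * (c True * c False) * (fx True i p * fx False i p)
        + c False * c False * (fx False i p * fx False i p))"
    by (intro sum.cong refl) (simp add: UNIV_bool power2_eq_square algebra_simps)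
  also have "\<dots> = c True * c True * (\<Sum>i\<in>UNIV. fx True i p * fx True i p) + 2 * (c True * c False) * (\<Sum>i\<in>UNIV. fx True i p * fx False i p)
        + c False * c False * (\<Sum>i\<in>UNIV. fx False i p * fx False i p)"
    by (simp only: sum.distrib sum_distrib_left)
  finally have 1: "(\<Sum>i\<in>UNIV. (\<Sum>b\<in>UNIV. c b * fx b i p)\<^sup>2) = \<dots>" .
  define A B C where "A = (\<Sum>i\<in>UNIV. fx True i p * fx True i p)" and "B = (\<Sum>i\<in>UNIV. fx True i p * fx False i p)"
    and "C = (\<Sum>i\<in>UNIV. fx False i p * fx False i p)"
  have B: "(\<Sum>i\<in>UNIV. fx False i p * fx True i p) = B" unfolding B_def by (intro sum.cong refl mult.commute)
  define q r where "q = E (fst p) * P (fst p) / (z (fst p))\<^sup>2" and "r = P (fst p) / E (fst p)"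
  have g: "G True True p = r * (fs True p * fs True p) + q * A" "G True False p = r * (fs True p * fs False p) + q * B"
     "G False True p = r * (fs False p * fs True p) + q * B" "G False False p = r * (fs False p * fs False p) + q * C"
    unfolding G_def q_def[symmetric] r_def[symmetric] B A_def[symmetric] B_def[symmetric] C_def[symmetric] by (rule refl)+
  show ?thesis
    unfolding 1 unfolding A_def[symmetric] B_def[symmetric] C_def[symmetric] q_def[symmetric] r_def[symmetric]
    by (simp add: UNIV_bool g power2_eq_square algebra_simps)
qed

lemma G_form_nonneg: "0 \<le> (\<Sum>a\<in>UNIV. \<Sum>b\<in>UNIV. c a * c b * G a b p)"
  unfolding G_form using P_pos[of "fst p"] E_pos[of "fst p"]
  by (intro add_nonneg_nonneg mult_nonneg_nonneg sum_nonneg) auto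

lemma G_diag_nonneg: "0 \<le> G b b p"
  using G_form_nonneg[of "\<lambda>a. if a = b then 1 else 0" p] by (cases b) (simp_all add: UNIV_bool)

lemma T_nonneg: "0 \<le> T p" unfolding T_def by (intro add_nonneg_nonneg G_diag_nonneg)

text \<open>The entries of a positive semidefinite 2x2 matrix are bounded by its trace; testing with
  (1,1) and (1,-1) controls the off-diagonal one.\<close>

lemma G_le_T: "\<bar>G a b p\<bar> \<le> T p"
proof -
  have "\<bar>2 * G True False p\<bar> \<le> T p"
    using G_form_nonneg[of "\<lambda>a. 1" p] G_form_nonneg[of "\<lambda>a. if a then 1 else -1" p]
    by (auto simp: UNIV_bool T_def G_sym[of False True] abs_le_iff)
  then have "\<bar>G True False p\<bar> \<le> T p" using T_nonneg[of p] by linarith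
  then show ?thesis
    using G_diag_nonneg[of True p] G_diag_nonneg[of False p] G_sym[of False True p]
    by (cases a; cases b) (auto simp: T_def)
qed

lemma ff_le_\<rho>: "\<bar>f a p * f b p\<bar> \<le> \<rho> p"
proof -
  have *: "\<bar>x * y\<bar> \<le> x\<^sup>2 + y\<^sup>2" "x\<^sup>2 \<le> x\<^sup>2 + y\<^sup>2" "y\<^sup>2 \<le> x\<^sup>2 + y\<^sup>2" for x y :: real
    using zero_le_power2[of "x - y"] zero_le_power2[of "x + y"] zero_le_power2[of x] zero_le_power2[of y]
    by (auto simp: abs_le_iff power2_eq_square algebra_simps)
  show ?thesis
    using *[of "f True p" "f False p"]
    by (cases a; cases b) (auto simp: \<rho>_def UNIV_bool power2_eq_square[symmetric] mult.commute add.commute)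
qed

lemma ffG_le: "\<bar>f a p * f b p * G c d p\<bar> \<le> \<rho> p * T p"
  unfolding abs_mult[of "f a p * f b p"] by (intro mult_mono ff_le_\<rho> G_le_T \<rho>_nonneg) auto

lemma cont_T: "continuous_on Om T" unfolding T_def[abs_def] by (intro continuous_intros cont_G)

lemmas cutk = cut_cyl[OF smooth_cut_cut_fun]

text \<open>Outside \<open>Om\<close> the functions \<open>fs\<close> and \<open>fx\<close> are
  arbitrary, so the energy density is restricted to the set where \<rho> is positive. There it is
  the limit of its truncations, which yields measurability.\<close>

definition T0 :: "real \<times> (real^'n) \<Rightarrow> real" where "T0 p = (if \<rho> p > 0 then T p else 0)"

lemma cut_T0: "cut_fun k (\<rho> p) * T p = cut_fun k (\<rho> p) * T0 p"
  using \<rho>_nonneg[of p] smooth_cut_cut_fun[of k] by (auto simp: T0_def smooth_cut_def)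

lemma T0_lim: "(\<lambda>k. cut_fun k (\<rho> p) * T p) \<longlonglongrightarrow> T0 p"
proof (cases "\<rho> p > 0")
  case True
  then show ?thesis using tendsto_mult[OF cut_fun_limits(1)[OF True] tendsto_const[of "T p"]] by (simp add: T0_def)
next
  case False
  then have "\<rho> p = 0" using \<rho>_nonneg[of p] by simp
  then show ?thesis using smooth_cut_cut_fun by (simp add: T0_def smooth_cut_def)
qed

lemma meas_cylM: "cyl_cont S h \<Longrightarrow> h \<in> borel_measurable cylM"
  using cyl_cont_integrable by auto

lemma T0_measurable [measurable]: "T0 \<in> borel_measurable cylM"
  by (rule borel_measurable_LIMSEQ_real[OF T0_lim]) (rule meas_cylM[OF cutk(1)[OF cont_T]])

lemma \<rho>_measurable [measurable]: "\<rho> \<in> borel_measurable cylM" by (rule meas_cylM[OF \<rho>_cyl])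

lemma T0_nonneg: "0 \<le> T0 p" by (simp add: T0_def T_nonneg)

text \<open>The energy estimate that takes the place of membership in the Sobolev space with zero
  boundary values. In the weak form with a = b, summed over b, the term with \<theta>' is
  nonnegative because the cut-off increases and \<open>G\<close> is positive semidefinite, and the
  right side is nonpositive because the eigenvalues are negative. So the truncated energy is bounded
  by the integral of |V| E P \<rho> for every k, and Fatou's lemma finishes.\<close>

lemma integrable_T0: "integrable cylM T0"
proof (rule integrableI_nonneg)
  define h where "h = (\<lambda>p. V (fst p) * E (fst p) * P (fst p) * \<rho> p)"
  have h: "cyl_cont S h" unfolding h_def by (rule cyl_cont_cmult[OF cont_coeff(3) \<rho>_cyl])
  define C where "C = (\<integral>p. \<bar>h p\<bar> \<partial>cylM)"
  have bound: "(\<integral>p. cut_fun k (\<rho> p) * T p \<partial>cylM) \<le> C" for k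
  proof -
    have cT: "cyl_cont S (\<lambda>p. cut_fun k (\<rho> p) * T p)" by (rule cutk(1)[OF cont_T])
    have ch: "cyl_cont S (\<lambda>p. cut_fun k (\<rho> p) * h p)" by (rule cutk(1)[OF cont_on_Om[OF h]])
    define X where "X = (\<lambda>b p. cut_fun k (\<rho> p) * (G b b p - V (fst p) * E (fst p) * P (fst p) * (f b p * f b p))
       + cut_der k (\<rho> p) * (2 * (\<Sum>c\<in>UNIV. f b p * f c p * G c b p)))"
    have cX: "cyl_cont S (X b)" for b
      unfolding X_def by (intro cyl_cont_add cutk) (intro continuous_intros cont_Om cont_G)+
    have "(\<integral>p. X b p \<partial>cylM) \<le> 0" for b
    proof -
      have "0 \<le> (\<integral>p. cut_fun k (\<rho> p) * (E (fst p) * P (fst p) * (f b p * f b p)) \<partial>cylM)"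
        by (rule Bochner_Integration.integral_nonneg, rule mult_nonneg_nonneg[OF cut_fun_bounds(1)
              mult_nonneg_nonneg[OF mult_nonneg_nonneg[OF less_imp_le[OF E_pos] less_imp_le[OF P_pos]] zero_le_square]])
      then show ?thesis
        unfolding X_def weak_form[OF smooth_cut_cut_fun] using lam_neg[of b] by (simp add: mult_nonpos_nonneg)
    qed
    then have "(\<integral>p. X True p + X False p \<partial>cylM) \<le> 0"
      using cyl_cont_integrable[OF cX] by (simp add: add_nonpos_nonpos)
    moreover have "(\<integral>p. cut_fun k (\<rho> p) * T p - cut_fun k (\<rho> p) * h p \<partial>cylM) \<le> (\<integral>p. X True p + X False p \<partial>cylM)"
    proof (rule integral_mono)
      fix p
      have "0 \<le> (\<Sum>a\<in>UNIV. \<Sum>b\<in>UNIV. f a p * f b p * G a b p)" by (rule G_form_nonneg)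
      then have "0 \<le> cut_der k (\<rho> p) * (2 * (\<Sum>a\<in>UNIV. \<Sum>b\<in>UNIV. f a p * f b p * G a b p))"
        by (intro mult_nonneg_nonneg cut_fun_bounds) auto
      then show "cut_fun k (\<rho> p) * T p - cut_fun k (\<rho> p) * h p \<le> X True p + X False p"
        by (simp add: X_def T_def h_def \<rho>_def UNIV_bool G_sym[of False True] power2_eq_square algebra_simps)
    qed (use cyl_cont_integrable[OF cX] cyl_cont_integrable[OF cT] cyl_cont_integrable[OF ch] in auto)
    ultimately have "(\<integral>p. cut_fun k (\<rho> p) * T p \<partial>cylM) \<le> (\<integral>p. cut_fun k (\<rho> p) * h p \<partial>cylM)"
      using cyl_cont_integrable[OF cT] cyl_cont_integrable[OF ch] by simp
    also have "\<dots> \<le> C"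
      unfolding C_def
    proof (rule integral_mono)
      show "cut_fun k (\<rho> p) * h p \<le> \<bar>h p\<bar>" for p
        using mult_right_mono[OF cut_fun_bounds(2)[of k "\<rho> p"], of "\<bar>h p\<bar>"] mult_left_mono[OF abs_ge_self[of "h p"] cut_fun_bounds(1)[of k "\<rho> p"]]
        by simp
    qed (use cyl_cont_integrable[OF h] cyl_cont_integrable[OF ch] in auto)
    finally show ?thesis .
  qed
  have "(\<integral>\<^sup>+p. ennreal (T0 p) \<partial>cylM) = (\<integral>\<^sup>+p. liminf (\<lambda>k. ennreal (cut_fun k (\<rho> p) * T p)) \<partial>cylM)"
  proof (rule nn_integral_cong)
    fix p
    have "(\<lambda>k. ennreal (cut_fun k (\<rho> p) * T p)) \<longlonglongrightarrow> ennreal (T0 p)" by (intro tendsto_ennrealI T0_lim)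
    then show "ennreal (T0 p) = liminf (\<lambda>k. ennreal (cut_fun k (\<rho> p) * T p))"
      by (simp add: lim_imp_Liminf)
  qed
  also have "\<dots> \<le> liminf (\<lambda>k. \<integral>\<^sup>+p. ennreal (cut_fun k (\<rho> p) * T p) \<partial>cylM)"
    by (rule nn_integral_liminf) (use meas_cylM[OF cutk(1)[OF cont_T]] in auto)
  also have "\<dots> \<le> liminf (\<lambda>k::nat. ennreal C)"
  proof (rule Liminf_mono, rule always_eventually, rule allI)
    fix k
    have "(\<integral>\<^sup>+p. ennreal (cut_fun k (\<rho> p) * T p) \<partial>cylM) = ennreal (\<integral>p. cut_fun k (\<rho> p) * T p \<partial>cylM)"
      by (rule nn_integral_eq_integral)
         (use cyl_cont_integrable[OF cutk(1)[OF cont_T]] in \<open>auto simp: cut_fun_bounds T_nonneg\<close>)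
    also have "\<dots> \<le> ennreal C" by (rule ennreal_leI[OF bound])
    finally show "(\<integral>\<^sup>+p. ennreal (cut_fun k (\<rho> p) * T p) \<partial>cylM) \<le> ennreal C" .
  qed
  also have "\<dots> < \<infinity>" by (simp add: Liminf_const)
  finally show "(\<integral>\<^sup>+p. ennreal (T0 p) \<partial>cylM) < \<infinity>" .
qed (auto simp: T0_nonneg)

lemma cut_der_0: "t \<le> 0 \<Longrightarrow> cut_der k t = 0"
proof -
  assume "t \<le> 0"
  moreover have "0 < 1 / real (Suc k)" by simp
  ultimately have "t - 1 / real (Suc k) \<le> 0" by linarith
  then show ?thesis unfolding cut_der_def Let_def by (simp add: max_absorb1 del: of_nat_Suc)
qed

lemma cut_der_measurable [measurable]: "cut_der k \<in> borel_measurable borel"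
  using smooth_cut_cut_fun[of k] by (auto simp: smooth_cut_def intro: borel_measurable_continuous_onI)

text \<open>Dominated convergence: \<rho> times the derivative of the cut-off at \<rho> is at most 3
  and tends to zero pointwise, and \<open>T0\<close> is integrable.\<close>

lemma error_tendsto_0: "(\<lambda>k. \<integral>p. (\<rho> p * cut_der k (\<rho> p)) * T0 p \<partial>cylM) \<longlonglongrightarrow> 0"
proof -
  have "(\<lambda>k. \<integral>p. (\<rho> p * cut_der k (\<rho> p)) * T0 p \<partial>cylM) \<longlonglongrightarrow> (\<integral>p. 0 \<partial>cylM)"
  proof (rule integral_dominated_convergence[where w="\<lambda>p. 3 * T0 p"])
    show "AE p in cylM. (\<lambda>k. \<rho> p * cut_der k (\<rho> p) * T0 p) \<longlonglongrightarrow> 0"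
    proof (rule AE_I2)
      fix p
      show "(\<lambda>k. \<rho> p * cut_der k (\<rho> p) * T0 p) \<longlonglongrightarrow> 0"
      proof (cases "\<rho> p > 0")
        case True
        then show ?thesis using tendsto_mult[OF cut_fun_limits(2)[OF True] tendsto_const[of "T0 p"]] by simp
      qed (simp add: T0_def)
    qed
    show "AE p in cylM. norm (\<rho> p * cut_der k (\<rho> p) * T0 p) \<le> 3 * T0 p" for k
      using cut_der_bound[OF \<rho>_nonneg] \<rho>_nonneg cut_fun_bounds(3) T0_nonneg
      by (intro AE_I2) (simp add: abs_mult mult_right_mono)
  qed (use integrable_T0 in auto)
  then show ?thesis by simp
qed

lemma integrable_error: "integrable cylM (\<lambda>p. (\<rho> p * cut_der k (\<rho> p)) * T0 p)"
proof (rule Bochner_Integration.integrable_bound[OF integrable_mult_right[OF integrable_T0, of 3]])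
  show "AE p in cylM. norm (\<rho> p * cut_der k (\<rho> p) * T0 p) \<le> norm (3 * T0 p)"
    using cut_der_bound[OF \<rho>_nonneg] \<rho>_nonneg cut_fun_bounds(3) T0_nonneg
    by (intro AE_I2) (simp add: abs_mult mult_right_mono)
qed measurable

lemma ffG_cut_le: "\<bar>cut_der k (\<rho> p) * (f a p * f b p * G c d p)\<bar> \<le> (\<rho> p * cut_der k (\<rho> p)) * T0 p"
proof (cases "\<rho> p > 0")
  case True
  have "\<bar>cut_der k (\<rho> p) * (f a p * f b p * G c d p)\<bar> \<le> cut_der k (\<rho> p) * (\<rho> p * T p)"
    using cut_fun_bounds(3)[of k "\<rho> p"] ffG_le[of a p b c d] by (simp add: abs_mult mult_left_mono)
  then show ?thesis using True by (simp add: T0_def mult_ac)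
next
  case False
  then show ?thesis using \<rho>_nonneg[of p] by (simp add: cut_der_0)
qed

text \<open>The weighted inner products of the truncated functions. The cut-off is squared because
  each of the two factors carries it.\<close>

definition Nk :: "nat \<Rightarrow> bool \<Rightarrow> bool \<Rightarrow> real" where
  "Nk k a b = (\<integral>p. (cut_fun k (\<rho> p))\<^sup>2 * (E (fst p) * P (fst p) * (f a p * f b p)) \<partial>cylM)"

definition N :: "bool \<Rightarrow> bool \<Rightarrow> real" where
  "N a b = (\<integral>p. E (fst p) * P (fst p) * (f a p * f b p) \<partial>cylM)"

lemma cyl_N: "cyl_cont S (\<lambda>p. E (fst p) * P (fst p) * (f a p * f b p))"
  by (intro cyl_cont_cmult[OF cont_coeff(4)] cyl_cont_mult f_cyl)

lemma Nk_tendsto: "(\<lambda>k. Nk k a b) \<longlonglongrightarrow> N a b"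
  unfolding Nk_def N_def
proof (rule integral_dominated_convergence[where w="\<lambda>p. \<bar>E (fst p) * P (fst p) * (f a p * f b p)\<bar>"])
  note sq = smooth_cut_square[OF smooth_cut_cut_fun]
  show "(\<lambda>p. (cut_fun k (\<rho> p))\<^sup>2 * (E (fst p) * P (fst p) * (f a p * f b p))) \<in> borel_measurable cylM" for k
    by (rule meas_cylM[OF cut_cyl(1)[OF sq cont_on_Om[OF cyl_N]]])
  show "AE p in cylM. norm ((cut_fun k (\<rho> p))\<^sup>2 * (E (fst p) * P (fst p) * (f a p * f b p))) \<le> \<bar>E (fst p) * P (fst p) * (f a p * f b p)\<bar>" for k
  proof (rule AE_I2)
    fix p
    have "(cut_fun k (\<rho> p))\<^sup>2 \<le> 1" using cut_fun_bounds[of k "\<rho> p"] by (simp add: power_le_one)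
    then show "norm ((cut_fun k (\<rho> p))\<^sup>2 * (E (fst p) * P (fst p) * (f a p * f b p))) \<le> \<bar>E (fst p) * P (fst p) * (f a p * f b p)\<bar>"
      using mult_right_mono[of "(cut_fun k (\<rho> p))\<^sup>2" 1 "\<bar>E (fst p) * P (fst p) * (f a p * f b p)\<bar>"]
      unfolding real_norm_def abs_mult[of "(cut_fun k (\<rho> p))\<^sup>2"] by simp
  qed
  show "AE p in cylM. (\<lambda>k. (cut_fun k (\<rho> p))\<^sup>2 * (E (fst p) * P (fst p) * (f a p * f b p))) \<longlonglongrightarrow> E (fst p) * P (fst p) * (f a p * f b p)"
  proof (rule AE_I2)
    fix p
    show "(\<lambda>k. (cut_fun k (\<rho> p))\<^sup>2 * (E (fst p) * P (fst p) * (f a p * f b p))) \<longlonglongrightarrow> E (fst p) * P (fst p) * (f a p * f b p)"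
    proof (cases "\<rho> p > 0")
      case True
      then show ?thesis
        using tendsto_mult[OF tendsto_power[OF cut_fun_limits(1)[OF True], of 2] tendsto_const[of "E (fst p) * P (fst p) * (f a p * f b p)"]]
        by simp
    next
      case False
      then have "\<bar>f a p * f b p\<bar> \<le> 0" using ff_le_\<rho>[of a p b] by linarith
      then have "f a p * f b p = 0" by (simp only: abs_le_zero_iff)
      then show ?thesis by (simp only: mult_zero_right) simp
    qed
  qed
qed (use cyl_cont_integrable[OF cyl_N] in \<open>auto intro: meas_cylM[OF cyl_N]\<close>)

lemma weak_form_square:
  "(\<integral>p. (cut_fun k (\<rho> p))\<^sup>2 * (G a b p - V (fst p) * E (fst p) * P (fst p) * (f a p * f b p))
       + 2 * cut_fun k (\<rho> p) * cut_der k (\<rho> p) * (2 * (\<Sum>c\<in>UNIV. f a p * f c p * G c b p)) \<partial>cylM) = lam b * Nk k a b"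
  unfolding Nk_def by (rule weak_form[OF smooth_cut_square[OF smooth_cut_cut_fun]])

definition f_comb :: "(bool \<Rightarrow> real) \<Rightarrow> real \<times> (real^'n) \<Rightarrow> real" where
  "f_comb \<alpha> p = (\<Sum>b\<in>UNIV. \<alpha> b * f b p)"

definition u_cut :: "nat \<Rightarrow> (bool \<Rightarrow> real) \<Rightarrow> real \<times> (real^'n) \<Rightarrow> real" where
  "u_cut k \<alpha> p = cut_fun k (\<rho> p) * f_comb \<alpha> p"

definition us_cut :: "nat \<Rightarrow> (bool \<Rightarrow> real) \<Rightarrow> real \<times> (real^'n) \<Rightarrow> real" where
  "us_cut k \<alpha> p = cut_der k (\<rho> p) * (\<rho>s p * f_comb \<alpha> p) + cut_fun k (\<rho> p) * (\<Sum>b\<in>UNIV. \<alpha> b * fs b p)"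

definition ux_cut :: "nat \<Rightarrow> (bool \<Rightarrow> real) \<Rightarrow> 'n \<Rightarrow> real \<times> (real^'n) \<Rightarrow> real" where
  "ux_cut k \<alpha> i p = cut_der k (\<rho> p) * (\<rho>x i p * f_comb \<alpha> p) + cut_fun k (\<rho> p) * (\<Sum>b\<in>UNIV. \<alpha> b * fx b i p)"

definition X_form :: "nat \<Rightarrow> bool \<Rightarrow> bool \<Rightarrow> real \<times> (real^'n) \<Rightarrow> real" where
  "X_form k a b p = (cut_fun k (\<rho> p))\<^sup>2 * (G a b p - V (fst p) * E (fst p) * P (fst p) * (f a p * f b p))
       + 2 * cut_fun k (\<rho> p) * cut_der k (\<rho> p) * (2 * (\<Sum>c\<in>UNIV. f a p * f c p * G c b p))"

lemma cyl_X_form: "cyl_cont S (X_form k a b)"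
  unfolding X_form_def[abs_def]
  by (intro cyl_cont_add cut_cyl[OF smooth_cut_square[OF smooth_cut_cut_fun]]) (intro continuous_intros cont_Om cont_G)+

lemma integral_X_form: "(\<integral>p. X_form k a b p \<partial>cylM) = lam b * Nk k a b"
  unfolding X_form_def by (rule weak_form_square)

lemma cont_f_comb: "continuous_on Om (f_comb \<alpha>)"
  unfolding f_comb_def[abs_def] by (intro continuous_intros cont_Om)

lemma cyl_cut: "cyl_cont S (u_cut k \<alpha>)" "cyl_cont S (us_cut k \<alpha>)" "cyl_cont S (ux_cut k \<alpha> i)"
  unfolding u_cut_def[abs_def] us_cut_def[abs_def] ux_cut_def[abs_def]
  by (intro cyl_cont_add cutk cont_f_comb continuous_intros cont_\<rho>s cont_\<rho>x cont_Om)+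

text \<open>The gradient of the truncated combination is a combination of the gradients of the
  \<open>f b\<close>, with coefficients \<theta> \<alpha>_b + 2 \<theta>' \<open>f_comb\<close>
  \<open>f b\<close>. Expanding with \<open>G_form\<close>, the part linear in \<theta>' is exactly
  that of \<open>X_form\<close>; only the part quadratic in \<theta>' remains as an error.\<close>

lemma energy_cut:
  "energy (u_cut k \<alpha>) (us_cut k \<alpha>) (ux_cut k \<alpha>) p
    = (\<Sum>a\<in>UNIV. \<Sum>b\<in>UNIV. \<alpha> a * \<alpha> b * X_form k a b p)
      + 4 * (cut_der k (\<rho> p) * f_comb \<alpha> p)\<^sup>2 * (\<Sum>a\<in>UNIV. \<Sum>b\<in>UNIV. f a p * f b p * G a b p)"
proof -
  define X X' where "X = cut_fun k (\<rho> p)" and "X' = cut_der k (\<rho> p)"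
  define c where "c = (\<lambda>b. 2 * X' * f_comb \<alpha> p * f b p + X * \<alpha> b)"
  have us: "us_cut k \<alpha> p = (\<Sum>b\<in>UNIV. c b * fs b p)"
    unfolding us_cut_def X_def[symmetric] X'_def[symmetric] c_def \<rho>s_def by (simp add: UNIV_bool algebra_simps)
  have ux: "ux_cut k \<alpha> i p = (\<Sum>b\<in>UNIV. c b * fx b i p)" for i
    unfolding ux_cut_def X_def[symmetric] X'_def[symmetric] c_def \<rho>x_def by (simp add: UNIV_bool algebra_simps)
  have "energy (u_cut k \<alpha>) (us_cut k \<alpha>) (ux_cut k \<alpha>) p
     = (\<Sum>a\<in>UNIV. \<Sum>b\<in>UNIV. c a * c b * G a b p) - V (fst p) * E (fst p) * P (fst p) * (X * f_comb \<alpha> p)\<^sup>2"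
    unfolding energy_def us ux G_form u_cut_def X_def ..
  also have "\<dots> = (\<Sum>a\<in>UNIV. \<Sum>b\<in>UNIV. \<alpha> a * \<alpha> b * X_form k a b p)
      + 4 * (X' * f_comb \<alpha> p)\<^sup>2 * (\<Sum>a\<in>UNIV. \<Sum>b\<in>UNIV. f a p * f b p * G a b p)"
  proof -
    define h where "h = V (fst p) * E (fst p) * P (fst p)"
    define F where "F = f_comb \<alpha> p"
    have F: "F = \<alpha> False * f False p + \<alpha> True * f True p" by (simp add: F_def f_comb_def UNIV_bool)
    have cc: "c a * c b = 4 * X'\<^sup>2 * F\<^sup>2 * (f a p * f b p) + 2 * X * X' * F * (f a p * \<alpha> b + \<alpha> a * f b p) + X\<^sup>2 * (\<alpha> a * \<alpha> b)" for a b
      unfolding c_def F_def[symmetric] by (simp add: power2_eq_square algebra_simps)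
    define g1 g2 g3 where "g1 = G False False p" and "g2 = G True False p" and "g3 = G True True p"
    have g: "G False False p = g1" "G True False p = g2" "G False True p = g2" "G True True p = g3"
      by (simp_all add: g1_def g2_def g3_def G_sym[of False True])
    have s1: "(\<Sum>a\<in>UNIV. \<Sum>b\<in>UNIV. \<alpha> a * \<alpha> b * X_form k a b p)
      = X\<^sup>2 * (\<alpha> False * \<alpha> False * g1 + 2 * (\<alpha> True * \<alpha> False) * g2 + \<alpha> True * \<alpha> True * g3) - X\<^sup>2 * h * F\<^sup>2
        + 4 * X * X' * F * (\<alpha> False * (f False p * g1 + f True p * g2) + \<alpha> True * (f False p * g2 + f True p * g3))"
      unfolding X_form_def X_def[symmetric] X'_def[symmetric] h_def[symmetric] F
      by (simp add: UNIV_bool g power2_eq_square algebra_simps)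
    show ?thesis
      unfolding s1 unfolding cc F_def[symmetric] h_def[symmetric]
      by (simp add: UNIV_bool g power2_eq_square algebra_simps)
  qed
  finally show ?thesis by (simp add: X'_def)
qed

definition err :: "nat \<Rightarrow> real" where "err k = (\<integral>p. (\<rho> p * cut_der k (\<rho> p)) * T0 p \<partial>cylM)"

lemma err_tendsto_0: "err \<longlonglongrightarrow> 0"
  unfolding err_def[abs_def] by (rule error_tendsto_0)

lemma f_comb_square_le: "(f_comb \<alpha> p)\<^sup>2 \<le> ((\<alpha> True)\<^sup>2 + (\<alpha> False)\<^sup>2) * \<rho> p"
proof -
  have "0 \<le> (\<alpha> True * f False p - \<alpha> False * f True p)\<^sup>2" by simp
  then show ?thesis by (simp add: f_comb_def \<rho>_def UNIV_bool power2_eq_square algebra_simps)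
qed

text \<open>The constant is 4 * 4 * 3: the factor in front, the four entries of the form, each
  controlled by \<open>ffG_cut_le\<close>, and the bound of \<open>cut_der_bound\<close>. By
  Cauchy-Schwarz the square of \<open>f_comb\<close> is at most \<rho> times the sum of the squared
  coefficients.\<close>

lemma error_term_le:
  "4 * (cut_der k (\<rho> p) * f_comb \<alpha> p)\<^sup>2 * (\<Sum>a\<in>UNIV. \<Sum>b\<in>UNIV. f a p * f b p * G a b p)
    \<le> 48 * ((\<alpha> True)\<^sup>2 + (\<alpha> False)\<^sup>2) * ((\<rho> p * cut_der k (\<rho> p)) * T0 p)"
proof -
  define X' where "X' = cut_der k (\<rho> p)"
  define Y where "Y = (\<Sum>a\<in>UNIV. \<Sum>b\<in>UNIV. f a p * f b p * G a b p)"
  define A where "A = (\<alpha> True)\<^sup>2 + (\<alpha> False)\<^sup>2"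
  define W where "W = (\<rho> p * X') * T0 p"
  have X': "X' \<ge> 0" "\<rho> p * X' \<le> 3" using cut_fun_bounds(3) cut_der_bound[OF \<rho>_nonneg] by (auto simp: X'_def)
  have A: "A \<ge> 0" by (simp add: A_def)
  have W: "W \<ge> 0" unfolding W_def using X' \<rho>_nonneg T0_nonneg by simp
  have Y0: "Y \<ge> 0" unfolding Y_def by (rule G_form_nonneg)
  have "X' * Y = (\<Sum>a\<in>UNIV. \<Sum>b\<in>UNIV. X' * (f a p * f b p * G a b p))"
    by (simp add: Y_def sum_distrib_left)
  also have "\<dots> \<le> (\<Sum>a\<in>(UNIV::bool set). \<Sum>b\<in>(UNIV::bool set). W)"
    unfolding W_def X'_def by (intro sum_mono order.trans[OF abs_ge_self ffG_cut_le])
  also have "\<dots> = 4 * W" by simp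
  finally have XY: "X' * Y \<le> 4 * W" .
  have "4 * (X' * f_comb \<alpha> p)\<^sup>2 * Y = 4 * X' * (f_comb \<alpha> p)\<^sup>2 * (X' * Y)" by (simp add: power2_eq_square)
  also have "\<dots> \<le> 4 * X' * (A * \<rho> p) * (4 * W)"
  proof (rule mult_mono[OF mult_left_mono XY])
    show "(f_comb \<alpha> p)\<^sup>2 \<le> A * \<rho> p" unfolding A_def by (rule f_comb_square_le)
    show "0 \<le> 4 * X'" "0 \<le> X' * Y" using X' Y0 by auto
    show "0 \<le> 4 * X' * (A * \<rho> p)" using X' A \<rho>_nonneg[of p] by simp
  qed
  also have "\<dots> = 16 * A * W * (\<rho> p * X')" by simp
  also have "\<dots> \<le> 16 * A * W * 3" using A W X' by (intro mult_left_mono) auto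
  also have "\<dots> = 48 * A * W" by simp
  finally show ?thesis unfolding A_def W_def X'_def Y_def .
qed

lemma energy_integral_le:
  "(\<integral>p. energy (u_cut k \<alpha>) (us_cut k \<alpha>) (ux_cut k \<alpha>) p \<partial>cylM)
    \<le> (\<Sum>a\<in>UNIV. \<Sum>b\<in>UNIV. \<alpha> a * \<alpha> b * (lam b * Nk k a b)) + 48 * ((\<alpha> True)\<^sup>2 + (\<alpha> False)\<^sup>2) * err k"
proof -
  have en: "cyl_cont S (energy (u_cut k \<alpha>) (us_cut k \<alpha>) (ux_cut k \<alpha>))"
    unfolding energy_def[abs_def]
    by (intro cyl_cont_add cyl_cont_diff cyl_cont_cmult[OF cont_coeff(1)] cyl_cont_cmult[OF cont_coeff(2)]
          cyl_cont_cmult[OF cont_coeff(3)] cyl_cont_power2 cyl_cont_sum cyl_cut finite)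
  have "(\<integral>p. energy (u_cut k \<alpha>) (us_cut k \<alpha>) (ux_cut k \<alpha>) p \<partial>cylM)
     \<le> (\<integral>p. (\<Sum>a\<in>UNIV. \<Sum>b\<in>UNIV. \<alpha> a * \<alpha> b * X_form k a b p)
         + 48 * ((\<alpha> True)\<^sup>2 + (\<alpha> False)\<^sup>2) * ((\<rho> p * cut_der k (\<rho> p)) * T0 p) \<partial>cylM)"
  proof (rule integral_mono)
    show "integrable cylM (energy (u_cut k \<alpha>) (us_cut k \<alpha>) (ux_cut k \<alpha>))" by (rule cyl_cont_integrable[OF en])
    show "integrable cylM (\<lambda>p. (\<Sum>a\<in>UNIV. \<Sum>b\<in>UNIV. \<alpha> a * \<alpha> b * X_form k a b p)
         + 48 * ((\<alpha> True)\<^sup>2 + (\<alpha> False)\<^sup>2) * ((\<rho> p * cut_der k (\<rho> p)) * T0 p))"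
      by (intro Bochner_Integration.integrable_add Bochner_Integration.integrable_sum integrable_mult_right
          cyl_cont_integrable[OF cyl_X_form] integrable_error)
    show "energy (u_cut k \<alpha>) (us_cut k \<alpha>) (ux_cut k \<alpha>) p \<le> (\<Sum>a\<in>UNIV. \<Sum>b\<in>UNIV. \<alpha> a * \<alpha> b * X_form k a b p)
         + 48 * ((\<alpha> True)\<^sup>2 + (\<alpha> False)\<^sup>2) * ((\<rho> p * cut_der k (\<rho> p)) * T0 p)" for p
      unfolding energy_cut by (rule add_left_mono[OF error_term_le])
  qed
  also have "\<dots> = (\<Sum>a\<in>UNIV. \<Sum>b\<in>UNIV. \<alpha> a * \<alpha> b * (lam b * Nk k a b)) + 48 * ((\<alpha> True)\<^sup>2 + (\<alpha> False)\<^sup>2) * err k"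
    using cyl_cont_integrable[OF cyl_X_form] integrable_error[of k]
    by (simp add: Bochner_Integration.integral_sum Bochner_Integration.integrable_sum integral_X_form err_def)
  finally show ?thesis .
qed

lemma u_cut_hom: "c > 0 \<Longrightarrow> u_cut k \<alpha> (s, c *\<^sub>R x) = u_cut k \<alpha> (s, x)"
  by (simp add: u_cut_def f_comb_def \<rho>_hom f_hom)

lemma energy_cut_nonneg:
  assumes "\<And>s. w s = 0 \<Longrightarrow> (\<integral>x. u_cut k \<alpha> (s, x) \<partial>sphere_measure) = 0"
  shows "0 \<le> (\<integral>p. energy (u_cut k \<alpha>) (us_cut k \<alpha>) (ux_cut k \<alpha>) p \<partial>cylM)"
proof -
  have en: "cyl_cont S (energy (u_cut k \<alpha>) (us_cut k \<alpha>) (ux_cut k \<alpha>))"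
    unfolding energy_def[abs_def]
    by (intro cyl_cont_add cyl_cont_diff cyl_cont_cmult[OF cont_coeff(1)] cyl_cont_cmult[OF cont_coeff(2)]
          cyl_cont_cmult[OF cont_coeff(3)] cyl_cont_power2 cyl_cont_sum cyl_cut finite)
  have ds: "((\<lambda>t. u_cut k \<alpha> (t, x)) has_real_derivative us_cut k \<alpha> (s, x)) (at s)" if x: "x \<noteq> 0" for s x
    unfolding u_cut_def us_cut_def
  proof (rule d_cut[OF smooth_cut_cut_fun x])
    assume "(s, x) \<in> Om"
    then show "((\<lambda>t. f_comb \<alpha> (t, x)) has_real_derivative (\<Sum>b\<in>UNIV. \<alpha> b * fs b (s, x))) (at s)"
      unfolding f_comb_def by (auto intro!: derivative_eq_intros d_f simp: mult.commute)
  qed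
  have dx: "((\<lambda>y. u_cut k \<alpha> (s, y)) has_derivative (\<lambda>h. \<Sum>i\<in>UNIV. h $ i * ux_cut k \<alpha> i (s, x))) (at x)" if x: "x \<noteq> 0" for s x
    unfolding u_cut_def ux_cut_def
  proof (rule dx_cut[OF smooth_cut_cut_fun x])
    assume "(s, x) \<in> Om"
    note D = dx_f[OF this]
    show "((\<lambda>y. f_comb \<alpha> (s, y)) has_derivative (\<lambda>e. \<Sum>j\<in>UNIV. e $ j * (\<Sum>b\<in>UNIV. \<alpha> b * fx b j (s, x)))) (at x)"
    proof -
      have eq: "(\<lambda>y. f_comb \<alpha> (s, y)) = (\<lambda>y. \<alpha> False * f False (s, y) + \<alpha> True * f True (s, y))"
        by (simp add: f_comb_def UNIV_bool fun_eq_iff)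
      show ?thesis
        unfolding eq
        by (rule has_derivative_eq_rhs[OF has_derivative_add[OF has_derivative_mult_right[OF D, of "\<alpha> False" False]
              has_derivative_mult_right[OF D, of "\<alpha> True" True]]])
           (simp add: fun_eq_iff UNIV_bool sum_distrib_left sum.distrib[symmetric] algebra_simps)
    qed
  qed
  have "0 \<le> (\<integral>s. \<integral>x. energy (u_cut k \<alpha>) (us_cut k \<alpha>) (ux_cut k \<alpha>) (s, x) \<partial>sphere_measure \<partial>lborel)"
    by (rule energy_integral_nonneg[OF cyl_cut ds dx u_cut_hom assms])
  then show ?thesis using cyl_cont_Fubini(2)[OF en] by simp
qed

text \<open>\<open>w\<close> has at most one zero, so this is one linear equation for two
  coefficients.\<close>

lemma exists_mean_zero: "\<exists>\<alpha>. (\<alpha> True \<noteq> 0 \<or> \<alpha> False \<noteq> 0) \<and> (\<forall>s. w s = 0 \<longrightarrow> (\<integral>x. u_cut k \<alpha> (s, x) \<partial>sphere_measure) = 0)"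
proof (cases "\<exists>s. w s = 0")
  case True
  then obtain s0 where s0: "w s0 = 0" by blast
  have uniq: "s = s0" if "w s = 0" for s
    using that s0 w_less[of s s0] w_less[of s0 s] by (cases s s0 rule: linorder_cases) auto
  define l where "l = (\<lambda>b. \<integral>x. cut_fun k (\<rho> (s0, x)) * f b (s0, x) \<partial>sphere_measure)"
  have i: "integrable sphere_measure (\<lambda>x. cut_fun k (\<rho> (s0, x)) * f b (s0, x))" for b
    by (rule cyl_cont_integrable_slice[OF cutk(1)[OF cont_on_Om[OF f_cyl]]])
  have m: "(\<integral>x. u_cut k \<alpha> (s0, x) \<partial>sphere_measure) = \<alpha> False * l False + \<alpha> True * l True" for \<alpha>
  proof -
    have "(\<integral>x. u_cut k \<alpha> (s0, x) \<partial>sphere_measure)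
      = (\<integral>x. \<alpha> False * (cut_fun k (\<rho> (s0, x)) * f False (s0, x)) + \<alpha> True * (cut_fun k (\<rho> (s0, x)) * f True (s0, x)) \<partial>sphere_measure)"
      by (simp add: u_cut_def f_comb_def UNIV_bool algebra_simps)
    also have "\<dots> = \<alpha> False * l False + \<alpha> True * l True" using i by (simp add: l_def)
    finally show ?thesis .
  qed
  \<comment> \<open>The kernel vector of the linear form with coefficients \<open>l\<close>; if both
    of these vanish, any nonzero vector will do.\<close>
  define \<alpha> where "\<alpha> = (if l True = 0 \<and> l False = 0 then (\<lambda>b. 1) else (\<lambda>b. if b then l False else - l True))"
  have "\<alpha> True \<noteq> 0 \<or> \<alpha> False \<noteq> 0" by (auto simp: \<alpha>_def)
  moreover have "\<alpha> False * l False + \<alpha> True * l True = 0" by (auto simp: \<alpha>_def)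
  ultimately show ?thesis using m[of \<alpha>] uniq by metis
next
  case False
  then show ?thesis by (intro exI[of _ "\<lambda>_. 1"]) auto
qed

text \<open>Subtract the weak form of one equation tested with the other function from the reverse
  one. The symmetric parts cancel; what is left is 4 times the cut-off times four terms with its
  derivative, hence at most 16 \<open>err k\<close>, and this tends to zero.\<close>

lemma N_orthogonal: "lam True \<noteq> lam False \<Longrightarrow> N True False = 0"
proof -
  assume ne: "lam True \<noteq> lam False"
  have sym: "Nk k False True = Nk k True False" for k unfolding Nk_def by (simp add: mult.commute[of "f False _"])
  have bound: "\<bar>(lam True - lam False) * Nk k True False\<bar> \<le> 16 * err k" for k
  proof -
    have eq: "(lam True - lam False) * Nk k True False = (\<integral>p. X_form k False True p - X_form k True False p \<partial>cylM)"
      using cyl_cont_integrable[OF cyl_X_form] by (simp add: integral_X_form sym algebra_simps)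
    have "\<bar>\<integral>p. X_form k False True p - X_form k True False p \<partial>cylM\<bar> \<le> (\<integral>p. \<bar>X_form k False True p - X_form k True False p\<bar> \<partial>cylM)"
      by (rule integral_abs_bound)
    also have "\<dots> \<le> (\<integral>p. 16 * ((\<rho> p * cut_der k (\<rho> p)) * T0 p) \<partial>cylM)"
    proof (rule integral_mono)
      fix p
      define W where "W = (\<rho> p * cut_der k (\<rho> p)) * T0 p"
      define Y where "Y = (\<lambda>a c d e. cut_der k (\<rho> p) * (f a p * f c p * G d e p))"
      have Y: "\<bar>Y a c d e\<bar> \<le> W" for a c d e unfolding Y_def W_def by (rule ffG_cut_le)
      have W0: "W \<ge> 0" unfolding W_def using cut_fun_bounds(3) \<rho>_nonneg T0_nonneg by simp
      have eqX: "X_form k False True p - X_form k True False p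
        = 4 * cut_fun k (\<rho> p) * ((Y False False False True + Y False True True True) - (Y True False False False + Y True True True False))"
      proof -
        have ident: "x\<^sup>2 * (g - h * (f1 * f2)) + 2 * x * c * (2 * r1 + 2 * r2) - (x\<^sup>2 * (g - h * (f2 * f1)) + 2 * x * c * (2 * r3 + 2 * r4))
          = 4 * x * ((c * r1 + c * r2) - (c * r3 + c * r4))" for x g h f1 f2 c r1 r2 r3 r4 :: real
          by (simp add: algebra_simps)
        have two: "2 * (\<Sum>c\<in>UNIV. h c) = 2 * h False + 2 * h True" for h :: "bool \<Rightarrow> real"
          by (simp add: UNIV_bool)
        show ?thesis unfolding X_form_def Y_def G_sym[of True False] two by (rule ident)
      qed
      have "\<bar>X_form k False True p - X_form k True False p\<bar> = 4 * cut_fun k (\<rho> p) * \<bar>(Y False False False True + Y False True True True) - (Y True False False False + Y True True True False)\<bar>"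
        unfolding eqX using cut_fun_bounds(1)[of k "\<rho> p"] by (simp add: abs_mult)
      also have "\<dots> \<le> 4 * 1 * (4 * W)"
        using cut_fun_bounds[of k "\<rho> p"] Y[of False False False True] Y[of False True True True] Y[of True False False False] Y[of True True True False] W0
        by (intro mult_mono) auto
      finally show "\<bar>X_form k False True p - X_form k True False p\<bar> \<le> 16 * ((\<rho> p * cut_der k (\<rho> p)) * T0 p)"
        by (simp add: W_def)
    qed (use cyl_cont_integrable[OF cyl_X_form] integrable_error in auto)
    also have "\<dots> = 16 * err k" by (simp add: err_def)
    finally show ?thesis unfolding eq .
  qed
  have "(\<lambda>k. 16 * err k) \<longlonglongrightarrow> 16 * 0" by (rule tendsto_mult_left[OF err_tendsto_0])
  then have z: "(\<lambda>k. 16 * err k) \<longlonglongrightarrow> 0" by simp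
  have "(\<lambda>k. (lam True - lam False) * Nk k True False) \<longlonglongrightarrow> 0"
  proof (rule Lim_null_comparison[OF _ z])
    show "eventually (\<lambda>k. norm ((lam True - lam False) * Nk k True False) \<le> 16 * err k) sequentially"
      using bound unfolding real_norm_def by (intro always_eventually allI)
  qed
  moreover have "(\<lambda>k. (lam True - lam False) * Nk k True False) \<longlonglongrightarrow> (lam True - lam False) * N True False"
    by (rule tendsto_mult_left[OF Nk_tendsto])
  ultimately have "(lam True - lam False) * N True False = 0" using LIMSEQ_unique by blast
  then show ?thesis using ne by simp
qed

text \<open>If the functions were independent, their Gram matrix \<open>N\<close> would be positive
  definite. The matrix that bounds the energy on the truncated span converges to the one with
  diagonal \<open>lam b * N b b\<close> and off-diagonal entry
  \<open>(lam True + lam False) / 2 * N True False\<close>. It is negative definite: for equal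
  eigenvalues it is a negative multiple of \<open>N\<close>, otherwise it is diagonal by
  \<open>N_orthogonal\<close>. For some k the energy is thus negative on all nonzero combinations,
  against \<open>exists_mean_zero\<close> and \<open>energy_cut_nonneg\<close>.\<close>

theorem linearly_dependent: "\<exists>\<alpha>. (\<alpha> True \<noteq> 0 \<or> \<alpha> False \<noteq> 0) \<and> (\<forall>p. \<alpha> True * f True p + \<alpha> False * f False p = 0)"
proof (rule ccontr)
  assume neg: "\<not> ?thesis"
  have Npos: "a\<^sup>2 * N True True + 2 * a * b * N True False + b\<^sup>2 * N False False > 0" if ab: "a \<noteq> 0 \<or> b \<noteq> 0" for a b
  proof -
    obtain s x where sx: "a * f True (s, x) + b * f False (s, x) \<noteq> 0"
      using neg ab by (auto dest!: spec[of _ "\<lambda>c. if c then a else b"])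
    define h where "h = (\<lambda>p. E (fst p) * P (fst p) * (a * f True p + b * f False p)\<^sup>2)"
    have h: "cyl_cont S h"
      unfolding h_def
      by (intro cyl_cont_cmult[OF cont_coeff(4)] cyl_cont_power2 cyl_cont_add
          cyl_cont_cmult[OF continuous_on_const, simplified] f_cyl)
    have "0 < (\<integral>p. h p \<partial>cylM)"
    proof (rule cyl_cont_integral_pos[OF h])
      show "0 \<le> h p" for p using E_pos[of "fst p"] P_pos[of "fst p"] by (simp add: h_def)
      show "h (s, c *\<^sub>R x) = h (s, x)" if "c > 0" for s c x using that by (simp add: h_def f_hom)
      show "h (s, x) > 0" using E_pos[of s] P_pos[of s] sx by (simp add: h_def)
    qed
    also have "(\<integral>p. h p \<partial>cylM) = (\<integral>p. (a\<^sup>2 * (E (fst p) * P (fst p) * (f True p * f True p))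
        + 2 * a * b * (E (fst p) * P (fst p) * (f True p * f False p))) + b\<^sup>2 * (E (fst p) * P (fst p) * (f False p * f False p)) \<partial>cylM)"
      by (rule arg_cong[where f="integral\<^sup>L cylM"]) (simp add: fun_eq_iff h_def power2_eq_square algebra_simps)
    also have "\<dots> = a\<^sup>2 * N True True + 2 * a * b * N True False + b\<^sup>2 * N False False"
      using cyl_cont_integrable[OF cyl_N] unfolding N_def by simp
    finally show ?thesis .
  qed
  have N11: "N True True > 0" using Npos[of 1 0] by simp
  have N22: "N False False > 0" using Npos[of 0 1] by simp
  have det: "N True True * N False False > (N True False)\<^sup>2"
  proof -
    \<comment> \<open>On the vector (N True False, - N True True) the Gram form takes the value N
      True True times the determinant.\<close>
    have "0 < N True True * (N True True * N False False - (N True False)\<^sup>2)"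
      using Npos[of "N True False" "- N True True"] N11 by (simp add: power2_eq_square algebra_simps)
    then show ?thesis using N11 by (simp add: zero_less_mult_iff)
  qed
  \<comment> \<open>Coefficients of the upper bound for the energy: the off-diagonal term is
    symmetrised, and the truncation error is added to the diagonal.\<close>
  define A B C where "A = (\<lambda>k. lam True * Nk k True True + 48 * err k)"
    and "B = (\<lambda>k. (lam True + lam False) / 2 * Nk k True False)"
    and "C = (\<lambda>k. lam False * Nk k False False + 48 * err k)"
  have lA: "A \<longlonglongrightarrow> lam True * N True True + 48 * 0" unfolding A_def by (rule tendsto_add[OF tendsto_mult_left[OF Nk_tendsto] tendsto_mult_left[OF err_tendsto_0]])
  have lB: "B \<longlonglongrightarrow> (lam True + lam False) / 2 * N True False" unfolding B_def by (rule tendsto_mult_left[OF Nk_tendsto])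
  have lC: "C \<longlonglongrightarrow> lam False * N False False + 48 * 0" unfolding C_def by (rule tendsto_add[OF tendsto_mult_left[OF Nk_tendsto] tendsto_mult_left[OF err_tendsto_0]])
  have lD: "(\<lambda>k. A k * C k - (B k)\<^sup>2) \<longlonglongrightarrow>
      (lam True * N True True + 48 * 0) * (lam False * N False False + 48 * 0) - ((lam True + lam False) / 2 * N True False)\<^sup>2"
    by (rule tendsto_diff[OF tendsto_mult[OF lA lC] tendsto_power[OF lB]])
  have "((lam True + lam False) / 2 * N True False)\<^sup>2 \<le> lam True * lam False * (N True False)\<^sup>2"
  proof (cases "lam True = lam False")
    case True
    then show ?thesis by (simp add: power2_eq_square)
  next
    case False
    then show ?thesis by (simp add: N_orthogonal)
  qed
  also have "\<dots> < lam True * lam False * (N True True * N False False)"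
    using lam_neg[of True] lam_neg[of False] det by (intro mult_strict_left_mono mult_neg_neg) auto
  finally have "0 < (lam True * N True True + 48 * 0) * (lam False * N False False + 48 * 0) - ((lam True + lam False) / 2 * N True False)\<^sup>2"
    by (simp add: mult_ac)
  with lD have eD: "eventually (\<lambda>k. 0 < A k * C k - (B k)\<^sup>2) sequentially" by (rule order_tendstoD)
  have "lam True * N True True + 48 * 0 < 0" using lam_neg[of True] N11 by (simp add: mult_neg_pos)
  with lA have eA: "eventually (\<lambda>k. A k < 0) sequentially" by (rule order_tendstoD)
  from eventually_conj[OF eA eD] obtain k where k: "A k < 0" "0 < A k * C k - (B k)\<^sup>2"
    by (auto simp: eventually_sequentially)
  obtain \<alpha> where \<alpha>: "\<alpha> True \<noteq> 0 \<or> \<alpha> False \<noteq> 0" "\<And>s. w s = 0 \<Longrightarrow> (\<integral>x. u_cut k \<alpha> (s, x) \<partial>sphere_measure) = 0"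
    using exists_mean_zero[of k] by blast
  have sym: "Nk k False True = Nk k True False" unfolding Nk_def by (simp add: mult.commute[of "f False _"])
  have "0 \<le> (\<Sum>a\<in>UNIV. \<Sum>b\<in>UNIV. \<alpha> a * \<alpha> b * (lam b * Nk k a b)) + 48 * ((\<alpha> True)\<^sup>2 + (\<alpha> False)\<^sup>2) * err k"
    using energy_cut_nonneg[OF \<alpha>(2)] energy_integral_le[of k \<alpha>] by linarith
  also have "\<dots> = A k * (\<alpha> True)\<^sup>2 + 2 * B k * \<alpha> True * \<alpha> False + C k * (\<alpha> False)\<^sup>2"
    by (simp add: A_def B_def C_def UNIV_bool sym power2_eq_square algebra_simps add_divide_distrib)
  also have "\<dots> < 0" using k \<alpha>(1) by (intro negative_definite_2x2) auto
  finally show False by simp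
qed

end

section \<open>Calculus of functions of class C^k\<close>

lemma frechet_derivative_cong_open:
  assumes "open U" "x \<in> U" "\<And>y. y \<in> U \<Longrightarrow> f y = g y"
  shows "frechet_derivative f (at x) = frechet_derivative g (at x)"
    and "f differentiable (at x) \<longleftrightarrow> g differentiable (at x)"
proof -
  have "(f has_derivative D) (at x) \<longleftrightarrow> (g has_derivative D) (at x)" for D
    using has_derivative_transform_within_open[of f D x UNIV U g] has_derivative_transform_within_open[of g D x UNIV U f] assms
    by auto
  then show "frechet_derivative f (at x) = frechet_derivative g (at x)" "f differentiable (at x) \<longleftrightarrow> g differentiable (at x)"
    by (auto simp: frechet_derivative_def differentiable_def)
qed

lemma C_k_on_cong:
  assumes "open U" "\<And>x. x \<in> U \<Longrightarrow> f x = g x"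
  shows "C_k_on k U f \<longleftrightarrow> C_k_on k U g"
  using assms(2)
proof (induction k arbitrary: f g)
  case 0
  then show ?case by (simp cong: continuous_on_cong)
next
  case (Suc k)
  have "C_k_on k U (\<lambda>x. frechet_derivative f (at x) v) \<longleftrightarrow> C_k_on k U (\<lambda>x. frechet_derivative g (at x) v)" for v
    by (rule Suc.IH) (simp add: frechet_derivative_cong_open(1)[OF \<open>open U\<close> _ Suc.prems])
  moreover have "\<And>x. x \<in> U \<Longrightarrow> f differentiable (at x) \<longleftrightarrow> g differentiable (at x)"
    by (rule frechet_derivative_cong_open(2)[OF \<open>open U\<close> _ Suc.prems])
  ultimately show ?case by auto
qed

text \<open>Lets the inductions below work with an explicit derivative on U in place of
  \<open>frechet_derivative\<close>.\<close>

lemma C_k_on_SucI: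
  assumes U: "open U" and D: "\<And>x. x \<in> U \<Longrightarrow> (f has_derivative D x) (at x)" and C: "\<And>v. C_k_on k U (\<lambda>x. D x v)"
  shows "C_k_on (Suc k) U f"
proof -
  have "C_k_on k U (\<lambda>x. frechet_derivative f (at x) v)" for v
  proof (rule C_k_on_cong[OF U, THEN iffD2, OF _ C])
    show "frechet_derivative f (at x) v = D x v" if "x \<in> U" for x
      using frechet_derivative_at[OF D[OF that]] by simp
  qed
  moreover have "\<forall>x\<in>U. f differentiable (at x)" using D by (blast intro: differentiableI)
  ultimately show ?thesis by simp
qed

lemma C_k_on_SucD': "C_k_on (Suc k) U f \<Longrightarrow> x \<in> U \<Longrightarrow> (f has_derivative frechet_derivative f (at x)) (at x)"
  "C_k_on (Suc k) U f \<Longrightarrow> C_k_on k U (\<lambda>x. frechet_derivative f (at x) v)"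
  by (auto simp: frechet_derivative_works)

lemma C_k_on_subset: "C_k_on k U f \<Longrightarrow> V \<subseteq> U \<Longrightarrow> C_k_on k V f"
  by (induction k arbitrary: f) (auto intro: continuous_on_subset)

lemma C_k_on_SucD: "C_k_on (Suc k) U f \<Longrightarrow> C_k_on k U f"
proof (induction k arbitrary: f)
  case 0
  then show ?case by (auto intro!: continuous_at_imp_continuous_on differentiable_imp_continuous_within)
next
  case (Suc k)
  then show ?case by (metis C_k_on.simps(2))
qed

lemma C_k_on_local:
  assumes "\<And>x. x \<in> U \<Longrightarrow> \<exists>W. open W \<and> x \<in> W \<and> C_k_on k W f"
  shows "C_k_on k U f"
  using assms
proof (induction k arbitrary: f)
  case 0
  show ?case
  proof (simp, rule continuous_at_imp_continuous_on, rule ballI)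
    fix x assume "x \<in> U"
    from 0[OF this] show "isCont f x" by (auto simp: continuous_on_eq_continuous_at)
  qed
next
  case (Suc k)
  show ?case
  proof (simp, intro conjI ballI allI)
    fix x assume "x \<in> U"
    from Suc.prems[OF this] show "f differentiable (at x)" by auto
  next
    fix v
    show "C_k_on k U (\<lambda>x. frechet_derivative f (at x) v)"
      by (rule Suc.IH) (use Suc.prems in fastforce)
  qed
qed

lemma C_k_on_const: "C_k_on k U (\<lambda>_. c)"
  by (induction k arbitrary: c) (auto simp: frechet_derivative_const)

lemma C_k_on_bounded_linear: "bounded_linear L \<Longrightarrow> C_k_on k U L"
proof (cases k)
  case (Suc m)
  assume L: "bounded_linear L"
  have "frechet_derivative L (at x) = L" for x
    using frechet_derivative_at[OF bounded_linear_imp_has_derivative[OF L]] by simp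
  then show ?thesis
    using L by (auto simp: Suc C_k_on_const bounded_linear_imp_differentiable)
qed (auto intro: linear_continuous_on)

lemma C_k_on_add:
  assumes U: "open U"
  shows "C_k_on k U f \<Longrightarrow> C_k_on k U g \<Longrightarrow> C_k_on k U (\<lambda>x. f x + g x)"
proof (induction k arbitrary: f g)
  case (Suc k)
  note D = C_k_on_SucD'[OF Suc.prems(1)] C_k_on_SucD'[OF Suc.prems(2)]
  show ?case
  proof (rule C_k_on_SucI[OF U])
    show "((\<lambda>x. f x + g x) has_derivative (\<lambda>v. frechet_derivative f (at x) v + frechet_derivative g (at x) v)) (at x)" if "x \<in> U" for x
      by (rule has_derivative_add[OF D(1)[OF that] D(3)[OF that]])
    show "C_k_on k U (\<lambda>x. frechet_derivative f (at x) v + frechet_derivative g (at x) v)" for v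
      by (rule Suc.IH[OF D(2) D(4)])
  qed
qed (auto intro: continuous_intros)

lemma C_k_on_sum: "finite I \<Longrightarrow> open U \<Longrightarrow> (\<And>i. i \<in> I \<Longrightarrow> C_k_on k U (f i)) \<Longrightarrow> C_k_on k U (\<lambda>x. \<Sum>i\<in>I. f i x)"
  by (induction I rule: finite_induct) (simp_all add: C_k_on_const C_k_on_add)

lemma C_k_on_bilinear:
  assumes B: "bounded_bilinear B" and U: "open U"
  shows "C_k_on k U f \<Longrightarrow> C_k_on k U g \<Longrightarrow> C_k_on k U (\<lambda>x. B (f x) (g x))"
proof (induction k arbitrary: f g)
  case 0
  then show ?case using bounded_bilinear.continuous_on[OF B] by auto
next
  case (Suc k)
  note D = C_k_on_SucD'[OF Suc.prems(1)] C_k_on_SucD'[OF Suc.prems(2)]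
  show ?case
  proof (rule C_k_on_SucI[OF U])
    show "((\<lambda>x. B (f x) (g x)) has_derivative
      (\<lambda>v. B (f x) (frechet_derivative g (at x) v) + B (frechet_derivative f (at x) v) (g x))) (at x)" if "x \<in> U" for x
      by (rule bounded_bilinear.FDERIV[OF B D(1)[OF that] D(3)[OF that]])
    show "C_k_on k U (\<lambda>x. B (f x) (frechet_derivative g (at x) v) + B (frechet_derivative f (at x) v) (g x))" for v
      by (rule C_k_on_add[OF U Suc.IH[OF C_k_on_SucD[OF Suc.prems(1)] D(4)] Suc.IH[OF D(2) C_k_on_SucD[OF Suc.prems(2)]]])
  qed
qed

text \<open>The derivative of h at p x in a varying direction is expanded in the standard basis, so
  that the chain rule becomes a sum of products of functions of one class less; the induction then
  varies h and keeps p.\<close>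

lemma C_k_on_compose:
  fixes p :: "'a::euclidean_space \<Rightarrow> 'b::euclidean_space" and h :: "'b \<Rightarrow> 'c::euclidean_space"
  assumes V: "open V" and U: "open U" and map: "\<And>x. x \<in> U \<Longrightarrow> p x \<in> V"
  shows "C_k_on k V h \<Longrightarrow> C_k_on k U p \<Longrightarrow> C_k_on k U (\<lambda>x. h (p x))"
proof (induction k arbitrary: h)
  case 0
  have "continuous_on U (\<lambda>x. h (p x))"
    by (rule continuous_on_compose2[of V h]) (use 0 map in auto)
  then show ?case by simp
next
  case (Suc k)
  note D = C_k_on_SucD'[OF Suc.prems(1)] C_k_on_SucD'[OF Suc.prems(2)]
  show ?case
  proof (rule C_k_on_SucI[OF U])
    show "((\<lambda>x. h (p x)) has_derivative (\<lambda>v. \<Sum>b\<in>Basis. (frechet_derivative p (at x) v \<bullet> b) *\<^sub>R frechet_derivative h (at (p x)) b)) (at x)"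
      if "x \<in> U" for x
    proof (rule has_derivative_eq_rhs[OF diff_chain_at[unfolded o_def, OF D(3)[OF that] D(1)[OF map[OF that]]]], rule ext)
      fix v
      have "linear (frechet_derivative h (at (p x)))" by (rule has_derivative_linear[OF D(1)[OF map[OF that]]])
      then have "frechet_derivative h (at (p x)) (\<Sum>b\<in>Basis. (w \<bullet> b) *\<^sub>R b) = (\<Sum>b\<in>Basis. (w \<bullet> b) *\<^sub>R frechet_derivative h (at (p x)) b)" for w
        by (simp add: linear_sum linear_cmul)
      then show "frechet_derivative h (at (p x)) (frechet_derivative p (at x) v)
         = (\<Sum>b\<in>Basis. (frechet_derivative p (at x) v \<bullet> b) *\<^sub>R frechet_derivative h (at (p x)) b)"
        unfolding euclidean_representation .
    qed
    fix v
    show "C_k_on k U (\<lambda>x. \<Sum>b\<in>Basis. (frechet_derivative p (at x) v \<bullet> b) *\<^sub>R frechet_derivative h (at (p x)) b)"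
    proof (rule C_k_on_sum[OF finite_Basis U], rule C_k_on_bilinear[OF bounded_bilinear_scaleR U])
      fix b :: 'b
      show "C_k_on k U (\<lambda>x. frechet_derivative p (at x) v \<bullet> b)"
        by (rule C_k_on_bilinear[OF bounded_bilinear_inner U D(4) C_k_on_const])
      show "C_k_on k U (\<lambda>x. frechet_derivative h (at (p x)) b)"
        by (rule Suc.IH[OF D(2) C_k_on_SucD[OF Suc.prems(2)]])
    qed
  qed
qed

lemma C_k_on_linear_compose:
  assumes "bounded_linear L" "open U" "C_k_on k U f"
  shows "C_k_on k U (\<lambda>x. L (f x))"
  by (rule C_k_on_compose[OF open_UNIV assms(2) _ C_k_on_bounded_linear[OF assms(1)] assms(3)]) simp

lemma C_k_on_Pair:
  fixes f :: "'a::euclidean_space \<Rightarrow> 'b::euclidean_space" and g :: "'a \<Rightarrow> 'c::euclidean_space"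
  assumes "open U" "C_k_on k U f" "C_k_on k U g"
  shows "C_k_on k U (\<lambda>x. (f x, g x))"
proof -
  have L: "bounded_linear (\<lambda>x :: 'b. (x, 0 :: 'c))" "bounded_linear (\<lambda>x :: 'c. (0 :: 'b, x))"
    by (rule bounded_linear_Pair[OF bounded_linear_ident bounded_linear_zero],
        rule bounded_linear_Pair[OF bounded_linear_zero bounded_linear_ident])
  have "C_k_on k U (\<lambda>x. (f x, 0) + (0, g x))"
    by (rule C_k_on_add[OF assms(1) C_k_on_linear_compose[OF L(1) assms(1,2)] C_k_on_linear_compose[OF L(2) assms(1,3)]])
  then show ?thesis by simp
qed

lemma C_k_on_inverse:
  fixes f :: "'a::euclidean_space \<Rightarrow> real"
  assumes U: "open U" and nz: "\<And>x. x \<in> U \<Longrightarrow> f x \<noteq> 0"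
  shows "C_k_on k U f \<Longrightarrow> C_k_on k U (\<lambda>x. inverse (f x))"
proof (induction k)
  case 0
  then show ?case using nz by (auto intro!: continuous_intros)
next
  case (Suc k)
  note D = C_k_on_SucD'[OF Suc.prems]
  note IH = Suc.IH[OF C_k_on_SucD[OF Suc.prems]]
  show ?case
  proof (rule C_k_on_SucI[OF U])
    show "((\<lambda>x. inverse (f x)) has_derivative (\<lambda>v. (-1) * ((inverse (f x) * frechet_derivative f (at x) v) * inverse (f x)))) (at x)" if "x \<in> U" for x
      using Deriv.has_derivative_inverse[OF nz[OF that] D(1)[OF that]] by simp
    show "C_k_on k U (\<lambda>x. (-1) * ((inverse (f x) * frechet_derivative f (at x) v) * inverse (f x)))" for v
      by (intro C_k_on_bilinear[OF bounded_bilinear_mult U] C_k_on_const IH D(2))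
  qed
qed

lemma C_k_on_sqrt:
  fixes f :: "'a::euclidean_space \<Rightarrow> real"
  assumes U: "open U" and pos: "\<And>x. x \<in> U \<Longrightarrow> f x > 0"
  shows "C_k_on k U f \<Longrightarrow> C_k_on k U (\<lambda>x. sqrt (f x))"
proof (induction k)
  case 0
  then show ?case by (auto intro!: continuous_intros)
next
  case (Suc k)
  note D = C_k_on_SucD'[OF Suc.prems]
  have "sqrt (f x) \<noteq> 0" if "x \<in> U" for x using pos[OF that] by simp
  note IH = C_k_on_inverse[OF U this Suc.IH[OF C_k_on_SucD[OF Suc.prems]]]
  show ?case
  proof (rule C_k_on_SucI[OF U])
    show "((\<lambda>x. sqrt (f x)) has_derivative (\<lambda>v. (1/2) * (inverse (sqrt (f x)) * frechet_derivative f (at x) v))) (at x)" if "x \<in> U" for x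
    proof -
      have "(sqrt has_derivative (\<lambda>t. (1/2) * (inverse (sqrt (f x)) * t))) (at (f x))"
        using DERIV_real_sqrt[OF pos[OF that]] unfolding has_field_derivative_def
        by (rule has_derivative_eq_rhs) (simp add: fun_eq_iff)
      from diff_chain_at[OF D(1)[OF that] this] show ?thesis by (simp add: o_def)
    qed
    show "C_k_on k U (\<lambda>x. (1/2) * (inverse (sqrt (f x)) * frechet_derivative f (at x) v))" for v
      by (intro C_k_on_bilinear[OF bounded_bilinear_mult U] C_k_on_const IH D(2))
  qed
qed

lemma C_k_on_sgn:
  assumes U: "open U" "\<And>x. x \<in> U \<Longrightarrow> f x \<noteq> 0" "C_k_on k U f"
  shows "C_k_on k U (\<lambda>x. sgn (f x))"
proof -
  have pos: "f x \<bullet> f x > 0" if "x \<in> U" for x using U(2)[OF that] by simp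
  have nz: "sqrt (f x \<bullet> f x) \<noteq> 0" if "x \<in> U" for x using pos[OF that] by simp
  have "C_k_on k U (\<lambda>x. inverse (sqrt (f x \<bullet> f x)) *\<^sub>R f x)"
    by (rule C_k_on_bilinear[OF bounded_bilinear_scaleR U(1) C_k_on_inverse[OF U(1) nz
          C_k_on_sqrt[OF U(1) pos C_k_on_bilinear[OF bounded_bilinear_inner U(1) U(3) U(3)]]] U(3)])
  then show ?thesis by (simp add: sgn_div_norm norm_eq_sqrt_inner)
qed

section \<open>Stereographic charts of the cylinder\<close>

text \<open>Inverse stereographic projection from \<open>- R e\<^sub>k\<close>, scaled to be isometric to first order at the centre.
  The \<open>k\<close>-th chart coordinate is the parameter of the generating curve.\<close>

lemma inner_diff_scaleR_expand:
  fixes A A' m :: "'a::real_inner"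
  shows "(a *\<^sub>R A - b *\<^sub>R m) \<bullet> (a' *\<^sub>R A' - b' *\<^sub>R m)
      = a * a' * (A \<bullet> A') - a * b' * (A \<bullet> m) - b * a' * (A' \<bullet> m) + b * b' * (m \<bullet> m)"
    and "(a *\<^sub>R m) \<bullet> (a' *\<^sub>R A' - b' *\<^sub>R m) = a * a' * (A' \<bullet> m) - a * b' * (m \<bullet> m)"
  by (simp_all add: inner_diff_left inner_diff_right inner_commute[of m A'] algebra_simps)

locale stereographic =
  fixes k :: "'n::finite" and R :: "real^'n \<Rightarrow> real^'n"
  assumes R: "orthogonal_transformation R"
begin

definition e :: "real^'n" where "e = axis k 1"
definition drp :: "real^'n \<Rightarrow> real^'n" where "drp u = u - (u \<bullet> e) *\<^sub>R e"
definition q :: "real^'n \<Rightarrow> real" where "q u = (drp u \<bullet> drp u) / 4"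
definition m :: "real^'n \<Rightarrow> real^'n" where "m u = (1 - q u) *\<^sub>R e + drp u"
definition sph :: "real^'n \<Rightarrow> real^'n" where "sph u = R (inverse (1 + q u) *\<^sub>R m u)"
definition Y :: "real^'n \<Rightarrow> real \<times> (real^'n)" where "Y u = (u \<bullet> e, sph u)"
definition R' :: "real^'n \<Rightarrow> real^'n" where "R' = inv R"
text \<open>A left inverse of \<open>Y\<close> that is smooth on the open set \<open>W\<close> of
  the ambient space, not only on the cylinder. On the cylinder, \<open>W\<close> excludes just the
  points whose sphere component is the projection centre.\<close>

definition Z :: "real \<times> (real^'n) \<Rightarrow> real^'n" where
  "Z p = fst p *\<^sub>R e + (2 * inverse (1 + R' (snd p) \<bullet> e)) *\<^sub>R drp (R' (snd p))"
definition W :: "(real \<times> (real^'n)) set" where "W = {p. 1 + R' (snd p) \<bullet> e > 0}"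

lemma R'_R [simp]: "R' (R x) = x" and R_R' [simp]: "R (R' x) = x"
  unfolding R'_def using orthogonal_transformation_inj[OF R] orthogonal_transformation_surj[OF R]
  by (simp_all add: inv_f_f surj_f_inv_f)

lemma R'_orth: "orthogonal_transformation R'"
  unfolding R'_def by (rule orthogonal_transformation_inv[OF R])

lemma blR: "bounded_linear R" and blR': "bounded_linear R'"
  using orthogonal_transformation_linear[OF R] orthogonal_transformation_linear[OF R'_orth]
  by (simp_all add: linear_conv_bounded_linear)

lemma R_inner [simp]: "R a \<bullet> R b = a \<bullet> b" and R'_inner [simp]: "R' a \<bullet> R' b = a \<bullet> b"
  using R R'_orth by (simp_all add: orthogonal_transformation_def)

lemma R_add: "R (a + b) = R a + R b" and R_scaleR: "R (c *\<^sub>R a) = c *\<^sub>R R a" and R_zero [simp]: "R 0 = 0"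
  using orthogonal_transformation_linear[OF R] by (simp_all add: linear_add linear_cmul linear_0)

lemma R'_scaleR: "R' (c *\<^sub>R a) = c *\<^sub>R R' a"
  using orthogonal_transformation_linear[OF R'_orth] by (simp add: linear_cmul)

lemma e_e [simp]: "e \<bullet> e = 1" by (simp add: e_def inner_axis_axis)

lemma drp_e [simp]: "drp u \<bullet> e = 0" "e \<bullet> drp u = 0" by (simp_all add: drp_def inner_diff inner_commute)

lemma bl_drp: "bounded_linear drp"
  unfolding drp_def by (intro bounded_linear_intros)

lemma drp_add: "drp (a + b) = drp a + drp b" and drp_scaleR: "drp (c *\<^sub>R a) = c *\<^sub>R drp a"
  by (simp_all add: drp_def inner_add algebra_simps)

lemma drp_e0 [simp]: "drp e = 0" by (simp add: drp_def)
lemma drp_drp [simp]: "drp (drp u) = drp u" by (simp add: drp_def inner_diff)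

lemma drp_axis: "i \<noteq> k \<Longrightarrow> drp (axis i 1) = axis i 1"
  by (simp add: drp_def e_def inner_axis_axis)

lemma q_nonneg: "q u \<ge> 0" by (simp add: q_def)
lemma q1 [simp]: "1 + q u \<noteq> 0" using q_nonneg[of u] by linarith
lemma drp_sq: "drp u \<bullet> drp u = 4 * q u" by (simp add: q_def)

lemma m_m: "m u \<bullet> m u = (1 + q u)\<^sup>2"
  by (simp add: m_def inner_add drp_sq power2_eq_square algebra_simps)

lemma sph_sph: "sph u \<bullet> sph u = 1"
proof -
  have "inverse M * (inverse M * M\<^sup>2) = 1" if "M \<noteq> 0" for M :: real
    using that by (simp add: power2_eq_square field_simps)
  from this[OF q1] show ?thesis unfolding sph_def R_inner inner_scaleR_left inner_scaleR_right m_m .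
qed

lemma norm_sph: "norm (sph u) = 1" by (simp add: norm_eq_sqrt_inner sph_sph)

definition dq :: "real^'n \<Rightarrow> real^'n \<Rightarrow> real" where "dq u h = (drp u \<bullet> drp h) / 2"
definition dsph :: "real^'n \<Rightarrow> real^'n \<Rightarrow> real^'n" where
  "dsph u h = R (inverse (1 + q u) *\<^sub>R (drp h - dq u h *\<^sub>R e) - (dq u h * inverse (1 + q u) * inverse (1 + q u)) *\<^sub>R m u)"

lemma drp_has_derivative: "(drp has_derivative drp) (at u)"
  by (rule bounded_linear_imp_has_derivative[OF bl_drp])

lemma q_has_derivative: "(q has_derivative dq u) (at u)"
  unfolding q_def[abs_def] dq_def[abs_def]
  by (rule has_derivative_eq_rhs, rule bounded_linear.has_derivative[OF bounded_linear_divide],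
      rule has_derivative_inner[OF drp_has_derivative drp_has_derivative])
     (simp add: fun_eq_iff inner_commute)

lemma sph_has_derivative: "(sph has_derivative dsph u) (at u)"
proof -
  have m': "(m has_derivative (\<lambda>h. drp h - dq u h *\<^sub>R e)) (at u)"
    unfolding m_def[abs_def]
    by (rule has_derivative_eq_rhs, rule has_derivative_add[OF has_derivative_scaleR_left[OF has_derivative_diff[OF has_derivative_const q_has_derivative]] drp_has_derivative])
       (simp add: fun_eq_iff)
  have i': "((\<lambda>u. inverse (1 + q u)) has_derivative (\<lambda>h. - (inverse (1 + q u) * dq u h * inverse (1 + q u)))) (at u)"
    by (rule has_derivative_eq_rhs, rule Deriv.has_derivative_inverse[OF q1 has_derivative_add[OF has_derivative_const q_has_derivative]])
       (simp add: fun_eq_iff)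
  show ?thesis
    unfolding sph_def[abs_def] dsph_def[abs_def]
    by (rule bounded_linear.has_derivative[OF blR], rule has_derivative_eq_rhs, rule has_derivative_scaleR[OF i' m'])
       (simp add: fun_eq_iff algebra_simps)
qed

lemma A_m: "(drp h - dq u h *\<^sub>R e) \<bullet> m u = dq u h * (1 + q u)"
  by (simp add: m_def dq_def inner_add inner_diff inner_commute field_simps)

text \<open>Stereographic projection is conformal. Its factor is one where \<open>drp u = 0\<close>,
  the line along which the curvature is computed.\<close>

lemma dsph_dsph: "dsph u h \<bullet> dsph u h' = (drp h \<bullet> drp h') / (1 + q u)\<^sup>2"
proof -
  define M where "M = 1 + q u"
  have M: "M \<noteq> 0" by (simp add: M_def)
  have AA: "(drp h - dq u h *\<^sub>R e) \<bullet> (drp h' - dq u h' *\<^sub>R e) = drp h \<bullet> drp h' + dq u h * dq u h'"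
    by (simp add: inner_diff algebra_simps)
  have "dsph u h \<bullet> dsph u h' = inverse M * inverse M * (drp h \<bullet> drp h' + dq u h * dq u h')
     - inverse M * (dq u h' * inverse M * inverse M) * (dq u h * M)
     - (dq u h * inverse M * inverse M) * inverse M * (dq u h' * M)
     + (dq u h * inverse M * inverse M) * (dq u h' * inverse M * inverse M) * M\<^sup>2"
    unfolding dsph_def R_inner inner_diff_scaleR_expand(1) AA A_m m_m M_def ..
  also have "\<dots> = (drp h \<bullet> drp h') / M\<^sup>2"
    using M by (simp add: field_simps power2_eq_square)
  finally show ?thesis by (simp add: M_def)
qed

lemma sph_dsph: "sph u \<bullet> dsph u h = 0"
proof -
  have "inverse M * inverse M * (d * M) - inverse M * (d * inverse M * inverse M) * M\<^sup>2 = 0" if "M \<noteq> 0" for M d :: real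
    using that by (simp add: power2_eq_square)
  from this[OF q1] show ?thesis
    unfolding sph_def dsph_def R_inner inner_diff_scaleR_expand(2) A_m m_m .
qed

lemma sph_center: "drp u = 0 \<Longrightarrow> sph u = R e" and dsph_center: "drp u = 0 \<Longrightarrow> dsph u h = R (drp h)"
  by (simp_all add: sph_def m_def q_def dsph_def dq_def)

lemma C_k_sph: "C_k_on j UNIV sph"
proof -
  have d: "C_k_on j UNIV drp" by (rule C_k_on_bounded_linear[OF bl_drp])
  have q: "C_k_on j UNIV q"
    using C_k_on_bilinear[OF bounded_bilinear_mult open_UNIV C_k_on_bilinear[OF bounded_bilinear_inner open_UNIV d d] C_k_on_const[of j UNIV "1/4"]]
    by (simp add: q_def[abs_def])
  have m: "C_k_on j UNIV m"
  proof -
    have "C_k_on j UNIV (\<lambda>u. (1 + (-1) * q u) *\<^sub>R e + drp u)"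
      by (rule C_k_on_add[OF open_UNIV C_k_on_bilinear[OF bounded_bilinear_scaleR open_UNIV
            C_k_on_add[OF open_UNIV C_k_on_const C_k_on_bilinear[OF bounded_bilinear_mult open_UNIV C_k_on_const q]] C_k_on_const] d])
    then show ?thesis by (simp add: m_def[abs_def])
  qed
  have nz: "1 + q u \<noteq> 0" for u by simp
  show ?thesis
    unfolding sph_def[abs_def]
    by (rule C_k_on_linear_compose[OF blR open_UNIV C_k_on_bilinear[OF bounded_bilinear_scaleR open_UNIV
          C_k_on_inverse[OF open_UNIV nz C_k_on_add[OF open_UNIV C_k_on_const q]] m]])
qed

lemma C_k_Y: "C_k_on j UNIV Y"
  unfolding Y_def[abs_def]
  by (rule C_k_on_Pair[OF open_UNIV C_k_on_bounded_linear[OF bounded_linear_inner_left] C_k_sph])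

lemma open_W: "open W"
  unfolding W_def
  by (intro open_Collect_less continuous_intros bounded_linear.continuous_on[OF blR'])

lemma C_k_Z: "C_k_on j W Z"
proof -
  have L: "bounded_linear (\<lambda>p :: real \<times> (real^'n). R' (snd p))" by (rule bounded_linear_compose[OF blR' bounded_linear_snd])
  have nz: "1 + R' (snd p) \<bullet> e \<noteq> 0" if "p \<in> W" for p using that by (simp add: W_def)
  have "C_k_on j W (\<lambda>p. fst p *\<^sub>R e + (2 * inverse (1 + R' (snd p) \<bullet> e)) *\<^sub>R drp (R' (snd p)))"
    by (rule C_k_on_add[OF open_W C_k_on_bilinear[OF bounded_bilinear_scaleR open_W C_k_on_bounded_linear[OF bounded_linear_fst] C_k_on_const]
        C_k_on_bilinear[OF bounded_bilinear_scaleR open_W C_k_on_bilinear[OF bounded_bilinear_mult open_W C_k_on_const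
           C_k_on_inverse[OF open_W nz C_k_on_add[OF open_W C_k_on_const C_k_on_bilinear[OF bounded_bilinear_inner open_W C_k_on_bounded_linear[OF L] C_k_on_const]]]]
           C_k_on_bounded_linear[OF bounded_linear_compose[OF bl_drp L]]]])
  then show ?thesis unfolding Z_def[abs_def] .
qed

lemma R'_sph: "R' (sph u) = inverse (1 + q u) *\<^sub>R m u" by (simp add: sph_def)

lemma sph_e: "R' (sph u) \<bullet> e = (1 - q u) / (1 + q u)"
  by (simp add: R'_sph m_def inner_add divide_inverse)

lemma Y_W: "Y u \<in> W"
proof -
  have "1 + R' (sph u) \<bullet> e = 2 / (1 + q u)" unfolding sph_e by (simp add: field_simps)
  then show ?thesis using q_nonneg[of u] by (simp add: W_def Y_def)
qed

lemma Z_Y: "Z (Y u) = u"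
proof -
  have 1: "1 + R' (sph u) \<bullet> e = 2 / (1 + q u)" unfolding sph_e by (simp add: field_simps)
  have 2: "drp (R' (sph u)) = inverse (1 + q u) *\<^sub>R drp u"
    unfolding R'_sph by (simp add: m_def drp_add drp_scaleR)
  have "Z (Y u) = (u \<bullet> e) *\<^sub>R e + drp u"
  proof -
    have "2 * inverse (2 / M) * inverse M = 1" if "M \<noteq> 0" for M :: real using that by simp
    from this[OF q1] show ?thesis unfolding Z_def Y_def fst_conv snd_conv 1 2 scaleR_scaleR by simp
  qed
  then show ?thesis by (simp add: drp_def)
qed

lemma Y_cylinder: "Y u \<in> cylinder" by (simp add: Y_def norm_sph)

lemma Y_Z:
  assumes "p \<in> cylinder" "p \<in> W"
  shows "Y (Z p) = p"
proof -
  obtain s x where p: "p = (s, x)" by (cases p)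
  define v where "v = R' x"
  define a where "a = v \<bullet> e"
  have x: "x \<bullet> x = 1" using assms(1) by (simp add: p dot_square_norm)
  then have v: "v \<bullet> v = 1" by (simp add: v_def)
  have a: "1 + a > 0" using assms(2) by (simp add: p W_def a_def v_def)
  have dv: "drp v \<bullet> drp v = 1 - a\<^sup>2"
    by (simp add: drp_def inner_diff v a_def[symmetric] inner_commute[of e v] power2_eq_square)
  have Zp: "Z p = s *\<^sub>R e + (2 * inverse (1 + a)) *\<^sub>R drp v" by (simp add: Z_def p v_def a_def)
  have dZ: "drp (Z p) = (2 * inverse (1 + a)) *\<^sub>R drp v" unfolding Zp by (simp add: drp_add drp_scaleR)
  have eZ: "Z p \<bullet> e = s" unfolding Zp by (simp add: inner_add)
  have qZ: "q (Z p) = (1 - a) / (1 + a)"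
  proof -
    have "(2 * inverse b * (2 * inverse b * (c * b))) / 4 = c / b" if "b \<noteq> 0" for b c :: real
      using that by (simp add: field_simps)
    moreover have "drp v \<bullet> drp v = (1 - a) * (1 + a)" unfolding dv by (simp add: power2_eq_square algebra_simps)
    moreover have "1 + a \<noteq> 0" using a by simp
    ultimately show ?thesis unfolding q_def dZ inner_scaleR_left inner_scaleR_right by metis
  qed
  have 1: "inverse (1 + q (Z p)) = (1 + a) / 2" "1 - q (Z p) = 2 * a / (1 + a)"
    unfolding qZ using a by (simp_all add: field_simps)
  have "sph (Z p) = R (((1 + a) / 2) *\<^sub>R ((2 * a / (1 + a)) *\<^sub>R e + (2 * inverse (1 + a)) *\<^sub>R drp v))"
    unfolding sph_def m_def 1 dZ ..
  also have "\<dots> = R (a *\<^sub>R e + drp v)"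
  proof -
    have c: "(b / 2) * (2 * a / b) = a" "(b / 2) * (2 * inverse b) = 1" if "b \<noteq> 0" for b
      using that by simp_all
    have "1 + a \<noteq> 0" using a by simp
    note c = c[OF this]
    show ?thesis unfolding scaleR_add_right scaleR_scaleR c scaleR_one ..
  qed
  also have "\<dots> = x" by (simp add: drp_def a_def v_def)
  finally have "sph (Z p) = x" .
  then show ?thesis unfolding Y_def eZ by (simp only: p)
qed

text \<open>Differentiating Z (Y u) = u gives injectivity of the differential. The image of U is the
  part of the cylinder in the ambient open set where \<open>Z\<close> is defined and takes values in
  U.\<close>

lemma chart_Y:
  assumes U: "open U"
  shows "chart cylinder U Y"
  unfolding chart_def
proof (intro conjI ballI exI)
  have cY: "continuous_on A Y" for A using C_k_on_subset[OF C_k_Y[of 0]] by (auto intro: continuous_on_subset)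
  have cZ: "continuous_on W Z" using C_k_Z[of 0] by simp
  show "smooth_on U Y" unfolding smooth_on_def using C_k_on_subset[OF C_k_Y] by blast
  show "inj (frechet_derivative Y (at u))" for u
  proof -
    have "(Y has_derivative frechet_derivative Y (at u)) (at u)" by (rule C_k_on_SucD'(1)[OF C_k_Y[of "Suc 0"]]) simp
    moreover have "(Z has_derivative frechet_derivative Z (at (Y u))) (at (Y u))"
      by (rule C_k_on_SucD'(1)[OF C_k_Z[of "Suc 0"] Y_W])
    ultimately have "((\<lambda>u. Z (Y u)) has_derivative (\<lambda>h. frechet_derivative Z (at (Y u)) (frechet_derivative Y (at u) h))) (at u)"
      by (rule diff_chain_at[unfolded o_def])
    then have "((\<lambda>u. u) has_derivative (\<lambda>h. frechet_derivative Z (at (Y u)) (frechet_derivative Y (at u) h))) (at u)"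
      by (simp add: Z_Y)
    from has_derivative_unique[OF this has_derivative_ident]
    have "frechet_derivative Z (at (Y u)) (frechet_derivative Y (at u) h) = h" for h by metis
    then show ?thesis by (rule inj_on_inverseI)
  qed
  have im: "Y ` U = cylinder \<inter> (W \<inter> Z -` U)"
  proof
    show "Y ` U \<subseteq> cylinder \<inter> (W \<inter> Z -` U)"
    proof
      fix p assume "p \<in> Y ` U"
      then obtain u where u: "u \<in> U" "p = Y u" by blast
      have "Y u \<in> Z -` U" using u by (simp add: Z_Y)
      then show "p \<in> cylinder \<inter> (W \<inter> Z -` U)" unfolding u(2) by (intro IntI Y_cylinder Y_W)
    qed
    show "cylinder \<inter> (W \<inter> Z -` U) \<subseteq> Y ` U"
    proof
      fix p assume p: "p \<in> cylinder \<inter> (W \<inter> Z -` U)"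
      then have "Y (Z p) = p" by (intro Y_Z) auto
      then show "p \<in> Y ` U" using p by (metis IntD2 imageI vimage_eq)
    qed
  qed
  have "open (W \<inter> Z -` U)" by (rule continuous_open_preimage[OF cZ open_W U])
  then show "openin (top_of_set cylinder) (Y ` U)" unfolding im by (rule openin_open_Int)
  show "homeomorphism U (Y ` U) Y Z"
  proof (rule homeomorphismI)
    show "continuous_on U Y" by (rule cY)
    show "continuous_on (Y ` U) Z" by (rule continuous_on_subset[OF cZ]) (use Y_W in auto)
  qed (auto simp: Z_Y)
qed (rule U)

end

section \<open>Metric and curvature of a rotated curve\<close>

lemma matrix_inv_diagonal:
  fixes A :: "real^'n::finite^'n"
  assumes "\<And>i j. i \<noteq> j \<Longrightarrow> A $ i $ j = 0" "\<And>i. A $ i $ i \<noteq> 0"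
  shows "matrix_inv A = (\<chi> i j. if i = j then inverse (A $ i $ i) else 0)"
proof -
  define B :: "real^'n^'n" where "B = (\<chi> i j. if i = j then inverse (A $ i $ i) else 0)"
  have 1: "A ** B = mat 1" and 2: "B ** A = mat 1"
  proof -
    have "(\<Sum>k\<in>UNIV. A $ i $ k * B $ k $ j) = A $ i $ i * B $ i $ j" for i j
      by (subst sum.remove[of _ i]) (auto simp: assms(1))
    then show "A ** B = mat 1" using assms by (auto simp: vec_eq_iff matrix_matrix_mult_def mat_def B_def)
    have "(\<Sum>k\<in>UNIV. B $ i $ k * A $ k $ j) = B $ i $ i * A $ i $ j" for i j
      by (subst sum.remove[of _ i]) (auto simp: B_def)
    then show "B ** A = mat 1" using assms by (auto simp: vec_eq_iff matrix_matrix_mult_def mat_def B_def)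
  qed
  have "A ** matrix_inv A = mat 1 \<and> matrix_inv A ** A = mat 1"
    unfolding matrix_inv_def by (rule someI[of _ B]) (use 1 2 in simp)
  then have "matrix_inv A = B"
    by (metis 2 matrix_mul_assoc matrix_mul_lid matrix_mul_rid)
  then show ?thesis by (simp add: B_def)
qed

lemma sum_one_special:
  fixes a b :: real
  shows "(\<Sum>i\<in>UNIV. if i = (k :: 'n::finite) then a else b) = a + (real CARD('n) - 1) * b"
proof -
  have "(\<Sum>i\<in>UNIV. if i = k then a else b) = a + (\<Sum>i\<in>UNIV - {k}. if i = k then a else b)"
    by (subst sum.remove[of _ k]) auto
  also have "(\<Sum>i\<in>UNIV - {k}. if i = k then a else b) = (\<Sum>i\<in>UNIV - {k}. b)" by (rule sum.cong) auto
  also have "\<dots> = (real CARD('n) - 1) * b" by (simp add: card_Diff_singleton of_nat_diff)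
  finally show ?thesis .
qed

lemma lorentz_inner_simp [simp]: "lorentz_inner (a, b, c) (a', b', c') = - (a * a') + b * b' + c \<bullet> c'"
  by (simp add: lorentz_inner_def)

text \<open>(n1, n2, n3) is the Lorentzian cross product of position and velocity of the generating
  curve, so it is orthogonal to both and has the same square as the velocity. The first six
  equations expand the Lorentz form of three-space in the frame of position, velocity and
  normal.\<close>

lemma lorentz_cross_product:
  fixes x y z x1 y1 z1 :: real
  assumes "x * x = 1 + y * y + z * z" "x * x1 = y * y1 + z * z1"
    and "E2 = - (x1 * x1) + y1 * y1 + z1 * z1"
    and "n1 = - (y * z1 - z * y1)" "n2 = z * x1 - x * z1" "n3 = x * y1 - y * x1"
  shows "E2 * (1 - x * x) = - (x1 * x1) - n1 * n1" "E2 * (x * y) = x1 * y1 + n1 * n2" "E2 * (x * z) = x1 * z1 + n1 * n3"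
    "E2 * (1 + y * y) = y1 * y1 + n2 * n2" "E2 * (y * z) = y1 * z1 + n2 * n3" "E2 * (1 + z * z) = z1 * z1 + n3 * n3"
    "- (n1 * x) + n2 * y + n3 * z = 0" "- (n1 * x1) + n2 * y1 + n3 * z1 = 0" "- (n1 * n1) + n2 * n2 + n3 * n3 = E2"
  unfolding assms(3-6) using assms(1,2) by algebra+

locale rotated_curve_chart = stereographic k R for k :: "'n::finite" and R +
  fixes T :: "'n lorentz \<Rightarrow> 'n lorentz" and x y z x1 y1 z1 x2 y2 z2 :: "real \<Rightarrow> real"
  assumes linT: "linear T" and T_inner [simp]: "lorentz_inner (T p) (T p') = lorentz_inner p p'"
    and hyp: "x s * x s = 1 + y s * y s + z s * z s" and z_pos: "z s > 0"
    and dx: "(x has_real_derivative x1 s) (at s)" and dy: "(y has_real_derivative y1 s) (at s)"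
    and dz: "(z has_real_derivative z1 s) (at s)"
    and dx1: "(x1 has_real_derivative x2 s) (at s)" and dy1: "(y1 has_real_derivative y2 s) (at s)"
    and dz1: "(z1 has_real_derivative z2 s) (at s)"
begin

definition X :: "real^'n \<Rightarrow> 'n lorentz" where "X u = T (x (u \<bullet> e), y (u \<bullet> e), z (u \<bullet> e) *\<^sub>R sph u)"
definition E2 :: "real \<Rightarrow> real" where "E2 s = - (x1 s * x1 s) + y1 s * y1 s + z1 s * z1 s"
definition n1 :: "real \<Rightarrow> real" where "n1 s = - (y s * z1 s - z s * y1 s)"
definition n2 :: "real \<Rightarrow> real" where "n2 s = z s * x1 s - x s * z1 s"
definition n3 :: "real \<Rightarrow> real" where "n3 s = x s * y1 s - y s * x1 s"
text \<open>The Lorentz product of the second derivative with the unnormalised normal, that is, the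
  numerator of the curvature of the generating curve.\<close>

definition \<kappa> :: "real \<Rightarrow> real" where "\<kappa> s = - (x2 s * n1 s) + y2 s * n2 s + z2 s * n3 s"

lemma hyp': "x s * x1 s = y s * y1 s + z s * z1 s"
proof -
  have "((\<lambda>s. x s * x s) has_real_derivative 2 * (x s * x1 s)) (at s)" by (auto intro!: derivative_eq_intros dx)
  moreover have "((\<lambda>s. x s * x s) has_real_derivative 2 * (y s * y1 s + z s * z1 s)) (at s)"
    unfolding hyp by (auto intro!: derivative_eq_intros dy dz)
  ultimately show ?thesis using DERIV_unique by fastforce
qed

lemma hyp'': "- (x2 s * x s) + y2 s * y s + z2 s * z s = - E2 s"
proof -
  have "((\<lambda>s. x s * x1 s) has_real_derivative x1 s * x1 s + x2 s * x s) (at s)"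
    by (auto intro!: derivative_eq_intros dx dx1)
  moreover have "((\<lambda>s. x s * x1 s) has_real_derivative (y1 s * y1 s + y2 s * y s) + (z1 s * z1 s + z2 s * z s)) (at s)"
    unfolding hyp' by (auto intro!: derivative_eq_intros dy dz dy1 dz1)
  ultimately have "x1 s * x1 s + x2 s * x s = (y1 s * y1 s + y2 s * y s) + (z1 s * z1 s + z2 s * z s)" by (rule DERIV_unique)
  then show ?thesis by (simp add: E2_def)
qed

lemmas frame = lorentz_cross_product[OF hyp hyp' E2_def n1_def n2_def n3_def]

lemma T_surj: "surj T"
proof (rule linear_injective_imp_surjective[OF linT], rule linear_injective_0[OF linT, THEN iffD2], intro allI impI)
  fix p :: "'n lorentz" assume "T p = 0"
  \<comment> \<open>Changing the sign of the first coordinate turns the Lorentz product of p with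
    itself into the squared Euclidean length.\<close>
  then have "lorentz_inner p (- fst p, fst (snd p), snd (snd p)) = 0"
    using T_inner[of p "(- fst p, fst (snd p), snd (snd p))"] by (simp add: lorentz_inner_def)
  then have "fst p * fst p + fst (snd p) * fst (snd p) + snd (snd p) \<bullet> snd (snd p) = 0"
    by (simp add: lorentz_inner_def)
  moreover have "fst p * fst p \<ge> 0" "fst (snd p) * fst (snd p) \<ge> 0" "snd (snd p) \<bullet> snd (snd p) \<ge> 0" by auto
  ultimately have "fst p * fst p = 0" "fst (snd p) * fst (snd p) = 0" "snd (snd p) \<bullet> snd (snd p) = 0" by linarith+
  then show "p = 0" by (simp add: prod_eq_iff)
qed (rule refl)

lemma blT: "bounded_linear T" using linT by (simp add: linear_conv_bounded_linear)

lemma along_e: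
  assumes "(a has_real_derivative a' (u \<bullet> e)) (at (u \<bullet> e))"
  shows "((\<lambda>v. a (v \<bullet> e)) has_derivative (\<lambda>h. (h \<bullet> e) * a' (u \<bullet> e))) (at u)"
proof -
  have "((\<lambda>v. v \<bullet> e) has_derivative (\<lambda>h. h \<bullet> e)) (at u)"
    by (rule bounded_linear_imp_has_derivative[OF bounded_linear_inner_left])
  moreover have "(a has_derivative (\<lambda>t. t * a' (u \<bullet> e))) (at (u \<bullet> e))"
    using assms unfolding has_field_derivative_def by (rule has_derivative_eq_rhs) (simp add: fun_eq_iff)
  ultimately show ?thesis by (rule diff_chain_at[unfolded o_def])
qed

lemma X_has_derivative:
  "(X has_derivative (\<lambda>h. T ((h \<bullet> e) * x1 (u \<bullet> e), (h \<bullet> e) * y1 (u \<bullet> e),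
      z (u \<bullet> e) *\<^sub>R dsph u h + ((h \<bullet> e) * z1 (u \<bullet> e)) *\<^sub>R sph u))) (at u)"
  unfolding X_def[abs_def]
  by (intro bounded_linear.has_derivative[OF blT] has_derivative_Pair along_e dx dy dz has_derivative_scaleR sph_has_derivative)

lemma dsph_e [simp]: "dsph u e = 0" by (simp add: dsph_def dq_def)

lemma axis_k: "axis k 1 = e" by (simp add: e_def)
lemma axis_e [simp]: "i \<noteq> k \<Longrightarrow> axis i 1 \<bullet> e = 0" by (simp add: e_def inner_axis_axis)

lemma pderiv_X: "pderiv_at i X u = (if i = k then T (x1 (u \<bullet> e), y1 (u \<bullet> e), z1 (u \<bullet> e) *\<^sub>R sph u)
      else T (0, 0, z (u \<bullet> e) *\<^sub>R dsph u (axis i 1)))"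
  unfolding pderiv_at_def frechet_derivative_at[OF X_has_derivative, symmetric]
  by (simp add: axis_k)

lemma metric_X: "metric_matrix X u $ i $ j
    = (if i = j then if i = k then E2 (u \<bullet> e) else (z (u \<bullet> e))\<^sup>2 / (1 + q u)\<^sup>2 else 0)"
  unfolding metric_matrix_def
  by (auto simp: pderiv_X sph_sph sph_dsph dsph_dsph E2_def inner_commute[of "dsph u _" "sph u"] drp_axis inner_axis_axis power2_eq_square)

end

locale rotation_chart = rotated_curve_chart k R T x y z x1 y1 z1 x2 y2 z2
  for k :: "'n::finite" and R T x y z x1 y1 z1 x2 y2 z2 +
  assumes E2_pos: "- (x1 s * x1 s) + y1 s * y1 s + z1 s * z1 s > 0"
begin

lemma E2_gt: "E2 s > 0" using E2_pos by (simp add: E2_def)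

lemma metric_X_inv: "matrix_inv (metric_matrix X u) $ i $ j
    = (if i = j then if i = k then inverse (E2 (u \<bullet> e)) else (1 + q u)\<^sup>2 / (z (u \<bullet> e))\<^sup>2 else 0)"
proof -
  have "E2 (u \<bullet> e) \<noteq> 0" "z (u \<bullet> e) \<noteq> 0" using E2_gt[of "u \<bullet> e"] z_pos[of "u \<bullet> e"] by auto
  then show ?thesis by (subst matrix_inv_diagonal) (auto simp: metric_X)
qed

text \<open>The unit normal along the line through the chart centre only. Varying \<open>R\<close>
  brings every point of the cylinder to such a line.\<close>

definition N0 :: "real \<Rightarrow> 'n lorentz" where
  "N0 s = T (n1 s / sqrt (E2 s), n2 s / sqrt (E2 s), (n3 s / sqrt (E2 s)) *\<^sub>R R e)"

lemma N0_unit_normal: "is_unit_normal X (s *\<^sub>R e) (N0 s)"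
proof -
  define r where "r = sqrt (E2 s)"
  have r: "r > 0" "r * r = E2 s" using E2_gt[of s] by (auto simp: r_def)
  have c: "sph (s *\<^sub>R e) = R e" "dsph (s *\<^sub>R e) h = R (drp h)" for h
    by (simp_all add: sph_center dsph_center drp_scaleR)
  have "- (n1 s / r * (n1 s / r)) + n2 s / r * (n2 s / r) + n3 s / r * (n3 s / r) = (- (n1 s * n1 s) + n2 s * n2 s + n3 s * n3 s) / (r * r)"
    using r(1) by (simp add: field_simps)
  also have "\<dots> = 1" using r E2_gt[of s] frame(9)[of s] by simp
  finally have 1: "- (n1 s / r * (n1 s / r)) + n2 s / r * (n2 s / r) + n3 s / r * (n3 s / r) = 1" .
  have 2: "- (n1 s / r * x s) + n2 s / r * y s + n3 s / r * z s = 0"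
    using frame(7)[of s] r(1) by (simp add: field_simps)
  have 3: "- (n1 s / r * x1 s) + n2 s / r * y1 s + n3 s / r * z1 s = 0"
    using frame(8)[of s] r(1) by (simp add: field_simps)
  show ?thesis
    unfolding is_unit_normal_def N0_def r_def[symmetric]
    using 1 2 3 by (simp add: pderiv_X X_def c mult.commute[of "z s"] mult.commute[of "z1 s"])
qed

text \<open>Orthogonality to the orbit directions forces the last component to be a multiple of
  \<open>R e\<close>. This leaves a vector of Lorentzian three-space orthogonal to position and
  velocity, which \<open>frame\<close> shows to be a multiple of the cross product; the norm then
  fixes the multiple up to sign.\<close>

lemma unit_normal_unique:
  assumes N: "is_unit_normal X (s *\<^sub>R e) N"
  shows "N = N0 s \<or> N = - N0 s"
proof -
  have c: "sph (s *\<^sub>R e) = R e" "dsph (s *\<^sub>R e) h = R (drp h)" for h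
    by (simp_all add: sph_center dsph_center drp_scaleR)
  obtain M where M: "N = T M" using T_surj by (metis surjD)
  obtain a b v where abv: "M = (a, b, v)" by (cases M)
  define d where "d = R' v \<bullet> e"
  have "v \<bullet> R (axis i 1) = 0" if "i \<noteq> k" for i
    using N z_pos[of s] that unfolding is_unit_normal_def M abv
    by (auto simp: pderiv_X c drp_axis dest!: spec[of _ i])
  then have "R' v \<bullet> axis i 1 = 0" if "i \<noteq> k" for i
    using R'_inner[of v "R (axis i 1)"] that by simp
  then have zero: "R' v $ i = 0" if "i \<noteq> k" for i using that by (simp add: inner_axis)
  have "d = R' v $ k" by (simp add: d_def e_def inner_axis)
  moreover have "axis k (1 :: real) $ i = (if i = k then 1 else 0)" for i by (simp add: axis_def)
  ultimately have "R' v = d *\<^sub>R e"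
    using zero by (auto simp: vec_eq_iff e_def)
  then have v: "v = d *\<^sub>R R e" by (metis R_R' R_scaleR)
  have Re: "R e \<bullet> R e = 1" by simp
  have 1: "- (a * a) + b * b + d * d = 1" and 2: "- (a * x s) + b * y s + d * z s = 0"
    and 3: "- (a * x1 s) + b * y1 s + d * z1 s = 0"
    using N unfolding is_unit_normal_def M abv v
    by (auto simp: pderiv_X X_def c mult.commute[of d "z s"] mult.commute[of d "z1 s"] dest!: spec[of _ k])
  \<comment> \<open>The product with the unnormalised normal; its square will be
    \<open>E2 s\<close>.\<close>
  define \<tau> where "\<tau> = - (a * n1 s) + b * n2 s + d * n3 s"
  have a: "E2 s * a = \<tau> * n1 s" and b: "E2 s * b = \<tau> * n2 s" and d: "E2 s * d = \<tau> * n3 s"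
    unfolding \<tau>_def using 2 3 frame(1-6)[of s] by algebra+
  have "E2 s * E2 s * (- (a * a) + b * b + d * d) = \<tau> * \<tau> * (- (n1 s * n1 s) + n2 s * n2 s + n3 s * n3 s)"
    using a b d by algebra
  then have "\<tau> * \<tau> = E2 s" using 1 frame(9)[of s] E2_gt[of s] by simp
  define r where "r = sqrt (E2 s)"
  have r: "r > 0" "r * r = E2 s" using E2_gt[of s] by (auto simp: r_def)
  have div: "c = t / r" if "E2 s * c = \<tau> * t'" "\<tau> * t' = r * t" for c t t'
  proof -
    have "r * (r * c) = r * t" using that r(2) by (metis mult.assoc)
    then show ?thesis using r(1) by (simp add: eq_divide_eq mult.commute)
  qed
  have "(\<tau> - r) * (\<tau> + r) = 0" using \<open>\<tau> * \<tau> = E2 s\<close> r(2) by (simp add: algebra_simps)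
  then consider "\<tau> = r" | "\<tau> = - r" by fastforce
  then show ?thesis
  proof cases
    case 1
    have "a = n1 s / r" "b = n2 s / r" "d = n3 s / r"
      by (rule div[OF a], simp only: 1, rule div[OF b], simp only: 1, rule div[OF d], simp only: 1)
    then show ?thesis unfolding N0_def r_def[symmetric] M abv v by simp
  next
    case 2
    have "a = (- n1 s) / r" "b = (- n2 s) / r" "d = (- n3 s) / r"
      by (rule div[OF a], simp add: 2, rule div[OF b], simp add: 2, rule div[OF d], simp add: 2)
    then have "(a, b, d *\<^sub>R R e) = - (n1 s / r, n2 s / r, (n3 s / r) *\<^sub>R R e)" by simp
    then have "T (a, b, d *\<^sub>R R e) = - T (n1 s / r, n2 s / r, (n3 s / r) *\<^sub>R R e)" by (simp only: linear_neg[OF linT])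
    then show ?thesis unfolding N0_def r_def[symmetric] M abv v by blast
  qed
qed

text \<open>The curve direction yields the curvature of the generating curve. Along the orbits only
  the component of the second derivative of \<open>sph\<close> in the direction of
  \<open>sph\<close> enters, and this one is determined by the first derivatives.\<close>

lemma second_derivative_X:
  defines "u \<equiv> \<lambda>s. s *\<^sub>R e"
  shows "lorentz_inner (pderiv_at i (pderiv_at j X) (u s)) (N0 s)
    = (if i = j then if i = k then \<kappa> s / sqrt (E2 s) else - (z s * n3 s / sqrt (E2 s)) else 0)"
proof -
  have c: "sph (u s) = R e" "dsph (u s) h = R (drp h)" "u s \<bullet> e = s" for h
    by (simp_all add: u_def sph_center dsph_center drp_scaleR)
  show ?thesis
  proof (cases "j = k")
    case True
    have f: "pderiv_at j X = (\<lambda>v. T (x1 (v \<bullet> e), y1 (v \<bullet> e), z1 (v \<bullet> e) *\<^sub>R sph v))"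
      using True by (auto simp: fun_eq_iff pderiv_X)
    have "(pderiv_at j X has_derivative (\<lambda>h. T ((h \<bullet> e) * x2 (u s \<bullet> e), (h \<bullet> e) * y2 (u s \<bullet> e),
      z1 (u s \<bullet> e) *\<^sub>R dsph (u s) h + ((h \<bullet> e) * z2 (u s \<bullet> e)) *\<^sub>R sph (u s)))) (at (u s))"
      unfolding f
      by (intro bounded_linear.has_derivative[OF blT] has_derivative_Pair along_e dx1 dy1 dz1 has_derivative_scaleR sph_has_derivative)
    from frechet_derivative_at[OF this, symmetric]
    have D: "pderiv_at i (pderiv_at j X) (u s) = T ((axis i 1 \<bullet> e) * x2 s, (axis i 1 \<bullet> e) * y2 s,
      z1 s *\<^sub>R R (drp (axis i 1)) + ((axis i 1 \<bullet> e) * z2 s) *\<^sub>R R e)"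
      by (simp add: pderiv_at_def c)
    show ?thesis
    proof (cases "i = k")
      case True
      then show ?thesis using \<open>j = k\<close> E2_gt[of s] unfolding D N0_def
        by (simp add: axis_k \<kappa>_def add_divide_distrib diff_divide_distrib)
    next
      case False
      then show ?thesis using \<open>j = k\<close> unfolding D N0_def by (simp add: drp_axis inner_add)
    qed
  next
    case False
    have f: "pderiv_at j X = (\<lambda>v. T (0, 0, z (v \<bullet> e) *\<^sub>R dsph v (axis j 1)))"
      using False by (auto simp: fun_eq_iff pderiv_X)
    have fr: "frechet_derivative sph (at v) = dsph v" for v using frechet_derivative_at[OF sph_has_derivative] by simp
    define dd where "dd = frechet_derivative (\<lambda>v. dsph v (axis j 1)) (at (u s))"
    have dd: "((\<lambda>v. dsph v (axis j 1)) has_derivative dd) (at (u s))"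
      unfolding dd_def using C_k_on_SucD'(1)[OF C_k_on_SucD'(2)[OF C_k_sph[of "Suc (Suc 0)"], of "axis j 1"], of "u s"]
      by (simp add: fr)
    \<comment> \<open>Differentiating the identity \<open>sph_dsph\<close> gives the normal
      component of the second derivative without computing the derivative itself.\<close>
    have "((\<lambda>v. sph v \<bullet> dsph v (axis j 1)) has_derivative (\<lambda>h. sph (u s) \<bullet> dd h + dsph (u s) h \<bullet> dsph (u s) (axis j 1))) (at (u s))"
      by (rule has_derivative_inner[OF sph_has_derivative dd])
    then have "((\<lambda>v. 0) has_derivative (\<lambda>h. sph (u s) \<bullet> dd h + dsph (u s) h \<bullet> dsph (u s) (axis j 1))) (at (u s))"
      by (simp only: sph_dsph)
    from has_derivative_unique[OF this has_derivative_const]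
    have "sph (u s) \<bullet> dd h + dsph (u s) h \<bullet> dsph (u s) (axis j 1) = 0" for h by metis
    then have ddn: "R e \<bullet> dd h = - (drp h \<bullet> axis j 1)" for h
      using False by (simp add: c drp_axis eq_neg_iff_add_eq_0)
    have "(pderiv_at j X has_derivative (\<lambda>h. T (0, 0, z (u s \<bullet> e) *\<^sub>R dd h + ((h \<bullet> e) * z1 (u s \<bullet> e)) *\<^sub>R dsph (u s) (axis j 1)))) (at (u s))"
      unfolding f
      by (intro bounded_linear.has_derivative[OF blT] has_derivative_Pair has_derivative_const along_e dz has_derivative_scaleR dd)
    from frechet_derivative_at[OF this, symmetric]
    have D: "pderiv_at i (pderiv_at j X) (u s) = T (0, 0, z s *\<^sub>R dd (axis i 1) + ((axis i 1 \<bullet> e) * z1 s) *\<^sub>R R (drp (axis j 1)))"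
      by (simp add: pderiv_at_def c)
    have "lorentz_inner (pderiv_at i (pderiv_at j X) (u s)) (N0 s) = - (z s * n3 s / sqrt (E2 s)) * (drp (axis i 1) \<bullet> axis j 1)"
      unfolding D N0_def using ddn[of "axis i 1"]
      by (simp add: inner_add_left inner_commute[of "dd _" "R e"])
    also have "drp (axis i 1) \<bullet> axis j 1 = (if i = j then 1 else 0)"
    proof (cases "i = k")
      case True
      then show ?thesis using False by (simp add: axis_k)
    next
      case False
      then show ?thesis by (simp add: drp_axis inner_axis_axis)
    qed
    finally show ?thesis using False by auto
  qed
qed

text \<open>The sign \<sigma> records which of the two unit normals was chosen by
  \<open>SOME\<close>; trace and norm below do not see it.\<close>

lemma second_ff_X:
  "\<exists>\<sigma> :: real. \<sigma> * \<sigma> = 1 \<and> (\<forall>i j. second_ff X (s *\<^sub>R e) $ i $ j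
     = \<sigma> * (if i = j then if i = k then \<kappa> s / sqrt (E2 s) else - (z s * n3 s / sqrt (E2 s)) else 0))"
proof -
  have "is_unit_normal X (s *\<^sub>R e) (unit_normal X (s *\<^sub>R e))"
    unfolding unit_normal_def by (rule someI[of _ "N0 s"]) (rule N0_unit_normal)
  then consider "unit_normal X (s *\<^sub>R e) = N0 s" | "unit_normal X (s *\<^sub>R e) = - N0 s" using unit_normal_unique by blast
  then show ?thesis
  proof cases
    case 1
    show ?thesis by (rule exI[of _ 1]) (simp add: second_ff_def 1 second_derivative_X)
  next
    case 2
    have neg: "lorentz_inner p (- p') = - lorentz_inner p p'" for p p' :: "'n lorentz" by (simp add: lorentz_inner_def)
    show ?thesis by (rule exI[of _ "-1"]) (simp add: second_ff_def 2 neg second_derivative_X)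
  qed
qed

text \<open>On the centre line the metric has entries \<open>E2\<close> along the curve and z^2
  along the orbits. Up to a common sign, the principal curvatures are therefore \<kappa>/E2^(3/2)
  and, n-1 times, -n3/(z E2^(1/2)).\<close>

lemma trace_shape_X:
  assumes "trace (shape_operator X (s *\<^sub>R e)) = 0"
  shows "\<kappa> s * z s = (real CARD('n) - 1) * n3 s * E2 s"
proof -
  obtain \<sigma> where \<sigma>: "\<sigma> * \<sigma> = 1" and h: "\<And>i j. second_ff X (s *\<^sub>R e) $ i $ j
     = \<sigma> * (if i = j then if i = k then \<kappa> s / sqrt (E2 s) else - (z s * n3 s / sqrt (E2 s)) else 0)"
    using second_ff_X[of s] by blast
  have q0: "q (s *\<^sub>R e) = 0" by (simp add: q_def drp_scaleR)
  have "shape_operator X (s *\<^sub>R e) $ i $ i = (if i = k then \<sigma> * (\<kappa> s / sqrt (E2 s)) / E2 s else - \<sigma> * (n3 s / sqrt (E2 s)) / z s)" for i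
  proof -
    have "shape_operator X (s *\<^sub>R e) $ i $ i = matrix_inv (metric_matrix X (s *\<^sub>R e)) $ i $ i * second_ff X (s *\<^sub>R e) $ i $ i"
      unfolding shape_operator_def matrix_matrix_mult_def
      by (simp, subst sum.remove[of _ i]) (auto simp: metric_X_inv)
    then show ?thesis using z_pos[of s] by (simp add: metric_X_inv h q0 field_simps power2_eq_square)
  qed
  then have "\<sigma> * (\<kappa> s / sqrt (E2 s)) / E2 s + (real CARD('n) - 1) * (- \<sigma> * (n3 s / sqrt (E2 s)) / z s) = 0"
    using assms by (simp only: trace_def sum_one_special)
  then have "\<sigma> * ((\<kappa> s * z s - (real CARD('n) - 1) * n3 s * E2 s) / (sqrt (E2 s) * E2 s * z s)) = 0"
    using E2_gt[of s] z_pos[of s] by (simp add: field_simps)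
  then show ?thesis using \<sigma> E2_gt[of s] z_pos[of s] by auto
qed

lemma normsq_X:
  assumes "\<kappa> s * z s = (real CARD('n) - 1) * n3 s * E2 s"
  shows "normsq_second_ff X (s *\<^sub>R e) = real CARD('n) * (real CARD('n) - 1) * ((n3 s)\<^sup>2 / (E2 s * (z s)\<^sup>2))"
proof -
  obtain \<sigma> where \<sigma>: "\<sigma> * \<sigma> = 1" and h: "\<And>i j. second_ff X (s *\<^sub>R e) $ i $ j
     = \<sigma> * (if i = j then if i = k then \<kappa> s / sqrt (E2 s) else - (z s * n3 s / sqrt (E2 s)) else 0)"
    using second_ff_X[of s] by blast
  have q0: "q (s *\<^sub>R e) = 0" by (simp add: q_def drp_scaleR)
  define g where "g = (\<lambda>i. matrix_inv (metric_matrix X (s *\<^sub>R e)) $ i $ i)"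
  define H where "H = (\<lambda>i. second_ff X (s *\<^sub>R e) $ i $ i)"
  have gd: "matrix_inv (metric_matrix X (s *\<^sub>R e)) $ i $ j = (if j = i then g i else 0)" for i j
    by (simp add: g_def metric_X_inv)
  have hd: "second_ff X (s *\<^sub>R e) $ i $ j = (if j = i then H i else 0)" for i j by (simp add: H_def h)
  have nsq: "normsq_second_ff X (s *\<^sub>R e) = (\<Sum>i\<in>UNIV. (g i * H i)\<^sup>2)"
    unfolding normsq_second_ff_def Let_def gd hd
    by (simp add: if_distrib[of "\<lambda>t. _ * t"] if_distrib[of "\<lambda>t. t * _"] sum.delta power2_eq_square mult_ac cong: if_cong)
  have sq: "(g i * H i)\<^sup>2 = (if i = k then (\<kappa> s)\<^sup>2 / (E2 s * E2 s * E2 s) else (n3 s)\<^sup>2 / (E2 s * (z s)\<^sup>2))" for i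
  proof -
    have r: "sqrt (E2 s) * sqrt (E2 s) = E2 s" using E2_gt[of s] by simp
    have "(g i * H i)\<^sup>2 = (\<sigma> * \<sigma>) * (if i = k then (\<kappa> s)\<^sup>2 / (E2 s * E2 s * (sqrt (E2 s) * sqrt (E2 s))) else (n3 s)\<^sup>2 / ((sqrt (E2 s) * sqrt (E2 s)) * (z s)\<^sup>2))"
      using z_pos[of s] E2_gt[of s] by (simp add: g_def H_def metric_X_inv h q0 field_simps power2_eq_square)
    then show ?thesis unfolding r \<sigma> by simp
  qed
  define t where "t = (n3 s)\<^sup>2 / (E2 s * (z s)\<^sup>2)"
  have "\<kappa> s = (real CARD('n) - 1) * n3 s * E2 s / z s" using assms z_pos[of s] by (simp add: field_simps)
  then have \<kappa>: "(\<kappa> s)\<^sup>2 / (E2 s * E2 s * E2 s) = (real CARD('n) - 1)\<^sup>2 * t"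
    using z_pos[of s] E2_gt[of s] by (simp add: t_def power2_eq_square mult_ac)
  have "normsq_second_ff X (s *\<^sub>R e) = (real CARD('n) - 1)\<^sup>2 * t + (real CARD('n) - 1) * t"
    unfolding nsq sq sum_one_special \<kappa> t_def[symmetric] ..
  then show ?thesis unfolding t_def[symmetric] by (simp add: power2_eq_square algebra_simps)
qed

definition E :: "real \<Rightarrow> real" where "E s = sqrt (E2 s)"
definition w :: "real \<Rightarrow> real" where "w s = z1 s / E s"

lemma E_gt: "E s > 0" and E_E: "E s * E s = E2 s" using E2_gt[of s] by (auto simp: E_def)

text \<open>Divided by \<open>E2\<close> z^2, this identifies the squared principal curvature of the
  orbits with the function \<open>K\<close> of \<open>rotation_profile\<close>.\<close>

lemma n3_square: "(n3 s)\<^sup>2 = E2 s * (1 + (z s)\<^sup>2 - (w s)\<^sup>2)"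
proof -
  have "E2 s * (w s)\<^sup>2 = z1 s * z1 s" using E_gt[of s] by (simp add: w_def power2_eq_square E_E[symmetric])
  then show ?thesis using frame(6)[of s] by (simp add: power2_eq_square algebra_simps)
qed

lemma dE: "(E has_real_derivative (- (x1 s * x2 s) + y1 s * y2 s + z1 s * z2 s) / E s) (at s)"
proof -
  have "(E2 has_real_derivative 2 * (- (x1 s * x2 s) + y1 s * y2 s + z1 s * z2 s)) (at s)"
    unfolding E2_def[abs_def] by (auto intro!: derivative_eq_intros dx1 dy1 dz1)
  from DERIV_chain2[OF DERIV_real_sqrt[OF E2_gt] this]
  have d: "(E has_real_derivative inverse (E s) / 2 * (2 * (- (x1 s * x2 s) + y1 s * y2 s + z1 s * z2 s))) (at s)"
    unfolding E_def[abs_def] .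
  have half: "inverse r / 2 * (2 * a) = a / r" for r a :: real by (cases "r = 0") (simp_all add: field_simps)
  show ?thesis by (rule DERIV_cong[OF d half])
qed

text \<open>The second derivative of z is resolved in the frame of position, velocity and normal.
  The position component is known from the hyperboloid equation, the velocity component is the
  derivative of the speed, and minimality determines the normal component; dividing by the speed
  gives the equation for \<open>w\<close>.\<close>

lemma rotation_profile_X:
  assumes n2: "CARD('n) \<ge> 2" and tr: "\<And>s. trace (shape_operator X (s *\<^sub>R e)) = 0"
  shows "rotation_profile CARD('n) z E w"
proof (rule rotation_profile.intro)
  show "2 \<le> CARD('n)" by fact
  show "0 < z s" "0 < E s" for s by (rule z_pos, rule E_gt)
  show "continuous_on UNIV E" using dE by (auto intro!: continuous_at_imp_continuous_on DERIV_isCont)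
  fix s
  have "0 \<le> (n3 s)\<^sup>2" by simp
  then show "(w s)\<^sup>2 \<le> 1 + (z s)\<^sup>2" unfolding n3_square using E2_gt[of s] by (simp add: zero_le_mult_iff)
  show "(z has_real_derivative E s * w s) (at s)" using dz[of s] E_gt[of s] by (simp add: w_def)
  define a where "a = - (x1 s * x2 s) + y1 s * y2 s + z1 s * z2 s"
  define c where "c = real CARD('n) - 1"
  have kap: "\<kappa> s * z s = c * n3 s * E2 s" unfolding c_def by (rule trace_shape_X[OF tr])
  \<comment> \<open>The z-component of this expansion: position contributes the first term, velocity
    the second and the normal the third.\<close>
  have "E2 s * z2 s = E2 s * E2 s * z s + a * z1 s + \<kappa> s * n3 s"
    unfolding a_def \<kappa>_def using hyp''[of s] frame(3,5,6)[of s] by algebra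
  moreover have "(p :: real) = r * zz + a * v / r + c * t\<^sup>2 / zz"
    if "r * p = r * r * zz + a * v + kk * t" "kk * zz = c * t * r" "r > 0" "zz > 0" for p r v zz kk t
  proof -
    have kk: "kk = c * t * r / zz" using that(2,4) by (simp add: field_simps)
    have "p = (r * p) / r" using that(3) by simp
    also have "\<dots> = r * zz + a * v / r + c * t\<^sup>2 / zz"
      unfolding that(1) kk using that(3,4) by (simp add: field_simps power2_eq_square)
    finally show ?thesis .
  qed
  ultimately have z2: "z2 s = E2 s * z s + a * z1 s / E2 s + c * (n3 s)\<^sup>2 / z s"
    using E2_gt[of s] z_pos[of s] kap by blast
  have dw: "(w has_real_derivative (z2 s * E s - z1 s * (a / E s)) / (E s * E s)) (at s)"
    unfolding w_def[abs_def] a_def by (rule DERIV_divide[OF dz1 dE]) (use E_gt[of s] in auto)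
  have alg: "((rr * zz + a * v / rr + c * t / zz) * r - v * (a / r)) / (r * r) = r * (zz + c * (u / zz\<^sup>2) * zz)"
    if "rr = r * r" "t = rr * u" "r > 0" "zz > 0" for rr r zz v t u :: real
    unfolding that(1,2) using that(3,4) by (simp add: field_simps power2_eq_square)
  show "(w has_real_derivative E s * (z s + (real CARD('n) - 1) * ((1 + (z s)\<^sup>2 - (w s)\<^sup>2) / (z s)\<^sup>2) * z s)) (at s)"
    by (rule DERIV_cong[OF dw], unfold z2 c_def[symmetric], rule alg[OF E_E[symmetric] n3_square E_gt z_pos])
qed

end

section \<open>The stability operator on functions homogeneous of degree zero\<close>

lemma has_real_derivative_along_line:
  assumes "(F has_derivative D) (at (u + t0 *\<^sub>R b))"
  shows "((\<lambda>t. F (u + t *\<^sub>R b)) has_real_derivative D b) (at t0)"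
proof -
  have "((\<lambda>t. u + t *\<^sub>R b) has_derivative (\<lambda>t. t *\<^sub>R b)) (at t0)"
    by (auto intro!: derivative_eq_intros)
  then have "((\<lambda>t. F (u + t *\<^sub>R b)) has_derivative (\<lambda>t. D (t *\<^sub>R b))) (at t0)"
    using assms by (rule diff_chain_at[unfolded o_def])
  moreover have "D (t *\<^sub>R b) = D b * t" for t
    using linear_cmul[OF has_derivative_linear[OF assms]] by simp
  ultimately show ?thesis by (simp add: has_field_derivative_def)
qed

lemma frechet_derivative_along_line:
  fixes F :: "'a::real_normed_vector \<Rightarrow> real"
  assumes "F differentiable (at u)" "((\<lambda>t. F (u + t *\<^sub>R b)) has_real_derivative d) (at 0)"
  shows "frechet_derivative F (at u) b = d"
proof -
  have "(F has_derivative frechet_derivative F (at u)) (at (u + 0 *\<^sub>R b))"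
    using assms(1) by (simp add: frechet_derivative_works)
  from DERIV_unique[OF has_real_derivative_along_line[OF this] assms(2)] show ?thesis .
qed

text \<open>A function on the cylinder in its extension that is constant along rays of the sphere
  variable, so that spherical derivatives at unit vectors can be computed as Euclidean ones.\<close>

locale homogeneous_C2 =
  fixes fh :: "real \<times> (real^'n::finite) \<Rightarrow> real" and Om :: "(real \<times> (real^'n)) set"
  assumes open_Om: "open Om" and C2: "C_k_on 2 Om fh"
    and hom: "c > 0 \<Longrightarrow> fh (s, c *\<^sub>R x) = fh (s, x)" and cone: "(s, x) \<in> Om \<Longrightarrow> c > 0 \<Longrightarrow> (s, c *\<^sub>R x) \<in> Om"
begin

definition D1 :: "real \<times> (real^'n) \<Rightarrow> real \<times> (real^'n) \<Rightarrow> real" where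
  "D1 b p = frechet_derivative fh (at p) b"
definition D2 :: "real \<times> (real^'n) \<Rightarrow> real \<times> (real^'n) \<Rightarrow> real \<times> (real^'n) \<Rightarrow> real" where
  "D2 a b p = frechet_derivative (D1 b) (at p) a"

lemma C1_D1: "C_k_on (Suc 0) Om (D1 b)"
  unfolding D1_def[abs_def] using C2 C_k_on_SucD'(2)[of "Suc 0" Om fh b] by (simp add: numeral_2_eq_2)

lemma d1: "p \<in> Om \<Longrightarrow> (fh has_derivative (\<lambda>h. D1 h p)) (at p)"
  unfolding D1_def using C2 C_k_on_SucD'(1)[of "Suc 0" Om fh p] by (simp add: numeral_2_eq_2)

lemma d2: "p \<in> Om \<Longrightarrow> (D1 b has_derivative (\<lambda>h. D2 h b p)) (at p)"
  unfolding D2_def using C1_D1[of b] C_k_on_SucD'(1)[of 0 Om "D1 b" p] by simp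

lemma cont_D1: "continuous_on Om (D1 b)" using C_k_on_SucD[OF C1_D1] by simp
lemma cont_D2: "continuous_on Om (D2 a b)"
  unfolding D2_def[abs_def] using C_k_on_SucD'(2)[OF C1_D1] by simp

lemma D1_linear: "p \<in> Om \<Longrightarrow> linear (\<lambda>h. D1 h p)" by (rule has_derivative_linear[OF d1])
lemma D2_linear: "p \<in> Om \<Longrightarrow> linear (\<lambda>h. D2 h b p)" by (rule has_derivative_linear[OF d2])

lemma D2_sum_right:
  assumes p: "p \<in> Om"
  shows "D2 a (\<Sum>i\<in>(UNIV :: 'i::finite set). c i *\<^sub>R b i) p = (\<Sum>i\<in>UNIV. c i * D2 a (b i) p)"
proof -
  have "((\<lambda>p. \<Sum>i\<in>UNIV. c i * D1 (b i) p) has_derivative (\<lambda>h. \<Sum>i\<in>UNIV. c i * D2 h (b i) p)) (at p)"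
    by (intro has_derivative_sum has_derivative_mult_right d2 p)
  moreover have "(\<Sum>i\<in>UNIV. c i * D1 (b i) p') = D1 (\<Sum>i\<in>UNIV. c i *\<^sub>R b i) p'" if "p' \<in> Om" for p'
    by (simp add: linear_sum[OF D1_linear[OF that]] linear_cmul[OF D1_linear[OF that]])
  ultimately have "(D1 (\<Sum>i\<in>UNIV. c i *\<^sub>R b i) has_derivative (\<lambda>h. \<Sum>i\<in>UNIV. c i * D2 h (b i) p)) (at p)"
    using has_derivative_transform_within_open[OF _ open_Om p] by blast
  from has_derivative_unique[OF this d2[OF p]] show ?thesis by metis
qed

lemma D1_radial:
  assumes p: "(s, x) \<in> Om"
  shows "D1 (0, x) (s, x) = 0"
proof -
  have "((\<lambda>t. fh ((s, x) + t *\<^sub>R (0, x))) has_real_derivative D1 (0, x) (s, x)) (at 0)"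
    by (rule has_real_derivative_along_line) (use d1[OF p] in simp)
  moreover have "((\<lambda>t. fh ((s, x) + t *\<^sub>R (0, x))) has_real_derivative 0) (at 0)"
  proof (rule DERIV_cong_ev[THEN iffD2, OF refl _ refl])
    show "eventually (\<lambda>t. fh ((s, x) + t *\<^sub>R (0, x)) = fh (s, x)) (nhds 0)"
      unfolding eventually_nhds
    proof (intro exI[of _ "{-1<..}"] conjI ballI)
      fix t :: real assume "t \<in> {-1<..}"
      then show "fh ((s, x) + t *\<^sub>R (0, x)) = fh (s, x)"
        using hom[of "1 + t" s x] by (simp add: scaleR_add_left)
    qed auto
  qed simp
  ultimately show ?thesis by (rule DERIV_unique)
qed

text \<open>By \<open>D1_radial\<close> and linearity in the direction, the derivative in direction
  x vanishes along the whole ray through x, so it can be differentiated once more.\<close>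

lemma D2_radial:
  assumes p: "(s, x) \<in> Om"
  shows "D2 (0, x) (0, x) (s, x) = 0"
proof -
  have "((\<lambda>t. D1 (0, x) ((s, x) + t *\<^sub>R (0, x))) has_real_derivative D2 (0, x) (0, x) (s, x)) (at 0)"
    by (rule has_real_derivative_along_line) (use d2[OF p] in simp)
  moreover have "((\<lambda>t. D1 (0, x) ((s, x) + t *\<^sub>R (0, x))) has_real_derivative 0) (at 0)"
  proof (rule DERIV_cong_ev[THEN iffD2, OF refl _ refl])
    show "eventually (\<lambda>t. D1 (0, x) ((s, x) + t *\<^sub>R (0, x)) = 0) (nhds 0)"
      unfolding eventually_nhds
    proof (intro exI[of _ "{-1<..}"] conjI ballI)
      fix t :: real assume "t \<in> {-1<..}"
      then have t: "1 + t > 0" by simp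
      have "(1 + t) * D1 (0, x) (s, (1 + t) *\<^sub>R x) = D1 (0, (1 + t) *\<^sub>R x) (s, (1 + t) *\<^sub>R x)"
        using linear_cmul[OF D1_linear[OF cone[OF p t]], of "1 + t" "(0, x)"] by simp
      also have "\<dots> = 0" by (rule D1_radial[OF cone[OF p t]])
      finally show "D1 (0, x) ((s, x) + t *\<^sub>R (0, x)) = 0" using t by (simp add: scaleR_add_left)
    qed auto
  qed simp
  ultimately show ?thesis by (rule DERIV_unique)
qed

lemma D2_trace:
  fixes R :: "real^'n \<Rightarrow> real^'n"
  assumes p: "p \<in> Om" and R: "orthogonal_transformation R"
  shows "(\<Sum>m\<in>UNIV. D2 (0, R (axis m 1)) (0, R (axis m 1)) p) = (\<Sum>i\<in>UNIV. D2 (0, axis i 1) (0, axis i 1) p)"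
proof -
  \<comment> \<open>Only the facts about \<open>R\<close> and its inverse are used; the index of the
    chart coordinate is irrelevant.\<close>
  interpret stereographic undefined R by unfold_locales (rule R)
  have ex: "(0, v) = (\<Sum>i\<in>UNIV. (v $ i) *\<^sub>R (0 :: real, axis i (1 :: real)))" for v :: "real^'n"
    by (simp add: prod_eq_iff fst_sum snd_sum vec_eq_iff axis_def if_distrib[of "\<lambda>t. _ * t"] sum.delta cong: if_cong)
  have R_rows: "(\<Sum>m\<in>UNIV. R (axis m 1) $ i * R (axis m 1) $ j) = (if i = j then 1 else 0)" for i j
  proof -
    have "R (axis m 1) $ i = R' (axis i 1) $ m" for m i
    proof -
      have "R (axis m 1) $ i = R (axis m 1) \<bullet> R (R' (axis i 1))" by (simp only: R_R' inner_axis) simp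
      also have "\<dots> = R' (axis i 1) $ m" unfolding R_inner by (simp add: inner_axis')
      finally show ?thesis .
    qed
    then have "(\<Sum>m\<in>UNIV. R (axis m 1) $ i * R (axis m 1) $ j) = R' (axis i 1) \<bullet> R' (axis j 1)"
      by (simp add: inner_vec_def)
    then show ?thesis by (simp add: inner_axis_axis)
  qed
  have "D2 (0, v) (0, v) p = (\<Sum>i\<in>UNIV. \<Sum>j\<in>UNIV. v $ i * v $ j * D2 (0, axis i 1) (0, axis j 1) p)" for v
  proof -
    have "D2 (0, v) (0, v) p = (\<Sum>i\<in>UNIV. v $ i * D2 (0, axis i 1) (0, v) p)"
      by (subst ex) (simp only: linear_sum[OF D2_linear[OF p]] linear_cmul[OF D2_linear[OF p]] real_scaleR_def)
    also have "\<dots> = (\<Sum>i\<in>UNIV. v $ i * (\<Sum>j\<in>UNIV. v $ j * D2 (0, axis i 1) (0, axis j 1) p))"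
      by (subst (2) ex) (simp only: D2_sum_right[OF p])
    finally show ?thesis by (simp add: sum_distrib_left mult.assoc)
  qed
  then have "(\<Sum>m\<in>UNIV. D2 (0, R (axis m 1)) (0, R (axis m 1)) p)
    = (\<Sum>m\<in>UNIV. \<Sum>i\<in>UNIV. \<Sum>j\<in>UNIV. R (axis m 1) $ i * R (axis m 1) $ j * D2 (0, axis i 1) (0, axis j 1) p)" by simp
  also have "\<dots> = (\<Sum>i\<in>UNIV. \<Sum>m\<in>UNIV. \<Sum>j\<in>UNIV. R (axis m 1) $ i * R (axis m 1) $ j * D2 (0, axis i 1) (0, axis j 1) p)"
    by (rule sum.swap)
  also have "\<dots> = (\<Sum>i\<in>UNIV. \<Sum>j\<in>UNIV. (\<Sum>m\<in>UNIV. R (axis m 1) $ i * R (axis m 1) $ j) * D2 (0, axis i 1) (0, axis j 1) p)"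
    unfolding sum_distrib_right by (rule sum.cong[OF refl], rule sum.swap)
  also have "\<dots> = (\<Sum>i\<in>UNIV. D2 (0, axis i 1) (0, axis i 1) p)"
    by (simp add: R_rows if_distrib[of "\<lambda>t. t * _"] sum.delta cong: if_cong)
  finally show ?thesis .
qed

end

locale rotation_chart_homogeneous = rotation_chart k R T x y z x1 y1 z1 x2 y2 z2 + homogeneous_C2 fh Om
  for k :: "'n::finite" and R T x y z x1 y1 z1 x2 y2 z2 and fh :: "real \<times> (real^'n) \<Rightarrow> real" and Om
begin

lemma Y_has_derivative: "(Y has_derivative (\<lambda>h. (h \<bullet> e, dsph u h))) (at u)"
  unfolding Y_def[abs_def]
  by (intro has_derivative_Pair bounded_linear_imp_has_derivative[OF bounded_linear_inner_left] sph_has_derivative)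

definition rho :: "real^'n \<Rightarrow> real" where "rho v = E (v \<bullet> e) * (z (v \<bullet> e) / (1 + q v)) ^ (CARD('n) - 1)"
text \<open>The diagonal coefficients of the Laplacian in divergence form: volume density times
  inverse metric.\<close>

definition coef :: "'n \<Rightarrow> real^'n \<Rightarrow> real" where
  "coef i v = rho v * (if i = k then inverse (E (v \<bullet> e) * E (v \<bullet> e)) else (1 + q v)\<^sup>2 / (z (v \<bullet> e))\<^sup>2)"

lemma sqrt_det_metric_X: "sqrt (det (metric_matrix X v)) = rho v"
proof -
  have pos: "z (v \<bullet> e) / (1 + q v) > 0" using z_pos[of "v \<bullet> e"] q_nonneg[of v] by (simp add: divide_pos_pos add_pos_nonneg)
  have sw: "(a\<^sup>2) ^ M = (a ^ M)\<^sup>2" for a :: real and M by (simp add: power_mult[symmetric] mult.commute)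
  have "det (metric_matrix X v) = (\<Prod>i\<in>UNIV. metric_matrix X v $ i $ i)"
    by (rule det_diagonal) (simp add: metric_X)
  also have "\<dots> = E2 (v \<bullet> e) * (\<Prod>i\<in>UNIV - {k}. metric_matrix X v $ i $ i)"
    by (subst prod.remove[of _ k]) (simp_all add: metric_X)
  also have "(\<Prod>i\<in>UNIV - {k}. metric_matrix X v $ i $ i) = (\<Prod>i\<in>UNIV - {k}. (z (v \<bullet> e) / (1 + q v))\<^sup>2)"
    by (rule prod.cong) (auto simp: metric_X power_divide)
  also have "\<dots> = ((z (v \<bullet> e) / (1 + q v))\<^sup>2) ^ (CARD('n) - 1)" by (simp add: card_Diff_singleton)
  also have "E2 (v \<bullet> e) * \<dots> = (rho v)\<^sup>2"
    unfolding sw E_E[symmetric] rho_def power_mult_distrib by (simp only: power2_eq_square[of "E (v \<bullet> e)"])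
  finally show ?thesis using pos E_gt[of "v \<bullet> e"] by (simp add: rho_def)
qed

lemma coef_differentiable: "coef i differentiable (at u)"
proof -
  have 1: "(\<lambda>v. E (v \<bullet> e)) differentiable (at u)"
    using along_e[where a=E and a'="\<lambda>s. (- (x1 s * x2 s) + y1 s * y2 s + z1 s * z2 s) / E s", OF dE] by (rule differentiableI)
  have 2: "(\<lambda>v. z (v \<bullet> e)) differentiable (at u)"
    using along_e[where a=z and a'=z1, OF dz] by (rule differentiableI)
  have 3: "q differentiable (at u)" by (rule differentiableI[OF q_has_derivative])
  have "E (v \<bullet> e) \<noteq> 0" "z (v \<bullet> e) \<noteq> 0" for v using E_gt[of "v \<bullet> e"] z_pos[of "v \<bullet> e"] by auto
  then show ?thesis
    unfolding coef_def[abs_def] rho_def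
    by (cases "i = k")
      (auto intro!: differentiable_mult differentiable_inverse differentiable_divide differentiable_power
        differentiable_add differentiable_const 1 2 3)
qed

text \<open>The metric is diagonal, so the Laplacian is a sum over the chart coordinates. Along the
  centre line the k-th term is the derivative \<open>G\<close> of the flux of the curve direction.
  The other terms are second derivatives in orthonormal tangent directions of the sphere; together
  with the radial one, which is zero, they form the Euclidean Laplacian of the extension.\<close>

lemma laplacian_X:
  assumes p: "(s, R e) \<in> Om"
    and G: "((\<lambda>t. z t ^ (CARD('n) - 1) / E t * D1 (1, 0) (t, R e)) has_real_derivative G) (at s)"
  shows "laplacian X (fh \<circ> Y) (s *\<^sub>R e) = (G + E s * z s ^ (CARD('n) - 1) / (z s)\<^sup>2
      * (\<Sum>i\<in>UNIV. D2 (0, axis i 1) (0, axis i 1) (s, R e))) / (E s * z s ^ (CARD('n) - 1))"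
proof -
  define N where "N = CARD('n) - 1"
  define h where "h = fh \<circ> Y"
  define U where "U = Y -` Om"
  define u0 where "u0 = s *\<^sub>R e"
  define c where "c = E s * z s ^ N / (z s)\<^sup>2"
  have openU: "open U"
    unfolding U_def by (rule open_vimage[OF open_Om]) (use C_k_Y[of 0] in simp)
  have u0: "drp u0 = 0" "u0 \<bullet> e = s" "q u0 = 0" by (simp_all add: u0_def q_def drp_scaleR)
  have Yu0: "Y u0 = (s, R e)" by (simp add: Y_def sph_center u0)
  have u0U: "u0 \<in> U" using p by (simp add: U_def Yu0)
  have C2h: "C_k_on (Suc (Suc 0)) U h"
    unfolding h_def o_def
    by (rule C_k_on_compose[OF open_Om openU _ C2[unfolded numeral_2_eq_2] C_k_on_subset[OF C_k_Y]]) (auto simp: U_def)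
  have dh: "(h has_derivative (\<lambda>b. D1 (b \<bullet> e, dsph v b) (Y v))) (at v)" if "v \<in> U" for v
    unfolding h_def by (rule diff_chain_at[OF Y_has_derivative d1, unfolded o_def[of "\<lambda>b. D1 b _"]]) (use that in \<open>simp add: U_def\<close>)
  have pd: "pderiv_at i h v = D1 (axis i 1 \<bullet> e, dsph v (axis i 1)) (Y v)" if "v \<in> U" for i v
    unfolding pderiv_at_def using frechet_derivative_at[OF dh[OF that], symmetric] by simp
  have pd_diff: "pderiv_at i h differentiable (at u0)" for i
    using C_k_on_SucD'(1)[OF C_k_on_SucD'(2)[OF C2h, of "axis i 1"] u0U]
    unfolding pderiv_at_def[abs_def] by (rule differentiableI)
  define \<Phi> where "\<Phi> i v = coef i v * pderiv_at i h v" for i v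
  have \<Phi>_diff: "\<Phi> i differentiable (at u0)" for i
    unfolding \<Phi>_def[abs_def] by (rule differentiable_mult[OF coef_differentiable pd_diff])
  have open_line: "open {t. u0 + t *\<^sub>R b \<in> U}" and zero_line: "0 \<in> {t. u0 + t *\<^sub>R b \<in> U}" for b
  proof -
    have "continuous_on UNIV (\<lambda>t :: real. u0 + t *\<^sub>R b)" by (intro continuous_intros)
    from open_vimage[OF openU this] show "open {t. u0 + t *\<^sub>R b \<in> U}" by (simp add: vimage_def)
  qed (use u0U in simp)
  have lap: "laplacian X h u0 = (\<Sum>i\<in>UNIV. pderiv_at i (\<Phi> i) u0) / (E s * z s ^ N)"
  proof -
    have "sqrt (det (metric_matrix X v)) * (\<Sum>j\<in>UNIV. matrix_inv (metric_matrix X v) $ i $ j * pderiv_at j h v) = \<Phi> i v" for i v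
      unfolding sqrt_det_metric_X \<Phi>_def coef_def
      by (subst sum.remove[of _ i]) (auto simp: metric_X_inv E_E)
    moreover have "rho u0 = E s * z s ^ N" by (simp add: rho_def u0 N_def)
    ultimately show ?thesis unfolding laplacian_def Let_def by (simp only: sqrt_det_metric_X)
  qed
  have k_term: "pderiv_at k (\<Phi> k) u0 = G"
    unfolding pderiv_at_def
  proof (rule frechet_derivative_along_line[OF \<Phi>_diff])
    have "((\<lambda>t. z (t + s) ^ N / E (t + s) * D1 (1, 0) (t + s, R e)) has_real_derivative G) (at 0)"
      using G DERIV_shift[of "\<lambda>t. z t ^ (CARD('n) - 1) / E t * D1 (1, 0) (t, R e)" G 0 s] by (simp add: N_def)
    then show "((\<lambda>t. \<Phi> k (u0 + t *\<^sub>R axis k 1)) has_real_derivative G) (at 0)"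
    proof (rule has_field_derivative_transform_within_open[OF _ open_line[of "axis k 1"] zero_line])
      fix t assume t: "t \<in> {t. u0 + t *\<^sub>R axis k 1 \<in> U}"
      have v: "u0 + t *\<^sub>R axis k 1 = (t + s) *\<^sub>R e" by (simp add: u0_def axis_k scaleR_add_left)
      have c0: "drp ((t + s) *\<^sub>R e) = 0" "q ((t + s) *\<^sub>R e) = 0" by (simp_all add: q_def drp_scaleR)
      have "pderiv_at k h ((t + s) *\<^sub>R e) = D1 (1, 0) (t + s, R e)"
        using pd[of "(t + s) *\<^sub>R e" k] t v by (simp add: axis_k Y_def sph_center c0)
      moreover have "coef k ((t + s) *\<^sub>R e) = z (t + s) ^ N / E (t + s)"
      proof -
        have "coef k v = z r ^ N / E r" if "q v = 0" "v \<bullet> e = r" for v r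
          using E_gt[of r] that by (simp add: coef_def rho_def N_def field_simps)
        from this[OF c0(2), of "t + s"] show ?thesis by simp
      qed
      ultimately show "z (t + s) ^ N / E (t + s) * D1 (1, 0) (t + s, R e) = \<Phi> k (u0 + t *\<^sub>R axis k 1)"
        unfolding v \<Phi>_def by simp
    qed
  qed
  have other: "pderiv_at i (\<Phi> i) u0 = c * D2 (0, R (axis i 1)) (0, R (axis i 1)) (s, R e)" if ik: "i \<noteq> k" for i
    unfolding pderiv_at_def
  proof (rule frechet_derivative_along_line[OF \<Phi>_diff])
    define b :: "real^'n" where "b = axis i 1"
    have b: "b \<bullet> e = 0" "drp b = b" "b \<bullet> b = 1" using ik by (simp_all add: b_def drp_axis inner_axis_axis)
    define B where "B = R b"
    \<comment> \<open>The image of the coordinate line on the sphere, up to a positive factor that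
      homogeneity allows to drop; this leaves a quadratic polynomial in t.\<close>
    define \<gamma> where "\<gamma> t = (1 - t\<^sup>2 / 4) *\<^sub>R R e + t *\<^sub>R B" for t :: real
    have line: "drp (u0 + t *\<^sub>R b) = t *\<^sub>R b" "(u0 + t *\<^sub>R b) \<bullet> e = s" "q (u0 + t *\<^sub>R b) = t\<^sup>2 / 4" for t
      by (simp_all add: drp_add drp_scaleR u0 b inner_add q_def power2_eq_square)
    have sphl: "sph (u0 + t *\<^sub>R b) = inverse (1 + t\<^sup>2 / 4) *\<^sub>R \<gamma> t" for t
      by (simp add: sph_def m_def line \<gamma>_def B_def R_scaleR R_add)
    have pos: "1 + t\<^sup>2 / 4 > 0" for t :: real by (simp add: add_pos_nonneg)
    have h_line: "h (u0 + t *\<^sub>R b) = fh (s, \<gamma> t)" for t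
      unfolding h_def o_def Y_def line sphl using hom[of "inverse (1 + t\<^sup>2 / 4)"] pos[of t] by simp
    have \<gamma>_Om: "(s, \<gamma> t) \<in> Om" if "u0 + t *\<^sub>R b \<in> U" for t
    proof -
      have "(s, inverse (1 + t\<^sup>2 / 4) *\<^sub>R \<gamma> t) \<in> Om" using that by (simp add: U_def Y_def line sphl)
      from cone[OF this pos[of t]] show ?thesis using pos[of t] by simp
    qed
    have d\<gamma>: "((\<lambda>t. (s, \<gamma> t)) has_derivative (\<lambda>\<tau>. \<tau> *\<^sub>R (0, - (t / 2) *\<^sub>R R e + B))) (at t)" for t
      unfolding \<gamma>_def
      by (auto intro!: derivative_eq_intros simp: fun_eq_iff algebra_simps)
    have d\<gamma>': "((\<lambda>t. F (s, \<gamma> t)) has_real_derivative DF (0, - (t / 2) *\<^sub>R R e + B)) (at t)"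
      if "(F has_derivative DF) (at (s, \<gamma> t))" for F DF t
    proof -
      have "((\<lambda>t. F (s, \<gamma> t)) has_derivative (\<lambda>\<tau>. DF (\<tau> *\<^sub>R (0, - (t / 2) *\<^sub>R R e + B)))) (at t)"
        by (rule diff_chain_at[OF d\<gamma> that, unfolded o_def])
      moreover have "DF (\<tau> *\<^sub>R v) = DF v * \<tau>" for \<tau> v
        using linear_cmul[OF has_derivative_linear[OF that]] by simp
      ultimately show ?thesis by (simp add: has_field_derivative_def del: scaleR_Pair)
    qed
    have pd_line: "pderiv_at i h (u0 + t *\<^sub>R b) = - (t / 2) * D1 (0, R e) (s, \<gamma> t) + D1 (0, B) (s, \<gamma> t)"
      if t: "u0 + t *\<^sub>R b \<in> U" for t
    proof -
      have "((\<lambda>t. h (u0 + t *\<^sub>R b)) has_real_derivative pderiv_at i h (u0 + t *\<^sub>R b)) (at t)"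
        unfolding pd[OF t] b_def[symmetric] by (rule has_real_derivative_along_line[OF dh[OF t]])
      moreover have "((\<lambda>t. h (u0 + t *\<^sub>R b)) has_real_derivative D1 (0, - (t / 2) *\<^sub>R R e + B) (s, \<gamma> t)) (at t)"
        unfolding h_line by (rule d\<gamma>'[OF d1[OF \<gamma>_Om[OF t]]])
      ultimately have "pderiv_at i h (u0 + t *\<^sub>R b) = D1 (0, - (t / 2) *\<^sub>R R e + B) (s, \<gamma> t)" by (rule DERIV_unique)
      also have "(0 :: real, - (t / 2) *\<^sub>R R e + B) = (- (t / 2)) *\<^sub>R (0, R e) + (0, B)" by simp
      also have "D1 \<dots> (s, \<gamma> t) = - (t / 2) * D1 (0, R e) (s, \<gamma> t) + D1 (0, B) (s, \<gamma> t)"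
        unfolding linear_add[OF D1_linear[OF \<gamma>_Om[OF t]]] linear_cmul[OF D1_linear[OF \<gamma>_Om[OF t]]] by simp
      finally show ?thesis .
    qed
    have \<gamma>0: "\<gamma> 0 = R e" by (simp add: \<gamma>_def)
    have dD1: "((\<lambda>t. D1 v (s, \<gamma> t)) has_real_derivative D2 (0, B) v (s, R e)) (at 0)" for v
      using d\<gamma>'[of "D1 v" "\<lambda>h. D2 h v (s, R e)" 0] d2[OF p, of v] by (simp add: \<gamma>0)
    have "((\<lambda>t. - (t / 2) * D1 (0, R e) (s, \<gamma> t) + D1 (0, B) (s, \<gamma> t)) has_real_derivative D2 (0, B) (0, B) (s, R e)) (at 0)"
      by (auto intro!: derivative_eq_intros dD1 simp: \<gamma>0 D1_radial[OF p])
    then have dpd: "((\<lambda>t. pderiv_at i h (u0 + t *\<^sub>R b)) has_real_derivative D2 (0, B) (0, B) (s, R e)) (at 0)"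
      by (rule has_field_derivative_transform_within_open[OF _ open_line[of b] zero_line]) (simp add: pd_line)
    have coefl: "coef i (u0 + t *\<^sub>R b) = E s * (z s / (1 + t\<^sup>2 / 4)) ^ N * ((1 + t\<^sup>2 / 4)\<^sup>2 / (z s)\<^sup>2)" for t
      using ik by (simp add: coef_def rho_def line N_def)
    \<comment> \<open>The coefficient depends on t only through t^2, so at the centre it does not
      contribute to the derivative of the product.\<close>
    have dc: "((\<lambda>t. coef i (u0 + t *\<^sub>R b)) has_real_derivative 0) (at 0)"
      unfolding coefl using z_pos[of s] by (auto intro!: derivative_eq_intros)
    have "((\<lambda>t. \<Phi> i (u0 + t *\<^sub>R b)) has_real_derivative c * D2 (0, B) (0, B) (s, R e)) (at 0)"
      unfolding \<Phi>_def using DERIV_mult[OF dc dpd] coefl[of 0] by (simp add: c_def mult.commute)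
    then show "((\<lambda>t. \<Phi> i (u0 + t *\<^sub>R axis i 1)) has_real_derivative c * D2 (0, R (axis i 1)) (0, R (axis i 1)) (s, R e)) (at 0)"
      by (simp only: b_def B_def)
  qed
  have "(\<Sum>i\<in>UNIV. pderiv_at i (\<Phi> i) u0) = G + (\<Sum>i\<in>UNIV - {k}. c * D2 (0, R (axis i 1)) (0, R (axis i 1)) (s, R e))"
    by (subst sum.remove[of _ k]) (auto simp: k_term other)
  \<comment> \<open>The missing direction \<open>R e\<close> is radial and contributes zero, so the
    sum can run over a full orthonormal basis and \<open>D2_trace\<close> applies.\<close>
  also have "(\<Sum>i\<in>UNIV - {k}. c * D2 (0, R (axis i 1)) (0, R (axis i 1)) (s, R e)) = (\<Sum>i\<in>UNIV. c * D2 (0, R (axis i 1)) (0, R (axis i 1)) (s, R e))"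
    by (subst (2) sum.remove[of _ k]) (auto simp: axis_k D2_radial[OF p])
  also have "\<dots> = c * (\<Sum>i\<in>UNIV. D2 (0, axis i 1) (0, axis i 1) (s, R e))"
    unfolding sum_distrib_left[symmetric] D2_trace[OF p R] ..
  finally show ?thesis unfolding h_def[symmetric] u0_def[symmetric] lap c_def N_def by simp
qed

text \<open>The eigenvalue equation multiplied by the area density, with \<open>normsq_X\<close> and
  minimality expressing |A|^2 by the profile functions. This is the equation required in
  \<open>two_solutions\<close>.\<close>

lemma jacobi_equation:
  assumes p: "(s, R e) \<in> Om"
    and G: "((\<lambda>t. z t ^ (CARD('n) - 1) / E t * D1 (1, 0) (t, R e)) has_real_derivative G) (at s)"
    and tr: "trace (shape_operator X (s *\<^sub>R e)) = 0"
    and eig: "stability_operator X (fh \<circ> Y) (s *\<^sub>R e) = - lam * fh (s, R e)"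
  shows "G + E s * z s ^ (CARD('n) - 1) / (z s)\<^sup>2 * (\<Sum>i\<in>UNIV. D2 (0, axis i 1) (0, axis i 1) (s, R e))
      + (real CARD('n) * (real CARD('n) - 1) * ((1 + (z s)\<^sup>2 - (w s)\<^sup>2) / (z s)\<^sup>2) - real CARD('n))
          * E s * z s ^ (CARD('n) - 1) * fh (s, R e)
      = - lam * E s * z s ^ (CARD('n) - 1) * fh (s, R e)"
proof -
  have Y0: "(fh \<circ> Y) (s *\<^sub>R e) = fh (s, R e)" by (simp add: Y_def sph_center drp_scaleR)
  have n3: "(n3 s)\<^sup>2 / (E2 s * (z s)\<^sup>2) = (1 + (z s)\<^sup>2 - (w s)\<^sup>2) / (z s)\<^sup>2"
    unfolding n3_square using E2_gt[of s] by simp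
  have alg: "a + m * b * c = - l * b * c" if "a / b + m * c = - l * c" "b > 0" for a b c m l :: real
    using that by (simp add: field_simps)
  have "E s * z s ^ (CARD('n) - 1) > 0" using E_gt[of s] z_pos[of s] by simp
  from alg[OF eig[unfolded stability_operator_def normsq_X[OF trace_shape_X[OF tr]] laplacian_X[OF p G] Y0 n3] this]
  show ?thesis by (simp only: mult.assoc)
qed

end

section \<open>From Dirichlet eigenfunctions on the catenoid to a pair of solutions\<close>

text \<open>Nonzero functions that are dependent are nonzero multiples of each other, so their inner
  product does not vanish; for different eigenvalues it would, by
  \<open>N_orthogonal\<close>.\<close>

lemma (in two_solutions) eigenvalues_equal:
  assumes "f True (s, x) \<noteq> 0" "f False (s', x') \<noteq> 0"
  shows "lam True = lam False"
proof (rule ccontr)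
  assume "lam True \<noteq> lam False"
  then have N0: "N True False = 0" by (rule N_orthogonal)
  obtain \<alpha> where \<alpha>: "\<alpha> True \<noteq> 0 \<or> \<alpha> False \<noteq> 0" "\<And>p. \<alpha> True * f True p + \<alpha> False * f False p = 0"
    using linearly_dependent by blast
  have "\<alpha> True \<noteq> 0" using \<alpha>(1) \<alpha>(2)[of "(s', x')"] assms(2) by auto
  define c where "c = - (\<alpha> False / \<alpha> True)"
  have c: "f True p = c * f False p" for p
    using \<alpha>(2)[of p] \<open>\<alpha> True \<noteq> 0\<close> by (simp add: c_def field_simps eq_neg_iff_add_eq_0)
  then have "c \<noteq> 0" using assms(1) by auto
  define h where "h = (\<lambda>p. E (fst p) * P (fst p) * (f False p * f False p))"
  have "0 < (\<integral>p. h p \<partial>cylM)"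
  proof (rule cyl_cont_integral_pos)
    show "cyl_cont S h" unfolding h_def by (rule cyl_N)
    show "0 \<le> h p" for p using E_pos[of "fst p"] P_pos[of "fst p"] by (simp add: h_def)
    show "h (s, c *\<^sub>R x) = h (s, x)" if "c > 0" for s c x using that by (simp add: h_def f_hom)
    show "h (s', x') > 0" using E_pos[of s'] P_pos[of s'] assms(2)
      by (auto simp: h_def zero_less_mult_iff)
  qed
  moreover have "N True False = c * (\<integral>p. h p \<partial>cylM)"
    unfolding N_def c h_def integral_mult_right_zero[symmetric] by (simp add: mult_ac)
  ultimately show False using N0 \<open>c \<noteq> 0\<close> by simp
qed

lemma smooth_on_real_derivative:
  fixes f :: "real \<Rightarrow> real"
  assumes f: "smooth_on UNIV f"
  obtains f' where "\<And>s. (f has_real_derivative f' s) (at s)" "smooth_on UNIV f'"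
proof
  show "smooth_on UNIV (\<lambda>s. frechet_derivative f (at s) 1)"
    using f C_k_on_SucD'(2) unfolding smooth_on_def by blast
  have D: "(f has_derivative frechet_derivative f (at s)) (at s)" for s
    using f C_k_on_SucD'(1)[of 0 UNIV f s] unfolding smooth_on_def by blast
  show "(f has_real_derivative frechet_derivative f (at s) 1) (at s)" for s
    using has_real_derivative_along_line[of f "frechet_derivative f (at s)" 0 s 1] D[of s] by simp
qed

lemma has_derivative_snd_axis:
  fixes F :: "'a::real_normed_vector \<times> (real^'n::finite) \<Rightarrow> real"
  assumes F: "(F has_derivative D) (at (s, x))"
  shows "((\<lambda>y. F (s, y)) has_derivative (\<lambda>h. \<Sum>i\<in>UNIV. h $ i * D (0, axis i 1))) (at x)"
proof -
  have "((\<lambda>y. (s, y)) has_derivative (\<lambda>h. (0, h))) (at x)" by (auto intro!: derivative_eq_intros)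
  then have F2: "((\<lambda>y. F (s, y)) has_derivative (\<lambda>h. D (0, h))) (at x)" using F by (rule diff_chain_at[unfolded o_def])
  have "D (0, h) = (\<Sum>i\<in>UNIV. h $ i * D (0, axis i 1))" for h
  proof -
    have "(0, h) = (\<Sum>i\<in>UNIV. (h $ i) *\<^sub>R (0 :: 'a, axis i (1 :: real)))"
      by (simp add: prod_eq_iff fst_sum snd_sum vec_eq_iff axis_def if_distrib[of "\<lambda>t. _ * t"] sum.delta cong: if_cong)
    then show ?thesis
      by (simp only: linear_sum[OF has_derivative_linear[OF F]] linear_cmul[OF has_derivative_linear[OF F]] real_scaleR_def)
  qed
  then show ?thesis by (intro has_derivative_eq_rhs[OF F2] ext)
qed

text \<open>One set of profile functions serves the charts for all rotations \<open>R\<close>. The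
  velocity of the generating curve is nonzero because the map is an immersion, and a nonzero tangent
  vector of the hyperboloid is spacelike.\<close>

lemma catenoid_charts:
  fixes F :: "real \<times> (real^'n::finite) \<Rightarrow> 'n lorentz"
  assumes cat: "spherical_catenoid F"
  obtains T x y z x1 y1 z1 x2 y2 z2 where
    "\<And>R :: real^'n \<Rightarrow> real^'n. orthogonal_transformation R \<Longrightarrow> rotation_chart R T x y z x1 y1 z1 x2 y2 z2"
    "\<And>(k :: 'n) R. orthogonal_transformation R \<Longrightarrow> F \<circ> stereographic.Y k R = rotated_curve_chart.X k R T x y z"
    "continuous_on UNIV x2" "continuous_on UNIV y2" "continuous_on UNIV z2"
proof -
  obtain T x y z where T: "hyperbolic_isometry T" and sm: "smooth_on UNIV x" "smooth_on UNIV y" "smooth_on UNIV z"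
    and z: "\<And>s. z s > 0" and F: "\<And>p. p \<in> cylinder \<Longrightarrow> F p = T (rotate_curve x y z p)"
    using cat unfolding spherical_catenoid_def by blast
  have imm: "immersed_hypersurface cylinder F"
    using cat unfolding spherical_catenoid_def minimal_hypersurface_def by blast
  have linT: "linear T" and Ti: "lorentz_inner (T p) (T p') = lorentz_inner p p'" for p p'
    using T unfolding hyperbolic_isometry_def by blast+
  have hyp: "x s * x s = 1 + y s * y s + z s * z s" for s
  proof -
    define \<omega> :: "real^'n" where "\<omega> = axis undefined 1"
    have p: "(s, \<omega>) \<in> cylinder" by (simp add: \<omega>_def norm_axis_1)
    then have "F (s, \<omega>) \<in> hyperbolic_space" using imm unfolding immersed_hypersurface_def by blast
    then have "lorentz_inner (rotate_curve x y z (s, \<omega>)) (rotate_curve x y z (s, \<omega>)) = -1"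
      unfolding F[OF p] hyperbolic_space_def using Ti by simp
    then show ?thesis by (simp add: rotate_curve_def \<omega>_def inner_axis_axis)
  qed
  obtain x1 where x1: "\<And>s. (x has_real_derivative x1 s) (at s)" "smooth_on UNIV x1" using smooth_on_real_derivative[OF sm(1)] by blast
  obtain y1 where y1: "\<And>s. (y has_real_derivative y1 s) (at s)" "smooth_on UNIV y1" using smooth_on_real_derivative[OF sm(2)] by blast
  obtain z1 where z1: "\<And>s. (z has_real_derivative z1 s) (at s)" "smooth_on UNIV z1" using smooth_on_real_derivative[OF sm(3)] by blast
  obtain x2 where x2: "\<And>s. (x1 has_real_derivative x2 s) (at s)" "smooth_on UNIV x2" using smooth_on_real_derivative[OF x1(2)] by blast
  obtain y2 where y2: "\<And>s. (y1 has_real_derivative y2 s) (at s)" "smooth_on UNIV y2" using smooth_on_real_derivative[OF y1(2)] by blast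
  obtain z2 where z2: "\<And>s. (z1 has_real_derivative z2 s) (at s)" "smooth_on UNIV z2" using smooth_on_real_derivative[OF z1(2)] by blast
  have cont: "continuous_on UNIV h" if "smooth_on UNIV h" for h :: "real \<Rightarrow> real"
    using that C_k_on.simps(1) unfolding smooth_on_def by blast
  have chart: "rotated_curve_chart R T x y z x1 y1 z1 x2 y2 z2" if "orthogonal_transformation R" for R :: "real^'n \<Rightarrow> real^'n"
    by (intro rotated_curve_chart.intro stereographic.intro rotated_curve_chart_axioms.intro
        that linT Ti hyp z x1(1) y1(1) z1(1) x2(1) y2(1) z2(1))
  have FX: "F \<circ> stereographic.Y k R = rotated_curve_chart.X k R T x y z" if "orthogonal_transformation R" for k :: 'n and R
  proof -
    interpret rotated_curve_chart k R T x y z x1 y1 z1 x2 y2 z2 by (rule chart[OF that])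
    show ?thesis
    proof
      fix u show "(F \<circ> Y) u = X u" using F[OF Y_cylinder[of u]] by (simp add: rotate_curve_def Y_def X_def)
    qed
  qed
  have pos: "- (x1 s * x1 s) + y1 s * y1 s + z1 s * z1 s > 0" for s
  proof -
    define k :: 'n where "k = undefined"
    have id: "orthogonal_transformation (id :: real^'n \<Rightarrow> real^'n)" by (simp add: orthogonal_transformation_id id_def)
    interpret rotated_curve_chart k id T x y z x1 y1 z1 x2 y2 z2 by (rule chart[OF id])
    have "inj (frechet_derivative (F \<circ> Y) (at (s *\<^sub>R e)))"
      using imm chart_Y[OF open_UNIV] unfolding immersed_hypersurface_def by blast
    then have inj_dX: "inj (\<lambda>h. T ((h \<bullet> e) * x1 s, (h \<bullet> e) * y1 s, z s *\<^sub>R dsph (s *\<^sub>R e) h + ((h \<bullet> e) * z1 s) *\<^sub>R sph (s *\<^sub>R e)))"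
      unfolding FX[OF id] using frechet_derivative_at[OF X_has_derivative[of "s *\<^sub>R e"]] by simp
    have "e \<noteq> 0" using e_e by (metis inner_zero_left zero_neq_one)
    with injD[OF inj_dX, of e 0] have nz: "\<not> (x1 s = 0 \<and> y1 s = 0 \<and> z1 s = 0)"
      by (auto simp: dsph_def dq_def drp_def)
    define a where "a = y1 s * y1 s + z1 s * z1 s"
    have xx: "x s * x s \<ge> 1" using hyp[of s] by simp
    have "a > 0"
    proof (rule ccontr)
      assume "\<not> a > 0"
      then have yz: "y1 s = 0" "z1 s = 0" unfolding a_def by (auto simp: not_less sum_squares_le_zero_iff)
      then have "x s * x1 s = 0" using hyp'[of s] by simp
      moreover have "x s \<noteq> 0" using xx by auto
      ultimately show False using nz yz by simp
    qed
    \<comment> \<open>Lagrange's identity in the plane of the last two coordinates; with the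
      hyperboloid equation it gives the reverse Cauchy-Schwarz inequality.\<close>
    have "(x s * x1 s) * (x s * x1 s) + (y s * z1 s - z s * y1 s)\<^sup>2 = (y s * y s + z s * z s) * a"
      unfolding hyp' a_def by (simp add: power2_eq_square algebra_simps)
    moreover have "y s * y s + z s * z s = x s * x s - 1" using hyp[of s] by simp
    ultimately have "x s * x s * (a - x1 s * x1 s) = a + (y s * z1 s - z s * y1 s)\<^sup>2"
      by (simp add: algebra_simps)
    also have "\<dots> > 0" using \<open>a > 0\<close> by (simp add: add_pos_nonneg)
    finally have "a - x1 s * x1 s > 0" using xx by (simp add: zero_less_mult_iff)
    then show ?thesis by (simp add: a_def)
  qed
  have "rotation_chart R T x y z x1 y1 z1 x2 y2 z2" if "orthogonal_transformation R" for R :: "real^'n \<Rightarrow> real^'n"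
    using chart[OF that] pos by (simp add: rotation_chart_def rotation_chart_axioms_def)
  then show ?thesis using that[of T x y z x1 y1 z1 x2 y2 z2] FX cont x2(2) y2(2) z2(2) by blast
qed

text \<open>The extension that is constant along rays, with the default value at the origin that
  \<open>cyl_cont\<close> prescribes.\<close>

definition extend :: "(real \<times> (real^'n::finite) \<Rightarrow> real) \<Rightarrow> real \<times> (real^'n) \<Rightarrow> real" where
  "extend f p = (if snd p = 0 then 0 else f (fst p, sgn (snd p)))"

lemma extend_unit: "norm x = 1 \<Longrightarrow> extend f (s, x) = f (s, x)"
  by (auto simp: extend_def sgn_div_norm)

lemma cone_over:
  fixes G :: "(real \<times> (real^'n::finite)) set"
  assumes "open G"
  shows "open {p. snd p \<noteq> 0 \<and> (fst p, sgn (snd p)) \<in> G}"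
    and "continuous_on {p. snd p \<noteq> 0} (\<lambda>p :: real \<times> (real^'n). (fst p, sgn (snd p)))"
proof -
  have o: "open {p :: real \<times> (real^'n). snd p \<noteq> 0}"
    by (intro open_Collect_neq continuous_intros)
  show c: "continuous_on {p. snd p \<noteq> 0} (\<lambda>p :: real \<times> (real^'n). (fst p, sgn (snd p)))"
    unfolding sgn_div_norm by (intro continuous_intros) auto
  have "open ({p. snd p \<noteq> 0} \<inter> (\<lambda>p. (fst p, sgn (snd p))) -` G)"
    by (rule continuous_open_preimage[OF c o assms])
  then show "open {p. snd p \<noteq> 0 \<and> (fst p, sgn (snd p)) \<in> G}"
    by (simp add: vimage_def Int_def)
qed

context
  fixes F :: "real \<times> (real^'n::finite) \<Rightarrow> 'n lorentz" and \<Omega> G and f :: "real \<times> (real^'n) \<Rightarrow> real" and lam S :: real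
  assumes f: "f \<in> dirichlet_eigenspace cylinder F \<Omega> lam"
    and \<Omega>: "compact_domain cylinder \<Omega>" and G: "open G" "top_of_set cylinder interior_of \<Omega> = cylinder \<inter> G"
    and S: "\<And>s x. (s, x) \<in> \<Omega> \<Longrightarrow> \<bar>s\<bar> \<le> S"
begin

text \<open>A point of the domain that is not interior lies on the frontier, where the boundary
  condition holds; outside the domain the function is zero by convention.\<close>

lemma eigenfunction_zero:
  assumes "p \<in> cylinder" "p \<notin> G"
  shows "f p = 0"
proof (cases "p \<in> \<Omega>")
  case True
  have "\<Omega> \<subseteq> cylinder" using \<Omega> by (simp add: compact_domain_def)
  then have "\<Omega> \<subseteq> top_of_set cylinder closure_of \<Omega>" by (intro closure_of_subset) simp
  then have "p \<in> top_of_set cylinder frontier_of \<Omega>"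
    using True assms G(2) by (auto simp: frontier_of_def)
  then show ?thesis using f unfolding dirichlet_eigenspace_def by blast
next
  case False
  then show ?thesis using f unfolding dirichlet_eigenspace_def by blast
qed

lemma extend_zero: "p \<notin> {p. snd p \<noteq> 0 \<and> (fst p, sgn (snd p)) \<in> G} \<Longrightarrow> extend f p = 0"
  by (cases p) (auto simp: extend_def norm_sgn intro!: eigenfunction_zero)

text \<open>The cylinder is the union of the compact domain and the closed set
  \<open>cylinder - G\<close>. The function is continuous on the first and zero on the second, so
  the two pieces glue.\<close>

lemma cyl_cont_extend: "cyl_cont S (extend f)"
proof -
  have \<Omega>': "\<Omega> \<subseteq> cylinder" "compact \<Omega>" using \<Omega> by (auto simp: compact_domain_def)
  have "top_of_set cylinder interior_of \<Omega> \<subseteq> \<Omega>" by (rule interior_of_subset)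
  then have cyl: "cylinder = \<Omega> \<union> (cylinder - G)" using \<Omega>' G(2) by blast
  have "continuous_on (cylinder - G) f \<longleftrightarrow> continuous_on (cylinder - G) (\<lambda>_. 0 :: real)"
    by (rule continuous_on_cong) (auto intro: eigenfunction_zero)
  moreover have "continuous_on \<Omega> f" using f unfolding dirichlet_eigenspace_def by blast
  moreover have "closed (cylinder - G)" using G(1) by (intro closed_Diff closed_Times) auto
  ultimately have "continuous_on (\<Omega> \<union> (cylinder - G)) f"
    using \<Omega>'(2) by (intro continuous_on_closed_Un) (auto simp: compact_imp_closed)
  then have cf: "continuous_on cylinder f" by (simp only: cyl[symmetric])
  have "continuous_on (UNIV \<times> (- {0})) (\<lambda>p. f (fst p, sgn (snd p)))"
    by (rule continuous_on_compose2[OF cf continuous_on_subset[OF cone_over(2)[OF open_UNIV]]]) (auto simp: norm_sgn)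
  then have "continuous_on (UNIV \<times> (- {0})) (extend f)"
    by (rule continuous_on_eq) (auto simp: extend_def)
  moreover have "extend f (s, x) = 0" if "\<bar>s\<bar> > S" for s x
  proof -
    have "(s, sgn x) \<notin> \<Omega>" using S[of s "sgn x"] that by linarith
    then show ?thesis using f unfolding dirichlet_eigenspace_def by (auto simp: extend_def)
  qed
  ultimately show ?thesis by (auto simp: cyl_cont_def extend_def)
qed

text \<open>Eigenfunctions are smooth only in charts. Near a given point, the extension is the
  radial projection followed by the inverse \<open>Z\<close> of a chart centred there and by the
  chart expression of the function, each of class C^2 on open sets.\<close>

lemma homogeneous_C2_extend: "homogeneous_C2 (extend f) {p. snd p \<noteq> 0 \<and> (fst p, sgn (snd p)) \<in> G}" (is "homogeneous_C2 _ ?Om")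
proof
  show "open ?Om" by (rule cone_over(1)[OF G(1)])
  show "extend f (s, c *\<^sub>R x) = extend f (s, x)" if "c > 0" for c s x using that by (simp add: extend_def sgn_scaleR)
  show "(s, c *\<^sub>R x) \<in> ?Om" if "(s, x) \<in> ?Om" "c > 0" for s x c using that by (simp add: sgn_scaleR)
  show "C_k_on 2 ?Om (extend f)"
  proof (rule C_k_on_local)
    fix p0 assume p0: "p0 \<in> ?Om"
    define k :: 'n where "k = undefined"
    have "norm (axis k (1 :: real)) = 1" "norm (sgn (snd p0)) = 1" using p0 by (simp_all add: norm_axis_1 norm_sgn)
    then obtain R :: "real^'n \<Rightarrow> real^'n" where Ro: "orthogonal_transformation R" "R (axis k 1) = sgn (snd p0)"
      using orthogonal_transformation_exists_1 by blast
    interpret stereographic k R by unfold_locales (rule Ro(1))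
    define \<phi> where "\<phi> = (\<lambda>p :: real \<times> (real^'n). (fst p, sgn (snd p)))"
    define U where "U = Y -` G"
    define W0 where "W0 = {p. snd p \<noteq> 0 \<and> \<phi> p \<in> W \<inter> G}"
    have openU: "open U" unfolding U_def by (rule open_vimage[OF G(1)]) (use C_k_Y[of 0] in simp)
    have openW0: "open W0" unfolding W0_def \<phi>_def by (rule cone_over(1)) (intro open_Int open_W G(1))
    have cyl: "\<phi> p \<in> cylinder" if "p \<in> W0" for p using that by (simp add: W0_def \<phi>_def norm_sgn)
    have YZ: "Y (Z (\<phi> p)) = \<phi> p" if "p \<in> W0" for p
      using Y_Z[OF cyl[OF that]] that by (simp add: W0_def)
    have "chart cylinder U Y" by (rule chart_Y[OF openU])
    moreover have "Y ` U \<subseteq> top_of_set cylinder interior_of \<Omega>" unfolding G(2) U_def using Y_cylinder by blast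
    ultimately have C2: "C_k_on 2 U (f \<circ> Y)" using f unfolding dirichlet_eigenspace_def by blast
    have C\<phi>: "C_k_on 2 W0 \<phi>"
      unfolding \<phi>_def
      by (intro C_k_on_Pair openW0 C_k_on_bounded_linear bounded_linear_fst C_k_on_sgn bounded_linear_snd) (simp add: W0_def)
    have CZ: "C_k_on 2 W0 (\<lambda>p. Z (\<phi> p))"
      by (rule C_k_on_compose[OF open_W openW0 _ C_k_Z C\<phi>]) (simp add: W0_def)
    have C2': "C_k_on 2 W0 (\<lambda>p. (f \<circ> Y) (Z (\<phi> p)))"
      by (rule C_k_on_compose[OF openU openW0 _ C2 CZ]) (simp add: U_def YZ, simp add: W0_def)
    have eq: "(f \<circ> Y) (Z (\<phi> p)) = extend f p" if "p \<in> W0" for p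
      using YZ[OF that] that by (simp add: W0_def extend_def \<phi>_def)
    have "C_k_on 2 W0 (extend f)"
      by (rule C_k_on_cong[where f="\<lambda>p. (f \<circ> Y) (Z (\<phi> p))" and g="extend f", OF openW0 eq, THEN iffD1, OF _ C2'])
    moreover have "p0 \<in> W0"
      using p0 by (auto simp: W0_def \<phi>_def W_def Ro(2)[symmetric] inner_axis_axis e_def[symmetric])
    ultimately show "\<exists>W. open W \<and> p0 \<in> W \<and> C_k_on 2 W (extend f)" using openW0 by blast
  qed
qed

end

text \<open>The extended functions satisfy the assumptions of \<open>two_solutions\<close>. The
  conclusions are carried back on the cylinder, where a function and its extension agree.\<close>

lemma eigenfunction_pair:
  fixes F :: "real \<times> (real^'n::finite) \<Rightarrow> 'n lorentz" and lam :: "bool \<Rightarrow> real"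
  assumes n2: "CARD('n) \<ge> 2" and cat: "spherical_catenoid F" and \<Omega>: "compact_domain cylinder \<Omega>"
    and lam: "\<And>b. lam b < 0" and f: "\<And>b. f b \<in> dirichlet_eigenspace cylinder F \<Omega> (lam b)"
  shows "\<exists>\<alpha>. (\<alpha> True \<noteq> 0 \<or> \<alpha> False \<noteq> 0) \<and> (\<forall>p. \<alpha> True * f True p + \<alpha> False * f False p = 0)"
    and "f True p \<noteq> 0 \<Longrightarrow> f False p' \<noteq> 0 \<Longrightarrow> lam True = lam False"
proof -
  obtain T x y z x1 y1 z1 x2 y2 z2 where
    rc: "\<And>R :: real^'n \<Rightarrow> real^'n. orthogonal_transformation R \<Longrightarrow> rotation_chart R T x y z x1 y1 z1 x2 y2 z2"
    and FX: "\<And>(k :: 'n) R. orthogonal_transformation R \<Longrightarrow> F \<circ> stereographic.Y k R = rotated_curve_chart.X k R T x y z"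
    and cont2: "continuous_on UNIV x2" "continuous_on UNIV y2" "continuous_on UNIV z2"
    using catenoid_charts[OF cat] by blast
  have tr: "trace (shape_operator (rotated_curve_chart.X k R T x y z) u) = 0" if R: "orthogonal_transformation R" for k :: 'n and R u
  proof -
    interpret stereographic k R by unfold_locales (rule R)
    show ?thesis using cat chart_Y[OF open_UNIV] FX[OF R, of k]
      unfolding spherical_catenoid_def minimal_hypersurface_def by (metis UNIV_I)
  qed
  obtain G where G: "open G" "top_of_set cylinder interior_of \<Omega> = cylinder \<inter> G"
    using openin_interior_of[of "top_of_set cylinder" \<Omega>] unfolding openin_open by blast
  obtain S where S: "\<And>s x. (s, x) \<in> \<Omega> \<Longrightarrow> \<bar>s\<bar> \<le> S"
  proof -
    have "bounded \<Omega>" using \<Omega> by (auto simp: compact_domain_def compact_imp_bounded)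
    then obtain B where B: "\<And>p. p \<in> \<Omega> \<Longrightarrow> norm p \<le> B" by (auto simp: bounded_iff)
    show ?thesis
    proof (rule that)
      show "\<bar>s\<bar> \<le> B" if "(s, x) \<in> \<Omega>" for s x
        using B[OF that] norm_fst_le[of s x] by simp
    qed
  qed
  define Om where "Om = {p. snd p \<noteq> 0 \<and> (fst p, sgn (snd p)) \<in> G}"
  define fh where "fh b = extend (f b)" for b
  have H: "homogeneous_C2 (fh b) Om" for b
    unfolding fh_def Om_def by (rule homogeneous_C2_extend[OF f \<Omega> G S])
  note H_D1 = homogeneous_C2.d1[OF H] and H_D2 = homogeneous_C2.d2[OF H]
  define k :: 'n where "k = undefined"
  have id: "orthogonal_transformation (id :: real^'n \<Rightarrow> real^'n)" by (simp add: orthogonal_transformation_id id_def)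
  \<comment> \<open>The profile functions \<open>E\<close> and \<open>w\<close> do not depend on the
    rotation, so the chart for the identity supplies them for all others.\<close>
  interpret R0: rotation_chart k id T x y z x1 y1 z1 x2 y2 z2 by (rule rc[OF id])
  interpret RP: rotation_profile_dim "CARD('n)" z R0.E R0.w "TYPE('n)"
    by (intro rotation_profile_dim.intro rotation_profile_dim_axioms.intro R0.rotation_profile_X[OF n2 tr[OF id]] refl)
  define dE where "dE s = (- (x1 s * x2 s) + y1 s * y2 s + z1 s * z2 s) / R0.E s" for s
  define pe where "pe s = z s ^ (CARD('n) - 1) / R0.E s" for s
  define pe' where "pe' s = (real (CARD('n) - 1) * z s ^ (CARD('n) - 2) * z1 s * R0.E s - z s ^ (CARD('n) - 1) * dE s) / (R0.E s * R0.E s)" for s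
  have dpe: "(pe has_real_derivative pe' s) (at s)" for s
    unfolding pe_def[abs_def] pe'_def dE_def
    by (rule DERIV_cong[OF DERIV_divide[OF DERIV_power[OF R0.dz] R0.dE]]) (simp_all add: mult_ac numeral_2_eq_2)
  have E0: "R0.E s \<noteq> 0" for s using R0.E_gt[of s] by simp
  have c: "continuous_on UNIV x1" "continuous_on UNIV y1" "continuous_on UNIV z1" "continuous_on UNIV z" "continuous_on UNIV R0.E"
    using R0.dx1 R0.dy1 R0.dz1 R0.dz R0.dE by (auto intro!: continuous_at_imp_continuous_on DERIV_isCont)
  have cpe: "continuous_on UNIV pe" "continuous_on UNIV pe'"
    unfolding pe_def[abs_def] pe'_def[abs_def] dE_def by (intro continuous_intros c cont2; simp add: E0)+
  have cfst: "continuous_on Om (\<lambda>p. h (fst p))" if "continuous_on UNIV h" for h :: "real \<Rightarrow> real"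
    by (rule continuous_on_compose2[OF that]) (auto intro!: continuous_intros)
  define fs where "fs b = homogeneous_C2.D1 (fh b) (1, 0)" for b
  define fx where "fx b i = homogeneous_C2.D1 (fh b) (0, axis i 1)" for b i
  define fxx where "fxx b i j = homogeneous_C2.D2 (fh b) (0, axis j 1) (0, axis i 1)" for b i j
  define g where "g b p = pe' (fst p) * fs b p + homogeneous_C2.D2 (fh b) (1, 0) (1, 0) p * pe (fst p)" for b p
  have dt: "((\<lambda>t. K (t, v)) has_real_derivative D (1, 0)) (at s)" if "(K has_derivative D) (at (s, v))"
    for K :: "real \<times> (real^'n) \<Rightarrow> real" and D s v
  proof -
    have "(0, v) + t *\<^sub>R (1, 0) = (t, v)" for t :: real and v :: "real^'n"
      unfolding scaleR_Pair add_Pair by simp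
    note line = this
    have "(K has_derivative D) (at ((0, v) + s *\<^sub>R (1, 0)))" unfolding line by (rule that)
    from has_real_derivative_along_line[OF this] show ?thesis unfolding line .
  qed
  have dg: "((\<lambda>t. pe t * fs b (t, v)) has_real_derivative g b (s, v)) (at s)" if "(s, v) \<in> Om" for b s v
    unfolding g_def fst_conv fs_def by (rule DERIV_mult[OF dpe dt[OF H_D2[OF that]]])
  interpret TS: two_solutions "CARD('n)" z R0.E R0.w "TYPE('n)" S Om lam fh fs g fx fxx
  proof unfold_locales
    show "open Om" by (rule homogeneous_C2.open_Om[OF H[of True]])
    show "v \<noteq> 0" if "(s, v) \<in> Om" for s v using that by (simp add: Om_def)
    show "(s, r *\<^sub>R v) \<in> Om" if "(s, v) \<in> Om" "r > 0" for s v r by (rule homogeneous_C2.cone[OF H[of True] that])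
    show "lam b < 0" for b by (rule lam)
    show "cyl_cont S (fh b)" for b unfolding fh_def by (rule cyl_cont_extend[OF f \<Omega> G S])
    show "fh b p = 0" if p: "p \<notin> Om" for b p
    proof -
      have p': "p \<notin> {p. snd p \<noteq> 0 \<and> (fst p, sgn (snd p)) \<in> G}" using p by (simp only: Om_def not_False_eq_True)
      show ?thesis unfolding fh_def by (rule extend_zero[OF f[of b] \<Omega> G S p'])
    qed
    show "fh b (s, r *\<^sub>R v) = fh b (s, v)" if "r > 0" for b s v r by (rule homogeneous_C2.hom[OF H that])
    show "continuous_on Om (fs b)" for b unfolding fs_def by (rule homogeneous_C2.cont_D1[OF H])
    show "continuous_on Om (g b)" for b
      unfolding g_def[abs_def] fs_def
      by (intro continuous_intros cfst cpe homogeneous_C2.cont_D1[OF H] homogeneous_C2.cont_D2[OF H])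
    show "continuous_on Om (fx b i)" for b i unfolding fx_def by (rule homogeneous_C2.cont_D1[OF H])
    show "continuous_on Om (fxx b i j)" for b i j unfolding fxx_def by (rule homogeneous_C2.cont_D2[OF H])
    show "((\<lambda>t. fh b (t, v)) has_real_derivative fs b (s, v)) (at s)" if "(s, v) \<in> Om" for b s v
      unfolding fs_def by (rule dt[OF H_D1[OF that]])
    show "((\<lambda>t. RP.P t / R0.E t * fs b (t, v)) has_real_derivative g b (s, v)) (at s)" if "(s, v) \<in> Om" for b s v
      using dg[OF that] by (simp add: RP.P_def pe_def)
    show "((\<lambda>v. fh b (s, v)) has_derivative (\<lambda>h. \<Sum>i\<in>UNIV. h $ i * fx b i (s, v))) (at v)" if "(s, v) \<in> Om" for b s v
      unfolding fx_def by (rule has_derivative_snd_axis[OF H_D1[OF that]])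
    show "((\<lambda>v. fx b i (s, v)) has_derivative (\<lambda>h. \<Sum>j\<in>UNIV. h $ j * fxx b i j (s, v))) (at v)" if "(s, v) \<in> Om" for b i s v
      unfolding fx_def fxx_def by (rule has_derivative_snd_axis[OF H_D2[OF that]])
    show "g b (s, v) + R0.E s * RP.P s / (z s)\<^sup>2 * (\<Sum>i\<in>UNIV. fxx b i i (s, v)) + RP.V s * R0.E s * RP.P s * fh b (s, v)
         = - lam b * R0.E s * RP.P s * fh b (s, v)" if p: "(s, v) \<in> Om" and v: "norm v = 1" for b s v
    proof -
      \<comment> \<open>The chart is rotated so that the given point (s, v) lies on its centre line,
        where \<open>jacobi_equation\<close> is available.\<close>
      have "norm (axis k (1 :: real)) = 1" by (simp add: norm_axis_1)
      then obtain R :: "real^'n \<Rightarrow> real^'n" where R: "orthogonal_transformation R" "R (axis k 1) = v"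
        using v orthogonal_transformation_exists_1 by blast
      interpret C: rotation_chart_homogeneous k R T x y z x1 y1 z1 x2 y2 z2 "fh b" Om
        by (rule rotation_chart_homogeneous.intro[OF rc[OF R(1)] H])
      have Re: "R C.e = v" by (simp add: C.e_def R(2))
      have openU: "open (C.Y -` Om)" by (rule open_vimage[OF C.open_Om]) (use C.C_k_Y[of 0] in simp)
      have "fst p = fst p \<and> p \<in> G" if "p \<in> Om" "p \<in> cylinder" for p
        using that by (cases p) (auto simp: Om_def sgn_div_norm)
      then have "C.Y ` (C.Y -` Om) \<subseteq> top_of_set cylinder interior_of \<Omega>" unfolding G(2) using C.Y_cylinder by blast
      then have st: "\<forall>u\<in>C.Y -` Om. stability_operator (F \<circ> C.Y) (f b \<circ> C.Y) u = - lam b * f b (C.Y u)"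
        using f[of b] C.chart_Y[OF openU] unfolding dirichlet_eigenspace_def by blast
      have u: "s *\<^sub>R C.e \<in> C.Y -` Om" and Yu: "C.Y (s *\<^sub>R C.e) = (s, v)"
        using p by (simp_all add: C.Y_def C.sph_center C.drp_scaleR Re)
      have feq: "f b \<circ> C.Y = fh b \<circ> C.Y"
        unfolding fun_eq_iff fh_def o_def C.Y_def extend_unit[OF C.norm_sph] by blast
      have eig: "stability_operator C.X (fh b \<circ> C.Y) (s *\<^sub>R C.e) = - lam b * fh b (s, R C.e)"
        using bspec[OF st u] unfolding feq FX[OF R(1)] Yu Re fh_def extend_unit[OF v] .
      have G: "((\<lambda>t. z t ^ (CARD('n) - 1) / R0.E t * C.D1 (1, 0) (t, R C.e)) has_real_derivative g b (s, v)) (at s)"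
        using dg[OF p, of b] by (simp only: pe_def fs_def Re)
      have pR: "(s, R C.e) \<in> Om" using p by (simp only: Re)
      show ?thesis
        using C.jacobi_equation[OF pR G tr[OF R(1)] eig] by (simp only: Re fxx_def RP.P_def RP.V_def RP.K_def)
    qed
  qed
  \<comment> \<open>Off the cylinder a function vanishes while its extension need not, so the two
    cases are kept apart below.\<close>
  have off: "f b p = 0" if "p \<notin> cylinder" for b p
  proof -
    have "\<Omega> \<subseteq> cylinder" using \<Omega> by (simp add: compact_domain_def)
    then show ?thesis using f[of b] that unfolding dirichlet_eigenspace_def by blast
  qed
  have on: "fh b p = f b p" if "p \<in> cylinder" for b p
    using that by (cases p) (auto simp: fh_def extend_unit)
  have fh_f: "fh b p \<noteq> 0" if "f b p \<noteq> 0" for b p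
  proof -
    have "p \<in> cylinder" using off[of p b] that by blast
    then show ?thesis using on[of p b] that by simp
  qed
  show "\<exists>\<alpha>. (\<alpha> True \<noteq> 0 \<or> \<alpha> False \<noteq> 0) \<and> (\<forall>p. \<alpha> True * f True p + \<alpha> False * f False p = 0)"
  proof -
    obtain \<alpha> where \<alpha>: "\<alpha> True \<noteq> 0 \<or> \<alpha> False \<noteq> 0" "\<And>p. \<alpha> True * fh True p + \<alpha> False * fh False p = 0"
      using TS.linearly_dependent by blast
    have "\<alpha> True * f True p + \<alpha> False * f False p = 0" for p
    proof (cases "p \<in> cylinder")
      case True
      then show ?thesis using \<alpha>(2)[of p] on[of p] by simp
    qed (simp add: off)
    then show ?thesis using \<alpha>(1) by blast
  qed
  show "lam True = lam False" if "f True p \<noteq> 0" "f False p' \<noteq> 0"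
    using TS.eigenvalues_equal[of "fst p" "snd p" "fst p'" "snd p'"] fh_f[OF that(1)] fh_f[OF that(2)] by simp
qed

section \<open>Counting eigenvalues\<close>

lemma module_fun: "module (\<lambda>(c :: real) f x. c * f x)"
  by unfold_locales (auto simp: fun_eq_iff algebra_simps)

lemma fun_space_dim_le_1:
  fixes A :: "('a \<Rightarrow> real) set"
  assumes "\<And>f g. f \<in> A \<Longrightarrow> g \<in> A \<Longrightarrow> \<exists>a b. (a \<noteq> 0 \<or> b \<noteq> 0) \<and> (\<forall>p. a * f p + b * g p = 0)"
  shows "fun_space_dim A \<le> 1"
  unfolding fun_space_dim_def
proof (rule SUP_least, safe)
  interpret vs: module "\<lambda>(c :: real) f x. c * f (x :: 'a)" by (rule module_fun)
  fix B :: "('a \<Rightarrow> real) set"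
  assume B: "finite B" "B \<subseteq> A" "\<not> vs.dependent B"
  have "f = g" if fg: "f \<in> B" "g \<in> B" for f g
  proof (rule ccontr)
    assume ne: "f \<noteq> g"
    obtain a b where ab: "a \<noteq> 0 \<or> b \<noteq> 0" "\<And>p. a * f p + b * g p = 0" using assms[of f g] B(2) fg by blast
    define u where "u v = (if v = f then a else b)" for v
    have "(\<Sum>v\<in>{f, g}. (\<lambda>x. u v * v x)) = 0" using ne ab(2) by (auto simp: u_def fun_eq_iff)
    moreover have "\<exists>v\<in>{f, g}. u v \<noteq> 0" using ab(1) ne by (auto simp: u_def)
    ultimately have "vs.dependent B"
      unfolding vs.dependent_explicit using fg by (intro exI[of _ "{f, g}"] exI[of _ u]) simp
    then show False using B(3) by simp
  qed
  then have "card B \<le> 1" using B(1) by (simp add: card_le_Suc0_iff_eq)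
  then show "enat (card B) \<le> 1" by (simp add: one_enat_def)
qed

lemma fun_space_dim_trivial:
  fixes A :: "('a \<Rightarrow> real) set"
  assumes "\<And>f p. f \<in> A \<Longrightarrow> f p = 0"
  shows "fun_space_dim A = 0"
proof -
  interpret vs: module "\<lambda>(c :: real) f x. c * f (x :: 'a)" by (rule module_fun)
  have "B = {}" if "B \<subseteq> A" "\<not> vs.dependent B" for B
  proof (rule ccontr)
    assume "B \<noteq> {}"
    then obtain f where "f \<in> B" by blast
    moreover have "f = 0" using assms[of f] that(1) \<open>f \<in> B\<close> by (auto simp: fun_eq_iff)
    ultimately show False using vs.dependent_zero that(2) by blast
  qed
  then have "fun_space_dim A \<le> 0" unfolding fun_space_dim_def by (intro SUP_least) (auto simp: zero_enat_def)
  then show ?thesis by simp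
qed

theorem theorem4p3:
  fixes F :: "real \<times> (real^'n::finite) \<Rightarrow> 'n lorentz"
  assumes "CARD('n) \<ge> 2"
    and "spherical_catenoid F"
  shows "hypersurface_index cylinder F \<le> 1"
  unfolding hypersurface_index_def domain_index_def
proof (rule SUP_least, rule SUP_least, safe)
  fix \<Omega> :: "(real \<times> (real^'n)) set" and \<Lambda> :: "real set"
  assume \<Omega>: "compact_domain cylinder \<Omega>" and \<Lambda>: "finite \<Lambda>" "\<Lambda> \<subseteq> {..<0}"
  define A where "A = dirichlet_eigenspace cylinder F \<Omega>"
  have dep: "\<exists>a b. (a \<noteq> 0 \<or> b \<noteq> 0) \<and> (\<forall>p. a * f p + b * g p = 0)"
    if "f \<in> A l" "g \<in> A l" "l < 0" for f g l
  proof -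
    \<comment> \<open>Both members of the pair have the same eigenvalue here; \<open>eq\<close>
      below uses two different ones.\<close>
    have "\<exists>\<alpha>. (\<alpha> True \<noteq> 0 \<or> \<alpha> False \<noteq> 0)
        \<and> (\<forall>p. \<alpha> True * (if True then f else g) p + \<alpha> False * (if False then f else g) p = 0)"
      by (rule eigenfunction_pair(1)[OF assms \<Omega>, of "\<lambda>_. l" "\<lambda>c. if c then f else g"])
        (use that in \<open>auto simp: A_def\<close>)
    then show ?thesis by (simp only: if_True if_False) blast
  qed
  have eq: "l = l'" if "f \<in> A l" "g \<in> A l'" "l < 0" "l' < 0" "f p \<noteq> 0" "g p' \<noteq> 0" for f g l l' p p'
    using eigenfunction_pair(2)[OF assms \<Omega>, of "\<lambda>c. if c then l else l'" "\<lambda>c. if c then f else g" p p'] that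
    by (auto simp: A_def)
  have le1: "fun_space_dim (A l) \<le> 1" if "l \<in> \<Lambda>" for l
    using dep that \<Lambda>(2) by (intro fun_space_dim_le_1) auto
  have "(\<Sum>l\<in>\<Lambda>. fun_space_dim (A l)) \<le> 1"
  \<comment> \<open>If one eigenvalue has a nonzero eigenfunction, then by \<open>eq\<close> every
    other eigenspace in the sum is trivial, and this one has dimension at most one.\<close>
  proof (cases "\<exists>l0\<in>\<Lambda>. \<exists>f\<in>A l0. \<exists>p. f p \<noteq> 0")
    case True
    then obtain l0 f p where l0: "l0 \<in> \<Lambda>" "f \<in> A l0" "f p \<noteq> 0" by blast
    have "fun_space_dim (A l) = 0" if "l \<in> \<Lambda> - {l0}" for l
    proof (rule fun_space_dim_trivial, rule ccontr)
      fix g q assume g: "g \<in> A l" "g q \<noteq> 0"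
      have "l0 < 0" "l < 0" using l0(1) that \<Lambda>(2) by auto
      from eq[OF l0(2) g(1) this l0(3) g(2)] show False using that by simp
    qed
    then have "(\<Sum>l\<in>\<Lambda>. fun_space_dim (A l)) = fun_space_dim (A l0)"
      using sum.remove[OF \<Lambda>(1) l0(1), of "\<lambda>l. fun_space_dim (A l)"] by simp
    then show ?thesis using le1[OF l0(1)] by simp
  next
    case False
    then have "fun_space_dim (A l) = 0" if "l \<in> \<Lambda>" for l using that by (intro fun_space_dim_trivial) blast
    then show ?thesis by simp
  qed
  then show "(\<Sum>lam\<in>\<Lambda>. fun_space_dim (dirichlet_eigenspace cylinder F \<Omega> lam)) \<le> 1" by (simp add: A_def)
qed

end
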